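(* Let $\theta\in\mathbb{R}$ and let $J_\theta$ be the two-sided ideal of $\mathcal{A}(\mathrm{Sp}_\theta(2))$ generated by all entries of the blocks $b$ and $c$ of the defining matrix. Then $J_\theta$ is a Hopf ideal. Let $\pi_{J_\theta}$ be the quotient map. The $*$-algebra of coinvariants of the right coaction $(\mathrm{id}\otimes\pi_{J_\theta})\circ\Delta$ of $\pi_{J_\theta}(\mathcal{A}(\mathrm{Sp}_\theta(2)))$ on $\mathcal{A}(\mathrm{Sp}_\theta(2))$ is generated, as a $*$-algebra, by the elements $$a_1a_1^*+a_2a_2^*,\qquad c_1a_1^*+c_2a_2^*,\qquad -c_1a_2+c_2a_1,$$ and it is isomorphic to $\mathcal{A}(S^4_\theta)$, the identification being given by the $*$-map $a_1\mapsto z_1$, $a_2\mapsto z_2$, $c_1\mapsto z_3$, $c_2\mapsto z_4$ with values in $\mathcal{A}(S^4_\theta)\subset\mathcal{A}(S^7_\theta)$.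
   Context: Let $\theta\in\mathbb{R}$, $\mu=e^{\pi \mathrm{i}\theta}$, and let $\eta=(\eta_{ij})$ be $$\eta=\begin{pmatrix} 1&1&\bar\mu&\mu \\ 1&1&\mu&\bar\mu \\ \mu&\bar\mu&1&1 \\ \bar\mu&\mu&1&1 \end{pmatrix}.$$ $\mathcal{A}(M_\theta(2,\mathbb{H}))$ is the unital complex $*$-algebra generated by the entries of $$A_\theta=(A_{ij})=\begin{pmatrix} a&b \\ c&d \end{pmatrix}=\begin{pmatrix} a_1&a_2&b_1&b_2 \\ -a_2^*&a_1^*&-b_2^*&b_1^* \\ c_1&c_2&d_1&d_2 \\ -c_2^*&c_1^*&-d_2^*&d_1^* \end{pmatrix}$$ with relations $A_{ij}A_{kl}=\eta_{ki}\eta_{jl}A_{kl}A_{ij}$. The determinant is $\det(A_\theta)=\sum_{\sigma\in S_4}(-1)^{|\sigma|}\varepsilon^{\sigma(1)\sigma(2)\sigma(3)\sigma(4)}A_{1,\sigma(1)}\cdots A_{4,\sigma(4)}$, where $\varepsilon^{ijkl}=\mu$ if $(i,j,k,l)$ is $(1,3,2,4)$ or one of its cyclic rotations, $\bar\mu$ if it is $(1,4,2,3)$ or one of its cyclic rotations, and $1$ for all other permutations; it is central. $\mathcal{A}(\mathrm{SL}_\theta(2,\mathbb{H}))$ is the quotient of $\mathcal{A}(M_\theta(2,\mathbb{H}))$ by the ideal generated by $\det(A_\theta)-1$, a Hopf algebra with $\Delta(A_{ij})=\sum_kA_{ik}\otimes A_{kj}$, $\epsilon(A_{ij})=\delta_{ij}$.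 $\mathcal{A}(\mathrm{Sp}_\theta(2))$ is its quotient Hopf algebra by the two-sided $*$-ideal generated by the elements $\sum_k(A_{ki})^*A_{kj}-\delta_{ij}$; in it $A_\theta^*A_\theta=A_\theta A_\theta^*=1$ and $S(A_\theta)=A_\theta^*$. $\mathcal{A}(S^7_\theta)$ is the unital $*$-algebra generated by $z_1,\dots,z_4$ and adjoints, with relations expressed through the $4\times2$ matrix $$u=(u_{ia})=\begin{pmatrix} z_1&z_2 \\ -z_2^*&z_1^* \\ z_3&z_4 \\ -z_4^*&z_3^* \end{pmatrix}$$ as $u_{ia}u_{jb}=\eta_{ji}u_{jb}u_{ia}$ for all $i,j,a,b$, together with $\sum_jz_j^*z_j=1$. $\mathcal{A}(S^4_\theta)\subset\mathcal{A}(S^7_\theta)$ is the $*$-subalgebra generated by $\alpha=2(z_1z_3^*+z_2z_4^* )$, $\beta=2(-z_1z_4+z_2z_3)$, $x=z_1z_1^*+z_2z_2^*-z_3z_3^*-z_4z_4^*$. A two-sided ideal $I$ in a Hopf algebra $\mathcal{A}$ is a Hopf ideal if $\Delta(I)\subseteq I\otimes\mathcal{A}+\mathcal{A}\otimes I$, $\epsilon(I)=0$, $S(I)\subseteq I$. Coinvariants of a right coaction $\delta$ are the elements $f$ with $\delta(f)=f\otimes1$. *)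

theory Defs
  imports
    Complex_Main
    "HOL-Library.Poly_Mapping"
    "HOL-Combinatorics.Permutations"
    "HOL-Algebra.Module"
    "HOL-Algebra.QuotRing"
begin

section \<open>Unital complex *-algebras\<close>

record 'a star_algebra = "(complex, 'a) module" +
  star :: "'a \<Rightarrow> 'a"

definition complex_alg :: "complex star_algebra" where
  "complex_alg = \<lparr>carrier = UNIV, mult = (*), one = 1, zero = 0, add = (+), smult = (*), star = cnj\<rparr>"

definition alg_hom ::
  "('a, 'm) star_algebra_scheme \<Rightarrow> ('b, 'n) star_algebra_scheme \<Rightarrow> ('a \<Rightarrow> 'b) set" where
  "alg_hom A B = {h \<in> ring_hom A B. \<forall>c. \<forall>x\<in>carrier A. h (c \<odot>\<^bsub>A\<^esub> x) = c \<odot>\<^bsub>B\<^esub> h x}"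

definition alg_antihom ::
  "('a, 'm) star_algebra_scheme \<Rightarrow> ('b, 'n) star_algebra_scheme \<Rightarrow> ('a \<Rightarrow> 'b) set" where
  "alg_antihom A B = alg_hom A (B\<lparr>mult := \<lambda>x y. y \<otimes>\<^bsub>B\<^esub> x\<rparr>)"

definition star_alg_hom ::
  "('a, 'm) star_algebra_scheme \<Rightarrow> ('b, 'n) star_algebra_scheme \<Rightarrow> ('a \<Rightarrow> 'b) set" where
  "star_alg_hom A B = {h \<in> alg_hom A B. \<forall>x\<in>carrier A. h (star A x) = star B (h x)}"

definition star_alg_iso ::
  "('a, 'm) star_algebra_scheme \<Rightarrow> ('b, 'n) star_algebra_scheme \<Rightarrow> ('a \<Rightarrow> 'b) set" where
  "star_alg_iso A B = {h \<in> star_alg_hom A B. bij_betw h (carrier A) (carrier B)}"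

text \<open>The unital *-subalgebra generated by a set.\<close>

inductive_set star_subalg :: "('a, 'm) star_algebra_scheme \<Rightarrow> 'a set \<Rightarrow> 'a set"
  for A :: "('a, 'm) star_algebra_scheme" and X :: "'a set" where
  gen: "x \<in> X \<Longrightarrow> x \<in> star_subalg A X"
| one: "\<one>\<^bsub>A\<^esub> \<in> star_subalg A X"
| add: "x \<in> star_subalg A X \<Longrightarrow> y \<in> star_subalg A X \<Longrightarrow> x \<oplus>\<^bsub>A\<^esub> y \<in> star_subalg A X"
| mult: "x \<in> star_subalg A X \<Longrightarrow> y \<in> star_subalg A X \<Longrightarrow> x \<otimes>\<^bsub>A\<^esub> y \<in> star_subalg A X"
| smult: "x \<in> star_subalg A X \<Longrightarrow> c \<odot>\<^bsub>A\<^esub> x \<in> star_subalg A X"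
| star: "x \<in> star_subalg A X \<Longrightarrow> star A x \<in> star_subalg A X"

inductive_set lin_span :: "('a, 'm) star_algebra_scheme \<Rightarrow> 'a set \<Rightarrow> 'a set"
  for A :: "('a, 'm) star_algebra_scheme" and X :: "'a set" where
  gen: "x \<in> X \<Longrightarrow> x \<in> lin_span A X"
| zero: "\<zero>\<^bsub>A\<^esub> \<in> lin_span A X"
| add: "x \<in> lin_span A X \<Longrightarrow> y \<in> lin_span A X \<Longrightarrow> x \<oplus>\<^bsub>A\<^esub> y \<in> lin_span A X"
| smult: "x \<in> lin_span A X \<Longrightarrow> c \<odot>\<^bsub>A\<^esub> x \<in> lin_span A X"

text \<open>The two-sided *-ideal generated by a set; \<^const>\<open>ideal\<close> means two-sided ideal. Ideals of a
  unital complex algebra are automatically complex subspaces.\<close>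

definition star_genideal :: "('a, 'm) star_algebra_scheme \<Rightarrow> 'a set \<Rightarrow> 'a set" where
  "star_genideal A X = \<Inter>{I. ideal I A \<and> star A ` I \<subseteq> I \<and> X \<subseteq> I}"

text \<open>The quotient ring \<open>A Quot I\<close> together with the induced scalar multiplication and, when \<open>I\<close>
  is closed under the star, the induced star.\<close>

definition quot_alg :: "('a, 'm) star_algebra_scheme \<Rightarrow> 'a set \<Rightarrow> 'a set star_algebra" where
  "quot_alg A I =
    \<lparr>carrier = carrier (A Quot I),
     mult = monoid.mult (A Quot I),
     one = monoid.one (A Quot I),
     zero = ring.zero (A Quot I),
     add = ring.add (A Quot I),
     smult = (\<lambda>c X. \<Union>x\<in>X. I +>\<^bsub>A\<^esub> (c \<odot>\<^bsub>A\<^esub> x)),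
     star = (\<lambda>X. \<Union>x\<in>X. I +>\<^bsub>A\<^esub> star A x)\<rparr>"


section \<open>Monoid algebras, free *-algebras, tensor products\<close>

text \<open>The monoid algebra of \<open>M\<close> over the complex numbers, with the star that extends the
  anti-multiplicative involution \<open>s\<close> of \<open>M\<close> antilinearly.\<close>

definition monoid_alg ::
  "('k, 'm) monoid_scheme \<Rightarrow> ('k \<Rightarrow> 'k) \<Rightarrow> ('k \<Rightarrow>\<^sub>0 complex) star_algebra" where
  "monoid_alg M s =
    \<lparr>carrier = {f. Poly_Mapping.keys f \<subseteq> carrier M},
     mult = (\<lambda>f g. \<Sum>p\<in>Poly_Mapping.keys f. \<Sum>q\<in>Poly_Mapping.keys g.
       Poly_Mapping.single (p \<otimes>\<^bsub>M\<^esub> q) (Poly_Mapping.lookup f p * Poly_Mapping.lookup g q)),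
     one = Poly_Mapping.single \<one>\<^bsub>M\<^esub> 1,
     zero = 0,
     add = (+),
     smult = (\<lambda>c f. Poly_Mapping.map ((*) c) f),
     star = (\<lambda>f. \<Sum>p\<in>Poly_Mapping.keys f.
       Poly_Mapping.single (s p) (cnj (Poly_Mapping.lookup f p)))\<rparr>"

text \<open>The letter \<open>(g, False)\<close> is the generator \<open>g\<close> and \<open>(g, True)\<close> its adjoint.\<close>

definition word_monoid :: "('g \<times> bool) list monoid" where
  "word_monoid = \<lparr>carrier = UNIV, mult = (@), one = []\<rparr>"

definition word_star :: "('g \<times> bool) list \<Rightarrow> ('g \<times> bool) list" where
  "word_star w = rev (map (\<lambda>(g, b). (g, \<not> b)) w)"

type_synonym 'g free_elt = "('g \<times> bool) list \<Rightarrow>\<^sub>0 complex"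

definition free_star_alg :: "'g free_elt star_algebra" where
  "free_star_alg = monoid_alg word_monoid word_star"

definition free_gen :: "'g \<Rightarrow> 'g free_elt" where
  "free_gen g = Poly_Mapping.single [(g, False)] 1"

text \<open>The tensor product is the space of formal combinations of pairs, modulo bilinearity. The
  formal combinations form the monoid algebra of the multiplicative monoid of pairs, whose product
  is \<open>(x, y) (x', y') = (x x', y y')\<close>. The ideal generated by the bilinearity relations is just
  their linear span, since a pair times a relation is again a relation.\<close>

definition pair_alg ::
  "('a, 'm) star_algebra_scheme \<Rightarrow> ('b, 'n) star_algebra_scheme
    \<Rightarrow> ('a \<times> 'b \<Rightarrow>\<^sub>0 complex) star_algebra" where
  "pair_alg A B = monoid_alg (A \<times>\<times> B) (map_prod (star A) (star B))"

abbreviation pair :: "'a \<Rightarrow> 'b \<Rightarrow> 'a \<times> 'b \<Rightarrow>\<^sub>0 complex" where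
  "pair x y \<equiv> Poly_Mapping.single (x, y) 1"

definition bilinear_rels ::
  "('a, 'm) star_algebra_scheme \<Rightarrow> ('b, 'n) star_algebra_scheme \<Rightarrow> ('a \<times> 'b \<Rightarrow>\<^sub>0 complex) set" where
  "bilinear_rels A B =
     {pair (x \<oplus>\<^bsub>A\<^esub> x') y - pair x y - pair x' y | x x' y.
        x \<in> carrier A \<and> x' \<in> carrier A \<and> y \<in> carrier B}
   \<union> {pair x (y \<oplus>\<^bsub>B\<^esub> y') - pair x y - pair x y' | x y y'.
        x \<in> carrier A \<and> y \<in> carrier B \<and> y' \<in> carrier B}
   \<union> {pair (c \<odot>\<^bsub>A\<^esub> x) y - Poly_Mapping.single (x, y) c | c x y.
        x \<in> carrier A \<and> y \<in> carrier B}
   \<union> {pair x (c \<odot>\<^bsub>B\<^esub> y) - Poly_Mapping.single (x, y) c | c x y.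
        x \<in> carrier A \<and> y \<in> carrier B}"

definition tensor_ideal ::
  "('a, 'm) star_algebra_scheme \<Rightarrow> ('b, 'n) star_algebra_scheme \<Rightarrow> ('a \<times> 'b \<Rightarrow>\<^sub>0 complex) set" where
  "tensor_ideal A B = Idl\<^bsub>pair_alg A B\<^esub> (bilinear_rels A B)"

definition tensor_alg ::
  "('a, 'm) star_algebra_scheme \<Rightarrow> ('b, 'n) star_algebra_scheme
    \<Rightarrow> ('a \<times> 'b \<Rightarrow>\<^sub>0 complex) set star_algebra" where
  "tensor_alg A B = quot_alg (pair_alg A B) (tensor_ideal A B)"

definition tens ::
  "('a, 'm) star_algebra_scheme \<Rightarrow> ('b, 'n) star_algebra_scheme \<Rightarrow> 'a \<Rightarrow> 'b
    \<Rightarrow> ('a \<times> 'b \<Rightarrow>\<^sub>0 complex) set" where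
  "tens A B x y = tensor_ideal A B +>\<^bsub>pair_alg A B\<^esub> pair x y"

text \<open>The linear map \<open>f \<otimes> g\<close>, with values in the tensor product of \<open>A'\<close> and \<open>B'\<close>, for linear
  maps \<open>f\<close> and \<open>g\<close>.\<close>

definition tensor_map ::
  "('c, 'm) star_algebra_scheme \<Rightarrow> ('d, 'n) star_algebra_scheme \<Rightarrow> ('a \<Rightarrow> 'c) \<Rightarrow> ('b \<Rightarrow> 'd)
    \<Rightarrow> ('a \<times> 'b \<Rightarrow>\<^sub>0 complex) set \<Rightarrow> ('c \<times> 'd \<Rightarrow>\<^sub>0 complex) set" where
  "tensor_map A' B' f g T = (\<Union>t\<in>T. tensor_ideal A' B' +>\<^bsub>pair_alg A' B'\<^esub>
     (\<Sum>p\<in>Poly_Mapping.keys t. Poly_Mapping.single (map_prod f g p) (Poly_Mapping.lookup t p)))"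

text \<open>For subspaces \<open>V\<close> of \<open>A\<close> and \<open>W\<close> of \<open>B\<close>, the subspace \<open>V \<otimes> W\<close> of the tensor product.\<close>

definition tensor_sub ::
  "('a, 'm) star_algebra_scheme \<Rightarrow> ('b, 'n) star_algebra_scheme \<Rightarrow> 'a set \<Rightarrow> 'b set
    \<Rightarrow> ('a \<times> 'b \<Rightarrow>\<^sub>0 complex) set set" where
  "tensor_sub A B V W = lin_span (tensor_alg A B) {tens A B x y | x y. x \<in> V \<and> y \<in> W}"

definition hopf_ideal ::
  "('a, 'm) star_algebra_scheme \<Rightarrow> ('a \<Rightarrow> ('a \<times> 'a \<Rightarrow>\<^sub>0 complex) set) \<Rightarrow> ('a \<Rightarrow> complex)
    \<Rightarrow> ('a \<Rightarrow> 'a) \<Rightarrow> 'a set \<Rightarrow> bool" where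
  "hopf_ideal A \<Delta> \<epsilon> S I \<longleftrightarrow> ideal I A
     \<and> \<Delta> ` I \<subseteq> tensor_sub A A I (carrier A) <+>\<^bsub>tensor_alg A A\<^esub> tensor_sub A A (carrier A) I
     \<and> (\<forall>x\<in>I. \<epsilon> x = 0)
     \<and> S ` I \<subseteq> I"

definition coinvariants ::
  "('a, 'm) star_algebra_scheme \<Rightarrow> ('b, 'n) star_algebra_scheme
    \<Rightarrow> ('a \<Rightarrow> ('a \<times> 'b \<Rightarrow>\<^sub>0 complex) set) \<Rightarrow> 'a set" where
  "coinvariants A H \<delta> = {f \<in> carrier A. \<delta> f = tens A H f \<one>\<^bsub>H\<^esub>}"


section \<open>The quantum group and the quantum spheres\<close>

text \<open>Rows and columns of matrices are numbered from 1.\<close>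

definition mat_entry :: "'a list list \<Rightarrow> nat \<Rightarrow> nat \<Rightarrow> 'a" where
  "mat_entry M i j = M ! (i - 1) ! (j - 1)"

definition mu :: "real \<Rightarrow> complex" where
  "mu \<theta> = exp (of_real (pi * \<theta>) * \<i>)"

definition eta :: "real \<Rightarrow> nat \<Rightarrow> nat \<Rightarrow> complex" where
  "eta \<theta> = mat_entry
    [[1, 1, cnj (mu \<theta>), mu \<theta>],
     [1, 1, mu \<theta>, cnj (mu \<theta>)],
     [mu \<theta>, cnj (mu \<theta>), 1, 1],
     [cnj (mu \<theta>), mu \<theta>, 1, 1]]"

datatype M_gen = gen_a1 | gen_a2 | gen_b1 | gen_b2 | gen_c1 | gen_c2 | gen_d1 | gen_d2

text \<open>The matrix \<open>A\<^sub>\<theta>\<close>, for elements \<open>a\<^sub>1, \<dots>, d\<^sub>2\<close> of a *-algebra given by a valuation \<open>v\<close> of the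
  generators.\<close>

definition A_mat :: "('a, 'm) star_algebra_scheme \<Rightarrow> (M_gen \<Rightarrow> 'a) \<Rightarrow> nat \<Rightarrow> nat \<Rightarrow> 'a" where
  "A_mat B v = (let s = star B; n = (\<lambda>x. \<ominus>\<^bsub>B\<^esub> (star B x)) in mat_entry
    [[v gen_a1,     v gen_a2,     v gen_b1,     v gen_b2],
     [n (v gen_a2), s (v gen_a1), n (v gen_b2), s (v gen_b1)],
     [v gen_c1,     v gen_c2,     v gen_d1,     v gen_d2],
     [n (v gen_c2), s (v gen_c1), n (v gen_d2), s (v gen_d1)]])"

definition M_ideal :: "real \<Rightarrow> M_gen free_elt set" where
  "M_ideal \<theta> = (let F = free_star_alg; A = A_mat F free_gen in star_genideal F
    {(A i j \<otimes>\<^bsub>F\<^esub> A k l) \<ominus>\<^bsub>F\<^esub> ((eta \<theta> k i * eta \<theta> j l) \<odot>\<^bsub>F\<^esub> (A k l \<otimes>\<^bsub>F\<^esub> A i j)) | i j k l.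
       {i, j, k, l} \<subseteq> {1..4}})"

definition M_alg :: "real \<Rightarrow> M_gen free_elt set star_algebra" where
  "M_alg \<theta> = quot_alg free_star_alg (M_ideal \<theta>)"

definition M_val :: "real \<Rightarrow> M_gen \<Rightarrow> M_gen free_elt set" where
  "M_val \<theta> g = M_ideal \<theta> +>\<^bsub>free_star_alg\<^esub> free_gen g"

definition det_eps :: "real \<Rightarrow> nat list \<Rightarrow> complex" where
  "det_eps \<theta> w =
    (if \<exists>n. w = rotate n [1, 3, 2, 4] then mu \<theta>
     else if \<exists>n. w = rotate n [1, 4, 2, 3] then cnj (mu \<theta>)
     else 1)"

definition M_det :: "real \<Rightarrow> M_gen free_elt set" where
  "M_det \<theta> = (let B = M_alg \<theta>; A = A_mat B (M_val \<theta>) in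
    \<Oplus>\<^bsub>B\<^esub>\<sigma>\<in>{\<sigma>. \<sigma> permutes {1..4}}.
      (of_int (sign \<sigma>) * det_eps \<theta> [\<sigma> 1, \<sigma> 2, \<sigma> 3, \<sigma> 4]) \<odot>\<^bsub>B\<^esub>
        (A 1 (\<sigma> 1) \<otimes>\<^bsub>B\<^esub> A 2 (\<sigma> 2) \<otimes>\<^bsub>B\<^esub> A 3 (\<sigma> 3) \<otimes>\<^bsub>B\<^esub> A 4 (\<sigma> 4)))"

definition SL_ideal :: "real \<Rightarrow> M_gen free_elt set set" where
  "SL_ideal \<theta> = Idl\<^bsub>M_alg \<theta>\<^esub> {M_det \<theta> \<ominus>\<^bsub>M_alg \<theta>\<^esub> \<one>\<^bsub>M_alg \<theta>\<^esub>}"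

definition SL_alg :: "real \<Rightarrow> M_gen free_elt set set star_algebra" where
  "SL_alg \<theta> = quot_alg (M_alg \<theta>) (SL_ideal \<theta>)"

definition SL_val :: "real \<Rightarrow> M_gen \<Rightarrow> M_gen free_elt set set" where
  "SL_val \<theta> g = SL_ideal \<theta> +>\<^bsub>M_alg \<theta>\<^esub> M_val \<theta> g"

definition Sp_ideal :: "real \<Rightarrow> M_gen free_elt set set set" where
  "Sp_ideal \<theta> = (let B = SL_alg \<theta>; A = A_mat B (SL_val \<theta>) in star_genideal B
    {(\<Oplus>\<^bsub>B\<^esub>k\<in>{1..4}. star B (A k i) \<otimes>\<^bsub>B\<^esub> A k j) \<ominus>\<^bsub>B\<^esub> (if i = j then \<one>\<^bsub>B\<^esub> else \<zero>\<^bsub>B\<^esub>) | i j.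
       {i, j} \<subseteq> {1..4}})"

type_synonym Sp_elt = "M_gen free_elt set set set"

definition Sp_alg :: "real \<Rightarrow> Sp_elt star_algebra" where
  "Sp_alg \<theta> = quot_alg (SL_alg \<theta>) (Sp_ideal \<theta>)"

definition Sp_val :: "real \<Rightarrow> M_gen \<Rightarrow> Sp_elt" where
  "Sp_val \<theta> g = Sp_ideal \<theta> +>\<^bsub>SL_alg \<theta>\<^esub> SL_val \<theta> g"

abbreviation Sp_mat :: "real \<Rightarrow> nat \<Rightarrow> nat \<Rightarrow> Sp_elt" where
  "Sp_mat \<theta> \<equiv> A_mat (Sp_alg \<theta>) (Sp_val \<theta>)"

text \<open>The Hopf structure maps. The entries of the matrix generate the algebra, so the conditions
  determine the values on the carrier.\<close>

definition Sp_comult :: "real \<Rightarrow> Sp_elt \<Rightarrow> (Sp_elt \<times> Sp_elt \<Rightarrow>\<^sub>0 complex) set" where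
  "Sp_comult \<theta> = (SOME \<Delta>. \<Delta> \<in> alg_hom (Sp_alg \<theta>) (tensor_alg (Sp_alg \<theta>) (Sp_alg \<theta>)) \<and>
    (\<forall>i\<in>{1..4}. \<forall>j\<in>{1..4}. \<Delta> (Sp_mat \<theta> i j) =
      (\<Oplus>\<^bsub>tensor_alg (Sp_alg \<theta>) (Sp_alg \<theta>)\<^esub>k\<in>{1..4}.
         tens (Sp_alg \<theta>) (Sp_alg \<theta>) (Sp_mat \<theta> i k) (Sp_mat \<theta> k j))))"

definition Sp_counit :: "real \<Rightarrow> Sp_elt \<Rightarrow> complex" where
  "Sp_counit \<theta> = (SOME \<epsilon>. \<epsilon> \<in> alg_hom (Sp_alg \<theta>) complex_alg \<and>
    (\<forall>i\<in>{1..4}. \<forall>j\<in>{1..4}. \<epsilon> (Sp_mat \<theta> i j) = (if i = j then 1 else 0)))"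

definition Sp_antipode :: "real \<Rightarrow> Sp_elt \<Rightarrow> Sp_elt" where
  "Sp_antipode \<theta> = (SOME S. S \<in> alg_antihom (Sp_alg \<theta>) (Sp_alg \<theta>) \<and>
    (\<forall>i\<in>{1..4}. \<forall>j\<in>{1..4}. S (Sp_mat \<theta> i j) = star (Sp_alg \<theta>) (Sp_mat \<theta> j i)))"

text \<open>The ideal generated by the entries of the off-diagonal blocks \<open>b\<close> and \<open>c\<close>.\<close>

definition J_ideal :: "real \<Rightarrow> Sp_elt set" where
  "J_ideal \<theta> = Idl\<^bsub>Sp_alg \<theta>\<^esub>
    ({Sp_mat \<theta> i j | i j. i \<in> {1, 2} \<and> j \<in> {3, 4}} \<union> {Sp_mat \<theta> i j | i j. i \<in> {3, 4} \<and> j \<in> {1, 2}})"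

definition J_quot :: "real \<Rightarrow> Sp_elt set star_algebra" where
  "J_quot \<theta> = quot_alg (Sp_alg \<theta>) (J_ideal \<theta>)"

definition J_proj :: "real \<Rightarrow> Sp_elt \<Rightarrow> Sp_elt set" where
  "J_proj \<theta> x = J_ideal \<theta> +>\<^bsub>Sp_alg \<theta>\<^esub> x"

definition J_coaction :: "real \<Rightarrow> Sp_elt \<Rightarrow> (Sp_elt \<times> Sp_elt set \<Rightarrow>\<^sub>0 complex) set" where
  "J_coaction \<theta> = tensor_map (Sp_alg \<theta>) (J_quot \<theta>) id (J_proj \<theta>) \<circ> Sp_comult \<theta>"

definition J_coinvariants :: "real \<Rightarrow> Sp_elt set" where
  "J_coinvariants \<theta> = coinvariants (Sp_alg \<theta>) (J_quot \<theta>) (J_coaction \<theta>)"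

datatype S7_gen = gen_z1 | gen_z2 | gen_z3 | gen_z4

definition u_mat :: "('a, 'm) star_algebra_scheme \<Rightarrow> (S7_gen \<Rightarrow> 'a) \<Rightarrow> nat \<Rightarrow> nat \<Rightarrow> 'a" where
  "u_mat B v = (let s = star B; n = (\<lambda>x. \<ominus>\<^bsub>B\<^esub> (star B x)) in mat_entry
    [[v gen_z1,     v gen_z2],
     [n (v gen_z2), s (v gen_z1)],
     [v gen_z3,     v gen_z4],
     [n (v gen_z4), s (v gen_z3)]])"

definition S7_ideal :: "real \<Rightarrow> S7_gen free_elt set" where
  "S7_ideal \<theta> = (let F = free_star_alg; u = u_mat F free_gen in star_genideal F
    ({(u i a \<otimes>\<^bsub>F\<^esub> u j b) \<ominus>\<^bsub>F\<^esub> (eta \<theta> j i \<odot>\<^bsub>F\<^esub> (u j b \<otimes>\<^bsub>F\<^esub> u i a)) | i j a b.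
        {i, j} \<subseteq> {1..4} \<and> {a, b} \<subseteq> {1..2}}
     \<union> {(\<Oplus>\<^bsub>F\<^esub>g\<in>{gen_z1, gen_z2, gen_z3, gen_z4}. star F (free_gen g) \<otimes>\<^bsub>F\<^esub> free_gen g)
          \<ominus>\<^bsub>F\<^esub> \<one>\<^bsub>F\<^esub>}))"

type_synonym S7_elt = "S7_gen free_elt set"

definition S7_alg :: "real \<Rightarrow> S7_elt star_algebra" where
  "S7_alg \<theta> = quot_alg free_star_alg (S7_ideal \<theta>)"

definition S7_val :: "real \<Rightarrow> S7_gen \<Rightarrow> S7_elt" where
  "S7_val \<theta> g = S7_ideal \<theta> +>\<^bsub>free_star_alg\<^esub> free_gen g"

definition S4_alpha :: "real \<Rightarrow> S7_elt" where
  "S4_alpha \<theta> = (let B = S7_alg \<theta>; z = S7_val \<theta> in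
    2 \<odot>\<^bsub>B\<^esub> (z gen_z1 \<otimes>\<^bsub>B\<^esub> star B (z gen_z3) \<oplus>\<^bsub>B\<^esub> z gen_z2 \<otimes>\<^bsub>B\<^esub> star B (z gen_z4)))"

definition S4_beta :: "real \<Rightarrow> S7_elt" where
  "S4_beta \<theta> = (let B = S7_alg \<theta>; z = S7_val \<theta> in
    2 \<odot>\<^bsub>B\<^esub> (\<ominus>\<^bsub>B\<^esub> (z gen_z1 \<otimes>\<^bsub>B\<^esub> z gen_z4) \<oplus>\<^bsub>B\<^esub> z gen_z2 \<otimes>\<^bsub>B\<^esub> z gen_z3))"

definition S4_x :: "real \<Rightarrow> S7_elt" where
  "S4_x \<theta> = (let B = S7_alg \<theta>; z = S7_val \<theta> in
    z gen_z1 \<otimes>\<^bsub>B\<^esub> star B (z gen_z1) \<oplus>\<^bsub>B\<^esub> z gen_z2 \<otimes>\<^bsub>B\<^esub> star B (z gen_z2)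
      \<ominus>\<^bsub>B\<^esub> z gen_z3 \<otimes>\<^bsub>B\<^esub> star B (z gen_z3) \<ominus>\<^bsub>B\<^esub> z gen_z4 \<otimes>\<^bsub>B\<^esub> star B (z gen_z4))"

definition S4_alg :: "real \<Rightarrow> S7_elt star_algebra" where
  "S4_alg \<theta> = (S7_alg \<theta>)\<lparr>carrier := star_subalg (S7_alg \<theta>) {S4_alpha \<theta>, S4_beta \<theta>, S4_x \<theta>}\<rparr>"

end

theory Submission
  imports Defs
begin

text \<open>The relation \<open>A\<^sup>* A = 1\<close> forces \<open>A A\<^sup>* = 1\<close> and \<open>det A = 1\<close>, so the quantum group is universal
  for matrices with the commutation relations and \<open>A\<^sup>* A = 1\<close>; this yields the structure maps and the
  Hopf ideal. The \<open>2 \<times> 2\<close> minors of the first two columns are coinvariant. Conversely, triangular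
  representations of the quotient by \<open>J\<close> make root vectors of \<open>SU(2) \<times> SU(2)\<close> act on the quantum
  group and kill every coinvariant, and a Capelli identity then rewrites a coinvariant as a polynomial
  in the minors. The first two columns define a *-homomorphism from the sphere to the quantum group.
  It is injective because, after inverting the central element \<open>r = z\<^sub>1 z\<^sub>1\<^sup>* + z\<^sub>2 z\<^sub>2\<^sup>*\<close> or
  \<open>r = z\<^sub>3 z\<^sub>3\<^sup>* + z\<^sub>4 z\<^sub>4\<^sup>*\<close>, the columns can be completed to a symplectic matrix, so that an element
  of the kernel is annihilated by powers of both, whose sum is \<open>1\<close>. Its inverse carries the minors to
  the generators of the four-sphere.\<close>

section \<open>Typed algebras without unit\<close>

text \<open>No basis or normal form of the algebra of the quantum group is at hand, so neither
  injectivity nor membership in a subalgebra can be read off coefficients. All information comes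
  from maps out of algebras given by generators and relations: a matrix that satisfies the relations
  in some target is a homomorphism. The targets (tensor products, an opposite algebra, triangular
  matrices, operators on sequences) have different types, and the maps into them need not respect a
  star. The star is therefore traded for indices: the adjoint of an entry is, up to sign, the entry
  in the conjugate row and column, and each algebra becomes a plain algebra on its matrix entries.
  In the invariant theory the deformation shows up as a twist: root vectors act as derivations
  twisted by a phase operator, and the twist disappears on words that use the two columns of a block
  equally often. In the localisation the phases explain the double sequences: the two new columns
  need two normalising factors with mutually inverse phases whose product inverts \<open>r\<close>,
  and one shift per index provides them.\<close>

class calg = ring +
  fixes cscale :: "complex \<Rightarrow> 'a \<Rightarrow> 'a" (infixr "*c" 75)
  assumes cscale_add_right: "c *c (x + y) = c *c x + c *c y"
    and cscale_add_left: "(c + d) *c x = c *c x + d *c x"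
    and cscale_cscale [simp]: "c *c d *c x = (c * d) *c x"
    and cscale_one [simp]: "1 *c x = x"
    and mult_cscale_left [simp]: "(c *c x) * y = c *c (x * y)"
    and mult_cscale_right [simp]: "x * (c *c y) = c *c (x * y)"
begin

lemma cscale_zero_right [simp]: "c *c 0 = 0"
  using cscale_add_right[of c 0 0] by simp

lemma cscale_zero_left [simp]: "0 *c x = 0"
  using cscale_add_left[of 0 0 x] by simp

lemma cscale_minus_right [simp]: "c *c (- x) = - (c *c x)"
  using cscale_add_right[of c x "- x"] by (simp add: eq_neg_iff_add_eq_0 add.commute)

lemma cscale_minus_left [simp]: "(- c) *c x = - (c *c x)"
  using cscale_add_left[of c "- c" x] by (simp add: eq_neg_iff_add_eq_0 add.commute)

lemma cscale_diff_right: "c *c (x - y) = c *c x - c *c y"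
  using cscale_add_right[of c x "- y"] by simp

lemma cscale_diff_left: "(c - d) *c x = c *c x - d *c x"
  using cscale_add_left[of c "- d" x] by simp

lemma cscale_sum_right: "c *c (\<Sum>i\<in>I. f i) = (\<Sum>i\<in>I. c *c f i)"
  by (induction I rule: infinite_finite_induct) (auto simp: cscale_add_right)

lemma cscale_cancel: "c \<noteq> 0 \<Longrightarrow> c *c x = c *c y \<longleftrightarrow> x = y"
  by (metis cscale_cscale cscale_one left_inverse)

end

section \<open>Complex algebras as records\<close>

text \<open>One flat formula, so that the typedef and the liftings below can quantify over all
  algebras on a type; it is equivalent to the locale \<open>alg\<close>.\<close>

definition is_alg :: "'a star_algebra \<Rightarrow> bool" where
  "is_alg A \<longleftrightarrow> ring A \<and>
     (\<forall>c. \<forall>x\<in>carrier A. c \<odot>\<^bsub>A\<^esub> x \<in> carrier A) \<and>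
     (\<forall>c. \<forall>x\<in>carrier A. \<forall>y\<in>carrier A. c \<odot>\<^bsub>A\<^esub> (x \<oplus>\<^bsub>A\<^esub> y) = c \<odot>\<^bsub>A\<^esub> x \<oplus>\<^bsub>A\<^esub> c \<odot>\<^bsub>A\<^esub> y) \<and>
     (\<forall>c d. \<forall>x\<in>carrier A. (c + d) \<odot>\<^bsub>A\<^esub> x = c \<odot>\<^bsub>A\<^esub> x \<oplus>\<^bsub>A\<^esub> d \<odot>\<^bsub>A\<^esub> x) \<and>
     (\<forall>c d. \<forall>x\<in>carrier A. c \<odot>\<^bsub>A\<^esub> (d \<odot>\<^bsub>A\<^esub> x) = (c * d) \<odot>\<^bsub>A\<^esub> x) \<and>
     (\<forall>x\<in>carrier A. 1 \<odot>\<^bsub>A\<^esub> x = x) \<and>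
     (\<forall>c. \<forall>x\<in>carrier A. \<forall>y\<in>carrier A. (c \<odot>\<^bsub>A\<^esub> x) \<otimes>\<^bsub>A\<^esub> y = c \<odot>\<^bsub>A\<^esub> (x \<otimes>\<^bsub>A\<^esub> y)) \<and>
     (\<forall>c. \<forall>x\<in>carrier A. \<forall>y\<in>carrier A. x \<otimes>\<^bsub>A\<^esub> (c \<odot>\<^bsub>A\<^esub> y) = c \<odot>\<^bsub>A\<^esub> (x \<otimes>\<^bsub>A\<^esub> y))"

locale alg = ring A for A :: "'a star_algebra" (structure) +
  assumes smult_closed [simp]: "x \<in> carrier A \<Longrightarrow> c \<odot> x \<in> carrier A"
    and smult_add: "x \<in> carrier A \<Longrightarrow> y \<in> carrier A \<Longrightarrow> c \<odot> (x \<oplus> y) = c \<odot> x \<oplus> c \<odot> y"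
    and add_smult: "x \<in> carrier A \<Longrightarrow> (c + d) \<odot> x = c \<odot> x \<oplus> d \<odot> x"
    and smult_smult: "x \<in> carrier A \<Longrightarrow> c \<odot> (d \<odot> x) = (c * d) \<odot> x"
    and one_smult [simp]: "x \<in> carrier A \<Longrightarrow> 1 \<odot> x = x"
    and smult_mult_left: "x \<in> carrier A \<Longrightarrow> y \<in> carrier A \<Longrightarrow> (c \<odot> x) \<otimes> y = c \<odot> (x \<otimes> y)"
    and smult_mult_right: "x \<in> carrier A \<Longrightarrow> y \<in> carrier A \<Longrightarrow> x \<otimes> (c \<odot> y) = c \<odot> (x \<otimes> y)"

lemma is_alg_iff: "is_alg A \<longleftrightarrow> alg A"
  unfolding is_alg_def alg_def alg_axioms_def by auto

context alg begin

lemma smult_zero_right [simp]: "c \<odot> \<zero> = \<zero>"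
  using smult_add[of \<zero> \<zero> c] by (simp add: add.l_cancel_one')

lemma smult_zero_left [simp]: "x \<in> carrier A \<Longrightarrow> 0 \<odot> x = \<zero>"
  using add_smult[of x 0 0] by (simp add: add.l_cancel_one')

lemma minus_smult: "x \<in> carrier A \<Longrightarrow> (- c) \<odot> x = \<ominus> (c \<odot> x)"
  using add_smult[of x "- c" c] by (simp add: minus_equality)

end

lemma is_algD:
  assumes "is_alg A"
  shows "ring A" "x \<in> carrier A \<Longrightarrow> c \<odot>\<^bsub>A\<^esub> x \<in> carrier A"
    "\<zero>\<^bsub>A\<^esub> \<in> carrier A"
    "x \<in> carrier A \<Longrightarrow> y \<in> carrier A \<Longrightarrow> x \<oplus>\<^bsub>A\<^esub> y \<in> carrier A"
    "x \<in> carrier A \<Longrightarrow> y \<in> carrier A \<Longrightarrow> x \<ominus>\<^bsub>A\<^esub> y \<in> carrier A"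
    "x \<in> carrier A \<Longrightarrow> y \<in> carrier A \<Longrightarrow> x \<otimes>\<^bsub>A\<^esub> y \<in> carrier A"
    "x \<in> carrier A \<Longrightarrow> \<ominus>\<^bsub>A\<^esub> x \<in> carrier A"
  using assms by (simp_all add: is_alg_def ring.ring_simprules(1-5))

section \<open>The product of all algebras with elements in a type\<close>

text \<open>Every algebra on a given type embeds as a factor of one ring of a type class; this gives
  access to the type class machinery (sums, simplification) for computations in record algebras.
  The unit of the factor is an idempotent \<open>iota A \<one>\<close>, which is why \<^class>\<open>calg\<close> has no unit.\<close>

typedef 'a algprod = "{f :: 'a star_algebra \<Rightarrow> 'a.
    \<forall>A. (is_alg A \<longrightarrow> f A \<in> carrier A) \<and> (\<not> is_alg A \<longrightarrow> f A = undefined)}"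
  morphisms ev_raw Abs_algprod
  by (rule exI[of _ "\<lambda>A. if is_alg A then \<zero>\<^bsub>A\<^esub> else undefined"]) (simp add: is_algD)

setup_lifting type_definition_algprod

instantiation algprod :: (type) calg
begin

lift_definition zero_algprod :: "'a algprod" is
  "\<lambda>A. if is_alg A then \<zero>\<^bsub>A\<^esub> else undefined"
  by (simp add: is_algD)

lift_definition plus_algprod :: "'a algprod \<Rightarrow> 'a algprod \<Rightarrow> 'a algprod" is
  "\<lambda>f g A. if is_alg A then f A \<oplus>\<^bsub>A\<^esub> g A else undefined"
  by (simp add: is_algD)

lift_definition uminus_algprod :: "'a algprod \<Rightarrow> 'a algprod" is
  "\<lambda>f A. if is_alg A then \<ominus>\<^bsub>A\<^esub> f A else undefined"
  by (simp add: is_algD)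

lift_definition minus_algprod :: "'a algprod \<Rightarrow> 'a algprod \<Rightarrow> 'a algprod" is
  "\<lambda>f g A. if is_alg A then f A \<ominus>\<^bsub>A\<^esub> g A else undefined"
  by (simp add: is_algD)

lift_definition times_algprod :: "'a algprod \<Rightarrow> 'a algprod \<Rightarrow> 'a algprod" is
  "\<lambda>f g A. if is_alg A then f A \<otimes>\<^bsub>A\<^esub> g A else undefined"
  by (simp add: is_algD)

lift_definition cscale_algprod :: "complex \<Rightarrow> 'a algprod \<Rightarrow> 'a algprod" is
  "\<lambda>c f A. if is_alg A then c \<odot>\<^bsub>A\<^esub> f A else undefined"
  by (simp add: is_algD)

instance
proof
  fix a b c :: "'a algprod" and r s :: complex
  show "a * b * c = a * (b * c)"
    by transfer (auto simp: fun_eq_iff is_algD intro: ring.ring_simprules(11) is_algD(1))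
  show "a + b + c = a + (b + c)"
    by transfer (auto simp: fun_eq_iff is_algD intro: ring.ring_simprules(7) is_algD(1))
  show "a + b = b + a"
    by transfer (auto simp: fun_eq_iff is_algD intro: ring.ring_simprules(10) is_algD(1))
  show "0 + a = a"
    by transfer (auto simp: fun_eq_iff is_algD intro: ring.ring_simprules(8) is_algD(1))
  show "- a + a = 0"
    by transfer (auto simp: fun_eq_iff is_algD intro: ring.ring_simprules(9) is_algD(1))
  show "a - b = a + - b"
    by transfer (auto simp: fun_eq_iff is_algD intro: ring.ring_simprules(14) is_algD(1))
  show "(a + b) * c = a * c + b * c"
    by transfer (auto simp: fun_eq_iff is_algD intro: ring.ring_simprules(13) is_algD(1))
  show "a * (b + c) = a * b + a * c"
    by transfer (auto simp: fun_eq_iff is_algD intro: ring.ring_simprules(23) is_algD(1))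
  show "r *c (a + b) = r *c a + r *c b"
    by transfer (auto simp: fun_eq_iff is_algD is_alg_iff intro: alg.smult_add)
  show "(r + s) *c a = r *c a + s *c a"
    by transfer (auto simp: fun_eq_iff is_algD is_alg_iff intro: alg.add_smult)
  show "r *c s *c a = (r * s) *c a"
    by transfer (auto simp: fun_eq_iff is_algD is_alg_iff intro: alg.smult_smult)
  show "1 *c a = a"
    by transfer (auto simp: fun_eq_iff is_algD is_alg_iff intro: alg.one_smult)
  show "r *c a * b = r *c (a * b)"
    by transfer (auto simp: fun_eq_iff is_algD is_alg_iff intro: alg.smult_mult_left)
  show "a * r *c b = r *c (a * b)"
    by transfer (auto simp: fun_eq_iff is_algD is_alg_iff intro: alg.smult_mult_right)
qed

end

lift_definition ev :: "'a star_algebra \<Rightarrow> 'a algprod \<Rightarrow> 'a" is "\<lambda>A f. f A" .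

text \<open>An argument outside the carrier goes to zero, which keeps the map total; the laws for
  elements carry carrier hypotheses. The projection \<open>ev A\<close> is a homomorphism on the
  whole product and inverts \<open>iota A\<close> on the carrier.\<close>

lift_definition iota :: "'a star_algebra \<Rightarrow> 'a \<Rightarrow> 'a algprod" is
  "\<lambda>A x B. if is_alg B then if B = A \<and> x \<in> carrier A then x else \<zero>\<^bsub>B\<^esub> else undefined"
  by (simp add: is_algD)

lemma algprod_eqI:
  assumes "\<And>B. alg B \<Longrightarrow> ev B u = ev B v"
  shows "u = v"
  using assms unfolding is_alg_iff[symmetric] by transfer (rule ext, metis)

lemma ev_iota_if: "alg B \<Longrightarrow> ev B (iota A x) = (if B = A \<and> x \<in> carrier A then x else \<zero>\<^bsub>B\<^esub>)"
  unfolding is_alg_iff[symmetric] by transfer simp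

context alg begin

lemma is_alg [simp]: "is_alg A"
  by (simp add: is_alg_iff alg_axioms)

lemma ev_closed [simp]: "ev A u \<in> carrier A"
  using is_alg by transfer auto

lemma ev_add: "ev A (u + v) = ev A u \<oplus> ev A v"
  using is_alg by transfer auto

lemma ev_mult: "ev A (u * v) = ev A u \<otimes> ev A v"
  using is_alg by transfer auto

lemma ev_cscale: "ev A (c *c u) = c \<odot> ev A u"
  using is_alg by transfer auto

lemma ev_zero: "ev A 0 = \<zero>"
  using is_alg by transfer auto

lemma ev_iota [simp]: "x \<in> carrier A \<Longrightarrow> ev A (iota A x) = x"
  using is_alg by transfer auto

lemma iota_eq_iff: "x \<in> carrier A \<Longrightarrow> y \<in> carrier A \<Longrightarrow> iota A x = iota A y \<longleftrightarrow> x = y"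
  by (metis ev_iota)

lemma iota_add [simp]: "x \<in> carrier A \<Longrightarrow> y \<in> carrier A \<Longrightarrow> iota A (x \<oplus> y) = iota A x + iota A y"
proof (rule algprod_eqI)
  fix B :: "'a star_algebra"
  assume "alg B" "x \<in> carrier A" "y \<in> carrier A"
  then interpret B: alg B by simp
  show "ev B (iota A (x \<oplus> y)) = ev B (iota A x + iota A y)"
    using \<open>x \<in> carrier A\<close> \<open>y \<in> carrier A\<close> by (simp add: ev_iota_if B.alg_axioms B.ev_add)
qed

lemma iota_mult [simp]: "x \<in> carrier A \<Longrightarrow> y \<in> carrier A \<Longrightarrow> iota A (x \<otimes> y) = iota A x * iota A y"
proof (rule algprod_eqI)
  fix B :: "'a star_algebra"
  assume "alg B" "x \<in> carrier A" "y \<in> carrier A"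
  then interpret B: alg B by simp
  show "ev B (iota A (x \<otimes> y)) = ev B (iota A x * iota A y)"
    using \<open>x \<in> carrier A\<close> \<open>y \<in> carrier A\<close> by (simp add: ev_iota_if B.alg_axioms B.ev_mult)
qed

lemma iota_smult [simp]: "x \<in> carrier A \<Longrightarrow> iota A (c \<odot> x) = c *c iota A x"
proof (rule algprod_eqI)
  fix B :: "'a star_algebra"
  assume "alg B" "x \<in> carrier A"
  then interpret B: alg B by simp
  show "ev B (iota A (c \<odot> x)) = ev B (c *c iota A x)"
    using \<open>x \<in> carrier A\<close> by (simp add: ev_iota_if B.alg_axioms B.ev_cscale)
qed

lemma iota_zero [simp]: "iota A \<zero> = 0"
  using iota_add[of \<zero> \<zero>] by simp

lemma iota_minus [simp]: "x \<in> carrier A \<Longrightarrow> iota A (\<ominus> x) = - iota A x"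
  using iota_add[of "\<ominus> x" x] by (simp add: l_neg eq_neg_iff_add_eq_0 del: iota_add)

lemma iota_diff [simp]: "x \<in> carrier A \<Longrightarrow> y \<in> carrier A \<Longrightarrow> iota A (x \<ominus> y) = iota A x - iota A y"
  by (simp add: minus_eq)

lemma iota_one_left [simp]: "x \<in> carrier A \<Longrightarrow> iota A \<one> * iota A x = iota A x"
  using iota_mult[of \<one> x] by (simp del: iota_mult)

lemma iota_one_right [simp]: "x \<in> carrier A \<Longrightarrow> iota A x * iota A \<one> = iota A x"
  using iota_mult[of x \<one>] by (simp del: iota_mult)

lemma iota_finsum [simp]:
  assumes "finite S" "f \<in> S \<rightarrow> carrier A"
  shows "iota A (\<Oplus>i\<in>S. f i) = (\<Sum>i\<in>S. iota A (f i))"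
  using assms by (induction S rule: finite_induct) (auto simp: finsum_insert)

end

section \<open>Quotients\<close>

locale salg = alg A for A :: "'a star_algebra" (structure) +
  assumes star_closed [simp]: "x \<in> carrier A \<Longrightarrow> star A x \<in> carrier A"
    and star_add: "x \<in> carrier A \<Longrightarrow> y \<in> carrier A \<Longrightarrow> star A (x \<oplus> y) = star A x \<oplus> star A y"
    and star_mult: "x \<in> carrier A \<Longrightarrow> y \<in> carrier A \<Longrightarrow> star A (x \<otimes> y) = star A y \<otimes> star A x"
    and star_smult: "x \<in> carrier A \<Longrightarrow> star A (c \<odot> x) = cnj c \<odot> star A x"
    and star_star [simp]: "x \<in> carrier A \<Longrightarrow> star A (star A x) = x"
begin

lemma star_zero [simp]: "star A \<zero> = \<zero>"
  using star_add[of \<zero> \<zero>] by (simp add: add.l_cancel_one')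

lemma star_minus: "x \<in> carrier A \<Longrightarrow> star A (\<ominus> x) = \<ominus> star A x"
  using star_add[of "\<ominus> x" x] by (simp add: l_neg minus_equality)

lemma star_diff: "x \<in> carrier A \<Longrightarrow> y \<in> carrier A \<Longrightarrow> star A (x \<ominus> y) = star A x \<ominus> star A y"
  by (simp add: minus_eq star_add star_minus)

lemma star_one [simp]: "star A \<one> = \<one>"
  using star_mult[of "star A \<one>" \<one>] by simp

lemma star_finsum:
  assumes "finite S" "f \<in> S \<rightarrow> carrier A"
  shows "star A (\<Oplus>i\<in>S. f i) = (\<Oplus>i\<in>S. star A (f i))"
  using assms
  by (induction S rule: finite_induct) (auto simp: finsum_insert star_add Pi_def)

end

locale alg_ideal = alg A + ideal I A for A :: "'a star_algebra" (structure) and I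
begin

text \<open>Since \<open>c \<odot> x\<close> is the product of \<open>c \<odot> \<one>\<close> with
  \<open>x\<close>, every ideal is a complex subspace.\<close>

lemma smult_ideal: "x \<in> I \<Longrightarrow> c \<odot> x \<in> I"
  by (metis I_l_closed Icarr l_one one_closed smult_closed smult_mult_left)

lemma coset_eq_iff: "x \<in> carrier A \<Longrightarrow> y \<in> carrier A \<Longrightarrow> I +> x = I +> y \<longleftrightarrow> x \<ominus> y \<in> I"
  using quotient_eq_iff_same_a_r_cos[OF ideal_axioms] by auto

lemma mem_cosetD: "x' \<in> I +> x \<Longrightarrow> x \<in> carrier A \<Longrightarrow> \<exists>i\<in>I. x' = i \<oplus> x"
  by (auto simp: a_r_coset_def' )

lemma mem_coset_self: "x \<in> carrier A \<Longrightarrow> x \<in> I +> x"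
  by (simp add: a_rcos_self)

lemma quot_carrier: "carrier (quot_alg A I) = (\<lambda>x. I +> x) ` carrier A"
  by (auto simp: quot_alg_def FactRing_def A_RCOSETS_def')

lemma quot_carrierI [simp]: "x \<in> carrier A \<Longrightarrow> I +> x \<in> carrier (quot_alg A I)"
  by (simp add: quot_carrier)

lemma quot_carrierE: "X \<in> carrier (quot_alg A I) \<Longrightarrow> (\<And>x. x \<in> carrier A \<Longrightarrow> X = I +> x \<Longrightarrow> P) \<Longrightarrow> P"
  by (auto simp: quot_carrier)

lemma quot_mult: "x \<in> carrier A \<Longrightarrow> y \<in> carrier A \<Longrightarrow> (I +> x) \<otimes>\<^bsub>quot_alg A I\<^esub> (I +> y) = I +> (x \<otimes> y)"
  by (simp add: quot_alg_def FactRing_def rcoset_mult_add)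

lemma quot_add: "x \<in> carrier A \<Longrightarrow> y \<in> carrier A \<Longrightarrow> (I +> x) \<oplus>\<^bsub>quot_alg A I\<^esub> (I +> y) = I +> (x \<oplus> y)"
  by (simp add: quot_alg_def FactRing_def a_rcos_sum)

lemma quot_one: "\<one>\<^bsub>quot_alg A I\<^esub> = I +> \<one>"
  by (simp add: quot_alg_def FactRing_def)

lemma quot_zero: "\<zero>\<^bsub>quot_alg A I\<^esub> = I +> \<zero>"
  using a_coset_add_zero[OF a_subset] by (simp add: quot_alg_def FactRing_def)

text \<open>The union in the definition runs over all representatives and collapses, because each of
  them yields the same coset.\<close>

lemma quot_smult: "x \<in> carrier A \<Longrightarrow> c \<odot>\<^bsub>quot_alg A I\<^esub> (I +> x) = I +> (c \<odot> x)"
proof -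
  assume x: "x \<in> carrier A"
  have *: "I +> (c \<odot> x') = I +> (c \<odot> x)" if x': "x' \<in> I +> x" for x'
  proof -
    obtain i where i: "i \<in> I" "x' = i \<oplus> x"
      using mem_cosetD[OF x' x] by blast
    then have "i \<in> carrier A" by auto
    then have "(c \<odot> x') \<ominus> (c \<odot> x) = c \<odot> i"
      using x i by (simp add: smult_add minus_eq add.m_assoc r_neg)
    then show ?thesis
      using x i \<open>i \<in> carrier A\<close> smult_ideal by (subst coset_eq_iff) auto
  qed
  have "(\<Union>x'\<in>I +> x. I +> (c \<odot> x')) = I +> (c \<odot> x)"
    using mem_coset_self[OF x] by (intro SUP_eq_const *) blast+
  then show ?thesis by (simp add: quot_alg_def)
qed

lemma quot_ring: "ring (quot_alg A I)"
proof (rule ringI)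
  show "abelian_group (quot_alg A I)"
  proof (rule abelian_groupI)
    show "\<exists>Y\<in>carrier (quot_alg A I). Y \<oplus>\<^bsub>quot_alg A I\<^esub> X = \<zero>\<^bsub>quot_alg A I\<^esub>"
      if X: "X \<in> carrier (quot_alg A I)" for X
    proof -
      obtain x where x: "x \<in> carrier A" "X = I +> x"
        using X by (rule quot_carrierE)
      then have "(I +> (\<ominus> x)) \<oplus>\<^bsub>quot_alg A I\<^esub> X = \<zero>\<^bsub>quot_alg A I\<^esub>"
        by (simp add: quot_add quot_zero l_neg)
      then show ?thesis using x by (intro bexI[of _ "I +> (\<ominus> x)"]) auto
    qed
  qed (auto elim!: quot_carrierE simp: quot_add quot_zero a_ac)
  show "monoid (quot_alg A I)"
    by (rule monoidI) (auto elim!: quot_carrierE simp: quot_mult quot_one m_assoc)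
qed (auto elim!: quot_carrierE simp: quot_add quot_mult l_distr r_distr)

lemma quot_alg: "alg (quot_alg A I)"
proof -
  interpret Q: ring "quot_alg A I" by (rule quot_ring)
  show ?thesis
    by unfold_locales
      (auto elim!: quot_carrierE simp: quot_smult quot_add quot_mult smult_add add_smult
        smult_smult smult_mult_left smult_mult_right)
qed

sublocale Q: alg "quot_alg A I"
  by (rule quot_alg)

lemma quot_minus: "x \<in> carrier A \<Longrightarrow> \<ominus>\<^bsub>quot_alg A I\<^esub> (I +> x) = I +> (\<ominus> x)"
  by (rule Q.minus_equality) (auto simp: quot_add quot_zero l_neg)

lemma quot_finsum:
  assumes "finite S" "f \<in> S \<rightarrow> carrier A"
  shows "(\<Oplus>\<^bsub>quot_alg A I\<^esub>i\<in>S. I +> f i) = I +> (\<Oplus>i\<in>S. f i)"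
  using assms
proof (induction S rule: finite_induct)
  case empty
  then show ?case by (simp add: quot_zero)
next
  case (insert s S)
  then have "\<And>i. i \<in> S \<Longrightarrow> f i \<in> carrier A" "f s \<in> carrier A" by auto
  then show ?case using insert by (auto simp: finsum_insert Q.finsum_insert quot_add)
qed

lemma quot_eq_zero_iff: "x \<in> carrier A \<Longrightarrow> I +> x = \<zero>\<^bsub>quot_alg A I\<^esub> \<longleftrightarrow> x \<in> I"
  by (simp add: quot_zero coset_eq_iff minus_eq)

text \<open>Descends an arbitrary function that is constant on cosets. As no structure is involved,
  the same fact serves homomorphisms and linear maps on tensor products.\<close>

lemma ex_quot_map:
  assumes "\<And>x i. x \<in> carrier A \<Longrightarrow> i \<in> I \<Longrightarrow> h (i \<oplus> x) = h x"
  shows "\<exists>h'. \<forall>x\<in>carrier A. h' (I +> x) = h x"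
proof (intro exI ballI)
  fix x assume x: "x \<in> carrier A"
  have "(SOME y. y \<in> I +> x) \<in> I +> x"
    using mem_coset_self[OF x] by (rule someI)
  then show "h (SOME y. y \<in> I +> x) = h x"
    using mem_cosetD[OF _ x] assms[OF x] by metis
qed

end

locale salg_ideal = salg A + alg_ideal A I for A :: "'a star_algebra" (structure) and I +
  assumes star_ideal: "star A ` I \<subseteq> I"
begin

lemma quot_star: "x \<in> carrier A \<Longrightarrow> star (quot_alg A I) (I +> x) = I +> star A x"
proof -
  assume x: "x \<in> carrier A"
  have *: "I +> star A x' = I +> star A x" if x': "x' \<in> I +> x" for x'
  proof -
    obtain i where i: "i \<in> I" "x' = i \<oplus> x"
      using mem_cosetD[OF x' x] by blast
    then have "i \<in> carrier A" by auto
    then have "star A x' \<ominus> star A x = star A i"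
      using x i by (simp add: star_add minus_eq add.m_assoc r_neg)
    then show ?thesis
      using x i \<open>i \<in> carrier A\<close> star_ideal by (subst coset_eq_iff) auto
  qed
  have "(\<Union>x'\<in>I +> x. I +> star A x') = I +> star A x"
    using mem_coset_self[OF x] by (intro SUP_eq_const *) blast+
  then show ?thesis by (simp add: quot_alg_def)
qed

lemma quot_salg: "salg (quot_alg A I)"
  by unfold_locales
    (auto elim!: quot_carrierE simp: quot_star quot_smult quot_add quot_mult star_add star_mult star_smult)

end

section \<open>Homomorphisms into typed algebras\<close>

text \<open>Nothing is asked of the unit, since the target has none: the unit goes to an idempotent,
  which the universal properties below carry along as \<open>e\<close>.\<close>

definition typed_hom :: "'a star_algebra \<Rightarrow> ('a \<Rightarrow> 'b::calg) \<Rightarrow> bool" where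
  "typed_hom A h \<longleftrightarrow> (\<forall>x\<in>carrier A. \<forall>y\<in>carrier A.
     h (x \<oplus>\<^bsub>A\<^esub> y) = h x + h y \<and> h (x \<otimes>\<^bsub>A\<^esub> y) = h x * h y) \<and>
     (\<forall>c. \<forall>x\<in>carrier A. h (c \<odot>\<^bsub>A\<^esub> x) = c *c h x)"

lemma typed_homD:
  assumes "typed_hom A h" "x \<in> carrier A"
  shows "y \<in> carrier A \<Longrightarrow> h (x \<oplus>\<^bsub>A\<^esub> y) = h x + h y" "y \<in> carrier A \<Longrightarrow> h (x \<otimes>\<^bsub>A\<^esub> y) = h x * h y"
    "h (c \<odot>\<^bsub>A\<^esub> x) = c *c h x"
  using assms by (auto simp: typed_hom_def)

context alg begin

lemma typed_hom_zero: "typed_hom A h \<Longrightarrow> h \<zero> = 0"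
  using typed_homD(1)[of A h \<zero> \<zero>] by simp

lemma typed_hom_minus: "typed_hom A h \<Longrightarrow> x \<in> carrier A \<Longrightarrow> h (\<ominus> x) = - h x"
  using typed_homD(1)[of A h "\<ominus> x" x] by (simp add: l_neg typed_hom_zero eq_neg_iff_add_eq_0)

lemma typed_hom_diff: "typed_hom A h \<Longrightarrow> x \<in> carrier A \<Longrightarrow> y \<in> carrier A \<Longrightarrow> h (x \<ominus> y) = h x - h y"
  by (simp add: minus_eq typed_homD typed_hom_minus)

lemma typed_hom_finsum:
  assumes "typed_hom A h" "finite S" "f \<in> S \<rightarrow> carrier A"
  shows "h (\<Oplus>i\<in>S. f i) = (\<Sum>i\<in>S. h (f i))"
  using assms(2,3)
  by (induction S rule: finite_induct)
    (auto simp: finsum_insert typed_homD[OF assms(1)] typed_hom_zero[OF assms(1)] Pi_def)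

lemma typed_hom_iota: "typed_hom A (iota A)"
  by (simp add: typed_hom_def)

lemma typed_hom_kernel_ideal:
  assumes h: "typed_hom A h"
  shows "ideal {x \<in> carrier A. h x = 0} A"
proof (rule idealI)
  show "ring A" by (rule ring_axioms)
  show "subgroup {x \<in> carrier A. h x = 0} (add_monoid A)"
    using typed_hom_minus[OF h]
    by (intro subgroup.intro) (auto simp: typed_homD[OF h] typed_hom_zero[OF h] a_inv_def[symmetric])
qed (auto simp: typed_homD[OF h])

lemma typed_hom_genideal:
  assumes h: "typed_hom A h" and X: "X \<subseteq> carrier A" "\<And>x. x \<in> X \<Longrightarrow> h x = 0" and y: "y \<in> Idl X"
  shows "h y = 0"
  using genideal_minimal[OF typed_hom_kernel_ideal[OF h], of X] X y by auto

end

lemma (in alg_ideal) typed_hom_quot: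
  assumes h: "typed_hom A h" and I: "\<And>x. x \<in> I \<Longrightarrow> h x = 0"
  shows "\<exists>h'. typed_hom (quot_alg A I) h' \<and> (\<forall>x\<in>carrier A. h' (I +> x) = h x)"
proof -
  obtain h' where h': "\<forall>x\<in>carrier A. h' (I +> x) = h x"
    using ex_quot_map[of h] typed_homD(1)[OF h] I by (metis Icarr add_0)
  have "typed_hom (quot_alg A I) h'"
    unfolding typed_hom_def
    by (auto elim!: quot_carrierE simp: quot_add quot_mult quot_smult h' typed_homD[OF h])
  with h' show ?thesis by blast
qed

context salg begin

lemma star_genideal:
  assumes "X \<subseteq> carrier A"
  shows "ideal (star_genideal A X) A" "star A ` star_genideal A X \<subseteq> star_genideal A X"
    "X \<subseteq> star_genideal A X"
proof -
  have "carrier A \<in> {I. ideal I A \<and> star A ` I \<subseteq> I \<and> X \<subseteq> I}"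
    using assms oneideal by auto
  then show "ideal (star_genideal A X) A"
    unfolding star_genideal_def by (intro i_Intersect) auto
  show "star A ` star_genideal A X \<subseteq> star_genideal A X" "X \<subseteq> star_genideal A X"
    unfolding star_genideal_def by blast+
qed

text \<open>The target has no star, so the kernel of \<open>h\<close> need not be closed under the
  star. The ideal of all \<open>x\<close> such that \<open>h\<close> kills both \<open>x\<close> and
  its adjoint is closed under it, which is why relations and their adjoints must both be
  checked.\<close>

lemma typed_hom_star_genideal:
  assumes h: "typed_hom A h" and X: "X \<subseteq> carrier A" "\<And>x. x \<in> X \<Longrightarrow> h x = 0"
    "\<And>x. x \<in> X \<Longrightarrow> h (star A x) = 0" and y: "y \<in> star_genideal A X"
  shows "h y = 0"
proof -
  let ?I = "{x \<in> carrier A. h x = 0 \<and> h (star A x) = 0}"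
  have "ideal ?I A"
  proof (rule idealI)
    show "ring A" by (rule ring_axioms)
    show "subgroup ?I (add_monoid A)"
      by (intro subgroup.intro) (auto simp: typed_homD[OF h] typed_hom_zero[OF h] typed_hom_minus[OF h]
          star_add star_minus a_inv_def[symmetric])
  qed (auto simp: typed_homD[OF h] star_mult)
  then show ?thesis
    using X y by (auto simp: star_genideal_def)
qed

end

section \<open>Monoid algebras\<close>

text \<open>Common form of the product, the star and linear extension on formal combinations: a sum
  over the support, additive as soon as its summand is additive in the coefficient.\<close>

definition pm_sum :: "('k \<Rightarrow> complex \<Rightarrow> 'c::comm_monoid_add) \<Rightarrow> ('k \<Rightarrow>\<^sub>0 complex) \<Rightarrow> 'c" where
  "pm_sum \<phi> f = (\<Sum>p\<in>Poly_Mapping.keys f. \<phi> p (Poly_Mapping.lookup f p))"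

lemma pm_sum_superset:
  assumes "\<And>p. \<phi> p 0 = 0" "finite S" "Poly_Mapping.keys f \<subseteq> S"
  shows "pm_sum \<phi> f = (\<Sum>p\<in>S. \<phi> p (Poly_Mapping.lookup f p))"
  unfolding pm_sum_def
  by (rule sum.mono_neutral_left) (use assms in \<open>auto simp: in_keys_iff\<close>)

lemma pm_sum_add:
  assumes "\<And>p. \<phi> p 0 = 0" "\<And>p a b. \<phi> p (a + b) = \<phi> p a + \<phi> p b"
  shows "pm_sum \<phi> (f + g) = pm_sum \<phi> f + pm_sum \<phi> g"
proof -
  let ?S = "Poly_Mapping.keys f \<union> Poly_Mapping.keys g"
  have "pm_sum \<phi> (f + g) = (\<Sum>p\<in>?S. \<phi> p (Poly_Mapping.lookup (f + g) p))"
    by (rule pm_sum_superset) (use assms keys_add[of f g] in auto)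
  also have "\<dots> = pm_sum \<phi> f + pm_sum \<phi> g"
    using pm_sum_superset[of \<phi> ?S f] pm_sum_superset[of \<phi> ?S g] assms
    by (simp add: lookup_add sum.distrib)
  finally show ?thesis .
qed

lemma pm_sum_single:
  assumes "\<phi> p 0 = 0"
  shows "pm_sum \<phi> (Poly_Mapping.single p c) = \<phi> p c"
  using assms by (simp add: pm_sum_def)

lemma pm_sum_zero [simp]: "pm_sum \<phi> 0 = 0"
  by (simp add: pm_sum_def)

text \<open>The new term may meet the support of \<open>f\<close> or have coefficient zero, so an
  inductive step is a plain appeal to additivity.\<close>

lemma pm_induct [consumes 1, case_names zero add]:
  fixes f :: "'k \<Rightarrow>\<^sub>0 complex"
  assumes "Poly_Mapping.keys f \<subseteq> K" and "P 0"
    and "\<And>p c f. p \<in> K \<Longrightarrow> Poly_Mapping.keys f \<subseteq> K \<Longrightarrow> P f \<Longrightarrow> P (Poly_Mapping.single p c + f)"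
  shows "P f"
proof -
  have *: "f = (\<Sum>p\<in>Poly_Mapping.keys f. Poly_Mapping.single p (Poly_Mapping.lookup f p))"
    by (rule poly_mapping_eqI) (auto simp: lookup_sum lookup_single when_def in_keys_iff)
  have "P (\<Sum>p\<in>S. Poly_Mapping.single p (Poly_Mapping.lookup f p)) \<and>
      Poly_Mapping.keys (\<Sum>p\<in>S. Poly_Mapping.single p (Poly_Mapping.lookup f p)) \<subseteq> K"
    if "finite S" "S \<subseteq> K" for S
    using that
  proof (induction S rule: finite_induct)
    case (insert s S)
    then show ?case
      using keys_add[of "Poly_Mapping.single s (Poly_Mapping.lookup f s)"
          "\<Sum>p\<in>S. Poly_Mapping.single p (Poly_Mapping.lookup f p)"]
      by (auto intro!: assms(3) split: if_splits)
  qed (auto simp: assms(2))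
  from this[of "Poly_Mapping.keys f"] show ?thesis
    using * assms(1) by simp
qed

definition pm_conv :: "('k \<Rightarrow> 'k \<Rightarrow> 'k) \<Rightarrow> ('k \<Rightarrow>\<^sub>0 complex) \<Rightarrow> ('k \<Rightarrow>\<^sub>0 complex) \<Rightarrow> ('k \<Rightarrow>\<^sub>0 complex)" where
  "pm_conv m f g = pm_sum (\<lambda>p a. pm_sum (\<lambda>q b. Poly_Mapping.single (m p q) (a * b)) g) f"

lemma pm_sum_add_fun: "pm_sum (\<lambda>p a. F p a + G p a) f = pm_sum F f + pm_sum G f"
  by (simp add: pm_sum_def sum.distrib)

lemma pm_conv_add_left: "pm_conv m (f + f') g = pm_conv m f g + pm_conv m f' g"
  unfolding pm_conv_def
proof (rule pm_sum_add)
  show "pm_sum (\<lambda>q b. Poly_Mapping.single (m p q) (0 * b)) g = 0" for p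
    by (simp add: pm_sum_def)
  show "pm_sum (\<lambda>q c. Poly_Mapping.single (m p q) ((a + b) * c)) g =
      pm_sum (\<lambda>q c. Poly_Mapping.single (m p q) (a * c)) g + pm_sum (\<lambda>q c. Poly_Mapping.single (m p q) (b * c)) g" for p a b
    by (simp add: pm_sum_add_fun[symmetric] single_add[symmetric] ring_distribs)
qed

lemma pm_conv_add_right: "pm_conv m f (g + g') = pm_conv m f g + pm_conv m f g'"
proof -
  have "pm_sum (\<lambda>q b. Poly_Mapping.single (m p q) (a * b)) (g + g') =
     pm_sum (\<lambda>q b. Poly_Mapping.single (m p q) (a * b)) g + pm_sum (\<lambda>q b. Poly_Mapping.single (m p q) (a * b)) g'" for p a
    by (rule pm_sum_add) (simp_all add: single_add[symmetric] ring_distribs)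
  then show ?thesis
    by (simp add: pm_conv_def pm_sum_add_fun)
qed

lemma pm_conv_zero [simp]: "pm_conv m 0 g = 0" "pm_conv m f 0 = 0"
  by (simp_all add: pm_conv_def pm_sum_def)

lemma pm_conv_single [simp]:
  "pm_conv m (Poly_Mapping.single p a) (Poly_Mapping.single q b) = Poly_Mapping.single (m p q) (a * b)"
  by (simp add: pm_conv_def pm_sum_single)

lemma pm_conv_keys:
  assumes "Poly_Mapping.keys f \<subseteq> K" "Poly_Mapping.keys g \<subseteq> K" "\<And>p q. p \<in> K \<Longrightarrow> q \<in> K \<Longrightarrow> m p q \<in> K"
  shows "Poly_Mapping.keys (pm_conv m f g) \<subseteq> K"
  using assms(1)
proof (induction f rule: pm_induct)
  case (add p a f)
  have "Poly_Mapping.keys (pm_conv m (Poly_Mapping.single p a) g) \<subseteq> K"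
    using assms(2)
  proof (induction g rule: pm_induct)
    case (add q b g)
    then show ?case
      using keys_add[of "Poly_Mapping.single (m p q) (a * b)" "pm_conv m (Poly_Mapping.single p a) g"]
        assms(3)[OF \<open>p \<in> K\<close>, of q]
      by (auto simp: pm_conv_add_right split: if_splits)
  qed simp
  then show ?case
    using add keys_add[of "pm_conv m (Poly_Mapping.single p a) g" "pm_conv m f g"]
    by (auto simp: pm_conv_add_left)
qed simp

definition pm_scale :: "complex \<Rightarrow> ('k \<Rightarrow>\<^sub>0 complex) \<Rightarrow> ('k \<Rightarrow>\<^sub>0 complex)" where
  "pm_scale c f = Poly_Mapping.map ((*) c) f"

lemma lookup_pm_scale: "Poly_Mapping.lookup (pm_scale c f) k = c * Poly_Mapping.lookup f k"
  by (simp add: pm_scale_def Poly_Mapping.map.rep_eq when_def)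

lemma pm_scale_add: "pm_scale c (f + g) = pm_scale c f + pm_scale c g"
  by (rule poly_mapping_eqI) (simp add: lookup_pm_scale lookup_add ring_distribs)

lemma pm_scale_single [simp]: "pm_scale c (Poly_Mapping.single p a) = Poly_Mapping.single p (c * a)"
  by (rule poly_mapping_eqI) (simp add: lookup_pm_scale lookup_single when_def)

lemma pm_scale_zero [simp]: "pm_scale c 0 = 0"
  by (rule poly_mapping_eqI) (simp add: lookup_pm_scale)

lemma keys_pm_scale: "Poly_Mapping.keys (pm_scale c f) \<subseteq> Poly_Mapping.keys f"
  by (auto simp: in_keys_iff lookup_pm_scale)

lemma monoid_alg_simps:
  "carrier (monoid_alg M s) = {f. Poly_Mapping.keys f \<subseteq> carrier M}"
  "f \<otimes>\<^bsub>monoid_alg M s\<^esub> g = pm_conv (\<lambda>p q. p \<otimes>\<^bsub>M\<^esub> q) f g"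
  "\<one>\<^bsub>monoid_alg M s\<^esub> = Poly_Mapping.single \<one>\<^bsub>M\<^esub> 1"
  "\<zero>\<^bsub>monoid_alg M s\<^esub> = 0"
  "f \<oplus>\<^bsub>monoid_alg M s\<^esub> g = f + g"
  "c \<odot>\<^bsub>monoid_alg M s\<^esub> f = pm_scale c f"
  "star (monoid_alg M s) f = pm_sum (\<lambda>p a. Poly_Mapping.single (s p) (cnj a)) f"
  by (simp_all add: monoid_alg_def pm_conv_def pm_sum_def pm_scale_def)

lemma keys_add_subset:
  "Poly_Mapping.keys f \<subseteq> K \<Longrightarrow> Poly_Mapping.keys g \<subseteq> K \<Longrightarrow> Poly_Mapping.keys (f + g) \<subseteq> K"
  using keys_add[of f g] by blast

text \<open>The laws of the product are linear in each argument, so \<open>pm_induct\<close> reduces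
  them one argument at a time to basis elements, where they are laws of the monoid.\<close>

lemma monoid_alg_alg:
  assumes "monoid M"
  shows "alg (monoid_alg M s)"
proof -
  interpret M: monoid M by fact
  let ?K = "carrier M" and ?m = "\<lambda>p q. p \<otimes>\<^bsub>M\<^esub> q"
  have assoc: "pm_conv ?m (pm_conv ?m f g) h = pm_conv ?m f (pm_conv ?m g h)"
    if f: "Poly_Mapping.keys f \<subseteq> ?K" and g: "Poly_Mapping.keys g \<subseteq> ?K" and h: "Poly_Mapping.keys h \<subseteq> ?K" for f g h
    using f
  proof (induction f rule: pm_induct)
    case (add p a f)
    have "pm_conv ?m (pm_conv ?m (Poly_Mapping.single p a) g) h = pm_conv ?m (Poly_Mapping.single p a) (pm_conv ?m g h)"
      using g
    proof (induction g rule: pm_induct)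
      case (add q b g)
      have "pm_conv ?m (pm_conv ?m (Poly_Mapping.single p a) (Poly_Mapping.single q b)) h =
          pm_conv ?m (Poly_Mapping.single p a) (pm_conv ?m (Poly_Mapping.single q b) h)"
        using h \<open>p \<in> ?K\<close> \<open>q \<in> ?K\<close>
        by (induction h rule: pm_induct) (auto simp: pm_conv_add_right M.m_assoc mult.assoc)
      with add show ?case by (simp add: pm_conv_add_left pm_conv_add_right)
    qed simp
    with add show ?case by (simp add: pm_conv_add_left)
  qed simp
  have one_l: "pm_conv ?m (Poly_Mapping.single \<one>\<^bsub>M\<^esub> 1) f = f"
    and one_r: "pm_conv ?m f (Poly_Mapping.single \<one>\<^bsub>M\<^esub> 1) = f"
    if "Poly_Mapping.keys f \<subseteq> ?K" for f
    using that by (induction f rule: pm_induct) (auto simp: pm_conv_add_left pm_conv_add_right)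
  have scale_l: "pm_conv ?m (pm_scale c f) g = pm_scale c (pm_conv ?m f g)" 
    and scale_r: "pm_conv ?m f (pm_scale c g) = pm_scale c (pm_conv ?m f g)" 
    if f: "Poly_Mapping.keys f \<subseteq> ?K" and g: "Poly_Mapping.keys g \<subseteq> ?K" for c f g
  proof -
    have "pm_conv ?m (pm_scale c f) g = pm_scale c (pm_conv ?m f g) \<and> pm_conv ?m f (pm_scale c g) = pm_scale c (pm_conv ?m f g)"
      using f
    proof (induction f rule: pm_induct)
      case (add p a f)
      have "pm_conv ?m (pm_scale c (Poly_Mapping.single p a)) g = pm_scale c (pm_conv ?m (Poly_Mapping.single p a) g) \<and>
         pm_conv ?m (Poly_Mapping.single p a) (pm_scale c g) = pm_scale c (pm_conv ?m (Poly_Mapping.single p a) g)"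
        using g
        by (induction g rule: pm_induct) (auto simp: pm_conv_add_right pm_scale_add mult_ac)
      with add show ?case by (auto simp: pm_conv_add_left pm_scale_add)
    qed simp
    then show "pm_conv ?m (pm_scale c f) g = pm_scale c (pm_conv ?m f g)"
      "pm_conv ?m f (pm_scale c g) = pm_scale c (pm_conv ?m f g)" by auto
  qed
  show ?thesis
  proof (rule alg.intro)
    show "ring (monoid_alg M s)"
    proof (rule ringI)
      show "abelian_group (monoid_alg M s)"
      proof (rule abelian_groupI)
        show "\<exists>y\<in>carrier (monoid_alg M s). y \<oplus>\<^bsub>monoid_alg M s\<^esub> x = \<zero>\<^bsub>monoid_alg M s\<^esub>"
          if "x \<in> carrier (monoid_alg M s)" for x
          using that by (intro bexI[of _ "- x"]) (auto simp: monoid_alg_simps in_keys_iff)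
      qed (auto simp: monoid_alg_simps ac_simps dest!: subsetD[OF keys_add])
      show "monoid (monoid_alg M s)"
        by (rule monoidI) (simp_all add: monoid_alg_simps assoc one_l one_r pm_conv_keys)
    qed (auto simp: monoid_alg_simps pm_conv_add_left pm_conv_add_right)
    show "alg_axioms (monoid_alg M s)"
    proof
      fix x y c d
      assume x: "x \<in> carrier (monoid_alg M s)"
      show "c \<odot>\<^bsub>monoid_alg M s\<^esub> x \<in> carrier (monoid_alg M s)"
        using x keys_pm_scale[of c x] by (auto simp: monoid_alg_simps)
      show "(c + d) \<odot>\<^bsub>monoid_alg M s\<^esub> x = c \<odot>\<^bsub>monoid_alg M s\<^esub> x \<oplus>\<^bsub>monoid_alg M s\<^esub> d \<odot>\<^bsub>monoid_alg M s\<^esub> x"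
        by (rule poly_mapping_eqI) (simp add: monoid_alg_simps lookup_pm_scale lookup_add ring_distribs)
      show "c \<odot>\<^bsub>monoid_alg M s\<^esub> (d \<odot>\<^bsub>monoid_alg M s\<^esub> x) = (c * d) \<odot>\<^bsub>monoid_alg M s\<^esub> x"
        by (rule poly_mapping_eqI) (simp add: monoid_alg_simps lookup_pm_scale)
      show "1 \<odot>\<^bsub>monoid_alg M s\<^esub> x = x"
        by (rule poly_mapping_eqI) (simp add: monoid_alg_simps lookup_pm_scale)
      assume y: "y \<in> carrier (monoid_alg M s)"
      show "c \<odot>\<^bsub>monoid_alg M s\<^esub> (x \<oplus>\<^bsub>monoid_alg M s\<^esub> y) = c \<odot>\<^bsub>monoid_alg M s\<^esub> x \<oplus>\<^bsub>monoid_alg M s\<^esub> c \<odot>\<^bsub>monoid_alg M s\<^esub> y"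
        by (simp add: monoid_alg_simps pm_scale_add)
      show "c \<odot>\<^bsub>monoid_alg M s\<^esub> x \<otimes>\<^bsub>monoid_alg M s\<^esub> y = c \<odot>\<^bsub>monoid_alg M s\<^esub> (x \<otimes>\<^bsub>monoid_alg M s\<^esub> y)"
        "x \<otimes>\<^bsub>monoid_alg M s\<^esub> (c \<odot>\<^bsub>monoid_alg M s\<^esub> y) = c \<odot>\<^bsub>monoid_alg M s\<^esub> (x \<otimes>\<^bsub>monoid_alg M s\<^esub> y)"
        using x y by (auto simp: monoid_alg_simps scale_l scale_r)
    qed
  qed
qed

lemma monoid_alg_salg:
  assumes "monoid M" and s: "\<And>p. p \<in> carrier M \<Longrightarrow> s p \<in> carrier M"
    "\<And>p. p \<in> carrier M \<Longrightarrow> s (s p) = p"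
    "\<And>p q. p \<in> carrier M \<Longrightarrow> q \<in> carrier M \<Longrightarrow> s (p \<otimes>\<^bsub>M\<^esub> q) = s q \<otimes>\<^bsub>M\<^esub> s p"
  shows "salg (monoid_alg M s)"
proof -
  interpret M: monoid M by fact
  interpret A: alg "monoid_alg M s" by (rule monoid_alg_alg) fact
  let ?K = "carrier M" and ?m = "\<lambda>p q. p \<otimes>\<^bsub>M\<^esub> q"
  define S where "S = pm_sum (\<lambda>p a. Poly_Mapping.single (s p) (cnj a))"
  have S_add: "S (f + g) = S f + S g" for f g
    unfolding S_def by (rule pm_sum_add) (simp_all add: single_add)
  have S_single: "S (Poly_Mapping.single p a) = Poly_Mapping.single (s p) (cnj a)" for p a
    unfolding S_def by (simp add: pm_sum_single)
  have S_0: "S 0 = 0" by (simp add: S_def)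
  have S_keys: "Poly_Mapping.keys (S f) \<subseteq> ?K" if "Poly_Mapping.keys f \<subseteq> ?K" for f
    using that
    by (induction f rule: pm_induct) (simp_all add: S_0 S_add S_single s keys_add_subset)
  have S_mult: "S (pm_conv ?m f g) = pm_conv ?m (S g) (S f)"
    if f: "Poly_Mapping.keys f \<subseteq> ?K" and g: "Poly_Mapping.keys g \<subseteq> ?K" for f g
    using f
  proof (induction f rule: pm_induct)
    case (add p a f)
    have "S (pm_conv ?m (Poly_Mapping.single p a) g) = pm_conv ?m (S g) (S (Poly_Mapping.single p a))"
      using g \<open>p \<in> ?K\<close>
      by (induction g rule: pm_induct)
        (auto simp: S_0 S_add S_single s pm_conv_add_left pm_conv_add_right mult.commute)
    with add show ?case
      by (simp add: S_add pm_conv_add_left pm_conv_add_right)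
  qed (simp add: S_0)
  have S_S: "S (S f) = f" if "Poly_Mapping.keys f \<subseteq> ?K" for f
    using that by (induction f rule: pm_induct) (auto simp: S_0 S_add S_single s)
  have S_scale: "S (pm_scale c f) = pm_scale (cnj c) (S f)" if "Poly_Mapping.keys f \<subseteq> ?K" for c f
    using that by (induction f rule: pm_induct) (auto simp: S_0 S_add S_single pm_scale_add)
  show ?thesis
    by unfold_locales
      (auto simp: monoid_alg_simps S_def[symmetric] S_add S_mult S_S S_scale dest: S_keys)
qed

section \<open>The linear extension of a map on the basis\<close>

definition lin_ext :: "('k \<Rightarrow> 'b::calg) \<Rightarrow> ('k \<Rightarrow>\<^sub>0 complex) \<Rightarrow> 'b" where
  "lin_ext h = pm_sum (\<lambda>p a. a *c h p)"

lemma lin_ext_add: "lin_ext h (f + g) = lin_ext h f + lin_ext h g"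
  unfolding lin_ext_def by (rule pm_sum_add) (auto simp: cscale_add_left)

lemma lin_ext_single [simp]: "lin_ext h (Poly_Mapping.single p a) = a *c h p"
  unfolding lin_ext_def by (rule pm_sum_single) simp

lemma lin_ext_zero [simp]: "lin_ext h 0 = 0"
  by (simp add: lin_ext_def)

lemma lin_ext_diff: "lin_ext h (f - g) = lin_ext h f - lin_ext h g"
  using lin_ext_add[of h "f - g" g] by simp

lemma lin_ext_scale: "lin_ext h (pm_scale c f) = c *c lin_ext h f"
  by (induction f rule: pm_induct[OF subset_UNIV])
    (auto simp: pm_scale_add lin_ext_add cscale_add_right)

lemma typed_hom_lin_ext:
  assumes "\<And>p q. p \<in> carrier M \<Longrightarrow> q \<in> carrier M \<Longrightarrow> h (p \<otimes>\<^bsub>M\<^esub> q) = h p * h q"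
  shows "typed_hom (monoid_alg M s) (lin_ext h)"
proof -
  have "lin_ext h (pm_conv (\<lambda>p q. p \<otimes>\<^bsub>M\<^esub> q) f g) = lin_ext h f * lin_ext h g"
    if f: "Poly_Mapping.keys f \<subseteq> carrier M" and g: "Poly_Mapping.keys g \<subseteq> carrier M" for f g
    using f
  proof (induction f rule: pm_induct)
    case (add p a f)
    have "lin_ext h (pm_conv (\<lambda>p q. p \<otimes>\<^bsub>M\<^esub> q) (Poly_Mapping.single p a) g) = (a *c h p) * lin_ext h g"
      using g \<open>p \<in> carrier M\<close>
      by (induction g rule: pm_induct)
        (auto simp: lin_ext_add pm_conv_add_right assms ring_distribs cscale_add_right mult.commute[of a])
    with add show ?case by (simp add: lin_ext_add pm_conv_add_left ring_distribs cscale_add_right)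
  qed simp
  then show ?thesis
    by (auto simp: typed_hom_def monoid_alg_simps lin_ext_add lin_ext_scale)
qed

section \<open>Free *-algebras\<close>

lemma word_monoid: "monoid word_monoid"
  by (rule monoidI) (auto simp: word_monoid_def)

lemma free_salg: "salg free_star_alg"
  unfolding free_star_alg_def
proof (rule monoid_alg_salg[OF word_monoid])
  fix p q :: "('a \<times> bool) list"
  show "word_star (word_star p) = p"
    by (simp add: word_star_def rev_map[symmetric] o_def split_def)
  show "word_star (p \<otimes>\<^bsub>word_monoid\<^esub> q) = word_star q \<otimes>\<^bsub>word_monoid\<^esub> word_star p"
    by (simp add: word_star_def word_monoid_def)
qed (auto simp: word_monoid_def)

lemma free_carrier [simp]: "x \<in> carrier free_star_alg"
  by (simp add: free_star_alg_def monoid_alg_simps word_monoid_def)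

text \<open>The empty word has value \<open>e\<close>, the idempotent that replaces the missing
  unit.\<close>

primrec word_val :: "'b::calg \<Rightarrow> ('g \<times> bool \<Rightarrow> 'b) \<Rightarrow> ('g \<times> bool) list \<Rightarrow> 'b" where
  "word_val e f [] = e"
| "word_val e f (l # w) = f l * word_val e f w"

text \<open>A generator and its adjoint are independent letters, so their values can be prescribed
  separately although the target has no star.\<close>

lemma free_typed_hom:
  assumes e: "e * e = e" "\<And>l. e * f l = f l" "\<And>l. f l * e = f l"
  shows "\<exists>h. typed_hom (free_star_alg :: 'g free_elt star_algebra) h \<and> h \<one>\<^bsub>free_star_alg\<^esub> = (e :: 'b::calg) \<and>
    (\<forall>g. h (free_gen g) = f (g, False) \<and> h (star free_star_alg (free_gen g)) = f (g, True))"
proof (intro exI conjI allI)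
  have el: "e * word_val e f w = word_val e f w" for w
    by (induction w) (simp_all add: e mult.assoc[symmetric])
  have "word_val e f (v @ w) = word_val e f v * word_val e f w" for v w
    by (induction v) (simp_all add: el mult.assoc)
  then show "typed_hom (free_star_alg :: 'g free_elt star_algebra) (lin_ext (word_val e f))"
    unfolding free_star_alg_def by (intro typed_hom_lin_ext) (simp add: word_monoid_def)
  show "lin_ext (word_val e f) \<one>\<^bsub>free_star_alg\<^esub> = e"
    by (simp add: free_star_alg_def monoid_alg_simps word_monoid_def)
  fix g
  show "lin_ext (word_val e f) (free_gen g) = f (g, False)"
    by (simp add: free_gen_def e)
  show "lin_ext (word_val e f) (star free_star_alg (free_gen g)) = f (g, True)"
    by (simp add: free_star_alg_def monoid_alg_simps free_gen_def pm_sum_single word_star_def e)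
qed

lemma free_induct [case_names one add mult smult gen star]:
  assumes one: "P \<one>\<^bsub>free_star_alg\<^esub>"
    and add: "\<And>x y. P x \<Longrightarrow> P y \<Longrightarrow> P (x \<oplus>\<^bsub>free_star_alg\<^esub> y)"
    and mult: "\<And>x y. P x \<Longrightarrow> P y \<Longrightarrow> P (x \<otimes>\<^bsub>free_star_alg\<^esub> y)"
    and smult: "\<And>c x. P x \<Longrightarrow> P (c \<odot>\<^bsub>free_star_alg\<^esub> x)"
    and gen: "\<And>g. P (free_gen g)"
    and star: "\<And>g. P (star free_star_alg (free_gen g))"
  shows "P (x :: 'g free_elt)"
proof -
  interpret F: salg "free_star_alg :: 'g free_elt star_algebra" by (rule free_salg)
  have letter: "P (Poly_Mapping.single [l] 1)" for l
  proof (cases l)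
    case (Pair g b)
    then show ?thesis
      using gen[of g] star[of g]
      by (cases b) (simp_all add: free_gen_def free_star_alg_def monoid_alg_simps pm_sum_single word_star_def)
  qed
  have word: "P (Poly_Mapping.single w 1)" for w
  proof (induction w)
    case Nil
    then show ?case using one by (simp add: free_star_alg_def monoid_alg_simps word_monoid_def)
  next
    case (Cons l w)
    from mult[OF letter[of l] Cons] show ?case
      by (simp add: free_star_alg_def monoid_alg_simps word_monoid_def)
  qed
  have "P 0"
    using smult[OF one, of 0] by (simp add: F.smult_zero_left) (simp add: free_star_alg_def monoid_alg_simps)
  then show ?thesis
  proof (induction x rule: pm_induct[OF subset_UNIV])
    case (2 p c f)
    then show ?case using add[OF smult[OF word[of p], of c], of f]
      by (simp add: free_star_alg_def monoid_alg_simps)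
  qed
qed

text \<open>Keeps the index 1 a numeral: rewritten to a successor of zero it would no longer match
  facts such as \<open>cj_simps\<close> or \<open>eta_simps\<close>.\<close>

declare One_nat_def [simp del]

section \<open>The matrix relations\<close>

definition ix :: "nat set" where "ix = {1, 2, 3, 4}"

lemma ix_finite [simp]: "finite ix" by (simp add: ix_def)

lemma ix_atLeastAtMost: "{1..4} = ix"
  by (auto simp: ix_def)

lemma ix_cases: "i \<in> ix \<Longrightarrow> (i = 1 \<Longrightarrow> P) \<Longrightarrow> (i = 2 \<Longrightarrow> P) \<Longrightarrow> (i = 3 \<Longrightarrow> P) \<Longrightarrow> (i = 4 \<Longrightarrow> P) \<Longrightarrow> P"
  by (auto simp: ix_def)

lemma ix_mem [simp]: "1 \<in> ix" "2 \<in> ix" "3 \<in> ix" "4 \<in> ix"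
  by (simp_all add: ix_def)

lemma sum_ix: "(\<Sum>k\<in>ix. f k) = f 1 + f 2 + f 3 + f (4 :: nat)" for f :: "nat \<Rightarrow> 'a::comm_monoid_add"
  by (simp add: ix_def add.assoc)

text \<open>Row \<open>cj i\<close> is the other row of the quaternionic block of row \<open>i\<close>, so that
  \<open>A\<^sub>i\<^sub>j\<^sup>* = sg (i + j) A\<^sub>i\<^sub>'\<^sub>j\<^sub>'\<close> with \<open>i' = cj i\<close> and \<open>j' = cj j\<close>.\<close>

definition cj :: "nat \<Rightarrow> nat" where
  "cj i = (if i = 1 then 2 else if i = 2 then 1 else if i = 3 then 4 else 3)"

definition sg :: "nat \<Rightarrow> complex" where
  "sg n = (if even n then 1 else - 1)"

lemma cj_simps [simp]: "cj 1 = 2" "cj 2 = 1" "cj 3 = 4" "cj 4 = 3"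
  by (simp_all add: cj_def)

lemma cj_ix [simp]: "i \<in> ix \<Longrightarrow> cj i \<in> ix"
  by (auto simp: ix_def)

lemma cj_cj [simp]: "i \<in> ix \<Longrightarrow> cj (cj i) = i"
  by (auto simp: ix_def)

lemma cj_eq_iff: "i \<in> ix \<Longrightarrow> j \<in> ix \<Longrightarrow> cj i = cj j \<longleftrightarrow> i = j"
  by (auto simp: ix_def)

lemma cj_bij: "bij_betw cj ix ix"
  by (rule bij_betwI[of _ _ _ cj]) auto

lemma sum_cj: "(\<Sum>k\<in>ix. f (cj k)) = (\<Sum>k\<in>ix. f k)"
  by (rule sum.reindex_bij_betw[OF cj_bij])

lemma sg_simps [simp]: "sg (m + n) = sg m * sg n" "sg 1 = - 1" "sg 2 = 1" "sg 3 = - 1" "sg 4 = 1" "sg 5 = - 1" "sg 6 = 1" "sg 7 = - 1" "sg 8 = 1"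
    "sg n * sg n = 1" "sg n * (sg n * z) = z" "cnj (sg n) = sg n"
  by (simp_all add: sg_def)

lemma sg_cj [simp]: "i \<in> ix \<Longrightarrow> sg (cj i) = - sg i"
  by (auto simp: ix_def)

lemma mu_cnj [simp]: "mu \<theta> * cnj (mu \<theta>) = 1" "cnj (mu \<theta>) * mu \<theta> = 1"
    "mu \<theta> * (cnj (mu \<theta>) * z) = z" "cnj (mu \<theta>) * (mu \<theta> * z) = z"
proof -
  have "mu \<theta> = cis (pi * \<theta>)"
    by (simp add: mu_def cis_conv_exp mult.commute)
  then show *: "mu \<theta> * cnj (mu \<theta>) = 1"
    by (simp add: cis_cnj cis_mult)
  then show **: "cnj (mu \<theta>) * mu \<theta> = 1" by (simp add: mult.commute)
  show "mu \<theta> * (cnj (mu \<theta>) * z) = z" "cnj (mu \<theta>) * (mu \<theta> * z) = z"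
    using * ** by (simp_all add: mult.assoc[symmetric])
qed

lemma eta_simps:
  "eta \<theta> 1 1 = 1" "eta \<theta> 1 2 = 1" "eta \<theta> 1 3 = cnj (mu \<theta>)" "eta \<theta> 1 4 = mu \<theta>"
  "eta \<theta> 2 1 = 1" "eta \<theta> 2 2 = 1" "eta \<theta> 2 3 = mu \<theta>" "eta \<theta> 2 4 = cnj (mu \<theta>)"
  "eta \<theta> 3 1 = mu \<theta>" "eta \<theta> 3 2 = cnj (mu \<theta>)" "eta \<theta> 3 3 = 1" "eta \<theta> 3 4 = 1"
  "eta \<theta> 4 1 = cnj (mu \<theta>)" "eta \<theta> 4 2 = mu \<theta>" "eta \<theta> 4 3 = 1" "eta \<theta> 4 4 = 1"
  by (simp_all add: eta_def mat_entry_def)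

lemma eta_swap [simp]: "i \<in> ix \<Longrightarrow> j \<in> ix \<Longrightarrow> eta \<theta> i j * eta \<theta> j i = 1"
    "i \<in> ix \<Longrightarrow> j \<in> ix \<Longrightarrow> eta \<theta> i j * (eta \<theta> j i * z) = z"
  by (auto elim!: ix_cases simp: eta_simps)

text \<open>The two rows of a quaternionic block carry opposite weights for the torus of the
  deformation, so conjugating an index inverts the phase. Phases therefore cancel over a pair
  \<open>l\<close>, \<open>cj l\<close>; many cancellations below are of this kind.\<close>

lemma eta_cj: "i \<in> ix \<Longrightarrow> j \<in> ix \<Longrightarrow> eta \<theta> (cj i) j = eta \<theta> j i"
    "i \<in> ix \<Longrightarrow> j \<in> ix \<Longrightarrow> eta \<theta> i (cj j) = eta \<theta> j i"
  by (auto elim!: ix_cases simp: eta_simps)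

lemma eta_cnj: "i \<in> ix \<Longrightarrow> j \<in> ix \<Longrightarrow> cnj (eta \<theta> i j) = eta \<theta> j i"
  by (auto elim!: ix_cases simp: eta_simps)

lemma eta_nonzero [simp]: "i \<in> ix \<Longrightarrow> j \<in> ix \<Longrightarrow> eta \<theta> i j \<noteq> 0"
  by (metis eta_swap(1) mult_zero_left zero_neq_one)

lemma eta_self [simp]: "i \<in> ix \<Longrightarrow> eta \<theta> i i = 1"
  by (auto elim!: ix_cases simp: eta_simps)

text \<open>The relations of the matrix algebra without the star: all sixteen entries count as
  generators, and \<open>e\<close> is a unit for them.\<close>

locale theta_mat =
  fixes \<theta> :: real and X :: "nat \<Rightarrow> nat \<Rightarrow> 'a::calg" and e :: 'a
  assumes ee [simp]: "e * e = e"
    and eX [simp]: "i \<in> ix \<Longrightarrow> j \<in> ix \<Longrightarrow> e * X i j = X i j"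
    and Xe [simp]: "i \<in> ix \<Longrightarrow> j \<in> ix \<Longrightarrow> X i j * e = X i j"
    and X_comm: "i \<in> ix \<Longrightarrow> j \<in> ix \<Longrightarrow> k \<in> ix \<Longrightarrow> l \<in> ix \<Longrightarrow>
      X i j * X k l = (eta \<theta> k i * eta \<theta> j l) *c (X k l * X i j)"
begin

lemma eX_left [simp]: "i \<in> ix \<Longrightarrow> j \<in> ix \<Longrightarrow> e * (X i j * z) = X i j * z"
  by (simp add: mult.assoc[symmetric])

lemma Xe_left [simp]: "i \<in> ix \<Longrightarrow> j \<in> ix \<Longrightarrow> X i j * (e * z) = X i j * z"
  by (simp add: mult.assoc[symmetric])

lemma X_comm_left:
  "i \<in> ix \<Longrightarrow> j \<in> ix \<Longrightarrow> k \<in> ix \<Longrightarrow> l \<in> ix \<Longrightarrow>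
    X i j * (X k l * z) = (eta \<theta> k i * eta \<theta> j l) *c (X k l * (X i j * z))"
  using X_comm[of i j k l] by (simp add: mult.assoc[symmetric])

text \<open>A minor without phases: \<open>eta\<close> is 1 on the pair \<open>l\<close>,
  \<open>cj l\<close>, so these columns behave classically towards each other. Replacing
  \<open>l\<close> by \<open>cj l\<close> only changes the sign.\<close>

definition mnr :: "nat \<Rightarrow> nat \<Rightarrow> nat \<Rightarrow> 'a" where
  "mnr l i j = X i l * X j (cj l) - X i (cj l) * X j l"

lemma e_mnr [simp]: "l \<in> ix \<Longrightarrow> i \<in> ix \<Longrightarrow> j \<in> ix \<Longrightarrow> e * mnr l i j = mnr l i j"
    "l \<in> ix \<Longrightarrow> i \<in> ix \<Longrightarrow> j \<in> ix \<Longrightarrow> mnr l i j * e = mnr l i j"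
  by (simp_all add: mnr_def ring_distribs mult.assoc[symmetric], simp add: mult.assoc)

lemma mnr_self: "l \<in> ix \<Longrightarrow> i \<in> ix \<Longrightarrow> mnr l i i = 0"
  using X_comm[of i l i "cj l"] by (simp add: mnr_def eta_cj)

lemma mnr_swap: "l \<in> ix \<Longrightarrow> i \<in> ix \<Longrightarrow> j \<in> ix \<Longrightarrow> mnr l j i = - (eta \<theta> i j *c mnr l i j)"
  using X_comm[of j l i "cj l"] X_comm[of j "cj l" i l]
  by (simp add: mnr_def eta_cj cscale_diff_right)

text \<open>The column phases \<open>eta \<theta> n l\<close> and
  \<open>eta \<theta> n (cj l)\<close> are inverse to each other, so only the rows
  contribute.\<close>

lemma X_mnr:
  assumes "k \<in> ix" "n \<in> ix" "l \<in> ix" "i \<in> ix" "j \<in> ix"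
  shows "X k n * mnr l i j = (eta \<theta> i k * eta \<theta> j k) *c (mnr l i j * X k n)"
proof -
  have 1: "X k n * (X i l * X j (cj l)) = (eta \<theta> i k * eta \<theta> j k) *c (X i l * X j (cj l) * X k n)"
    using assms by (simp add: X_comm_left[of k n] X_comm[of k n j] eta_cj mult.assoc) (simp add: mult_ac)
  have 2: "X k n * (X i (cj l) * X j l) = (eta \<theta> i k * eta \<theta> j k) *c (X i (cj l) * X j l * X k n)"
    using assms by (simp add: X_comm_left[of k n] X_comm[of k n j] eta_cj mult.assoc) (simp add: mult_ac)
  show ?thesis
    unfolding mnr_def by (simp add: right_diff_distrib left_diff_distrib cscale_diff_right 1 2)
qed

text \<open>For the row pair \<open>i\<close>, \<open>cj i\<close> the two remaining phases cancel
  as well.\<close>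

lemma X_mnr_central:
  assumes "k \<in> ix" "n \<in> ix" "l \<in> ix" "i \<in> ix"
  shows "X k n * mnr l i (cj i) = mnr l i (cj i) * X k n"
  using X_mnr[OF assms(1-4), of "cj i"] assms by (simp add: eta_cj)

end

text \<open>The relation A^* A = 1: the adjoint of the entry \<open>(k, i)\<close> has been replaced
  by the signed entry in conjugate row and column.\<close>

locale sp_mat = theta_mat +
  assumes unit: "i \<in> ix \<Longrightarrow> j \<in> ix \<Longrightarrow>
    (\<Sum>k\<in>ix. sg (k + i) *c (X (cj k) (cj i) * X k j)) = (if i = j then e else 0)"
begin

text \<open>The diagonal entry \<open>(l, l)\<close> of A^* A = 1, up to the order of the
  factors.\<close>

lemma mnr_col_sum: "l = 1 \<or> l = 3 \<Longrightarrow> mnr l 1 2 + mnr l 3 4 = e"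
  using unit[of l l] X_comm[of 2 "cj l" 1 l] X_comm[of 1 "cj l" 2 l] X_comm[of 4 "cj l" 3 l] X_comm[of 3 "cj l" 4 l]
  by (auto simp: sum_ix mnr_def eta_simps eta_cj)

text \<open>The defect \<open>q = 1 - A A\<^sup>*\<close> satisfies \<open>q A = 0\<close> and \<open>q\<^sup>2 = q\<close>; its diagonal blocks are the
  central scalars \<open>s\<close> and \<open>-s\<close>, which forces \<open>q = 0\<close>.\<close>

definition defect :: "nat \<Rightarrow> nat \<Rightarrow> 'a" where
  "defect i j = (if i = j then e else 0) - (\<Sum>k\<in>ix. sg (j + k) *c (X i k * X (cj j) (cj k)))"

text \<open>Taken in the column pairs 1, 2 and 3, 4, the sum over \<open>k\<close> in an entry of A
  A^* is, up to sign, one minor per pair.\<close>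

lemma q_mnr: "j \<in> ix \<Longrightarrow> defect i j = (if i = j then e else 0) + sg j *c (mnr 1 i (cj j) + mnr 3 i (cj j))"
  by (simp add: defect_def sum_ix mnr_def cscale_add_right cscale_diff_right)

text \<open>By associativity A A^* A = A, so the defect annihilates A from the left.\<close>

lemma q_X: "i \<in> ix \<Longrightarrow> l \<in> ix \<Longrightarrow> (\<Sum>j\<in>ix. defect i j * X j l) = 0"
proof -
  assume i: "i \<in> ix" and l: "l \<in> ix"
  have "(\<Sum>j\<in>ix. (\<Sum>k\<in>ix. sg (j + k) *c (X i k * X (cj j) (cj k))) * X j l) =
      (\<Sum>k\<in>ix. X i k * (\<Sum>j\<in>ix. sg (j + k) *c (X (cj j) (cj k) * X j l)))"
    by (simp add: sum_distrib_right sum_distrib_left cscale_sum_right mult.assoc) (rule sum.swap)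
  also have "\<dots> = X i l"
    using i l by (simp add: unit del: sg_simps) (simp add: if_distrib[of "\<lambda>z. _ * z"] cong: if_cong)
  moreover have "(\<Sum>j\<in>ix. (if i = j then e else 0) * X j l) = X i l"
    using i l by (simp add: if_distrib[of "\<lambda>z. z * _"] cong: if_cong)
  ultimately show ?thesis
    by (simp add: defect_def left_diff_distrib sum_subtractf)
qed

lemma e_q [simp]: "i \<in> ix \<Longrightarrow> j \<in> ix \<Longrightarrow> e * defect i j = defect i j" "i \<in> ix \<Longrightarrow> j \<in> ix \<Longrightarrow> defect i j * e = defect i j"
  by (simp_all add: q_mnr ring_distribs)

text \<open>Multiplying the vanishing product of the defect q and A by A^* gives q (1 - q) =
  0.\<close>

lemma q_q:
  assumes "i \<in> ix" "j \<in> ix"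
  shows "defect i j = (\<Sum>m\<in>ix. defect i m * defect m j)"
proof -
  have "0 = (\<Sum>l\<in>ix. (\<Sum>m\<in>ix. defect i m * X m l) * (sg (j + l) *c X (cj j) (cj l)))"
    using assms by (simp add: q_X)
  also have "\<dots> = (\<Sum>m\<in>ix. defect i m * (\<Sum>l\<in>ix. sg (j + l) *c (X m l * X (cj j) (cj l))))"
    by (simp add: sum_distrib_right sum_distrib_left cscale_sum_right mult.assoc) (rule sum.swap)
  also have "\<dots> = (\<Sum>m\<in>ix. defect i m * ((if m = j then e else 0) - defect m j))"
    by (simp add: defect_def)
  also have "\<dots> = defect i j - (\<Sum>m\<in>ix. defect i m * defect m j)"
    using assms by (simp add: right_diff_distrib sum_subtractf if_distrib[of "\<lambda>z. _ * z"] cong: if_cong)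
  finally show ?thesis by simp
qed

lemma q_zero: 
  assumes "i \<in> ix" "j \<in> ix"
  shows "defect i j = 0"
proof -
  let ?s = "defect 1 1"
  have s: "?s = e - (mnr 1 1 2 + mnr 3 1 2)" by (simp add: q_mnr)
  have q22: "defect 2 2 = ?s"
    using mnr_swap[of 1 1 2] mnr_swap[of 3 1 2] by (simp add: q_mnr eta_simps)
  \<comment> \<open>The two column sums add up to twice the unit. They express the minors of the
    lower rows by those of the upper rows, which reverses the sign of \<open>?s\<close>.\<close>
  have q33: "defect 3 3 = - ?s"
    using mnr_col_sum[of 1] mnr_col_sum[of 3] by (simp add: q_mnr algebra_simps)
  have q44: "defect 4 4 = - ?s"
    using mnr_swap[of 1 3 4] mnr_swap[of 3 3 4] q33 by (simp add: q_mnr eta_simps)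
  have q_off: "defect 1 2 = 0" "defect 2 1 = 0" "defect 3 4 = 0" "defect 4 3 = 0"
    by (simp_all add: q_mnr mnr_self)
  have sX: "?s * X k l = X k l * ?s" if "k \<in> ix" "l \<in> ix" for k l
    using X_mnr_central[of k l 1 1] X_mnr_central[of k l 3 1] that
    by (simp add: s ring_distribs)
  have sm: "?s * mnr l m n = mnr l m n * ?s" if "l \<in> ix" "m \<in> ix" "n \<in> ix" for l m n
    using that by (simp add: mnr_def ring_distribs mult.assoc sX)
      (simp add: mult.assoc[symmetric] sX, simp add: mult.assoc sX)
  have sq: "?s * defect m n = defect m n * ?s" if "m \<in> ix" "n \<in> ix" for m n
    using that unfolding q_mnr[OF \<open>n \<in> ix\<close>] by (simp add: ring_distribs sm)
  \<comment> \<open>Off the diagonal blocks the idempotent law reads q_ij = s q_ij - q_ij s or q_ij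
    = q_ij s - s q_ij, and \<open>?s\<close> commutes with all entries of the defect.\<close>
  have sym: "defect i j = 0" if "(i, j) \<in> {(1, 3), (1, 4), (2, 3), (2, 4), (3, 1), (3, 2), (4, 1), (4, 2)}" for i j
    using that q_q[of i j] sq[of i j] by (auto simp: sum_ix q22 q33 q44 q_off)
  \<comment> \<open>With the off-diagonal entries gone, a row of the defect times A is plus or minus
    \<open>?s\<close> times a row of A.\<close>
  have sX0: "?s * X m l = 0" if "m \<in> ix" "l \<in> ix" for m l
    using that(1) q_X[of m l] that(2)
    by (auto elim!: ix_cases simp: sum_ix q_off sym q22 q33 q44)
  \<comment> \<open>Inserting the diagonal entry \<open>(1, 1)\<close> of A^* A = 1 turns the
    annihilation of all entries into the vanishing of \<open>?s\<close>.\<close>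
  have "?s = ?s * (\<Sum>k\<in>ix. sg (k + 1) *c (X (cj k) (cj 1) * X k 1))"
    unfolding unit[OF ix_mem(1) ix_mem(1)] by simp
  also have "\<dots> = 0"
    by (simp add: sum_distrib_left mult.assoc[symmetric] sX0)
  finally have "?s = 0" .
  with assms q22 q33 q44 q_off sym show ?thesis
    by (auto elim!: ix_cases)
qed

lemma unit_right:
  "i \<in> ix \<Longrightarrow> j \<in> ix \<Longrightarrow> (\<Sum>k\<in>ix. sg (j + k) *c (X i k * X (cj j) (cj k))) = (if i = j then e else 0)"
  using q_zero[of i j] by (simp add: defect_def)

lemma mnr_row_sum:
  assumes "i \<in> ix" "j \<in> ix"
  shows "mnr 1 i j + mnr 3 i j = (if i = cj j then sg j *c e else 0)"
proof -
  have "sg j *c (mnr 1 i j + mnr 3 i j) = (if i = cj j then e else 0)"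
    using q_mnr[of "cj j" i] q_zero[of i "cj j"] assms by (auto simp: algebra_simps)
  then have "sg j *c sg j *c (mnr 1 i j + mnr 3 i j) = (if i = cj j then sg j *c e else 0)"
    by auto
  then show ?thesis by simp
qed

end

section \<open>The determinant\<close>

text \<open>The sign is an argument of \<open>G\<close>, so the expansions of the determinant and of
  its adjoint into 24 terms are two instances of one formula.\<close>

lemma sum_permutes_ix:
  fixes G :: "complex \<Rightarrow> nat \<Rightarrow> nat \<Rightarrow> nat \<Rightarrow> nat \<Rightarrow> 'a::comm_monoid_add"
  shows "(\<Sum>\<sigma>\<in>{\<sigma>. \<sigma> permutes ix}. G (of_int (sign \<sigma>)) (\<sigma> 1) (\<sigma> 2) (\<sigma> 3) (\<sigma> 4)) =
    G 1 1 2 3 4 + G (- 1) 1 2 4 3 + G (- 1) 1 3 2 4 + G 1 1 3 4 2 + G 1 1 4 2 3 + G (- 1) 1 4 3 2 + G (- 1) 2 1 3 4 + G 1 2 1 4 3 + G 1 2 3 1 4 + G (- 1) 2 3 4 1 + G (- 1) 2 4 1 3 + G 1 2 4 3 1 + G 1 3 1 2 4 + G (- 1) 3 1 4 2 + G (- 1) 3 2 1 4 + G 1 3 2 4 1 + G 1 3 4 1 2 + G (- 1) 3 4 2 1 + G (- 1) 4 1 2 3 + G 1 4 1 3 2 + G 1 4 2 1 3 + G (- 1) 4 2 3 1 + G (- 1) 4 3 1 2 + G 1 4 3 2 1"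
proof -
  have single: "{\<sigma>. \<sigma> permutes {4::nat}} = {id}"
    by (auto simp: permutes_sing)
  have sgn2: "sign (transpose a b \<circ> p) = (if a = b then 1 else - 1) * sign p" if "permutation p" for a b :: nat and p
    using that by (simp add: sign_compose sign_swap_id permutation_swap_id)
  have sgn1: "sign (transpose a b) = (if a = b then 1 else - 1)" for a b :: nat
    by (simp add: sign_swap_id)
  show ?thesis
    unfolding ix_def
    by (simp add: sum_over_permutations_insert single sgn1 sgn2 permutation_compose permutation_swap_id
        transpose_def o_def[symmetric] sign_id ac_simps)
qed

lemma rotate_4_cases:
  assumes "length w = 4"
  shows "(\<exists>n. v = rotate n w) \<longleftrightarrow> v \<in> {w, rotate 1 w, rotate 2 w, rotate 3 w}"
proof
  assume "\<exists>n. v = rotate n w"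
  then obtain n where "v = rotate (n mod 4) w"
    using assms by (metis rotate_conv_mod)
  moreover have "n mod 4 = 0 \<or> n mod 4 = 1 \<or> n mod 4 = 2 \<or> n mod 4 = 3"
    by presburger
  ultimately show "v \<in> {w, rotate 1 w, rotate 2 w, rotate 3 w}" by auto
next
  assume "v \<in> {w, rotate 1 w, rotate 2 w, rotate 3 w}"
  moreover have "w = rotate 0 w" by simp
  ultimately show "\<exists>n. v = rotate n w" by blast
qed

lemma det_eps_eq:
  "det_eps \<theta> w =
    (if w \<in> {[1,3,2,4], [3,2,4,1], [2,4,1,3], [4,1,3,2]} then mu \<theta>
     else if w \<in> {[1,4,2,3], [4,2,3,1], [2,3,1,4], [3,1,4,2]} then cnj (mu \<theta>)
     else 1)"
proof -
  have rot: "rotate 1 [a, b, c, d] = [b, c, d, a]" "rotate 2 [a, b, c, d] = [c, d, a, b]"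
    "rotate 3 [a, b, c, d] = [d, a, b, c]" for a b c d :: nat
    by (simp_all add: rotate_drop_take One_nat_def)
  show ?thesis
    unfolding det_eps_def by (simp add: rotate_4_cases rot)
qed

text \<open>The mixed terms of the determinant are products of the \<open>2 \<times> 2\<close> minors of the upper and of the
  lower two rows, which \<open>A\<^sup>* A = 1\<close> makes opposite to each other.\<close>

definition theta_det :: "real \<Rightarrow> (nat \<Rightarrow> nat \<Rightarrow> 'a::calg) \<Rightarrow> 'a" where
  "theta_det \<theta> X = (\<Sum>\<sigma>\<in>{\<sigma>. \<sigma> permutes ix}.
     (of_int (sign \<sigma>) * det_eps \<theta> [\<sigma> 1, \<sigma> 2, \<sigma> 3, \<sigma> 4]) *c (X 1 (\<sigma> 1) * (X 2 (\<sigma> 2) * (X 3 (\<sigma> 3) * X 4 (\<sigma> 4)))))"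

text \<open>The left-hand side is what the star makes of the determinant: it reverses the factors
  and conjugates rows and columns. Moving the lower rows back past the upper ones produces phases
  that turn the conjugated coefficients into those of the determinant, term by term after
  relabelling.\<close>

lemma (in theta_mat) theta_det_star:
  "(\<Sum>\<sigma>\<in>{\<sigma>. \<sigma> permutes ix}. (of_int (sign \<sigma>) * cnj (det_eps \<theta> [\<sigma> 1, \<sigma> 2, \<sigma> 3, \<sigma> 4])) *c
     (X 3 (cj (\<sigma> 4)) * (X 4 (cj (\<sigma> 3)) * (X 1 (cj (\<sigma> 2)) * X 2 (cj (\<sigma> 1)))))) = theta_det \<theta> X"
proof -
  have rows: "X i j * X k l = (eta \<theta> k i * eta \<theta> j l) *c (X k l * X i j)"
    "X i j * (X k l * z) = (eta \<theta> k i * eta \<theta> j l) *c (X k l * (X i j * z))"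
    if "i = 3 \<or> i = 4" "k = 1 \<or> k = 2" "j \<in> ix" "l \<in> ix" for i j k l z
    using that X_comm[of i j k l] X_comm_left[of i j k l z] by auto
  show ?thesis
    unfolding theta_det_def
    unfolding sum_permutes_ix[where G = "\<lambda>s i j k l. (s * cnj (det_eps \<theta> [i, j, k, l])) *c
      (X 3 (cj l) * (X 4 (cj k) * (X 1 (cj j) * X 2 (cj i))))"]
    unfolding sum_permutes_ix[where G = "\<lambda>s i j k l. (s * det_eps \<theta> [i, j, k, l]) *c
      (X 1 i * (X 2 j * (X 3 k * X 4 l)))"]
    by (simp add: det_eps_eq rows eta_simps) (simp add: algebra_simps)
qed

context sp_mat begin

text \<open>The off-diagonal entry \<open>(cj j, l)\<close> of A^* A = 1 for columns of different
  blocks. It relates the two factors in the mixed terms of the determinant.\<close>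

lemma minor_opp:
  assumes "j \<in> ix" "l \<in> ix" "l \<noteq> j" "l \<noteq> cj j"
  shows "X 1 j * X 2 l - eta \<theta> j l *c (X 1 l * X 2 j) = - (X 3 j * X 4 l - eta \<theta> j l *c (X 3 l * X 4 j))"
proof -
  have "(\<Sum>k\<in>ix. sg (k + cj j) *c (X (cj k) (cj (cj j)) * X k l)) = 0"
    using unit[of "cj j" l] assms by auto
  moreover have "X 2 j * X 1 l = eta \<theta> j l *c (X 1 l * X 2 j)" "X 4 j * X 3 l = eta \<theta> j l *c (X 3 l * X 4 j)"
    using X_comm[of 2 j 1 l] X_comm[of 4 j 3 l] assms by (simp_all add: eta_simps)
  ultimately have "sg j *c (X 1 j * X 2 l - eta \<theta> j l *c (X 1 l * X 2 j) + (X 3 j * X 4 l - eta \<theta> j l *c (X 3 l * X 4 j))) = 0"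
    using assms by (simp add: sum_ix cscale_add_right cscale_diff_right algebra_simps)
  then have "sg j *c sg j *c (X 1 j * X 2 l - eta \<theta> j l *c (X 1 l * X 2 j) + (X 3 j * X 4 l - eta \<theta> j l *c (X 3 l * X 4 j))) = 0"
    by (simp only: cscale_zero_right)
  then show ?thesis by (simp only: eq_neg_iff_add_eq_0 cscale_cscale sg_simps cscale_one)
qed

lemma theta_det_one: "theta_det \<theta> X = e"
proof -
  define m where "m j l = X 3 j * X 4 l - eta \<theta> j l *c (X 3 l * X 4 j)" for j l
  define n where "n j l = X 1 j * X 2 l - eta \<theta> j l *c (X 1 l * X 2 j)" for j l
  have nm: "n j l = - m j l" if "j \<in> {1, 2}" "l \<in> {3, 4}" for j l
    using minor_opp[of j l] that by (auto simp: m_def n_def)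
  \<comment> \<open>Laplace expansion along the two upper and the two lower rows; the coefficients
    \<open>det_eps\<close> are what makes the mixed terms factor into deformed minors.\<close>
  have 1: "theta_det \<theta> X = mnr 1 1 2 * mnr 3 3 4 + mnr 3 1 2 * mnr 1 3 4
      - mu \<theta> *c (n 1 3 * m 2 4) - mu \<theta> *c (n 2 4 * m 1 3)
      + cnj (mu \<theta>) *c (n 1 4 * m 2 3) + cnj (mu \<theta>) *c (n 2 3 * m 1 4)"
    unfolding theta_det_def
    unfolding sum_permutes_ix[where G = "\<lambda>s i j k l. (s * det_eps \<theta> [i, j, k, l]) *c
      (X 1 i * (X 2 j * (X 3 k * X 4 l)))"]
    by (simp add: det_eps_eq m_def n_def mnr_def eta_simps ring_distribs mult.assoc cscale_diff_right cscale_add_right)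
  have rows: "X 4 j * X 3 l = eta \<theta> j l *c (X 3 l * X 4 j)"
    "X 4 j * (X 3 l * z) = eta \<theta> j l *c (X 3 l * (X 4 j * z))"
    if "j \<in> ix" "l \<in> ix" for j l z
    using that X_comm[of 4 j 3 l] X_comm_left[of 4 j 3 l z] by (auto simp: eta_simps)
  have cols: "X i 2 * X i 1 = X i 1 * X i 2" "X i 2 * (X i 1 * z) = X i 1 * (X i 2 * z)"
    "X i 4 * X i 3 = X i 3 * X i 4" "X i 4 * (X i 3 * z) = X i 3 * (X i 4 * z)"
    "X i 3 * X i 1 = eta \<theta> 3 1 *c (X i 1 * X i 3)" "X i 3 * (X i 1 * z) = eta \<theta> 3 1 *c (X i 1 * (X i 3 * z))"
    "X i 3 * X i 2 = eta \<theta> 3 2 *c (X i 2 * X i 3)" "X i 3 * (X i 2 * z) = eta \<theta> 3 2 *c (X i 2 * (X i 3 * z))"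
    "X i 4 * X i 1 = eta \<theta> 4 1 *c (X i 1 * X i 4)" "X i 4 * (X i 1 * z) = eta \<theta> 4 1 *c (X i 1 * (X i 4 * z))"
    "X i 4 * X i 2 = eta \<theta> 4 2 *c (X i 2 * X i 4)" "X i 4 * (X i 2 * z) = eta \<theta> 4 2 *c (X i 2 * (X i 4 * z))"
    if "i \<in> ix" for i z
    using that X_comm[of i 2 i 1] X_comm[of i 4 i 3] X_comm[of i 3 i 1] X_comm[of i 3 i 2] X_comm[of i 4 i 1] X_comm[of i 4 i 2]
      X_comm_left[of i 2 i 1 z] X_comm_left[of i 4 i 3 z] X_comm_left[of i 3 i 1 z] X_comm_left[of i 3 i 2 z] X_comm_left[of i 4 i 1 z] X_comm_left[of i 4 i 2 z]
    by (simp_all add: eta_simps)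
  \<comment> \<open>Deformed Pluecker relations among the minors of the two lower rows.\<close>
  have 2: "mu \<theta> *c (m 1 3 * m 2 4) - cnj (mu \<theta>) *c (m 1 4 * m 2 3) = mnr 1 3 4 * mnr 3 3 4"
    "mu \<theta> *c (m 2 4 * m 1 3) - cnj (mu \<theta>) *c (m 2 3 * m 1 4) = mnr 1 3 4 * mnr 3 3 4"
    by (simp_all add: m_def mnr_def ring_distribs mult.assoc cscale_diff_right cscale_add_right rows cols eta_simps)
  have c: "mnr 1 1 2 + mnr 1 3 4 = e" "mnr 3 1 2 + mnr 3 3 4 = e" "mnr 1 1 2 + mnr 3 1 2 = e"
    using mnr_col_sum[of 1] mnr_col_sum[of 3] mnr_row_sum[of 1 2] by simp_all
  \<comment> \<open>Everything is now expressed by t = \<open>mnr 1 3 4\<close>, and the determinant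
    becomes the square of the sum of e - t and t.\<close>
  then have d: "mnr 3 1 2 = mnr 1 3 4" "mnr 3 3 4 = mnr 1 1 2" "mnr 1 1 2 = e - mnr 1 3 4"
    by (metis add_diff_cancel_left' add.commute)+
  have "theta_det \<theta> X = mnr 1 1 2 * mnr 3 3 4 + mnr 3 1 2 * mnr 1 3 4 +
      (mu \<theta> *c (m 1 3 * m 2 4) - cnj (mu \<theta>) *c (m 1 4 * m 2 3)) +
      (mu \<theta> *c (m 2 4 * m 1 3) - cnj (mu \<theta>) *c (m 2 3 * m 1 4))"
    by (simp add: 1 nm)
  also have "\<dots> = mnr 1 1 2 * mnr 1 1 2 + mnr 1 3 4 * mnr 1 3 4 + mnr 1 3 4 * mnr 1 1 2 + mnr 1 3 4 * mnr 1 1 2"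
    unfolding 2 by (simp add: d(1,2))
  also have "\<dots> = e"
    by (simp add: d(3) ring_distribs)
  finally show ?thesis .
qed

end

section \<open>Products and transposes of matrices\<close>

text \<open>The multiplicativity behind the coproduct. When two entries of the product are
  exchanged, the phases of the inner indices occur as \<open>eta\<close> of m, n for the first
  matrix and of n, m for the second, and cancel. Unitarity is R^* P^* P R = R^* R.\<close>

lemma sp_mat_product:
  fixes P R :: "nat \<Rightarrow> nat \<Rightarrow> 'a::calg"
  assumes "sp_mat \<theta> P e" "sp_mat \<theta> R e"
    and PR: "\<And>i j k l. i \<in> ix \<Longrightarrow> j \<in> ix \<Longrightarrow> k \<in> ix \<Longrightarrow> l \<in> ix \<Longrightarrow> P i j * R k l = R k l * P i j"
  shows "sp_mat \<theta> (\<lambda>i j. \<Sum>k\<in>ix. P i k * R k j) e"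
proof -
  interpret P: sp_mat \<theta> P e by fact
  interpret R: sp_mat \<theta> R e by fact
  have swap: "P i k * (R k j * (P l m * R m n)) = P i k * (P l m * (R k j * R m n))"
    if "i \<in> ix" "j \<in> ix" "k \<in> ix" "l \<in> ix" "m \<in> ix" "n \<in> ix" for i j k l m n
    using PR[of l m k j] that by (metis mult.assoc)
  show ?thesis
  proof
    fix i j assume ij: "i \<in> ix" "j \<in> ix"
    show "e * (\<Sum>k\<in>ix. P i k * R k j) = (\<Sum>k\<in>ix. P i k * R k j)"
      using ij by (simp add: sum_distrib_left)
    show "(\<Sum>k\<in>ix. P i k * R k j) * e = (\<Sum>k\<in>ix. P i k * R k j)"
      using ij by (simp add: sum_distrib_right mult.assoc)
    {
      fix k l assume kl: "k \<in> ix" "l \<in> ix"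
      have "(\<Sum>m\<in>ix. P i m * R m j) * (\<Sum>n\<in>ix. P k n * R n l) =
          (\<Sum>m\<in>ix. \<Sum>n\<in>ix. (P i m * P k n) * (R m j * R n l))"
        using ij kl by (simp add: sum_product mult.assoc swap)
      also have "\<dots> = (\<Sum>m\<in>ix. \<Sum>n\<in>ix. (eta \<theta> k i * eta \<theta> j l) *c ((P k n * P i m) * (R n l * R m j)))"
        using ij kl P.X_comm[of i _ k] R.X_comm[of _ j _ l]
        by (intro sum.cong refl) (simp add: mult_ac)
      also have "\<dots> = (eta \<theta> k i * eta \<theta> j l) *c (\<Sum>n\<in>ix. \<Sum>m\<in>ix. (P k n * P i m) * (R n l * R m j))"
        by (subst sum.swap) (simp add: cscale_sum_right)
      also have "(\<Sum>n\<in>ix. \<Sum>m\<in>ix. (P k n * P i m) * (R n l * R m j)) =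
          (\<Sum>n\<in>ix. P k n * R n l) * (\<Sum>m\<in>ix. P i m * R m j)"
        using ij kl by (simp add: sum_product mult.assoc swap)
      finally show "(\<Sum>m\<in>ix. P i m * R m j) * (\<Sum>n\<in>ix. P k n * R n l) =
        (eta \<theta> k i * eta \<theta> j l) *c ((\<Sum>n\<in>ix. P k n * R n l) * (\<Sum>m\<in>ix. P i m * R m j))" .
    }
    have "(\<Sum>k\<in>ix. sg (k + i) *c ((\<Sum>m\<in>ix. P (cj k) m * R m (cj i)) * (\<Sum>n\<in>ix. P k n * R n j))) =
        (\<Sum>k\<in>ix. sg (k + i) *c ((\<Sum>m\<in>ix. P (cj k) (cj m) * R (cj m) (cj i)) * (\<Sum>n\<in>ix. P k n * R n j)))"
      by (simp only: sum_cj[where f = "\<lambda>m. P _ m * R m _"])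
    also have "\<dots> = (\<Sum>k\<in>ix. \<Sum>m\<in>ix. \<Sum>n\<in>ix. sg (m + i) *c ((sg (k + m) *c (P (cj k) (cj m) * P k n)) * (R (cj m) (cj i) * R n j)))"
      using ij by (simp add: sum_product cscale_sum_right mult.assoc swap mult_ac)
    also have "\<dots> = (\<Sum>m\<in>ix. \<Sum>n\<in>ix. \<Sum>k\<in>ix. sg (m + i) *c ((sg (k + m) *c (P (cj k) (cj m) * P k n)) * (R (cj m) (cj i) * R n j)))"
      by (subst sum.swap, rule sum.cong[OF refl], rule sum.swap)
    also have "\<dots> = (\<Sum>m\<in>ix. \<Sum>n\<in>ix. sg (m + i) *c ((\<Sum>k\<in>ix. sg (k + m) *c (P (cj k) (cj m) * P k n)) * (R (cj m) (cj i) * R n j)))"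
      by (simp only: sum_distrib_right cscale_sum_right)
    also have "\<dots> = (\<Sum>m\<in>ix. \<Sum>n\<in>ix. sg (m + i) *c ((if m = n then e else 0) * (R (cj m) (cj i) * R n j)))"
      by (intro sum.cong refl) (simp only: P.unit)
    also have "\<dots> = (\<Sum>m\<in>ix. sg (m + i) *c (R (cj m) (cj i) * R m j))"
    proof (rule sum.cong[OF refl])
      fix m assume m: "m \<in> ix"
      have "(\<Sum>n\<in>ix. sg (m + i) *c ((if m = n then e else 0) * (R (cj m) (cj i) * R n j))) =
        (\<Sum>n\<in>ix. if m = n then sg (m + i) *c (R (cj m) (cj i) * R n j) else 0)"
        using m ij by (intro sum.cong refl) auto
      then show "(\<Sum>n\<in>ix. sg (m + i) *c ((if m = n then e else 0) * (R (cj m) (cj i) * R n j))) =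
          sg (m + i) *c (R (cj m) (cj i) * R m j)"
        using m by simp
    qed
    also have "\<dots> = (if i = j then e else 0)"
      using ij by (rule R.unit)
    finally show "(\<Sum>k\<in>ix. sg (k + i) *c ((\<Sum>m\<in>ix. P (cj k) m * R m (cj i)) * (\<Sum>n\<in>ix. P k n * R n j))) =
        (if i = j then e else 0)" .
  qed simp
qed

text \<open>A A^* = 1 with the factors of each summand exchanged. The phase of the exchange does not
  depend on \<open>k\<close>, and it is 1 when \<open>i = j\<close>. This is the relation that A^*
  must satisfy in the opposite algebra.\<close>

lemma (in sp_mat) unit_transpose:
  assumes "i \<in> ix" "j \<in> ix"
  shows "(\<Sum>k\<in>ix. sg (k + j) *c (X (cj j) (cj k) * X i k)) = (if i = j then e else 0)"
proof -
  have "(\<Sum>k\<in>ix. sg (k + j) *c (X (cj j) (cj k) * X i k)) = eta \<theta> i (cj j) *c (\<Sum>k\<in>ix. sg (j + k) *c (X i k * X (cj j) (cj k)))"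
    using assms X_comm[of "cj j" "cj _" i _]
    by (auto simp: cscale_sum_right eta_cj mult_ac intro!: sum.cong)
  then show ?thesis
    unfolding unit_right[OF assms] using assms by (auto simp: eta_cj)
qed

section \<open>The algebra of the quantum group\<close>

lemma A_mat_simps:
  "A_mat B v 1 1 = v gen_a1"
  "A_mat B v 1 2 = v gen_a2"
  "A_mat B v 1 3 = v gen_b1"
  "A_mat B v 1 4 = v gen_b2"
  "A_mat B v 2 1 = \<ominus>\<^bsub>B\<^esub> star B (v gen_a2)"
  "A_mat B v 2 2 = star B (v gen_a1)"
  "A_mat B v 2 3 = \<ominus>\<^bsub>B\<^esub> star B (v gen_b2)"
  "A_mat B v 2 4 = star B (v gen_b1)"
  "A_mat B v 3 1 = v gen_c1"
  "A_mat B v 3 2 = v gen_c2"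
  "A_mat B v 3 3 = v gen_d1"
  "A_mat B v 3 4 = v gen_d2"
  "A_mat B v 4 1 = \<ominus>\<^bsub>B\<^esub> star B (v gen_c2)"
  "A_mat B v 4 2 = star B (v gen_c1)"
  "A_mat B v 4 3 = \<ominus>\<^bsub>B\<^esub> star B (v gen_d2)"
  "A_mat B v 4 4 = star B (v gen_d1)"
  by (simp_all add: A_mat_def Let_def mat_entry_def)

lemma sg_Suc [simp]: "sg (Suc n) = - sg n"
  by (simp add: sg_def)

primrec gen_row :: "M_gen \<Rightarrow> nat" where
  "gen_row gen_a1 = 1" | "gen_row gen_a2 = 1" | "gen_row gen_b1 = 1" | "gen_row gen_b2 = 1"
| "gen_row gen_c1 = 3" | "gen_row gen_c2 = 3" | "gen_row gen_d1 = 3" | "gen_row gen_d2 = 3"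

primrec gen_col :: "M_gen \<Rightarrow> nat" where
  "gen_col gen_a1 = 1" | "gen_col gen_a2 = 2" | "gen_col gen_b1 = 3" | "gen_col gen_b2 = 4"
| "gen_col gen_c1 = 1" | "gen_col gen_c2 = 2" | "gen_col gen_d1 = 3" | "gen_col gen_d2 = 4"

lemma gen_row_col_ix [simp]: "gen_row g \<in> ix" "gen_col g \<in> ix"
  by (cases g; simp)+

lemma A_mat_gen: "A_mat B v (gen_row g) (gen_col g) = v g"
  by (cases g) (simp_all add: A_mat_simps)

context salg begin

lemma salg_idealI: "ideal I A \<Longrightarrow> star A ` I \<subseteq> I \<Longrightarrow> salg_ideal A I"
  by (intro salg_ideal.intro alg_ideal.intro salg_ideal_axioms.intro salg_axioms alg_axioms)

lemma salg_ideal_star_genideal: "X \<subseteq> carrier A \<Longrightarrow> salg_ideal A (star_genideal A X)"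
  by (intro salg_idealI star_genideal)

lemma A_mat_closed [simp]: "(\<And>g. v g \<in> carrier A) \<Longrightarrow> i \<in> ix \<Longrightarrow> j \<in> ix \<Longrightarrow> A_mat A v i j \<in> carrier A"
  by (auto elim!: ix_cases simp: A_mat_simps)

lemma A_mat_star:
  "(\<And>g. v g \<in> carrier A) \<Longrightarrow> i \<in> ix \<Longrightarrow> j \<in> ix \<Longrightarrow> star A (A_mat A v i j) = sg (i + j) \<odot> A_mat A v (cj i) (cj j)"
  by (auto elim!: ix_cases simp: A_mat_simps star_minus minus_smult)

lemma A_mat_star_gen:
  "(\<And>g. v g \<in> carrier A) \<Longrightarrow> star A (v g) = sg (gen_row g + gen_col g) \<odot> A_mat A v (cj (gen_row g)) (cj (gen_col g))"
  using A_mat_star[of v "gen_row g" "gen_col g"] by (simp add: A_mat_gen)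

lemma A_mat_typed_hom:
  assumes h: "typed_hom A h" and v: "\<And>g. v g \<in> carrier A"
    and hv: "\<And>g. h (v g) = X (gen_row g) (gen_col g)"
    "\<And>g. h (star A (v g)) = sg (gen_row g + gen_col g) *c X (cj (gen_row g)) (cj (gen_col g))"
    and ij: "i \<in> ix" "j \<in> ix"
  shows "h (A_mat A v i j) = X i j"
  using ij v hv(1)[of gen_a1] hv(1)[of gen_a2] hv(1)[of gen_b1] hv(1)[of gen_b2]
    hv(1)[of gen_c1] hv(1)[of gen_c2] hv(1)[of gen_d1] hv(1)[of gen_d2]
    hv(2)[of gen_a1] hv(2)[of gen_a2] hv(2)[of gen_b1] hv(2)[of gen_b2]
    hv(2)[of gen_c1] hv(2)[of gen_c2] hv(2)[of gen_d1] hv(2)[of gen_d2]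
  by (auto elim!: ix_cases simp: A_mat_simps typed_hom_minus[OF h])

end

lemma (in salg_ideal) A_mat_quot:
  assumes "\<And>g. v g \<in> carrier A" "i \<in> ix" "j \<in> ix"
  shows "A_mat (quot_alg A I) (\<lambda>g. I +> v g) i j = I +> A_mat A v i j"
  using assms(2,3)
  by (auto elim!: ix_cases simp: A_mat_simps quot_star quot_minus assms(1))

subsection \<open>The matrix algebra\<close>

abbreviation free_mat :: "nat \<Rightarrow> nat \<Rightarrow> M_gen free_elt" where
  "free_mat \<equiv> A_mat free_star_alg free_gen"

definition M_rels :: "real \<Rightarrow> M_gen free_elt set" where
  "M_rels \<theta> = {free_mat i j \<otimes>\<^bsub>free_star_alg\<^esub> free_mat k l \<ominus>\<^bsub>free_star_alg\<^esub>
     (eta \<theta> k i * eta \<theta> j l) \<odot>\<^bsub>free_star_alg\<^esub> (free_mat k l \<otimes>\<^bsub>free_star_alg\<^esub> free_mat i j) | i j k l.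
       i \<in> ix \<and> j \<in> ix \<and> k \<in> ix \<and> l \<in> ix}"

lemma M_ideal_eq: "M_ideal \<theta> = star_genideal free_star_alg (M_rels \<theta>)"
  unfolding M_ideal_def Let_def M_rels_def ix_atLeastAtMost
  by (rule arg_cong[where f = "star_genideal free_star_alg"]) auto

interpretation FM: salg "free_star_alg :: M_gen free_elt star_algebra"
  by (rule free_salg)

lemma M_salg_ideal: "salg_ideal (free_star_alg :: M_gen free_elt star_algebra) (M_ideal \<theta>)"
  unfolding M_ideal_eq by (rule FM.salg_ideal_star_genideal) (simp add: subset_iff)

lemmas FMI_quot_mult = alg_ideal.quot_mult[OF salg_ideal.axioms(2)[OF M_salg_ideal]]
lemmas FMI_quot_smult = alg_ideal.quot_smult[OF salg_ideal.axioms(2)[OF M_salg_ideal]]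
lemmas FMI_quot_one = alg_ideal.quot_one[OF salg_ideal.axioms(2)[OF M_salg_ideal]]
lemmas FMI_quot_salg = salg_ideal.quot_salg[OF M_salg_ideal]
lemmas FMI_coset_eq_iff = alg_ideal.coset_eq_iff[OF salg_ideal.axioms(2)[OF M_salg_ideal]]
lemmas FMI_A_mat_quot = salg_ideal.A_mat_quot[OF M_salg_ideal]
lemmas FMI_typed_hom_quot = alg_ideal.typed_hom_quot[OF salg_ideal.axioms(2)[OF M_salg_ideal]]
lemmas FMI_quot_carrierI = alg_ideal.quot_carrierI[OF salg_ideal.axioms(2)[OF M_salg_ideal]]
lemmas FMI_quot_carrierE = alg_ideal.quot_carrierE[OF salg_ideal.axioms(2)[OF M_salg_ideal]]
lemmas FMI_quot_add = alg_ideal.quot_add[OF salg_ideal.axioms(2)[OF M_salg_ideal]]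
lemmas FMI_quot_star = salg_ideal.quot_star[OF M_salg_ideal]

interpretation M: salg "M_alg \<theta>"
  unfolding M_alg_def by (rule FMI_quot_salg)

lemma M_val_closed [simp]: "M_val \<theta> g \<in> carrier (M_alg \<theta>)"
  by (simp add: M_alg_def M_val_def FMI_quot_carrierI)

abbreviation M_mat :: "real \<Rightarrow> nat \<Rightarrow> nat \<Rightarrow> M_gen free_elt set" where
  "M_mat \<theta> \<equiv> A_mat (M_alg \<theta>) (M_val \<theta>)"

lemma M_mat_eq: "i \<in> ix \<Longrightarrow> j \<in> ix \<Longrightarrow> M_mat \<theta> i j = M_ideal \<theta> +>\<^bsub>free_star_alg\<^esub> free_mat i j"
  using FMI_A_mat_quot[of free_gen i j \<theta>] by (simp add: M_alg_def M_val_def[abs_def])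

lemma M_mat_comm:
  assumes "i \<in> ix" "j \<in> ix" "k \<in> ix" "l \<in> ix"
  shows "M_mat \<theta> i j \<otimes>\<^bsub>M_alg \<theta>\<^esub> M_mat \<theta> k l =
    (eta \<theta> k i * eta \<theta> j l) \<odot>\<^bsub>M_alg \<theta>\<^esub> (M_mat \<theta> k l \<otimes>\<^bsub>M_alg \<theta>\<^esub> M_mat \<theta> i j)"
proof -
  have "free_mat i j \<otimes>\<^bsub>free_star_alg\<^esub> free_mat k l \<ominus>\<^bsub>free_star_alg\<^esub>
     (eta \<theta> k i * eta \<theta> j l) \<odot>\<^bsub>free_star_alg\<^esub> (free_mat k l \<otimes>\<^bsub>free_star_alg\<^esub> free_mat i j) \<in> M_ideal \<theta>"
    unfolding M_ideal_eq using assms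
    by (intro subsetD[OF FM.star_genideal(3)]) (auto simp: M_rels_def)
  then show ?thesis
    using assms
    by (simp add: M_mat_eq) (simp add: M_alg_def FMI_quot_mult FMI_quot_smult FMI_coset_eq_iff)
qed

lemma M_theta_mat:
  assumes h: "typed_hom (M_alg \<theta>) h"
  shows "theta_mat \<theta> (\<lambda>i j. h (M_mat \<theta> i j)) (h \<one>\<^bsub>M_alg \<theta>\<^esub>)"
proof
  fix i j k l assume "i \<in> ix" "j \<in> ix" "k \<in> ix" "l \<in> ix"
  then show "h (M_mat \<theta> i j) * h (M_mat \<theta> k l) = (eta \<theta> k i * eta \<theta> j l) *c (h (M_mat \<theta> k l) * h (M_mat \<theta> i j))"
    using M_mat_comm[of i j k l \<theta>] by (simp add: typed_homD[OF h, symmetric])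
qed (simp_all add: typed_homD[OF h, symmetric])

lemma M_universal:
  assumes "theta_mat \<theta> X e"
  shows "\<exists>h. typed_hom (M_alg \<theta>) h \<and> h \<one>\<^bsub>M_alg \<theta>\<^esub> = e \<and> (\<forall>i\<in>ix. \<forall>j\<in>ix. h (M_mat \<theta> i j) = X i j)"
proof -
  interpret theta_mat \<theta> X e by fact
  let ?f = "\<lambda>(g, b). if b then sg (gen_row g + gen_col g) *c X (cj (gen_row g)) (cj (gen_col g)) else X (gen_row g) (gen_col g)"
  have f: "e * ?f l = ?f l" "?f l * e = ?f l" for l
    by (cases l; simp)+
  obtain h where h: "typed_hom (free_star_alg :: M_gen free_elt star_algebra) h" and h1: "h \<one>\<^bsub>free_star_alg\<^esub> = e"
    and hg: "\<And>g. h (free_gen g) = X (gen_row g) (gen_col g)"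
      "\<And>g. h (star free_star_alg (free_gen g)) = sg (gen_row g + gen_col g) *c X (cj (gen_row g)) (cj (gen_col g))"
    using free_typed_hom[of e ?f, OF ee f] by auto
  have hm: "h (free_mat i j) = X i j" if "i \<in> ix" "j \<in> ix" for i j
    by (rule FM.A_mat_typed_hom[OF h]) (auto simp: hg that)
  have "h x = 0" if "x \<in> M_ideal \<theta>" for x
  proof (rule FM.typed_hom_star_genideal[OF h _ _ _ that[unfolded M_ideal_eq]])
    fix x assume "x \<in> M_rels \<theta>"
    then obtain i j k l where ix: "i \<in> ix" "j \<in> ix" "k \<in> ix" "l \<in> ix"
      and x: "x = free_mat i j \<otimes>\<^bsub>free_star_alg\<^esub> free_mat k l \<ominus>\<^bsub>free_star_alg\<^esub>
        (eta \<theta> k i * eta \<theta> j l) \<odot>\<^bsub>free_star_alg\<^esub> (free_mat k l \<otimes>\<^bsub>free_star_alg\<^esub> free_mat i j)"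
      by (auto simp: M_rels_def)
    show "h x = 0"
      using X_comm[of i j k l] ix by (simp add: x FM.typed_hom_diff[OF h] typed_homD[OF h] hm)
    \<comment> \<open>The adjoint of a defining relation is, up to sign, the relation for the
      conjugate indices in reversed order; \<open>eta_cj\<close> and \<open>eta_cnj\<close> match
      the phases.\<close>
    show "h (star free_star_alg x) = 0"
      using X_comm[of "cj k" "cj l" "cj i" "cj j"] ix
      by (simp add: x FM.star_diff FM.star_mult FM.star_smult FM.A_mat_star FM.typed_hom_diff[OF h]
          typed_homD[OF h] hm eta_cj eta_cnj mult_ac)
  qed auto
  then obtain h' where h': "typed_hom (M_alg \<theta>) h'" "\<And>x. h' (M_ideal \<theta> +>\<^bsub>free_star_alg\<^esub> x) = h x"
    using FMI_typed_hom_quot[OF h, of \<theta>] by (auto simp: M_alg_def)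
  moreover have "h' \<one>\<^bsub>M_alg \<theta>\<^esub> = e"
    using h1 by (simp add: M_alg_def FMI_quot_one h'(2))
  ultimately show ?thesis
    by (intro exI[of _ h']) (auto simp: M_mat_eq hm)
qed

subsection \<open>Determinant one\<close>

lemma M_det_eq: "M_det \<theta> = (\<Oplus>\<^bsub>M_alg \<theta>\<^esub>\<sigma>\<in>{\<sigma>. \<sigma> permutes ix}.
      (of_int (sign \<sigma>) * det_eps \<theta> [\<sigma> 1, \<sigma> 2, \<sigma> 3, \<sigma> 4]) \<odot>\<^bsub>M_alg \<theta>\<^esub>
        (M_mat \<theta> 1 (\<sigma> 1) \<otimes>\<^bsub>M_alg \<theta>\<^esub> M_mat \<theta> 2 (\<sigma> 2) \<otimes>\<^bsub>M_alg \<theta>\<^esub> M_mat \<theta> 3 (\<sigma> 3) \<otimes>\<^bsub>M_alg \<theta>\<^esub> M_mat \<theta> 4 (\<sigma> 4)))"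
  by (simp add: M_det_def Let_def ix_atLeastAtMost)

lemma permutes_ix_mem [simp]: "\<sigma> permutes ix \<Longrightarrow> i \<in> ix \<Longrightarrow> \<sigma> i \<in> ix"
  by (simp add: permutes_in_image)

lemma M_det_closed [simp]: "M_det \<theta> \<in> carrier (M_alg \<theta>)"
  unfolding M_det_eq by (rule M.finsum_closed) auto

lemma typed_hom_M_det:
  assumes h: "typed_hom (M_alg \<theta>) h"
  shows "h (M_det \<theta>) = theta_det \<theta> (\<lambda>i j. h (M_mat \<theta> i j))"
proof -
  have "h (M_det \<theta>) = (\<Sum>\<sigma>\<in>{\<sigma>. \<sigma> permutes ix}. h ((of_int (sign \<sigma>) * det_eps \<theta> [\<sigma> 1, \<sigma> 2, \<sigma> 3, \<sigma> 4]) \<odot>\<^bsub>M_alg \<theta>\<^esub>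
        (M_mat \<theta> 1 (\<sigma> 1) \<otimes>\<^bsub>M_alg \<theta>\<^esub> M_mat \<theta> 2 (\<sigma> 2) \<otimes>\<^bsub>M_alg \<theta>\<^esub> M_mat \<theta> 3 (\<sigma> 3) \<otimes>\<^bsub>M_alg \<theta>\<^esub> M_mat \<theta> 4 (\<sigma> 4))))"
    unfolding M_det_eq
    by (rule M.typed_hom_finsum[OF h]) (auto simp: finite_permutations)
  also have "\<dots> = theta_det \<theta> (\<lambda>i j. h (M_mat \<theta> i j))"
    unfolding theta_det_def by (intro sum.cong refl) (simp add: typed_homD[OF h] mult.assoc)
  finally show ?thesis .
qed

text \<open>Self-adjointness of the determinant makes the ideal generated by det - 1 stable under
  the star, and hence the next quotient a *-algebra.\<close>

lemma M_det_star: "star (M_alg \<theta>) (M_det \<theta>) = M_det \<theta>"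
proof -
  let ?h = "iota (M_alg \<theta>)"
  interpret T: theta_mat \<theta> "\<lambda>i j. ?h (M_mat \<theta> i j)" "?h \<one>\<^bsub>M_alg \<theta>\<^esub>"
    by (rule M_theta_mat[OF M.typed_hom_iota])
  \<comment> \<open>The signs from conjugating the columns are multiplied over a permutation of all
    four columns, so they are the signs of 1 to 4, with product 1.\<close>
  have s: "sg (\<sigma> 1) * sg (\<sigma> 2) * sg (\<sigma> 3) * sg (\<sigma> 4) = 1" if "\<sigma> permutes ix" for \<sigma>
  proof -
    have "(\<Prod>i\<in>ix. sg (\<sigma> i)) = (\<Prod>i\<in>ix. sg i)"
      using prod.permute[OF that, of sg] by (simp add: o_def)
    then show ?thesis by (simp add: ix_def mult.assoc)
  qed
  have "?h (star (M_alg \<theta>) (M_det \<theta>)) = (\<Sum>\<sigma>\<in>{\<sigma>. \<sigma> permutes ix}. ?h (star (M_alg \<theta>) ((of_int (sign \<sigma>) * det_eps \<theta> [\<sigma> 1, \<sigma> 2, \<sigma> 3, \<sigma> 4]) \<odot>\<^bsub>M_alg \<theta>\<^esub>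
        (M_mat \<theta> 1 (\<sigma> 1) \<otimes>\<^bsub>M_alg \<theta>\<^esub> M_mat \<theta> 2 (\<sigma> 2) \<otimes>\<^bsub>M_alg \<theta>\<^esub> M_mat \<theta> 3 (\<sigma> 3) \<otimes>\<^bsub>M_alg \<theta>\<^esub> M_mat \<theta> 4 (\<sigma> 4)))))"
    unfolding M_det_eq
    by (subst M.star_finsum) (auto simp: finite_permutations intro!: M.iota_finsum)
  also have "\<dots> = (\<Sum>\<sigma>\<in>{\<sigma>. \<sigma> permutes ix}. (of_int (sign \<sigma>) * cnj (det_eps \<theta> [\<sigma> 1, \<sigma> 2, \<sigma> 3, \<sigma> 4])) *c
     (?h (M_mat \<theta> 3 (cj (\<sigma> 4))) * (?h (M_mat \<theta> 4 (cj (\<sigma> 3))) * (?h (M_mat \<theta> 1 (cj (\<sigma> 2))) * ?h (M_mat \<theta> 2 (cj (\<sigma> 1)))))))"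
  proof (intro sum.cong refl)
    fix \<sigma> assume "\<sigma> \<in> {\<sigma>. \<sigma> permutes ix}"
    then have \<sigma>: "\<sigma> permutes ix" by simp
    have s': "sg (\<sigma> 1) * (sg (\<sigma> 2) * (sg (\<sigma> 3) * sg (\<sigma> 4))) = 1"
      using s[OF \<sigma>] by (simp add: mult_ac)
    show "?h (star (M_alg \<theta>) ((of_int (sign \<sigma>) * det_eps \<theta> [\<sigma> 1, \<sigma> 2, \<sigma> 3, \<sigma> 4]) \<odot>\<^bsub>M_alg \<theta>\<^esub>
        (M_mat \<theta> 1 (\<sigma> 1) \<otimes>\<^bsub>M_alg \<theta>\<^esub> M_mat \<theta> 2 (\<sigma> 2) \<otimes>\<^bsub>M_alg \<theta>\<^esub> M_mat \<theta> 3 (\<sigma> 3) \<otimes>\<^bsub>M_alg \<theta>\<^esub> M_mat \<theta> 4 (\<sigma> 4)))) =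
      (of_int (sign \<sigma>) * cnj (det_eps \<theta> [\<sigma> 1, \<sigma> 2, \<sigma> 3, \<sigma> 4])) *c
       (?h (M_mat \<theta> 3 (cj (\<sigma> 4))) * (?h (M_mat \<theta> 4 (cj (\<sigma> 3))) * (?h (M_mat \<theta> 1 (cj (\<sigma> 2))) * ?h (M_mat \<theta> 2 (cj (\<sigma> 1))))))"
      using \<sigma> s' by (simp add: M.star_smult M.star_mult M.A_mat_star mult.assoc)
  qed
  also have "\<dots> = ?h (M_det \<theta>)"
    using T.theta_det_star by (simp add: typed_hom_M_det[OF M.typed_hom_iota])
  finally show ?thesis
    by (simp add: M.iota_eq_iff)
qed

text \<open>The elements whose adjoint lies in the generated ideal form an ideal themselves, and it
  contains the generator.\<close>

lemma star_genideal_selfadjoint: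
  assumes "salg A" "x \<in> carrier A" "star A x = x"
  shows "star A ` (Idl\<^bsub>A\<^esub> {x}) \<subseteq> Idl\<^bsub>A\<^esub> {x}"
proof -
  interpret salg A by fact
  interpret I: ideal "Idl\<^bsub>A\<^esub> {x}" A by (rule genideal_ideal) (use assms in auto)
  have "ideal {y \<in> carrier A. star A y \<in> Idl\<^bsub>A\<^esub> {x}} A"
  proof (rule idealI)
    show "subgroup {y \<in> carrier A. star A y \<in> Idl\<^bsub>A\<^esub> {x}} (add_monoid A)"
      by (intro subgroup.intro) (auto simp: star_add star_minus a_inv_def[symmetric])
  qed (auto simp: ring_axioms star_mult I.I_l_closed I.I_r_closed)
  then have "Idl\<^bsub>A\<^esub> {x} \<subseteq> {y \<in> carrier A. star A y \<in> Idl\<^bsub>A\<^esub> {x}}"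
    using genideal_self[of "{x}"] assms by (intro genideal_minimal) auto
  then show ?thesis by auto
qed

lemma SL_salg_ideal: "salg_ideal (M_alg \<theta>) (SL_ideal \<theta>)"
proof (rule M.salg_idealI)
  show "ideal (SL_ideal \<theta>) (M_alg \<theta>)"
    unfolding SL_ideal_def by (rule M.genideal_ideal) simp
  show "star (M_alg \<theta>) ` SL_ideal \<theta> \<subseteq> SL_ideal \<theta>"
    unfolding SL_ideal_def
    by (rule star_genideal_selfadjoint[OF M.salg_axioms]) (simp_all add: M.star_diff M_det_star)
qed

lemmas MI_quot_mult = alg_ideal.quot_mult[OF salg_ideal.axioms(2)[OF SL_salg_ideal]]
lemmas MI_quot_smult = alg_ideal.quot_smult[OF salg_ideal.axioms(2)[OF SL_salg_ideal]]
lemmas MI_quot_one = alg_ideal.quot_one[OF salg_ideal.axioms(2)[OF SL_salg_ideal]]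
lemmas MI_quot_salg = salg_ideal.quot_salg[OF SL_salg_ideal]
lemmas MI_A_mat_quot = salg_ideal.A_mat_quot[OF SL_salg_ideal]
lemmas MI_typed_hom_quot = alg_ideal.typed_hom_quot[OF salg_ideal.axioms(2)[OF SL_salg_ideal]]
lemmas MI_quot_carrierI = alg_ideal.quot_carrierI[OF salg_ideal.axioms(2)[OF SL_salg_ideal]]
lemmas MI_quot_carrierE = alg_ideal.quot_carrierE[OF salg_ideal.axioms(2)[OF SL_salg_ideal]]
lemmas MI_quot_add = alg_ideal.quot_add[OF salg_ideal.axioms(2)[OF SL_salg_ideal]]
lemmas MI_quot_star = salg_ideal.quot_star[OF SL_salg_ideal]

interpretation SL: salg "SL_alg \<theta>"
  unfolding SL_alg_def by (rule MI_quot_salg)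

lemma SL_val_closed [simp]: "SL_val \<theta> g \<in> carrier (SL_alg \<theta>)"
  by (simp add: SL_alg_def SL_val_def MI_quot_carrierI)

abbreviation SL_mat :: "real \<Rightarrow> nat \<Rightarrow> nat \<Rightarrow> M_gen free_elt set set" where
  "SL_mat \<theta> \<equiv> A_mat (SL_alg \<theta>) (SL_val \<theta>)"

lemma SL_mat_eq: "i \<in> ix \<Longrightarrow> j \<in> ix \<Longrightarrow> SL_mat \<theta> i j = SL_ideal \<theta> +>\<^bsub>M_alg \<theta>\<^esub> M_mat \<theta> i j"
  using MI_A_mat_quot[of "M_val \<theta>" \<theta> i j] by (simp add: SL_alg_def SL_val_def[abs_def])

lemma SL_mat_comm:
  assumes "i \<in> ix" "j \<in> ix" "k \<in> ix" "l \<in> ix"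
  shows "SL_mat \<theta> i j \<otimes>\<^bsub>SL_alg \<theta>\<^esub> SL_mat \<theta> k l =
    (eta \<theta> k i * eta \<theta> j l) \<odot>\<^bsub>SL_alg \<theta>\<^esub> (SL_mat \<theta> k l \<otimes>\<^bsub>SL_alg \<theta>\<^esub> SL_mat \<theta> i j)"
  using M_mat_comm[OF assms, of \<theta>] assms
  by (simp add: SL_mat_eq) (simp add: SL_alg_def MI_quot_mult MI_quot_smult)

lemma SL_universal:
  assumes "theta_mat \<theta> X e" "theta_det \<theta> X = e"
  shows "\<exists>h. typed_hom (SL_alg \<theta>) h \<and> h \<one>\<^bsub>SL_alg \<theta>\<^esub> = e \<and> (\<forall>i\<in>ix. \<forall>j\<in>ix. h (SL_mat \<theta> i j) = X i j)"
proof -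
  interpret theta_mat \<theta> X e by fact
  obtain h where h: "typed_hom (M_alg \<theta>) h" and h1: "h \<one>\<^bsub>M_alg \<theta>\<^esub> = e"
    and hm: "\<And>i j. i \<in> ix \<Longrightarrow> j \<in> ix \<Longrightarrow> h (M_mat \<theta> i j) = X i j"
    using M_universal[OF assms(1)] by blast
  have "theta_det \<theta> (\<lambda>i j. h (M_mat \<theta> i j)) = theta_det \<theta> X"
    unfolding theta_det_def by (intro sum.cong refl) (simp add: hm)
  then have "h (M_det \<theta> \<ominus>\<^bsub>M_alg \<theta>\<^esub> \<one>\<^bsub>M_alg \<theta>\<^esub>) = 0"
    by (simp add: M.typed_hom_diff[OF h] typed_hom_M_det[OF h] h1 assms(2))
  then have "h x = 0" if "x \<in> SL_ideal \<theta>" for x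
    using M.typed_hom_genideal[OF h _ _ that[unfolded SL_ideal_def]] by auto
  then obtain h' where h': "typed_hom (SL_alg \<theta>) h'" "\<And>x. x \<in> carrier (M_alg \<theta>) \<Longrightarrow> h' (SL_ideal \<theta> +>\<^bsub>M_alg \<theta>\<^esub> x) = h x"
    using MI_typed_hom_quot[OF h] by (auto simp: SL_alg_def)
  moreover have "h' \<one>\<^bsub>SL_alg \<theta>\<^esub> = e"
    using h1 by (simp add: SL_alg_def MI_quot_one h'(2))
  ultimately show ?thesis
    by (intro exI[of _ h']) (auto simp: SL_mat_eq hm)
qed

subsection \<open>Unitarity\<close>

definition Sp_rel :: "real \<Rightarrow> nat \<Rightarrow> nat \<Rightarrow> M_gen free_elt set set" where
  "Sp_rel \<theta> i j = (\<Oplus>\<^bsub>SL_alg \<theta>\<^esub>k\<in>ix. star (SL_alg \<theta>) (SL_mat \<theta> k i) \<otimes>\<^bsub>SL_alg \<theta>\<^esub> SL_mat \<theta> k j)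
     \<ominus>\<^bsub>SL_alg \<theta>\<^esub> (if i = j then \<one>\<^bsub>SL_alg \<theta>\<^esub> else \<zero>\<^bsub>SL_alg \<theta>\<^esub>)"

lemma Sp_ideal_eq: "Sp_ideal \<theta> = star_genideal (SL_alg \<theta>) {Sp_rel \<theta> i j | i j. i \<in> ix \<and> j \<in> ix}"
  unfolding Sp_ideal_def Let_def Sp_rel_def ix_atLeastAtMost
  by (rule arg_cong[where f = "star_genideal (SL_alg \<theta>)"]) auto

lemma Sp_rel_sum_closed [simp]:
  "i \<in> ix \<Longrightarrow> j \<in> ix \<Longrightarrow> (\<Oplus>\<^bsub>SL_alg \<theta>\<^esub>k\<in>ix. star (SL_alg \<theta>) (SL_mat \<theta> k i) \<otimes>\<^bsub>SL_alg \<theta>\<^esub> SL_mat \<theta> k j) \<in> carrier (SL_alg \<theta>)"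
  by (rule SL.finsum_closed) auto

lemma Sp_rel_closed [simp]: "i \<in> ix \<Longrightarrow> j \<in> ix \<Longrightarrow> Sp_rel \<theta> i j \<in> carrier (SL_alg \<theta>)"
  by (simp add: Sp_rel_def)

lemma Sp_rel_star:
  assumes "i \<in> ix" "j \<in> ix"
  shows "star (SL_alg \<theta>) (Sp_rel \<theta> i j) = Sp_rel \<theta> j i"
proof -
  have "(\<Oplus>\<^bsub>SL_alg \<theta>\<^esub>k\<in>ix. star (SL_alg \<theta>) (star (SL_alg \<theta>) (SL_mat \<theta> k i) \<otimes>\<^bsub>SL_alg \<theta>\<^esub> SL_mat \<theta> k j)) =
    (\<Oplus>\<^bsub>SL_alg \<theta>\<^esub>k\<in>ix. star (SL_alg \<theta>) (SL_mat \<theta> k j) \<otimes>\<^bsub>SL_alg \<theta>\<^esub> SL_mat \<theta> k i)"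
    using assms by (intro SL.finsum_cong') (auto simp: SL.star_mult)
  moreover have "star (SL_alg \<theta>) (\<Oplus>\<^bsub>SL_alg \<theta>\<^esub>k\<in>ix. star (SL_alg \<theta>) (SL_mat \<theta> k i) \<otimes>\<^bsub>SL_alg \<theta>\<^esub> SL_mat \<theta> k j) =
    (\<Oplus>\<^bsub>SL_alg \<theta>\<^esub>k\<in>ix. star (SL_alg \<theta>) (star (SL_alg \<theta>) (SL_mat \<theta> k i) \<otimes>\<^bsub>SL_alg \<theta>\<^esub> SL_mat \<theta> k j))"
    using assms by (intro SL.star_finsum) auto
  ultimately show ?thesis
    using assms by (simp add: Sp_rel_def SL.star_diff)
qed

lemma Sp_salg_ideal: "salg_ideal (SL_alg \<theta>) (Sp_ideal \<theta>)"
  unfolding Sp_ideal_eq by (rule SL.salg_ideal_star_genideal) auto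

lemmas SI_quot_mult = alg_ideal.quot_mult[OF salg_ideal.axioms(2)[OF Sp_salg_ideal]]
lemmas SI_quot_smult = alg_ideal.quot_smult[OF salg_ideal.axioms(2)[OF Sp_salg_ideal]]
lemmas SI_quot_one = alg_ideal.quot_one[OF salg_ideal.axioms(2)[OF Sp_salg_ideal]]
lemmas SI_quot_salg = salg_ideal.quot_salg[OF Sp_salg_ideal]
lemmas SI_coset_eq_iff = alg_ideal.coset_eq_iff[OF salg_ideal.axioms(2)[OF Sp_salg_ideal]]
lemmas SI_A_mat_quot = salg_ideal.A_mat_quot[OF Sp_salg_ideal]
lemmas SI_typed_hom_quot = alg_ideal.typed_hom_quot[OF salg_ideal.axioms(2)[OF Sp_salg_ideal]]
lemmas SI_quot_carrierI = alg_ideal.quot_carrierI[OF salg_ideal.axioms(2)[OF Sp_salg_ideal]]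
lemmas SI_quot_carrierE = alg_ideal.quot_carrierE[OF salg_ideal.axioms(2)[OF Sp_salg_ideal]]
lemmas SI_quot_add = alg_ideal.quot_add[OF salg_ideal.axioms(2)[OF Sp_salg_ideal]]
lemmas SI_quot_finsum = alg_ideal.quot_finsum[OF salg_ideal.axioms(2)[OF Sp_salg_ideal]]
lemmas SI_quot_zero = alg_ideal.quot_zero[OF salg_ideal.axioms(2)[OF Sp_salg_ideal]]
lemmas SI_quot_star = salg_ideal.quot_star[OF Sp_salg_ideal]

interpretation Sp: salg "Sp_alg \<theta>"
  unfolding Sp_alg_def by (rule SI_quot_salg)

lemma Sp_salg: "salg (Sp_alg \<theta>)"
  by (rule Sp.salg_axioms)

lemma Sp_val_closed [simp]: "Sp_val \<theta> g \<in> carrier (Sp_alg \<theta>)"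
  by (simp add: Sp_alg_def Sp_val_def SI_quot_carrierI)

lemma Sp_mat_closed [simp]: "i \<in> ix \<Longrightarrow> j \<in> ix \<Longrightarrow> Sp_mat \<theta> i j \<in> carrier (Sp_alg \<theta>)"
  by simp

lemma Sp_mat_star: "i \<in> ix \<Longrightarrow> j \<in> ix \<Longrightarrow>
    star (Sp_alg \<theta>) (Sp_mat \<theta> i j) = sg (i + j) \<odot>\<^bsub>Sp_alg \<theta>\<^esub> Sp_mat \<theta> (cj i) (cj j)"
  by (rule Sp.A_mat_star) auto

lemma Sp_mat_eq: "i \<in> ix \<Longrightarrow> j \<in> ix \<Longrightarrow> Sp_mat \<theta> i j = Sp_ideal \<theta> +>\<^bsub>SL_alg \<theta>\<^esub> SL_mat \<theta> i j"
  using SI_A_mat_quot[of "SL_val \<theta>" \<theta> i j] by (simp add: Sp_alg_def Sp_val_def[abs_def])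

lemma Sp_mat_comm:
  assumes "i \<in> ix" "j \<in> ix" "k \<in> ix" "l \<in> ix"
  shows "Sp_mat \<theta> i j \<otimes>\<^bsub>Sp_alg \<theta>\<^esub> Sp_mat \<theta> k l =
    (eta \<theta> k i * eta \<theta> j l) \<odot>\<^bsub>Sp_alg \<theta>\<^esub> (Sp_mat \<theta> k l \<otimes>\<^bsub>Sp_alg \<theta>\<^esub> Sp_mat \<theta> i j)"
  using SL_mat_comm[OF assms, of \<theta>] assms
  by (simp add: Sp_mat_eq) (simp add: Sp_alg_def SI_quot_mult SI_quot_smult)

lemma Sp_unit:
  assumes "i \<in> ix" "j \<in> ix"
  shows "(\<Oplus>\<^bsub>Sp_alg \<theta>\<^esub>k\<in>ix. star (Sp_alg \<theta>) (Sp_mat \<theta> k i) \<otimes>\<^bsub>Sp_alg \<theta>\<^esub> Sp_mat \<theta> k j) =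
    (if i = j then \<one>\<^bsub>Sp_alg \<theta>\<^esub> else \<zero>\<^bsub>Sp_alg \<theta>\<^esub>)"
proof -
  have "Sp_rel \<theta> i j \<in> Sp_ideal \<theta>"
    unfolding Sp_ideal_eq using assms
    by (intro subsetD[OF SL.star_genideal(3)]) auto
  then have 1: "Sp_ideal \<theta> +>\<^bsub>SL_alg \<theta>\<^esub> (\<Oplus>\<^bsub>SL_alg \<theta>\<^esub>k\<in>ix. star (SL_alg \<theta>) (SL_mat \<theta> k i) \<otimes>\<^bsub>SL_alg \<theta>\<^esub> SL_mat \<theta> k j) =
     Sp_ideal \<theta> +>\<^bsub>SL_alg \<theta>\<^esub> (if i = j then \<one>\<^bsub>SL_alg \<theta>\<^esub> else \<zero>\<^bsub>SL_alg \<theta>\<^esub>)"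
    using assms by (subst SI_coset_eq_iff) (auto simp: Sp_rel_def)
  have "(\<Oplus>\<^bsub>Sp_alg \<theta>\<^esub>k\<in>ix. star (Sp_alg \<theta>) (Sp_mat \<theta> k i) \<otimes>\<^bsub>Sp_alg \<theta>\<^esub> Sp_mat \<theta> k j) =
    (\<Oplus>\<^bsub>Sp_alg \<theta>\<^esub>k\<in>ix. Sp_ideal \<theta> +>\<^bsub>SL_alg \<theta>\<^esub> (star (SL_alg \<theta>) (SL_mat \<theta> k i) \<otimes>\<^bsub>SL_alg \<theta>\<^esub> SL_mat \<theta> k j))"
    using assms
    by (intro Sp.finsum_cong') (auto simp: Sp_mat_eq, auto simp: Sp_alg_def SI_quot_star SI_quot_mult SI_quot_carrierI)
  also have "\<dots> = Sp_ideal \<theta> +>\<^bsub>SL_alg \<theta>\<^esub> (\<Oplus>\<^bsub>SL_alg \<theta>\<^esub>k\<in>ix. star (SL_alg \<theta>) (SL_mat \<theta> k i) \<otimes>\<^bsub>SL_alg \<theta>\<^esub> SL_mat \<theta> k j)"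
    unfolding Sp_alg_def using assms by (intro SI_quot_finsum) auto
  also note 1
  finally show ?thesis
    by (simp add: Sp_alg_def SI_quot_one SI_quot_zero)
qed

lemma Sp_sp_mat:
  assumes h: "typed_hom (Sp_alg \<theta>) h"
  shows "sp_mat \<theta> (\<lambda>i j. h (Sp_mat \<theta> i j)) (h \<one>\<^bsub>Sp_alg \<theta>\<^esub>)"
proof
  fix i j assume ij: "i \<in> ix" "j \<in> ix"
  {
    fix k l assume "k \<in> ix" "l \<in> ix"
    then show "h (Sp_mat \<theta> i j) * h (Sp_mat \<theta> k l) = (eta \<theta> k i * eta \<theta> j l) *c (h (Sp_mat \<theta> k l) * h (Sp_mat \<theta> i j))"
      using ij Sp_mat_comm[of i j k l \<theta>] by (simp add: typed_homD[OF h, symmetric])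
  }
  have "(\<Sum>k\<in>ix. h (star (Sp_alg \<theta>) (Sp_mat \<theta> k i) \<otimes>\<^bsub>Sp_alg \<theta>\<^esub> Sp_mat \<theta> k j)) =
    h (\<Oplus>\<^bsub>Sp_alg \<theta>\<^esub>k\<in>ix. star (Sp_alg \<theta>) (Sp_mat \<theta> k i) \<otimes>\<^bsub>Sp_alg \<theta>\<^esub> Sp_mat \<theta> k j)"
    using ij by (intro Sp.typed_hom_finsum[OF h, symmetric]) auto
  also have "\<dots> = (if i = j then h \<one>\<^bsub>Sp_alg \<theta>\<^esub> else 0)"
    using ij by (simp add: Sp_unit Sp.typed_hom_zero[OF h])
  finally show "(\<Sum>k\<in>ix. sg (k + i) *c (h (Sp_mat \<theta> (cj k) (cj i)) * h (Sp_mat \<theta> k j))) = (if i = j then h \<one>\<^bsub>Sp_alg \<theta>\<^esub> else 0)"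
    using ij by (simp add: Sp_mat_star typed_homD[OF h])
qed (simp_all add: typed_homD[OF h, symmetric])

text \<open>The determinant relation of the intermediate quotient is supplied by unitarity through
  \<open>theta_det_one\<close>.\<close>

lemma Sp_universal:
  assumes "sp_mat \<theta> X e"
  shows "\<exists>h. typed_hom (Sp_alg \<theta>) h \<and> h \<one>\<^bsub>Sp_alg \<theta>\<^esub> = e \<and> (\<forall>i\<in>ix. \<forall>j\<in>ix. h (Sp_mat \<theta> i j) = X i j)"
proof -
  interpret sp_mat \<theta> X e by fact
  obtain h where h: "typed_hom (SL_alg \<theta>) h" and h1: "h \<one>\<^bsub>SL_alg \<theta>\<^esub> = e"
    and hm: "\<And>i j. i \<in> ix \<Longrightarrow> j \<in> ix \<Longrightarrow> h (SL_mat \<theta> i j) = X i j"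
    using SL_universal[OF theta_mat_axioms theta_det_one] by blast
  have rel: "h (Sp_rel \<theta> i j) = 0" if ij: "i \<in> ix" "j \<in> ix" for i j
  proof -
    have "h (\<Oplus>\<^bsub>SL_alg \<theta>\<^esub>k\<in>ix. star (SL_alg \<theta>) (SL_mat \<theta> k i) \<otimes>\<^bsub>SL_alg \<theta>\<^esub> SL_mat \<theta> k j) =
      (\<Sum>k\<in>ix. h (star (SL_alg \<theta>) (SL_mat \<theta> k i) \<otimes>\<^bsub>SL_alg \<theta>\<^esub> SL_mat \<theta> k j))"
      using ij by (intro SL.typed_hom_finsum[OF h]) auto
    also have "\<dots> = (\<Sum>k\<in>ix. sg (k + i) *c (X (cj k) (cj i) * X k j))"
      using ij by (intro sum.cong refl) (simp add: SL.A_mat_star typed_homD[OF h] hm)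
    finally show ?thesis
      using ij unit[OF ij] by (simp add: Sp_rel_def SL.typed_hom_diff[OF h] SL.typed_hom_zero[OF h] h1)
  qed
  have "h x = 0" if "x \<in> Sp_ideal \<theta>" for x
    by (rule SL.typed_hom_star_genideal[OF h _ _ _ that[unfolded Sp_ideal_eq]]) (auto simp: rel Sp_rel_star)
  then obtain h' where h': "typed_hom (Sp_alg \<theta>) h'" "\<And>x. x \<in> carrier (SL_alg \<theta>) \<Longrightarrow> h' (Sp_ideal \<theta> +>\<^bsub>SL_alg \<theta>\<^esub> x) = h x"
    using SI_typed_hom_quot[OF h] by (auto simp: Sp_alg_def)
  moreover have "h' \<one>\<^bsub>Sp_alg \<theta>\<^esub> = e"
    using h1 by (simp add: Sp_alg_def SI_quot_one h'(2))
  ultimately show ?thesis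
    by (intro exI[of _ h']) (auto simp: Sp_mat_eq hm)
qed

text \<open>Adjoints of generators are signed matrix entries, so there is no case for the
  star.\<close>

lemma Sp_induct [consumes 1, case_names one add mult smult entry]:
  assumes x: "x \<in> carrier (Sp_alg \<theta>)"
    and one: "P \<one>\<^bsub>Sp_alg \<theta>\<^esub>"
    and add: "\<And>x y. x \<in> carrier (Sp_alg \<theta>) \<Longrightarrow> y \<in> carrier (Sp_alg \<theta>) \<Longrightarrow> P x \<Longrightarrow> P y \<Longrightarrow> P (x \<oplus>\<^bsub>Sp_alg \<theta>\<^esub> y)"
    and mult: "\<And>x y. x \<in> carrier (Sp_alg \<theta>) \<Longrightarrow> y \<in> carrier (Sp_alg \<theta>) \<Longrightarrow> P x \<Longrightarrow> P y \<Longrightarrow> P (x \<otimes>\<^bsub>Sp_alg \<theta>\<^esub> y)"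
    and smult: "\<And>c x. x \<in> carrier (Sp_alg \<theta>) \<Longrightarrow> P x \<Longrightarrow> P (c \<odot>\<^bsub>Sp_alg \<theta>\<^esub> x)"
    and entry: "\<And>i j. i \<in> ix \<Longrightarrow> j \<in> ix \<Longrightarrow> P (Sp_mat \<theta> i j)"
  shows "P x"
proof -
  \<comment> \<open>The composite of the three quotient maps, starting from the free
    algebra.\<close>
  define pr where "pr y = Sp_ideal \<theta> +>\<^bsub>SL_alg \<theta>\<^esub> (SL_ideal \<theta> +>\<^bsub>M_alg \<theta>\<^esub> (M_ideal \<theta> +>\<^bsub>free_star_alg\<^esub> y))" for y
  have M_cl: "M_ideal \<theta> +>\<^bsub>free_star_alg\<^esub> y \<in> carrier (M_alg \<theta>)" for y
    by (simp add: M_alg_def FMI_quot_carrierI)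
  have SL_cl: "SL_ideal \<theta> +>\<^bsub>M_alg \<theta>\<^esub> (M_ideal \<theta> +>\<^bsub>free_star_alg\<^esub> y) \<in> carrier (SL_alg \<theta>)" for y
    by (simp add: SL_alg_def MI_quot_carrierI M_cl)
  have cl: "pr y \<in> carrier (Sp_alg \<theta>)" for y
    by (simp add: pr_def Sp_alg_def SI_quot_carrierI SL_cl)
  have pr_one: "pr \<one>\<^bsub>free_star_alg\<^esub> = \<one>\<^bsub>Sp_alg \<theta>\<^esub>"
    by (simp add: pr_def Sp_alg_def SI_quot_one, simp add: SL_alg_def MI_quot_one, simp add: M_alg_def FMI_quot_one)
  have pr_add: "pr (y \<oplus>\<^bsub>free_star_alg\<^esub> z) = pr y \<oplus>\<^bsub>Sp_alg \<theta>\<^esub> pr z" for y z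
    using SL_cl M_cl
    by (simp add: pr_def Sp_alg_def SI_quot_add, simp add: SL_alg_def MI_quot_add, simp add: M_alg_def FMI_quot_add)
  have pr_mult: "pr (y \<otimes>\<^bsub>free_star_alg\<^esub> z) = pr y \<otimes>\<^bsub>Sp_alg \<theta>\<^esub> pr z" for y z
    using SL_cl M_cl
    by (simp add: pr_def Sp_alg_def SI_quot_mult, simp add: SL_alg_def MI_quot_mult, simp add: M_alg_def FMI_quot_mult)
  have pr_smult: "pr (c \<odot>\<^bsub>free_star_alg\<^esub> z) = c \<odot>\<^bsub>Sp_alg \<theta>\<^esub> pr z" for c z
    using SL_cl M_cl
    by (simp add: pr_def Sp_alg_def SI_quot_smult, simp add: SL_alg_def MI_quot_smult, simp add: M_alg_def FMI_quot_smult)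
  have pr_gen: "pr (free_gen g) = Sp_val \<theta> g" for g
    by (simp add: pr_def Sp_val_def SL_val_def M_val_def)
  have pr_star: "pr (star free_star_alg (free_gen g)) = star (Sp_alg \<theta>) (Sp_val \<theta> g)" for g
    using SL_cl M_cl
    by (simp add: pr_gen[symmetric], simp add: pr_def Sp_alg_def SI_quot_star, simp add: SL_alg_def MI_quot_star, simp add: M_alg_def FMI_quot_star)
  obtain y where "x = pr y"
    using x unfolding Sp_alg_def SL_alg_def M_alg_def pr_def by (metis SI_quot_carrierE MI_quot_carrierE FMI_quot_carrierE SL_alg_def M_alg_def)
  moreover have "P (pr y)"
  proof (induction y rule: free_induct)
    case (gen g)
    then show ?case using entry[of "gen_row g" "gen_col g"] by (simp add: pr_gen A_mat_gen)
  next
    case (star g)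
    show ?case
      using smult[OF _ entry[of "cj (gen_row g)" "cj (gen_col g)"], of "sg (gen_row g + gen_col g)"]
      by (simp add: pr_star Sp.A_mat_star_gen)
  qed (simp_all add: pr_one pr_add pr_mult pr_smult one add mult smult cl)
  ultimately show ?thesis by simp
qed

section \<open>Tensor products\<close>

locale alg_pair = A: alg A + B: alg B for A :: "'a star_algebra" and B :: "'b star_algebra"
begin

abbreviation "P \<equiv> pair_alg A B"
abbreviation "T \<equiv> tensor_alg A B"

lemma pair_alg: "alg (pair_alg A B)"
  unfolding pair_alg_def
  by (intro monoid_alg_alg DirProd_monoid A.monoid_axioms B.monoid_axioms)

lemma pair_alg_simps:
  "carrier P = {f. Poly_Mapping.keys f \<subseteq> carrier A \<times> carrier B}"
  "f \<otimes>\<^bsub>P\<^esub> g = pm_conv (\<lambda>p q. (fst p \<otimes>\<^bsub>A\<^esub> fst q, snd p \<otimes>\<^bsub>B\<^esub> snd q)) f g"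
  "\<one>\<^bsub>P\<^esub> = Poly_Mapping.single (\<one>\<^bsub>A\<^esub>, \<one>\<^bsub>B\<^esub>) 1"
  "\<zero>\<^bsub>P\<^esub> = 0"
  "f \<oplus>\<^bsub>P\<^esub> g = f + g"
  "c \<odot>\<^bsub>P\<^esub> f = pm_scale c f"
  by (simp_all add: pair_alg_def monoid_alg_simps DirProd_def split_def)

lemma pair_closed [simp]: "x \<in> carrier A \<Longrightarrow> y \<in> carrier B \<Longrightarrow> Poly_Mapping.single (x, y) c \<in> carrier P"
  by (simp add: pair_alg_simps)

sublocale P: alg P
  by (rule pair_alg)

lemma pair_minus: "f \<in> carrier P \<Longrightarrow> g \<in> carrier P \<Longrightarrow> f \<ominus>\<^bsub>P\<^esub> g = f - g"
proof -
  assume f: "f \<in> carrier P" and g: "g \<in> carrier P"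
  have "- g \<in> carrier P" using g by (simp add: pair_alg_simps in_keys_iff subset_iff)
  then have "\<ominus>\<^bsub>P\<^esub> g = - g"
    using g by (intro P.minus_equality) (simp_all add: pair_alg_simps)
  then show ?thesis by (simp add: P.minus_eq) (simp add: pair_alg_simps)
qed

lemma pair_diff_closed: "f \<in> carrier P \<Longrightarrow> g \<in> carrier P \<Longrightarrow> f - g \<in> carrier P"
  by (metis pair_minus P.minus_closed)

lemma bilinear_rels_closed: "bilinear_rels A B \<subseteq> carrier P"
  unfolding bilinear_rels_def by (auto intro!: pair_diff_closed)

lemma tensor_ideal: "alg_ideal P (tensor_ideal A B)"
  unfolding tensor_ideal_def
  by (intro alg_ideal.intro P.genideal_ideal bilinear_rels_closed P.alg_axioms)

sublocale TI: alg_ideal P "tensor_ideal A B"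
  by (rule tensor_ideal)

sublocale T: alg T
  unfolding tensor_alg_def by (rule TI.quot_alg)

lemma bilinear_rels_ideal: "r \<in> bilinear_rels A B \<Longrightarrow> r \<in> tensor_ideal A B"
  unfolding tensor_ideal_def using P.genideal_self[OF bilinear_rels_closed] by auto

lemma tens_closed [simp]: "x \<in> carrier A \<Longrightarrow> y \<in> carrier B \<Longrightarrow> tens A B x y \<in> carrier T"
  unfolding tens_def tensor_alg_def by simp

lemma tens_mult:
  assumes "x \<in> carrier A" "y \<in> carrier B" "x' \<in> carrier A" "y' \<in> carrier B"
  shows "tens A B x y \<otimes>\<^bsub>T\<^esub> tens A B x' y' = tens A B (x \<otimes>\<^bsub>A\<^esub> x') (y \<otimes>\<^bsub>B\<^esub> y')"
  using assms unfolding tens_def tensor_alg_def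
  by (simp add: TI.quot_mult) (simp add: pair_alg_simps)

lemma tens_one: "tens A B \<one>\<^bsub>A\<^esub> \<one>\<^bsub>B\<^esub> = \<one>\<^bsub>T\<^esub>"
  unfolding tens_def tensor_alg_def by (simp add: TI.quot_one pair_alg_simps)

lemma tens_add_left:
  assumes "x \<in> carrier A" "x' \<in> carrier A" "y \<in> carrier B"
  shows "tens A B (x \<oplus>\<^bsub>A\<^esub> x') y = tens A B x y \<oplus>\<^bsub>T\<^esub> tens A B x' y"
proof -
  have r: "pair (x \<oplus>\<^bsub>A\<^esub> x') y - pair x y - pair x' y \<in> tensor_ideal A B"
    using assms by (intro bilinear_rels_ideal) (auto simp: bilinear_rels_def)
  have "tensor_ideal A B +>\<^bsub>P\<^esub> pair (x \<oplus>\<^bsub>A\<^esub> x') y = tensor_ideal A B +>\<^bsub>P\<^esub> (pair x y \<oplus>\<^bsub>P\<^esub> pair x' y)"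
    using assms r by (subst TI.coset_eq_iff) (auto simp: pair_minus, simp add: pair_alg_simps(5) diff_diff_eq)
  then show ?thesis
    using assms unfolding tens_def tensor_alg_def by (simp add: TI.quot_add)
qed

lemma tens_add_right:
  assumes "x \<in> carrier A" "y \<in> carrier B" "y' \<in> carrier B"
  shows "tens A B x (y \<oplus>\<^bsub>B\<^esub> y') = tens A B x y \<oplus>\<^bsub>T\<^esub> tens A B x y'"
proof -
  have r: "pair x (y \<oplus>\<^bsub>B\<^esub> y') - pair x y - pair x y' \<in> tensor_ideal A B"
    using assms by (intro bilinear_rels_ideal) (auto simp: bilinear_rels_def)
  have "tensor_ideal A B +>\<^bsub>P\<^esub> pair x (y \<oplus>\<^bsub>B\<^esub> y') = tensor_ideal A B +>\<^bsub>P\<^esub> (pair x y \<oplus>\<^bsub>P\<^esub> pair x y')"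
    using assms r by (subst TI.coset_eq_iff) (auto simp: pair_minus, simp add: pair_alg_simps(5) diff_diff_eq)
  then show ?thesis
    using assms unfolding tens_def tensor_alg_def by (simp add: TI.quot_add)
qed

lemma tensor_single:
  assumes "x \<in> carrier A" "y \<in> carrier B"
  shows "tensor_ideal A B +>\<^bsub>P\<^esub> Poly_Mapping.single (x, y) c = c \<odot>\<^bsub>T\<^esub> tens A B x y"
  using assms unfolding tens_def tensor_alg_def
  by (simp add: TI.quot_smult) (simp add: pair_alg_simps)

lemma tens_smult_left:
  assumes "x \<in> carrier A" "y \<in> carrier B"
  shows "tens A B (c \<odot>\<^bsub>A\<^esub> x) y = c \<odot>\<^bsub>T\<^esub> tens A B x y"
proof -
  have r: "pair (c \<odot>\<^bsub>A\<^esub> x) y - Poly_Mapping.single (x, y) c \<in> tensor_ideal A B"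
    using assms by (intro bilinear_rels_ideal) (auto simp: bilinear_rels_def)
  have "tensor_ideal A B +>\<^bsub>P\<^esub> pair (c \<odot>\<^bsub>A\<^esub> x) y = tensor_ideal A B +>\<^bsub>P\<^esub> Poly_Mapping.single (x, y) c"
    using assms r by (subst TI.coset_eq_iff) (auto simp: pair_minus)
  then show ?thesis
    using assms by (simp add: tensor_single)
qed

lemma tens_smult_right:
  assumes "x \<in> carrier A" "y \<in> carrier B"
  shows "tens A B x (c \<odot>\<^bsub>B\<^esub> y) = c \<odot>\<^bsub>T\<^esub> tens A B x y"
proof -
  have r: "pair x (c \<odot>\<^bsub>B\<^esub> y) - Poly_Mapping.single (x, y) c \<in> tensor_ideal A B"
    using assms by (intro bilinear_rels_ideal) (auto simp: bilinear_rels_def)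
  have "tensor_ideal A B +>\<^bsub>P\<^esub> pair x (c \<odot>\<^bsub>B\<^esub> y) = tensor_ideal A B +>\<^bsub>P\<^esub> Poly_Mapping.single (x, y) c"
    using assms r by (subst TI.coset_eq_iff) (auto simp: pair_minus)
  then show ?thesis
    using assms by (simp add: tensor_single)
qed

lemma tens_zero [simp]:
  "y \<in> carrier B \<Longrightarrow> tens A B \<zero>\<^bsub>A\<^esub> y = \<zero>\<^bsub>T\<^esub>" "x \<in> carrier A \<Longrightarrow> tens A B x \<zero>\<^bsub>B\<^esub> = \<zero>\<^bsub>T\<^esub>"
  using tens_smult_left[of "\<zero>\<^bsub>A\<^esub>" y 0] tens_smult_right[of x "\<zero>\<^bsub>B\<^esub>" 0] by simp_all

text \<open>Scalars are absorbed into the left factor, so sums of pure tensors exhaust the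
  algebra.\<close>

lemma tens_induct [consumes 1, case_names zero add tens]:
  assumes t: "t \<in> carrier T" and zero: "Q \<zero>\<^bsub>T\<^esub>"
    and add: "\<And>s t. s \<in> carrier T \<Longrightarrow> t \<in> carrier T \<Longrightarrow> Q s \<Longrightarrow> Q t \<Longrightarrow> Q (s \<oplus>\<^bsub>T\<^esub> t)"
    and tens: "\<And>x y. x \<in> carrier A \<Longrightarrow> y \<in> carrier B \<Longrightarrow> Q (tens A B x y)"
  shows "Q t"
proof -
  obtain f where f: "f \<in> carrier P" "t = tensor_ideal A B +>\<^bsub>P\<^esub> f"
    using t unfolding tensor_alg_def by (rule TI.quot_carrierE)
  from f(1) have "Poly_Mapping.keys f \<subseteq> carrier A \<times> carrier B" by (simp add: pair_alg_simps)
  then have "Q (tensor_ideal A B +>\<^bsub>P\<^esub> f)"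
  proof (induction f rule: pm_induct)
    case zero
    then show ?case using \<open>Q \<zero>\<^bsub>T\<^esub>\<close> by (simp add: tensor_alg_def TI.quot_zero pair_alg_simps)
  next
    case (add p c f)
    then obtain x y where p: "p = (x, y)" "x \<in> carrier A" "y \<in> carrier B" by auto
    have f: "f \<in> carrier P" using add by (simp add: pair_alg_simps)
    have "tensor_ideal A B +>\<^bsub>P\<^esub> (Poly_Mapping.single p c \<oplus>\<^bsub>P\<^esub> f) =
        (tensor_ideal A B +>\<^bsub>P\<^esub> Poly_Mapping.single p c) \<oplus>\<^bsub>T\<^esub> (tensor_ideal A B +>\<^bsub>P\<^esub> f)"
      unfolding tensor_alg_def using p f by (simp add: TI.quot_add)
    moreover have "tensor_ideal A B +>\<^bsub>P\<^esub> Poly_Mapping.single p c = tens A B (c \<odot>\<^bsub>A\<^esub> x) y"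
      using p by (simp add: tensor_single tens_smult_left)
    moreover have "tensor_ideal A B +>\<^bsub>P\<^esub> f \<in> carrier T"
      unfolding tensor_alg_def using f by simp
    ultimately show ?case
      using p add(3) assms(3)[OF _ _ tens[of "c \<odot>\<^bsub>A\<^esub> x" y] add(3)]
      by (simp add: pair_alg_simps(5))
  qed
  then show ?thesis using f by simp
qed

definition bilin :: "('a \<Rightarrow> 'b \<Rightarrow> 'c::calg) \<Rightarrow> bool" where
  "bilin \<beta> \<longleftrightarrow>
    (\<forall>x\<in>carrier A. \<forall>x'\<in>carrier A. \<forall>y\<in>carrier B. \<beta> (x \<oplus>\<^bsub>A\<^esub> x') y = \<beta> x y + \<beta> x' y) \<and>
    (\<forall>x\<in>carrier A. \<forall>y\<in>carrier B. \<forall>y'\<in>carrier B. \<beta> x (y \<oplus>\<^bsub>B\<^esub> y') = \<beta> x y + \<beta> x y') \<and>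
    (\<forall>c. \<forall>x\<in>carrier A. \<forall>y\<in>carrier B. \<beta> (c \<odot>\<^bsub>A\<^esub> x) y = c *c \<beta> x y \<and> \<beta> x (c \<odot>\<^bsub>B\<^esub> y) = c *c \<beta> x y)"

text \<open>The elements on which all bilinear maps vanish form an ideal, because the translates of a
  bilinear map by multiplications are bilinear.\<close>

lemma bilin_tensor_ideal:
  assumes "bilin (\<beta> :: 'a \<Rightarrow> 'b \<Rightarrow> 'c::calg)" "t \<in> tensor_ideal A B"
  shows "lin_ext (case_prod \<beta>) t = 0"
proof -
  define K where "K = {t \<in> carrier P. \<forall>\<beta> :: 'a \<Rightarrow> 'b \<Rightarrow> 'c. bilin \<beta> \<longrightarrow> lin_ext (case_prod \<beta>) t = 0}"
  have "ideal K P"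
  proof (rule idealI)
    show "ring P" by (rule P.ring_axioms)
    show "subgroup K (add_monoid P)"
    proof (rule subgroup.intro)
      fix t assume t: "t \<in> K"
      then have tP: "t \<in> carrier P" by (simp add: K_def)
      have "\<ominus>\<^bsub>P\<^esub> t = pm_scale (- 1) t"
        using P.minus_smult[OF tP, of 1] P.one_smult[OF tP] by (simp add: pair_alg_simps)
      then show "inv\<^bsub>add_monoid P\<^esub> t \<in> K"
        using t P.a_inv_closed[OF tP] unfolding a_inv_def[symmetric]
        by (auto simp: K_def lin_ext_scale)
    next
      fix s t assume "s \<in> K" "t \<in> K"
      then show "s \<otimes>\<^bsub>add_monoid P\<^esub> t \<in> K"
        using P.a_closed[of s t] by (auto simp: K_def pair_alg_simps(5) lin_ext_add)
    qed (use P.zero_closed in \<open>auto simp: K_def pair_alg_simps(4)\<close>)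
    fix t s assume t: "t \<in> K" and s: "s \<in> carrier P"
    have tP: "Poly_Mapping.keys t \<subseteq> carrier A \<times> carrier B"
      and t0: "\<And>\<beta> :: 'a \<Rightarrow> 'b \<Rightarrow> 'c. bilin \<beta> \<Longrightarrow> lin_ext (case_prod \<beta>) t = 0"
      using t by (auto simp: K_def pair_alg_simps)
    have sP: "Poly_Mapping.keys s \<subseteq> carrier A \<times> carrier B"
      using s by (auto simp: pair_alg_simps)
    have "lin_ext (case_prod \<beta>) (s \<otimes>\<^bsub>P\<^esub> t) = 0" if \<beta>: "bilin \<beta>" for \<beta> :: "'a \<Rightarrow> 'b \<Rightarrow> 'c"
      using sP
    proof (induction s rule: pm_induct)
      case (add p c s)
      then obtain a b where p: "p = (a, b)" "a \<in> carrier A" "b \<in> carrier B" by auto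
      have "lin_ext (case_prod \<beta>) (Poly_Mapping.single p c \<otimes>\<^bsub>P\<^esub> t) =
          c *c lin_ext (case_prod (\<lambda>x y. \<beta> (a \<otimes>\<^bsub>A\<^esub> x) (b \<otimes>\<^bsub>B\<^esub> y))) t"
        using tP
        by (induction t rule: pm_induct)
          (auto simp: pair_alg_simps pm_conv_add_right lin_ext_add cscale_add_right p split: prod.splits)
      moreover have "bilin (\<lambda>x y. \<beta> (a \<otimes>\<^bsub>A\<^esub> x) (b \<otimes>\<^bsub>B\<^esub> y))"
        using \<beta> p by (auto simp: bilin_def A.r_distr B.r_distr A.smult_mult_right B.smult_mult_right)
      ultimately show ?case
        using add t0 by (simp add: pair_alg_simps pm_conv_add_left lin_ext_add)
    qed (simp add: pair_alg_simps)
    then show "s \<otimes>\<^bsub>P\<^esub> t \<in> K"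
      using s t by (auto simp: K_def)
    have "lin_ext (case_prod \<beta>) (t \<otimes>\<^bsub>P\<^esub> s) = 0" if \<beta>: "bilin \<beta>" for \<beta> :: "'a \<Rightarrow> 'b \<Rightarrow> 'c"
      using sP
    proof (induction s rule: pm_induct)
      case (add p c s)
      then obtain a b where p: "p = (a, b)" "a \<in> carrier A" "b \<in> carrier B" by auto
      have "lin_ext (case_prod \<beta>) (t \<otimes>\<^bsub>P\<^esub> Poly_Mapping.single p c) =
          c *c lin_ext (case_prod (\<lambda>x y. \<beta> (x \<otimes>\<^bsub>A\<^esub> a) (y \<otimes>\<^bsub>B\<^esub> b))) t"
        using tP
        by (induction t rule: pm_induct)
          (auto simp: pair_alg_simps pm_conv_add_left lin_ext_add cscale_add_right p mult.commute split: prod.splits)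
      moreover have "bilin (\<lambda>x y. \<beta> (x \<otimes>\<^bsub>A\<^esub> a) (y \<otimes>\<^bsub>B\<^esub> b))"
        using \<beta> p by (auto simp: bilin_def A.l_distr B.l_distr A.smult_mult_left B.smult_mult_left)
      ultimately show ?case
        using add t0 by (simp add: pair_alg_simps pm_conv_add_right lin_ext_add)
    qed (simp add: pair_alg_simps)
    then show "t \<otimes>\<^bsub>P\<^esub> s \<in> K"
      using s t by (auto simp: K_def)
  qed
  moreover have "bilinear_rels A B \<subseteq> K"
  proof
    fix r assume "r \<in> bilinear_rels A B"
    then have "r \<in> carrier P"
      using bilinear_rels_closed by auto
    moreover have "lin_ext (case_prod \<beta>) r = 0" if "bilin \<beta>" for \<beta> :: "'a \<Rightarrow> 'b \<Rightarrow> 'c"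
      using \<open>r \<in> bilinear_rels A B\<close> that
      unfolding bilinear_rels_def by (auto simp: lin_ext_diff bilin_def)
    ultimately show "r \<in> K" by (simp add: K_def)
  qed
  ultimately have "tensor_ideal A B \<subseteq> K"
    unfolding tensor_ideal_def by (rule P.genideal_minimal)
  then show ?thesis using assms by (auto simp: K_def)
qed

text \<open>The source of slice maps, which evaluate one tensor factor at a functional and keep the
  other.\<close>

lemma tensor_linear_map:
  assumes "bilin (\<beta> :: 'a \<Rightarrow> 'b \<Rightarrow> 'c::calg)"
  shows "\<exists>l. (\<forall>s\<in>carrier T. \<forall>t\<in>carrier T. l (s \<oplus>\<^bsub>T\<^esub> t) = l s + l t) \<and>
    (\<forall>c. \<forall>t\<in>carrier T. l (c \<odot>\<^bsub>T\<^esub> t) = c *c l t) \<and>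
    (\<forall>x\<in>carrier A. \<forall>y\<in>carrier B. l (tens A B x y) = \<beta> x y)"
proof -
  have "\<exists>l. \<forall>t\<in>carrier P. l (tensor_ideal A B +>\<^bsub>P\<^esub> t) = lin_ext (case_prod \<beta>) t"
    by (rule TI.ex_quot_map) (simp add: pair_alg_simps(5) lin_ext_add bilin_tensor_ideal[OF assms])
  then obtain l where l: "\<And>t. t \<in> carrier P \<Longrightarrow> l (tensor_ideal A B +>\<^bsub>P\<^esub> t) = lin_ext (case_prod \<beta>) t"
    by blast
  show ?thesis
  proof (intro exI[of _ l] conjI ballI allI)
    fix s t c assume s: "s \<in> carrier T" and t: "t \<in> carrier T"
    obtain s' t' where "s' \<in> carrier P" "t' \<in> carrier P"
      and eq: "s = tensor_ideal A B +>\<^bsub>P\<^esub> s'" "t = tensor_ideal A B +>\<^bsub>P\<^esub> t'"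
      using s t unfolding tensor_alg_def by (metis TI.quot_carrierE)
    then show "l (s \<oplus>\<^bsub>T\<^esub> t) = l s + l t"
      using P.a_closed[of s' t'] by (simp add: tensor_alg_def TI.quot_add l) (simp add: pair_alg_simps lin_ext_add)
  next
    fix t c assume t: "t \<in> carrier T"
    obtain t' where "t' \<in> carrier P" and eq: "t = tensor_ideal A B +>\<^bsub>P\<^esub> t'"
      using t unfolding tensor_alg_def by (metis TI.quot_carrierE)
    then show "l (c \<odot>\<^bsub>T\<^esub> t) = c *c l t"
      using P.smult_closed[of t' c] by (simp add: tensor_alg_def TI.quot_smult l) (simp add: pair_alg_simps lin_ext_scale)
  qed (simp add: tens_def l)
qed

lemma lin_span_closed: "X \<subseteq> carrier T \<Longrightarrow> x \<in> lin_span T X \<Longrightarrow> x \<in> carrier T"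
  by (rotate_tac, induction rule: lin_span.induct) auto

text \<open>Pure tensors multiply factorwise, so ideals in both factors suffice. The coproduct
  condition for a Hopf ideal thereby becomes membership in an ideal, which can be tested on
  generators.\<close>

lemma tensor_sub_ideal:
  assumes "ideal V A" "ideal W B"
  shows "ideal (tensor_sub A B V W) T"
proof -
  interpret V: ideal V A by fact
  interpret W: ideal W B by fact
  let ?X = "{tens A B x y | x y. x \<in> V \<and> y \<in> W}"
  have X: "?X \<subseteq> carrier T" by auto
  have cl: "x \<in> carrier T" if "x \<in> lin_span T ?X" for x
    using lin_span_closed[OF X that] .
  show ?thesis
    unfolding tensor_sub_def
  proof (rule idealI)
    show "ring T" by (rule T.ring_axioms)
    show "subgroup (lin_span T ?X) (add_monoid T)"
    proof (rule subgroup.intro)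
      fix x assume x: "x \<in> lin_span T ?X"
      have "\<ominus>\<^bsub>T\<^esub> x = (- 1) \<odot>\<^bsub>T\<^esub> x"
        using T.minus_smult[OF cl[OF x], of 1] cl[OF x] by simp
      then show "inv\<^bsub>add_monoid T\<^esub> x \<in> lin_span T ?X"
        using x unfolding a_inv_def[symmetric] by (auto intro: lin_span.smult)
    qed (auto intro: lin_span.intros cl)
    fix x t assume x: "x \<in> lin_span T ?X" and t: "t \<in> carrier T"
    from t x show "t \<otimes>\<^bsub>T\<^esub> x \<in> lin_span T ?X"
    proof (induction t rule: tens_induct)
      case (tens a b)
      from tens(3) show ?case
      proof (induction rule: lin_span.induct)
        case (gen x)
        then obtain v w where vw: "v \<in> V" "w \<in> W" "x = tens A B v w" by auto
        then have "tens A B a b \<otimes>\<^bsub>T\<^esub> x = tens A B (a \<otimes>\<^bsub>A\<^esub> v) (b \<otimes>\<^bsub>B\<^esub> w)"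
          using tens by (simp add: tens_mult)
        moreover have "a \<otimes>\<^bsub>A\<^esub> v \<in> V" "b \<otimes>\<^bsub>B\<^esub> w \<in> W"
          using vw tens V.I_l_closed W.I_l_closed by auto
        ultimately show ?case by (intro lin_span.gen) blast
      qed (use tens cl in \<open>auto simp: T.r_distr T.smult_mult_right intro: lin_span.intros\<close>)
    qed (auto simp: T.l_distr cl intro: lin_span.intros)
    from t x show "x \<otimes>\<^bsub>T\<^esub> t \<in> lin_span T ?X"
    proof (induction t rule: tens_induct)
      case (tens a b)
      from tens(3) show ?case
      proof (induction rule: lin_span.induct)
        case (gen x)
        then obtain v w where vw: "v \<in> V" "w \<in> W" "x = tens A B v w" by auto
        then have "x \<otimes>\<^bsub>T\<^esub> tens A B a b = tens A B (v \<otimes>\<^bsub>A\<^esub> a) (w \<otimes>\<^bsub>B\<^esub> b)"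
          using tens by (simp add: tens_mult)
        moreover have "v \<otimes>\<^bsub>A\<^esub> a \<in> V" "w \<otimes>\<^bsub>B\<^esub> b \<in> W"
          using vw tens V.I_r_closed W.I_r_closed by auto
        ultimately show ?case by (intro lin_span.gen) blast
      qed (use tens cl in \<open>auto simp: T.l_distr T.smult_mult_left intro: lin_span.intros\<close>)
    qed (auto simp: T.r_distr cl intro: lin_span.intros)
  qed
qed

lemma typed_hom_tens_left: "typed_hom A (\<lambda>x. iota T (tens A B x \<one>\<^bsub>B\<^esub>))"
  by (auto simp: typed_hom_def tens_add_left tens_smult_left)
    (metis (no_types, lifting) B.l_one B.one_closed T.iota_mult tens_closed tens_mult)

lemma typed_hom_tens_right: "typed_hom B (\<lambda>y. iota T (tens A B \<one>\<^bsub>A\<^esub> y))"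
  by (auto simp: typed_hom_def tens_add_right tens_smult_right)
    (metis (no_types, lifting) A.l_one A.one_closed T.iota_mult tens_closed tens_mult)

end

section \<open>Homomorphisms of record algebras and their tensor products\<close>

lemma alg_hom_iff:
  "h \<in> alg_hom A B \<longleftrightarrow> (\<forall>x\<in>carrier A. h x \<in> carrier B) \<and>
    (\<forall>x\<in>carrier A. \<forall>y\<in>carrier A. h (x \<oplus>\<^bsub>A\<^esub> y) = h x \<oplus>\<^bsub>B\<^esub> h y \<and> h (x \<otimes>\<^bsub>A\<^esub> y) = h x \<otimes>\<^bsub>B\<^esub> h y) \<and>
    (\<forall>c. \<forall>x\<in>carrier A. h (c \<odot>\<^bsub>A\<^esub> x) = c \<odot>\<^bsub>B\<^esub> h x) \<and> h \<one>\<^bsub>A\<^esub> = \<one>\<^bsub>B\<^esub>"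
  by (auto simp: alg_hom_def ring_hom_def)

lemma (in alg) ev_alg_hom:
  assumes "typed_hom C h" "h \<one>\<^bsub>C\<^esub> = iota A \<one>"
  shows "(\<lambda>x. ev A (h x)) \<in> alg_hom C A"
  unfolding alg_hom_iff
  by (auto simp: typed_homD[OF assms(1)] ev_add ev_mult ev_cscale assms(2))

lemma (in alg) typed_hom_alg_hom:
  assumes "h \<in> alg_hom C A"
  shows "typed_hom C (\<lambda>x. iota A (h x))"
  using assms by (auto simp: typed_hom_def alg_hom_iff)

text \<open>The push-forward of formal combinations along \<open>map_prod f g\<close> is
  multiplicative and takes bilinearity relations to bilinearity relations. The preimage of the
  target ideal is therefore an ideal containing all relations, and the union in the definition runs
  over equal cosets.\<close>

lemma tensor_map_alg_hom:
  assumes "alg A" "alg B" "alg A'" "alg B'" and f: "f \<in> alg_hom A A'" and g: "g \<in> alg_hom B B'"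
  shows "tensor_map A' B' f g \<in> alg_hom (tensor_alg A B) (tensor_alg A' B')"
    and "x \<in> carrier A \<Longrightarrow> y \<in> carrier B \<Longrightarrow> tensor_map A' B' f g (tens A B x y) = tens A' B' (f x) (g y)"
proof -
  interpret D: alg_pair A B using assms by (simp add: alg_pair_def)
  interpret C: alg_pair A' B' using assms by (simp add: alg_pair_def)
  define push where "push t = pm_sum (\<lambda>p c. Poly_Mapping.single (map_prod f g p) c) t" for t
  have push_add: "push (s + t) = push s + push t" for s t
    unfolding push_def by (rule pm_sum_add) (simp_all add: single_add)
  have push_single: "push (Poly_Mapping.single p c) = Poly_Mapping.single (map_prod f g p) c" for p c
    unfolding push_def by (simp add: pm_sum_single)
  have push_0: "push 0 = 0" by (simp add: push_def)
  have push_diff: "push (s - t) = push s - push t" for s t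
    using push_add[of "s - t" t] by simp
  have f': "f x \<in> carrier A'" if "x \<in> carrier A" for x using f that by (simp add: alg_hom_iff)
  have g': "g x \<in> carrier B'" if "x \<in> carrier B" for x using g that by (simp add: alg_hom_iff)
  have push_cl: "push t \<in> carrier C.P" if "t \<in> carrier D.P" for t
  proof -
    have "Poly_Mapping.keys (push t) \<subseteq> carrier A' \<times> carrier B'"
      using that[unfolded D.pair_alg_simps mem_Collect_eq]
    proof (induction t rule: pm_induct)
      case (add p c t)
      then show ?case
        by (auto simp: push_add push_single f' g' dest!: subsetD[OF keys_add] split: if_splits)
    qed (simp add: push_0)
    then show ?thesis by (simp add: C.pair_alg_simps)
  qed
  have push_mult: "push (s \<otimes>\<^bsub>D.P\<^esub> t) = push s \<otimes>\<^bsub>C.P\<^esub> push t" if s: "s \<in> carrier D.P" and t: "t \<in> carrier D.P" for s t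
    using s[unfolded D.pair_alg_simps mem_Collect_eq]
  proof (induction s rule: pm_induct)
    case (add p c s)
    have "push (Poly_Mapping.single p c \<otimes>\<^bsub>D.P\<^esub> t) = push (Poly_Mapping.single p c) \<otimes>\<^bsub>C.P\<^esub> push t"
      using t[unfolded D.pair_alg_simps mem_Collect_eq]
    proof (induction t rule: pm_induct)
      case (add q d t)
      then show ?case
        using f g \<open>p \<in> _\<close> by (auto simp: D.pair_alg_simps C.pair_alg_simps pm_conv_add_right push_add push_single alg_hom_iff)
    qed (simp add: D.pair_alg_simps C.pair_alg_simps push_0)
    then show ?case
      using add by (simp add: D.pair_alg_simps C.pair_alg_simps pm_conv_add_left push_add)
  qed (simp add: D.pair_alg_simps C.pair_alg_simps push_0)
  have push_scale: "push (pm_scale c t) = pm_scale c (push t)" for c t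
    by (induction t rule: pm_induct[OF subset_UNIV])
      (auto simp: pm_scale_add push_add push_single push_0)
  have vim: "ideal {t \<in> carrier D.P. push t \<in> tensor_ideal A' B'} D.P"
  proof (rule idealI)
    show "ring D.P" by (rule D.P.ring_axioms)
    show "subgroup {t \<in> carrier D.P. push t \<in> tensor_ideal A' B'} (add_monoid D.P)"
    proof (rule subgroup.intro)
      fix t assume "t \<in> {t \<in> carrier D.P. push t \<in> tensor_ideal A' B'}"
      then have tP: "t \<in> carrier D.P" and ti: "push t \<in> tensor_ideal A' B'" by auto
      have "\<ominus>\<^bsub>D.P\<^esub> t = pm_scale (- 1) t"
        using D.P.minus_smult[OF tP, of 1] D.P.one_smult[OF tP] by (simp add: D.pair_alg_simps)
      moreover have "pm_scale (- 1) (push t) \<in> tensor_ideal A' B'"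
        using C.TI.smult_ideal[OF ti, of "- 1"] by (simp add: C.pair_alg_simps)
      ultimately show "inv\<^bsub>add_monoid D.P\<^esub> t \<in> {t \<in> carrier D.P. push t \<in> tensor_ideal A' B'}"
        using D.P.a_inv_closed[OF tP] unfolding a_inv_def[symmetric] by (auto simp: push_scale)
    next
      fix s t assume "s \<in> {t \<in> carrier D.P. push t \<in> tensor_ideal A' B'}" "t \<in> {t \<in> carrier D.P. push t \<in> tensor_ideal A' B'}"
      then show "s \<otimes>\<^bsub>add_monoid D.P\<^esub> t \<in> {t \<in> carrier D.P. push t \<in> tensor_ideal A' B'}"
        using D.P.a_closed[of s t] C.TI.a_closed[of "push s" "push t"]
        by (auto simp: D.pair_alg_simps(5) C.pair_alg_simps(5) push_add)
    qed (use D.P.zero_closed C.TI.zero_closed in \<open>auto simp: D.pair_alg_simps(4) C.pair_alg_simps(4) push_0\<close>)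
  qed (auto simp: push_mult push_cl C.TI.I_l_closed C.TI.I_r_closed)
  have rels: "bilinear_rels A B \<subseteq> {t \<in> carrier D.P. push t \<in> tensor_ideal A' B'}"
  proof
    fix r assume r: "r \<in> bilinear_rels A B"
    have "push r \<in> bilinear_rels A' B'"
      using r unfolding bilinear_rels_def
    proof (elim UnE)
      assume "r \<in> {pair (x \<oplus>\<^bsub>A\<^esub> x') y - pair x y - pair x' y |x x' y. x \<in> carrier A \<and> x' \<in> carrier A \<and> y \<in> carrier B}"
      then obtain x x' y where "x \<in> carrier A" "x' \<in> carrier A" "y \<in> carrier B"
        "push r = pair (f x \<oplus>\<^bsub>A'\<^esub> f x') (g y) - pair (f x) (g y) - pair (f x') (g y)"
        using f by (auto simp: push_diff push_single alg_hom_iff)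
      then show "push r \<in> {pair (x \<oplus>\<^bsub>A'\<^esub> x') y - pair x y - pair x' y |x x' y. x \<in> carrier A' \<and> x' \<in> carrier A' \<and> y \<in> carrier B'} \<union>
        {pair x (y \<oplus>\<^bsub>B'\<^esub> y') - pair x y - pair x y' |x y y'. x \<in> carrier A' \<and> y \<in> carrier B' \<and> y' \<in> carrier B'} \<union>
        {pair (c \<odot>\<^bsub>A'\<^esub> x) y - Poly_Mapping.single (x, y) c |c x y. x \<in> carrier A' \<and> y \<in> carrier B'} \<union>
        {pair x (c \<odot>\<^bsub>B'\<^esub> y) - Poly_Mapping.single (x, y) c |c x y. x \<in> carrier A' \<and> y \<in> carrier B'}"
        using f' g' by blast
    next
      assume "r \<in> {pair x (y \<oplus>\<^bsub>B\<^esub> y') - pair x y - pair x y' |x y y'. x \<in> carrier A \<and> y \<in> carrier B \<and> y' \<in> carrier B}"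
      then obtain x y y' where "x \<in> carrier A" "y \<in> carrier B" "y' \<in> carrier B"
        "push r = pair (f x) (g y \<oplus>\<^bsub>B'\<^esub> g y') - pair (f x) (g y) - pair (f x) (g y')"
        using g by (auto simp: push_diff push_single alg_hom_iff)
      then show "push r \<in> {pair (x \<oplus>\<^bsub>A'\<^esub> x') y - pair x y - pair x' y |x x' y. x \<in> carrier A' \<and> x' \<in> carrier A' \<and> y \<in> carrier B'} \<union>
        {pair x (y \<oplus>\<^bsub>B'\<^esub> y') - pair x y - pair x y' |x y y'. x \<in> carrier A' \<and> y \<in> carrier B' \<and> y' \<in> carrier B'} \<union>
        {pair (c \<odot>\<^bsub>A'\<^esub> x) y - Poly_Mapping.single (x, y) c |c x y. x \<in> carrier A' \<and> y \<in> carrier B'} \<union>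
        {pair x (c \<odot>\<^bsub>B'\<^esub> y) - Poly_Mapping.single (x, y) c |c x y. x \<in> carrier A' \<and> y \<in> carrier B'}"
        using f' g' by blast
    next
      assume "r \<in> {pair (c \<odot>\<^bsub>A\<^esub> x) y - Poly_Mapping.single (x, y) c |c x y. x \<in> carrier A \<and> y \<in> carrier B}"
      then obtain c x y where "x \<in> carrier A" "y \<in> carrier B"
        "push r = pair (c \<odot>\<^bsub>A'\<^esub> f x) (g y) - Poly_Mapping.single (f x, g y) c"
        using f by (auto simp: push_diff push_single alg_hom_iff)
      then show "push r \<in> {pair (x \<oplus>\<^bsub>A'\<^esub> x') y - pair x y - pair x' y |x x' y. x \<in> carrier A' \<and> x' \<in> carrier A' \<and> y \<in> carrier B'} \<union>
        {pair x (y \<oplus>\<^bsub>B'\<^esub> y') - pair x y - pair x y' |x y y'. x \<in> carrier A' \<and> y \<in> carrier B' \<and> y' \<in> carrier B'} \<union>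
        {pair (c \<odot>\<^bsub>A'\<^esub> x) y - Poly_Mapping.single (x, y) c |c x y. x \<in> carrier A' \<and> y \<in> carrier B'} \<union>
        {pair x (c \<odot>\<^bsub>B'\<^esub> y) - Poly_Mapping.single (x, y) c |c x y. x \<in> carrier A' \<and> y \<in> carrier B'}"
        using f' g' by blast
    next
      assume "r \<in> {pair x (c \<odot>\<^bsub>B\<^esub> y) - Poly_Mapping.single (x, y) c |c x y. x \<in> carrier A \<and> y \<in> carrier B}"
      then obtain c x y where "x \<in> carrier A" "y \<in> carrier B"
        "push r = pair (f x) (c \<odot>\<^bsub>B'\<^esub> g y) - Poly_Mapping.single (f x, g y) c"
        using g by (auto simp: push_diff push_single alg_hom_iff)
      then show "push r \<in> {pair (x \<oplus>\<^bsub>A'\<^esub> x') y - pair x y - pair x' y |x x' y. x \<in> carrier A' \<and> x' \<in> carrier A' \<and> y \<in> carrier B'} \<union>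
        {pair x (y \<oplus>\<^bsub>B'\<^esub> y') - pair x y - pair x y' |x y y'. x \<in> carrier A' \<and> y \<in> carrier B' \<and> y' \<in> carrier B'} \<union>
        {pair (c \<odot>\<^bsub>A'\<^esub> x) y - Poly_Mapping.single (x, y) c |c x y. x \<in> carrier A' \<and> y \<in> carrier B'} \<union>
        {pair x (c \<odot>\<^bsub>B'\<^esub> y) - Poly_Mapping.single (x, y) c |c x y. x \<in> carrier A' \<and> y \<in> carrier B'}"
        using f' g' by blast
    qed
    then show "r \<in> {t \<in> carrier D.P. push t \<in> tensor_ideal A' B'}"
      using r D.bilinear_rels_closed C.bilinear_rels_ideal by auto
  qed
  have push_ideal: "push t \<in> tensor_ideal A' B'" if "t \<in> tensor_ideal A B" for t
    using that D.P.genideal_minimal[OF vim rels] unfolding tensor_ideal_def by auto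
  have map: "tensor_map A' B' f g (tensor_ideal A B +>\<^bsub>D.P\<^esub> t) = tensor_ideal A' B' +>\<^bsub>C.P\<^esub> push t"
    if t: "t \<in> carrier D.P" for t
  proof -
    have *: "tensor_ideal A' B' +>\<^bsub>C.P\<^esub> push s = tensor_ideal A' B' +>\<^bsub>C.P\<^esub> push t"
      if s: "s \<in> tensor_ideal A B +>\<^bsub>D.P\<^esub> t" for s
    proof -
      obtain i where i: "i \<in> tensor_ideal A B" "s = i + t"
        using D.TI.mem_cosetD[OF s t] by (auto simp: D.pair_alg_simps)
      then have iP: "i \<in> carrier D.P" using D.TI.Icarr by blast
      then have "s \<in> carrier D.P" using i t D.P.a_closed[of i t] by (simp add: D.pair_alg_simps)
      then have "push s \<ominus>\<^bsub>C.P\<^esub> push t = push i"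
        using i t by (simp add: C.pair_minus push_cl push_add[of i t])
          (metis C.pair_minus add_diff_cancel_right' push_add push_cl)
      then show ?thesis
        using \<open>s \<in> carrier D.P\<close> t push_ideal[OF i(1)] by (simp add: C.TI.coset_eq_iff push_cl)
    qed
    have "(\<Union>s\<in>tensor_ideal A B +>\<^bsub>D.P\<^esub> t. tensor_ideal A' B' +>\<^bsub>C.P\<^esub> push s) = tensor_ideal A' B' +>\<^bsub>C.P\<^esub> push t"
      using D.TI.mem_coset_self[OF t] by (intro SUP_eq_const *) blast+
    then show ?thesis by (simp add: tensor_map_def push_def pm_sum_def)
  qed
  show "tensor_map A' B' f g (tens A B x y) = tens A' B' (f x) (g y)" if "x \<in> carrier A" "y \<in> carrier B"
    using that by (simp add: tens_def map push_single)
  show "tensor_map A' B' f g \<in> alg_hom (tensor_alg A B) (tensor_alg A' B')"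
    unfolding alg_hom_iff
  proof (intro conjI ballI allI)
    fix s c assume "s \<in> carrier (tensor_alg A B)"
    then obtain s' where s': "s' \<in> carrier D.P" "s = tensor_ideal A B +>\<^bsub>D.P\<^esub> s'"
      unfolding tensor_alg_def by (rule D.TI.quot_carrierE)
    then show "tensor_map A' B' f g s \<in> carrier (tensor_alg A' B')"
      by (simp add: map push_cl tensor_alg_def)
    show "tensor_map A' B' f g (c \<odot>\<^bsub>tensor_alg A B\<^esub> s) = c \<odot>\<^bsub>tensor_alg A' B'\<^esub> tensor_map A' B' f g s"
      using s' by (simp add: map push_cl tensor_alg_def D.TI.quot_smult C.TI.quot_smult)
        (simp add: D.pair_alg_simps C.pair_alg_simps push_scale)
    fix t assume "t \<in> carrier (tensor_alg A B)"
    then obtain t' where t': "t' \<in> carrier D.P" "t = tensor_ideal A B +>\<^bsub>D.P\<^esub> t'"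
      unfolding tensor_alg_def by (rule D.TI.quot_carrierE)
    show "tensor_map A' B' f g (s \<oplus>\<^bsub>tensor_alg A B\<^esub> t) = tensor_map A' B' f g s \<oplus>\<^bsub>tensor_alg A' B'\<^esub> tensor_map A' B' f g t"
      using s' t' by (simp add: map push_cl tensor_alg_def D.TI.quot_add C.TI.quot_add)
        (simp add: D.pair_alg_simps C.pair_alg_simps push_add)
    show "tensor_map A' B' f g (s \<otimes>\<^bsub>tensor_alg A B\<^esub> t) = tensor_map A' B' f g s \<otimes>\<^bsub>tensor_alg A' B'\<^esub> tensor_map A' B' f g t"
      using s' t' by (simp add: map push_cl tensor_alg_def D.TI.quot_mult C.TI.quot_mult push_mult)
  next
    have "\<one>\<^bsub>D.P\<^esub> \<in> carrier D.P" by simp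
    then show "tensor_map A' B' f g \<one>\<^bsub>tensor_alg A B\<^esub> = \<one>\<^bsub>tensor_alg A' B'\<^esub>"
      using f g by (simp add: tensor_alg_def D.TI.quot_one C.TI.quot_one map)
        (simp add: D.pair_alg_simps C.pair_alg_simps push_single alg_hom_iff)
  qed
qed

section \<open>The Hopf structure\<close>

lemma Sp_alg_pair: "alg_pair (Sp_alg \<theta>) (Sp_alg \<theta>)"
  by (simp add: alg_pair_def Sp.alg_axioms)

text \<open>The universal matrix in the left tensor factor and its copy in the right one commute
  entrywise, so \<open>sp_mat_product\<close> applies; their product is the required matrix.\<close>

lemma Sp_comult_ex:
  "\<exists>\<Delta>. \<Delta> \<in> alg_hom (Sp_alg \<theta>) (tensor_alg (Sp_alg \<theta>) (Sp_alg \<theta>)) \<and>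
    (\<forall>i\<in>{1..4}. \<forall>j\<in>{1..4}. \<Delta> (Sp_mat \<theta> i j) =
      (\<Oplus>\<^bsub>tensor_alg (Sp_alg \<theta>) (Sp_alg \<theta>)\<^esub>k\<in>{1..4}.
         tens (Sp_alg \<theta>) (Sp_alg \<theta>) (Sp_mat \<theta> i k) (Sp_mat \<theta> k j)))"
proof -
  interpret D: alg_pair "Sp_alg \<theta>" "Sp_alg \<theta>" by (rule Sp_alg_pair)
  let ?t = "tens (Sp_alg \<theta>) (Sp_alg \<theta>)" and ?one = "\<one>\<^bsub>Sp_alg \<theta>\<^esub>" and ?i = "iota D.T"
  have "sp_mat \<theta> (\<lambda>i j. \<Sum>k\<in>ix. ?i (?t (Sp_mat \<theta> i k) ?one) * ?i (?t ?one (Sp_mat \<theta> k j))) (?i \<one>\<^bsub>D.T\<^esub>)"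
  proof (rule sp_mat_product)
    show "sp_mat \<theta> (\<lambda>i j. ?i (?t (Sp_mat \<theta> i j) ?one)) (?i \<one>\<^bsub>D.T\<^esub>)"
      using Sp_sp_mat[OF D.typed_hom_tens_left] by (simp add: D.tens_one)
    show "sp_mat \<theta> (\<lambda>i j. ?i (?t ?one (Sp_mat \<theta> i j))) (?i \<one>\<^bsub>D.T\<^esub>)"
      using Sp_sp_mat[OF D.typed_hom_tens_right] by (simp add: D.tens_one)
  qed (simp add: D.T.iota_mult[symmetric] D.tens_mult del: D.T.iota_mult)
  then obtain h where h: "typed_hom (Sp_alg \<theta>) h" "h ?one = ?i \<one>\<^bsub>D.T\<^esub>"
    and hX: "\<And>i j. i \<in> ix \<Longrightarrow> j \<in> ix \<Longrightarrow> h (Sp_mat \<theta> i j) = (\<Sum>k\<in>ix. ?i (?t (Sp_mat \<theta> i k) ?one) * ?i (?t ?one (Sp_mat \<theta> k j)))"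
    using Sp_universal by blast
  have hE: "h (Sp_mat \<theta> i j) = ?i (\<Oplus>\<^bsub>D.T\<^esub>k\<in>ix. ?t (Sp_mat \<theta> i k) (Sp_mat \<theta> k j))" if "i \<in> ix" "j \<in> ix" for i j
  proof -
    have "?i (\<Oplus>\<^bsub>D.T\<^esub>k\<in>ix. ?t (Sp_mat \<theta> i k) (Sp_mat \<theta> k j)) = (\<Sum>k\<in>ix. ?i (?t (Sp_mat \<theta> i k) (Sp_mat \<theta> k j)))"
      using that by (intro D.T.iota_finsum) auto
    then show ?thesis
      using that by (simp add: hX D.T.iota_mult[symmetric] D.tens_mult del: D.T.iota_mult)
  qed
  have "ev D.T (h (Sp_mat \<theta> i j)) = (\<Oplus>\<^bsub>D.T\<^esub>k\<in>ix. ?t (Sp_mat \<theta> i k) (Sp_mat \<theta> k j))" if "i \<in> ix" "j \<in> ix" for i j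
    unfolding hE[OF that] using that by (intro D.T.ev_iota D.T.finsum_closed) auto
  then show ?thesis
    unfolding ix_atLeastAtMost
    using D.T.ev_alg_hom[OF h] by (intro exI[of _ "\<lambda>x. ev D.T (h x)"]) blast
qed

lemma Sp_comult:
  shows "Sp_comult \<theta> \<in> alg_hom (Sp_alg \<theta>) (tensor_alg (Sp_alg \<theta>) (Sp_alg \<theta>))"
    and "i \<in> ix \<Longrightarrow> j \<in> ix \<Longrightarrow> Sp_comult \<theta> (Sp_mat \<theta> i j) =
      (\<Oplus>\<^bsub>tensor_alg (Sp_alg \<theta>) (Sp_alg \<theta>)\<^esub>k\<in>ix. tens (Sp_alg \<theta>) (Sp_alg \<theta>) (Sp_mat \<theta> i k) (Sp_mat \<theta> k j))"
  using someI_ex[OF Sp_comult_ex[of \<theta>]] unfolding Sp_comult_def[symmetric] unfolding ix_atLeastAtMost by blast+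

lemma complex_alg: "alg complex_alg"
proof (rule alg.intro)
  show "ring complex_alg"
    by (rule ringI; (rule abelian_groupI monoidI)?)
      (auto simp: complex_alg_def algebra_simps intro: exI[of _ "- x" for x])
  show "alg_axioms complex_alg"
    by unfold_locales (auto simp: complex_alg_def algebra_simps)
qed

lemma sp_mat_unit:
  assumes "e * e = (e :: 'a::calg)"
  shows "sp_mat \<theta> (\<lambda>i j. if i = j then e else 0) e"
  by unfold_locales (use assms in \<open>auto simp: sum_ix elim!: ix_cases\<close>)

lemma Sp_counit_ex:
  "\<exists>\<epsilon>. \<epsilon> \<in> alg_hom (Sp_alg \<theta>) complex_alg \<and>
    (\<forall>i\<in>{1..4}. \<forall>j\<in>{1..4}. \<epsilon> (Sp_mat \<theta> i j) = (if i = j then 1 else 0))"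
proof -
  interpret C: alg complex_alg by (rule complex_alg)
  have C: "1 \<in> carrier complex_alg" "\<one>\<^bsub>complex_alg\<^esub> = 1" "\<zero>\<^bsub>complex_alg\<^esub> = 0"
    by (simp_all add: complex_alg_def)
  have "sp_mat \<theta> (\<lambda>i j. if i = j then iota complex_alg 1 else 0) (iota complex_alg 1)"
    using C.iota_one_left[OF C(1)] by (intro sp_mat_unit) (simp add: C)
  then obtain h where h: "typed_hom (Sp_alg \<theta>) h" "h \<one>\<^bsub>Sp_alg \<theta>\<^esub> = iota complex_alg \<one>\<^bsub>complex_alg\<^esub>"
    and hX: "\<And>i j. i \<in> ix \<Longrightarrow> j \<in> ix \<Longrightarrow> h (Sp_mat \<theta> i j) = (if i = j then iota complex_alg 1 else 0)"
    unfolding C using Sp_universal by blast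
  show ?thesis
    unfolding ix_atLeastAtMost
    using C.ev_alg_hom[OF h] C.ev_zero C.ev_iota[OF C(1)] by (intro exI[of _ "\<lambda>x. ev complex_alg (h x)"]) (auto simp: hX C)
qed

lemma Sp_counit:
  shows "Sp_counit \<theta> \<in> alg_hom (Sp_alg \<theta>) complex_alg"
    and "i \<in> ix \<Longrightarrow> j \<in> ix \<Longrightarrow> Sp_counit \<theta> (Sp_mat \<theta> i j) = (if i = j then 1 else 0)"
  using someI_ex[OF Sp_counit_ex[of \<theta>]] unfolding Sp_counit_def[symmetric] unfolding ix_atLeastAtMost by blast+

text \<open>An antihomomorphism is a homomorphism into the opposite algebra, so the antipode also
  comes from the universal property.\<close>

definition op_alg :: "'a star_algebra \<Rightarrow> 'a star_algebra" where
  "op_alg A = A\<lparr>mult := \<lambda>x y. y \<otimes>\<^bsub>A\<^esub> x\<rparr>"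

lemma op_alg_simps [simp]:
  "carrier (op_alg A) = carrier A" "x \<otimes>\<^bsub>op_alg A\<^esub> y = y \<otimes>\<^bsub>A\<^esub> x" "\<one>\<^bsub>op_alg A\<^esub> = \<one>\<^bsub>A\<^esub>"
  "\<zero>\<^bsub>op_alg A\<^esub> = \<zero>\<^bsub>A\<^esub>" "x \<oplus>\<^bsub>op_alg A\<^esub> y = x \<oplus>\<^bsub>A\<^esub> y" "c \<odot>\<^bsub>op_alg A\<^esub> x = c \<odot>\<^bsub>A\<^esub> x"
  by (simp_all add: op_alg_def)

lemma (in alg) op_alg: "alg (op_alg A)"
proof (rule alg.intro)
  show "ring (op_alg A)"
  proof (rule ringI)
    show "abelian_group (op_alg A)"
      by (rule abelian_groupI) (auto simp: a_ac intro: bexI[of _ "\<ominus> x" for x] l_neg)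
    show "monoid (op_alg A)"
      by (rule monoidI) (auto simp: m_assoc)
  qed (auto simp: l_distr r_distr)
  show "alg_axioms (op_alg A)"
    by unfold_locales (auto simp: smult_add add_smult smult_smult smult_mult_left smult_mult_right)
qed

text \<open>A^* is a symplectic matrix over the opposite algebra. Its unitarity there is A A^* = 1,
  a relation that is derived and not imposed.\<close>

lemma Sp_antipode_ex:
  "\<exists>S. S \<in> alg_antihom (Sp_alg \<theta>) (Sp_alg \<theta>) \<and>
    (\<forall>i\<in>{1..4}. \<forall>j\<in>{1..4}. S (Sp_mat \<theta> i j) = star (Sp_alg \<theta>) (Sp_mat \<theta> j i))"
proof -
  let ?A = "Sp_alg \<theta>" and ?O = "op_alg (Sp_alg \<theta>)"
  interpret O: alg ?O by (rule Sp.op_alg)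
  let ?i = "iota ?O"
  interpret X: sp_mat \<theta> "\<lambda>i j. iota ?A (Sp_mat \<theta> i j)" "iota ?A \<one>\<^bsub>?A\<^esub>"
    by (rule Sp_sp_mat[OF Sp.typed_hom_iota])
  have i_mult: "?i x * ?i y = ?i (y \<otimes>\<^bsub>?A\<^esub> x)" if "x \<in> carrier ?A" "y \<in> carrier ?A" for x y
    using O.iota_mult[of x y] that by simp
  have i_smult: "?i (c \<odot>\<^bsub>?A\<^esub> x) = c *c ?i x" if "x \<in> carrier ?A" for c x
    using O.iota_smult[of x c] that by simp
  have i_add: "?i (x \<oplus>\<^bsub>?A\<^esub> y) = ?i x + ?i y" if "x \<in> carrier ?A" "y \<in> carrier ?A" for x y
    using O.iota_add[of x y] that by simp
  have i_zero: "?i \<zero>\<^bsub>?A\<^esub> = 0"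
    using O.iota_zero by simp
  have i_finsum: "?i (\<Oplus>\<^bsub>?A\<^esub>k\<in>S. f k) = (\<Sum>k\<in>S. ?i (f k))" if "finite S" "f \<in> S \<rightarrow> carrier ?A" for S and f :: "nat \<Rightarrow> Sp_elt"
    using that by (induction S rule: finite_induct) (auto simp: Sp.finsum_insert i_add i_zero)
  let ?X = "\<lambda>i j. ?i (star ?A (Sp_mat \<theta> j i))"
  have X_eq: "?X i j = sg (i + j) *c ?i (Sp_mat \<theta> (cj j) (cj i))" if "i \<in> ix" "j \<in> ix" for i j
    using that by (simp add: Sp_mat_star i_smult mult.commute)
  have "sp_mat \<theta> ?X (?i \<one>\<^bsub>?A\<^esub>)"
  proof
    show "?i \<one>\<^bsub>?A\<^esub> * ?i \<one>\<^bsub>?A\<^esub> = ?i \<one>\<^bsub>?A\<^esub>" by (simp add: i_mult)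
    fix i j assume ij: "i \<in> ix" "j \<in> ix"
    show "?i \<one>\<^bsub>?A\<^esub> * ?X i j = ?X i j" "?X i j * ?i \<one>\<^bsub>?A\<^esub> = ?X i j"
      using ij by (simp_all add: i_mult)
    {
      fix k l assume kl: "k \<in> ix" "l \<in> ix"
      have "?i (Sp_mat \<theta> (cj l) (cj k) \<otimes>\<^bsub>?A\<^esub> Sp_mat \<theta> (cj j) (cj i)) =
        (eta \<theta> k i * eta \<theta> j l) *c ?i (Sp_mat \<theta> (cj j) (cj i) \<otimes>\<^bsub>?A\<^esub> Sp_mat \<theta> (cj l) (cj k))"
        using ij kl Sp_mat_comm[of "cj l" "cj k" "cj j" "cj i" \<theta>]
        by (simp add: i_smult eta_cj mult.commute)
      then show "?X i j * ?X k l = (eta \<theta> k i * eta \<theta> j l) *c (?X k l * ?X i j)"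
        using ij kl by (simp add: X_eq i_mult mult_ac)
    }
    have "iota ?A (\<Oplus>\<^bsub>?A\<^esub>k\<in>ix. sg (k + j) \<odot>\<^bsub>?A\<^esub> (Sp_mat \<theta> (cj j) (cj k) \<otimes>\<^bsub>?A\<^esub> Sp_mat \<theta> i k)) =
      (\<Sum>k\<in>ix. iota ?A (sg (k + j) \<odot>\<^bsub>?A\<^esub> (Sp_mat \<theta> (cj j) (cj k) \<otimes>\<^bsub>?A\<^esub> Sp_mat \<theta> i k)))"
      using ij by (intro Sp.iota_finsum) auto
    also have "\<dots> = iota ?A (if i = j then \<one>\<^bsub>?A\<^esub> else \<zero>\<^bsub>?A\<^esub>)"
      using ij X.unit_transpose[OF ij] by auto
    finally have rec: "(\<Oplus>\<^bsub>?A\<^esub>k\<in>ix. sg (k + j) \<odot>\<^bsub>?A\<^esub> (Sp_mat \<theta> (cj j) (cj k) \<otimes>\<^bsub>?A\<^esub> Sp_mat \<theta> i k)) = (if i = j then \<one>\<^bsub>?A\<^esub> else \<zero>\<^bsub>?A\<^esub>)"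
      using ij by (subst (asm) Sp.iota_eq_iff) (auto intro!: Sp.finsum_closed)
    have "(\<Sum>k\<in>ix. sg (k + i) *c (?X (cj k) (cj i) * ?X k j)) =
      (\<Sum>k\<in>ix. ?i (sg (k + j) \<odot>\<^bsub>?A\<^esub> (Sp_mat \<theta> (cj j) (cj k) \<otimes>\<^bsub>?A\<^esub> Sp_mat \<theta> i k)))"
      using ij by (intro sum.cong refl) (simp add: X_eq i_mult i_smult mult_ac)
    also have "\<dots> = ?i (if i = j then \<one>\<^bsub>?A\<^esub> else \<zero>\<^bsub>?A\<^esub>)"
      unfolding rec[symmetric] using ij by (intro i_finsum[symmetric]) auto
    also have "\<dots> = (if i = j then ?i \<one>\<^bsub>?A\<^esub> else 0)"
      by (simp add: i_zero)
    finally show "(\<Sum>k\<in>ix. sg (k + i) *c (?X (cj k) (cj i) * ?X k j)) = (if i = j then ?i \<one>\<^bsub>?A\<^esub> else 0)" .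
  qed
  then obtain h where h: "typed_hom ?A h" "h \<one>\<^bsub>?A\<^esub> = ?i \<one>\<^bsub>?O\<^esub>"
    and hX: "\<And>i j. i \<in> ix \<Longrightarrow> j \<in> ix \<Longrightarrow> h (Sp_mat \<theta> i j) = ?X i j"
    unfolding op_alg_simps using Sp_universal by blast
  show ?thesis
    unfolding ix_atLeastAtMost alg_antihom_def op_alg_def[symmetric]
    using O.ev_alg_hom[OF h] O.ev_iota by (intro exI[of _ "\<lambda>x. ev ?O (h x)"]) (auto simp: hX)
qed

lemma Sp_antipode:
  shows "Sp_antipode \<theta> \<in> alg_hom (Sp_alg \<theta>) (op_alg (Sp_alg \<theta>))"
    and "i \<in> ix \<Longrightarrow> j \<in> ix \<Longrightarrow> Sp_antipode \<theta> (Sp_mat \<theta> i j) = star (Sp_alg \<theta>) (Sp_mat \<theta> j i)"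
  using someI_ex[OF Sp_antipode_ex[of \<theta>]]
  unfolding Sp_antipode_def[symmetric] unfolding ix_atLeastAtMost alg_antihom_def op_alg_def by blast+

section \<open>The Hopf ideal\<close>

definition J_gens :: "real \<Rightarrow> Sp_elt set" where
  "J_gens \<theta> = {Sp_mat \<theta> i j | i j. i \<in> {1, 2} \<and> j \<in> {3, 4}} \<union> {Sp_mat \<theta> i j | i j. i \<in> {3, 4} \<and> j \<in> {1, 2}}"

lemma J_ideal_eq: "J_ideal \<theta> = Idl\<^bsub>Sp_alg \<theta>\<^esub> (J_gens \<theta>)"
  by (simp add: J_ideal_def J_gens_def)

definition same_block :: "nat \<Rightarrow> nat \<Rightarrow> bool" where
  "same_block i j \<longleftrightarrow> i = j \<or> i = cj j"

lemma J_gensE: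
  assumes "x \<in> J_gens \<theta>"
  obtains i j where "i \<in> ix" "j \<in> ix" "\<not> same_block i j" "x = Sp_mat \<theta> i j"
proof -
  obtain i j where "x = Sp_mat \<theta> i j" "i \<in> {1, 2} \<and> j \<in> {3, 4} \<or> i \<in> {3, 4} \<and> j \<in> {1, 2}"
    using assms by (auto simp: J_gens_def)
  then show ?thesis
    by (intro that[of i j]) (auto simp: same_block_def)
qed

lemma J_gensI: "i \<in> ix \<Longrightarrow> j \<in> ix \<Longrightarrow> \<not> same_block i j \<Longrightarrow> Sp_mat \<theta> i j \<in> J_gens \<theta>"
  by (elim ix_cases) (auto simp: J_gens_def same_block_def)

lemma J_gens_closed: "J_gens \<theta> \<subseteq> carrier (Sp_alg \<theta>)"
  by (auto elim!: J_gensE)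

lemma J_alg_ideal: "alg_ideal (Sp_alg \<theta>) (J_ideal \<theta>)"
  unfolding J_ideal_eq
  by (intro alg_ideal.intro Sp.alg_axioms Sp.genideal_ideal J_gens_closed)

lemma J_mem: "i \<in> ix \<Longrightarrow> j \<in> ix \<Longrightarrow> \<not> same_block i j \<Longrightarrow> Sp_mat \<theta> i j \<in> J_ideal \<theta>"
  unfolding J_ideal_eq using Sp.genideal_self[OF J_gens_closed] J_gensI by blast

lemma alg_hom_vimage_ideal:
  assumes "alg A" "alg B" "h \<in> alg_hom A B" "ideal I B"
  shows "ideal {x \<in> carrier A. h x \<in> I} A"
proof -
  interpret A: alg A by fact
  interpret B: alg B by fact
  interpret I: ideal I B by fact
  interpret R: ring_hom_ring A B h
    by (rule ring_hom_ringI2) (use assms A.ring_axioms B.ring_axioms in \<open>auto simp: alg_hom_def\<close>)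
  show ?thesis
    using R.ideal_vimage[OF assms(4)] by simp
qed

lemma J_ideal_subset:
  assumes "ideal I (Sp_alg \<theta>)" "\<And>i j. i \<in> ix \<Longrightarrow> j \<in> ix \<Longrightarrow> \<not> same_block i j \<Longrightarrow> Sp_mat \<theta> i j \<in> I"
  shows "J_ideal \<theta> \<subseteq> I"
  unfolding J_ideal_eq by (rule Sp.genideal_minimal[OF assms(1)]) (auto elim!: J_gensE simp: assms(2))

text \<open>Each condition says that the ideal lies in the preimage of an ideal under a homomorphism
  (for the antipode, one into the opposite algebra), so only the generators have to be
  examined.\<close>

lemma J_hopf_ideal: "hopf_ideal (Sp_alg \<theta>) (Sp_comult \<theta>) (Sp_counit \<theta>) (Sp_antipode \<theta>) (J_ideal \<theta>)"
proof -
  interpret D: alg_pair "Sp_alg \<theta>" "Sp_alg \<theta>" by (rule Sp_alg_pair)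
  interpret J: alg_ideal "Sp_alg \<theta>" "J_ideal \<theta>" by (rule J_alg_ideal)
  let ?A = "Sp_alg \<theta>" and ?J = "J_ideal \<theta>"
  let ?K1 = "tensor_sub ?A ?A ?J (carrier ?A)" and ?K2 = "tensor_sub ?A ?A (carrier ?A) ?J"
  have K1: "ideal ?K1 D.T" and K2: "ideal ?K2 D.T"
    by (intro D.tensor_sub_ideal J.ideal_axioms Sp.oneideal)+
  have K: "ideal (?K1 <+>\<^bsub>D.T\<^esub> ?K2) D.T"
    by (rule D.T.add_ideals[OF K1 K2])
  interpret K: ideal "?K1 <+>\<^bsub>D.T\<^esub> ?K2" D.T by (rule K)
  interpret K1: ideal ?K1 D.T by (rule K1)
  interpret K2: ideal ?K2 D.T by (rule K2)
  have in_K: "x \<in> ?K1 <+>\<^bsub>D.T\<^esub> ?K2" if "x \<in> ?K1 \<or> x \<in> ?K2" for x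
  proof -
    have "x = x \<oplus>\<^bsub>D.T\<^esub> \<zero>\<^bsub>D.T\<^esub> \<and> x = \<zero>\<^bsub>D.T\<^esub> \<oplus>\<^bsub>D.T\<^esub> x"
      using that K1.Icarr K2.Icarr by auto
    then show ?thesis
      using that K1.zero_closed K2.zero_closed unfolding set_add_def' by blast
  qed
  have tens_K: "tens ?A ?A (Sp_mat \<theta> i k) (Sp_mat \<theta> k j) \<in> ?K1 <+>\<^bsub>D.T\<^esub> ?K2"
    if "i \<in> ix" "j \<in> ix" "k \<in> ix" "\<not> same_block i j" for i j k
  proof -
    have *: "tens ?A ?A x y \<in> tensor_sub ?A ?A V W" if "x \<in> V" "y \<in> W" for x y V W
      unfolding tensor_sub_def using that by (intro lin_span.gen) blast
    \<comment> \<open>A third index shares its block with at most one of two indices from different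
      blocks.\<close>
    have "\<not> same_block i k \<or> \<not> same_block k j"
      using that by (auto simp: same_block_def)
    then show ?thesis
      using that J_mem[of i k \<theta>] J_mem[of k j \<theta>] by (intro in_K) (auto intro!: *)
  qed
  have "?J \<subseteq> {x \<in> carrier ?A. Sp_comult \<theta> x \<in> ?K1 <+>\<^bsub>D.T\<^esub> ?K2}"
  proof (rule J_ideal_subset)
    show "ideal {x \<in> carrier ?A. Sp_comult \<theta> x \<in> ?K1 <+>\<^bsub>D.T\<^esub> ?K2} ?A"
      by (rule alg_hom_vimage_ideal[OF Sp.alg_axioms D.T.alg_axioms Sp_comult(1) K])
    fix i j assume ij: "i \<in> ix" "j \<in> ix" "\<not> same_block i j"
    have "(\<Oplus>\<^bsub>D.T\<^esub>k\<in>S. tens ?A ?A (Sp_mat \<theta> i k) (Sp_mat \<theta> k j)) \<in> ?K1 <+>\<^bsub>D.T\<^esub> ?K2"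
      if "finite S" "S \<subseteq> ix" for S
      using that
    proof (induction S rule: finite_induct)
      case (insert k S)
      have "(\<lambda>k. tens ?A ?A (Sp_mat \<theta> i k) (Sp_mat \<theta> k j)) \<in> S \<rightarrow> carrier D.T"
        using insert ij by auto
      then show ?case
        using insert ij tens_K[of i j k] by (simp add: D.T.finsum_insert K.a_closed subset_iff)
    qed simp
    from this[of ix] show "Sp_mat \<theta> i j \<in> {x \<in> carrier ?A. Sp_comult \<theta> x \<in> ?K1 <+>\<^bsub>D.T\<^esub> ?K2}"
      using ij by (simp add: Sp_comult)
  qed
  moreover have "?J \<subseteq> {x \<in> carrier ?A. Sp_counit \<theta> x \<in> {0}}"
  proof (rule J_ideal_subset)
    have "ideal {0} complex_alg"
      using ring.zeroideal[OF alg.axioms(1)[OF complex_alg]] by (simp add: complex_alg_def)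
    then show "ideal {x \<in> carrier ?A. Sp_counit \<theta> x \<in> {0}} ?A"
      by (rule alg_hom_vimage_ideal[OF Sp.alg_axioms complex_alg Sp_counit(1)])
  qed (auto simp: Sp_counit same_block_def)
  moreover have "?J \<subseteq> {x \<in> carrier ?A. Sp_antipode \<theta> x \<in> ?J}"
  proof (rule J_ideal_subset)
    have "ideal ?J (op_alg ?A)"
    proof (rule idealI)
      show "subgroup ?J (add_monoid (op_alg ?A))"
        using J.a_subgroup by (simp add: op_alg_def)
    qed (auto simp: J.I_l_closed J.I_r_closed intro: alg.axioms(1)[OF Sp.op_alg])
    then show "ideal {x \<in> carrier ?A. Sp_antipode \<theta> x \<in> ?J} ?A"
      by (rule alg_hom_vimage_ideal[OF Sp.alg_axioms Sp.op_alg Sp_antipode(1)])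
    fix i j assume ij: "i \<in> ix" "j \<in> ix" "\<not> same_block i j"
    then have "\<not> same_block (cj j) (cj i)"
      by (auto simp: same_block_def cj_eq_iff)
    then show "Sp_mat \<theta> i j \<in> {x \<in> carrier ?A. Sp_antipode \<theta> x \<in> ?J}"
      using ij J_mem[of "cj j" "cj i" \<theta>] by (simp add: Sp_antipode Sp_mat_star J.smult_ideal)
  qed
  ultimately show ?thesis
    unfolding hopf_ideal_def using J.ideal_axioms by auto
qed

section \<open>The coaction\<close>

lemma J_quot_alg: "alg (J_quot \<theta>)"
  unfolding J_quot_def by (rule alg_ideal.quot_alg[OF J_alg_ideal])

lemma J_proj_hom: "J_proj \<theta> \<in> alg_hom (Sp_alg \<theta>) (J_quot \<theta>)"
proof -
  interpret J: alg_ideal "Sp_alg \<theta>" "J_ideal \<theta>" by (rule J_alg_ideal)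
  show ?thesis
    by (auto simp: alg_hom_iff J_proj_def J_quot_def J.quot_add J.quot_mult J.quot_smult J.quot_one)
qed

lemma J_proj_off_block: "i \<in> ix \<Longrightarrow> j \<in> ix \<Longrightarrow> \<not> same_block i j \<Longrightarrow> J_proj \<theta> (Sp_mat \<theta> i j) = \<zero>\<^bsub>J_quot \<theta>\<^esub>"
  using alg_ideal.quot_eq_zero_iff[OF J_alg_ideal] J_mem by (simp add: J_proj_def J_quot_def)

lemma J_coaction_hom: "J_coaction \<theta> \<in> alg_hom (Sp_alg \<theta>) (tensor_alg (Sp_alg \<theta>) (J_quot \<theta>))"
proof -
  have "id \<in> alg_hom (Sp_alg \<theta>) (Sp_alg \<theta>)" by (simp add: alg_hom_iff)
  then have "tensor_map (Sp_alg \<theta>) (J_quot \<theta>) id (J_proj \<theta>) \<in>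
      alg_hom (tensor_alg (Sp_alg \<theta>) (Sp_alg \<theta>)) (tensor_alg (Sp_alg \<theta>) (J_quot \<theta>))"
    by (intro tensor_map_alg_hom Sp.alg_axioms J_quot_alg J_proj_hom)
  then show ?thesis
    using Sp_comult(1)[of \<theta>] by (simp add: J_coaction_def alg_hom_iff)
qed

section \<open>Linear spans in typed algebras\<close>

inductive_set cspan :: "'a::calg set \<Rightarrow> 'a set" for B where
  zero [simp]: "0 \<in> cspan B"
| step: "x \<in> B \<Longrightarrow> y \<in> cspan B \<Longrightarrow> c *c x + y \<in> cspan B"

lemma cspan_gen: "x \<in> B \<Longrightarrow> x \<in> cspan B"
  using cspan.step[of x B 0 1] by simp

lemma cspan_add: "x \<in> cspan B \<Longrightarrow> y \<in> cspan B \<Longrightarrow> x + y \<in> cspan B"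
  by (induction x rule: cspan.induct) (auto simp: add.assoc intro: cspan.step)

lemma cspan_scale: "x \<in> cspan B \<Longrightarrow> c *c x \<in> cspan B"
  by (induction x rule: cspan.induct) (auto simp: cscale_add_right intro: cspan.step)

lemma cspan_minus: "x \<in> cspan B \<Longrightarrow> - x \<in> cspan B"
  using cspan_scale[of x B "- 1"] by simp

lemma cspan_diff: "x \<in> cspan B \<Longrightarrow> y \<in> cspan B \<Longrightarrow> x - y \<in> cspan B"
  using cspan_add[of x B "- y"] cspan_minus[of y B] by simp

lemma cspan_subset:
  assumes "x \<in> cspan B" "\<And>x. x \<in> B \<Longrightarrow> x \<in> cspan C"
  shows "x \<in> cspan C"
  using assms(1) by induction (auto intro: cspan_add cspan_scale assms(2))

lemma cspan_mono: "B \<subseteq> C \<Longrightarrow> cspan B \<subseteq> cspan C"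
  using cspan_subset cspan_gen by (metis subsetD subsetI)

lemma cspan_mult_left:
  assumes "x \<in> cspan B" "\<And>x. x \<in> B \<Longrightarrow> a * x \<in> cspan C"
  shows "a * x \<in> cspan C"
  using assms(1) by induction (auto simp: ring_distribs intro: cspan_add cspan_scale assms(2))

lemma cspan_mult_right:
  assumes "x \<in> cspan B" "\<And>x. x \<in> B \<Longrightarrow> x * a \<in> cspan C"
  shows "x * a \<in> cspan C"
  using assms(1) by induction (auto simp: ring_distribs intro: cspan_add cspan_scale assms(2))

section \<open>Coinvariants are polynomials in the minors\<close>

text \<open>The operators \<open>E k\<close> below are the infinitesimal right translations by root vectors of
  \<open>SU(2) \<times> SU(2)\<close>: \<open>E k\<close> replaces column \<open>cj k\<close> by column \<open>k\<close>. On a word with \<open>j\<close> letters from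
  either column of a block the operator \<open>E (cj k) (E k _)\<close> acts by \<open>j (j + 1)\<close> modulo multiples of
  \<open>2 \<times> 2\<close> minors, which are coinvariant (Capelli identity). A coinvariant is annihilated by it and
  therefore has shorter and shorter expressions with coefficients in the algebra \<open>T\<close> of minors.\<close>

locale coinv_data = sp_mat \<theta> X e for \<theta> and X :: "nat \<Rightarrow> nat \<Rightarrow> 'a::calg" and e +
  fixes S T :: "'a set" and E H :: "nat \<Rightarrow> 'a \<Rightarrow> 'a"
  assumes S_X [simp]: "i \<in> ix \<Longrightarrow> j \<in> ix \<Longrightarrow> X i j \<in> S"
    and S_e [simp]: "e \<in> S"
    and S_add [simp]: "x \<in> S \<Longrightarrow> y \<in> S \<Longrightarrow> x + y \<in> S"
    and S_mult [simp]: "x \<in> S \<Longrightarrow> y \<in> S \<Longrightarrow> x * y \<in> S"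
    and S_scale [simp]: "x \<in> S \<Longrightarrow> c *c x \<in> S"
    and S_unit: "x \<in> S \<Longrightarrow> e * x = x" "x \<in> S \<Longrightarrow> x * e = x"
    and E_add: "k \<in> ix \<Longrightarrow> x \<in> S \<Longrightarrow> y \<in> S \<Longrightarrow> E k (x + y) = E k x + E k y"
    and E_scale: "k \<in> ix \<Longrightarrow> x \<in> S \<Longrightarrow> E k (c *c x) = c *c E k x"
    and E_mult: "k \<in> ix \<Longrightarrow> x \<in> S \<Longrightarrow> y \<in> S \<Longrightarrow> E k (x * y) = x * E k y + E k x * H k y"
    and E_X: "k \<in> ix \<Longrightarrow> i \<in> ix \<Longrightarrow> j \<in> ix \<Longrightarrow> E k (X i j) = (if j = cj k then X i k else 0)"
    and E_e: "k \<in> ix \<Longrightarrow> E k e = 0"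
    and H_mult: "k \<in> ix \<Longrightarrow> x \<in> S \<Longrightarrow> y \<in> S \<Longrightarrow> H k (x * y) = H k x * H k y"
    and H_X: "k \<in> ix \<Longrightarrow> i \<in> ix \<Longrightarrow> j \<in> ix \<Longrightarrow> H k (X i j) = (eta \<theta> j k * eta \<theta> (cj k) j) *c X i j"
    and H_e: "k \<in> ix \<Longrightarrow> H k e = e"
    and T_S: "T \<subseteq> S"
    and T_e [simp]: "e \<in> T"
    and T_add: "x \<in> T \<Longrightarrow> y \<in> T \<Longrightarrow> x + y \<in> T"
    and T_mult: "x \<in> T \<Longrightarrow> y \<in> T \<Longrightarrow> x * y \<in> T"
    and T_scale: "x \<in> T \<Longrightarrow> c *c x \<in> T"
    and T_mnr1: "i \<in> ix \<Longrightarrow> j \<in> ix \<Longrightarrow> mnr 1 i j \<in> T"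
    and T_commute: "i \<in> ix \<Longrightarrow> j \<in> ix \<Longrightarrow> t \<in> T \<Longrightarrow> \<exists>t'\<in>T. X i j * t = t' * X i j"
    and E_T: "k \<in> ix \<Longrightarrow> t \<in> T \<Longrightarrow> E k t = 0"
begin

lemma T_in_S [simp]: "t \<in> T \<Longrightarrow> t \<in> S"
  using T_S by auto

lemma S_0 [simp]: "0 \<in> S"
  using S_scale[OF S_e, of 0] by simp

lemma E_0: "k \<in> ix \<Longrightarrow> E k 0 = 0"
  using E_scale[of k e 0] by simp

lemma T_minus: "x \<in> T \<Longrightarrow> - x \<in> T"
  using T_scale[of x "- 1"] by simp

lemma T_diff: "x \<in> T \<Longrightarrow> y \<in> T \<Longrightarrow> x - y \<in> T"
  using T_add[of x "- y"] T_minus by simp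

lemma T_0 [simp]: "0 \<in> T"
  using T_scale[OF T_e, of 0] by simp

text \<open>Row sums from A A^* = 1 express the minors of columns 3, 4 by those of columns 1, 2; the
  remaining choices of \<open>l\<close> only change signs.\<close>

lemma T_mnr:
  assumes "l \<in> ix" "i \<in> ix" "j \<in> ix"
  shows "mnr l i j \<in> T"
proof -
  have "mnr 3 i j \<in> T"
  proof -
    have "mnr 3 i j = (if i = cj j then sg j *c e else 0) - mnr 1 i j"
      using mnr_row_sum[of i j] assms by (simp add: algebra_simps split: if_splits)
    then show ?thesis using T_mnr1 assms by (auto intro!: T_diff T_minus T_scale)
  qed
  moreover have "mnr 2 i j = - mnr 1 i j" "mnr 4 i j = - mnr 3 i j"
    by (simp_all add: mnr_def)
  moreover have "mnr 1 i j \<in> T" "- mnr 1 i j \<in> T" "- mnr 3 i j \<in> T"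
    using T_mnr1[OF assms(2,3)] \<open>mnr 3 i j \<in> T\<close> by (simp_all add: T_minus)
  ultimately show ?thesis
    using \<open>l \<in> ix\<close> by (elim ix_cases) simp_all
qed

section \<open>Words in the matrix entries and their degrees in the columns of a block\<close>

primrec wprod :: "(nat \<times> nat) list \<Rightarrow> 'a" where
  "wprod [] = e"
| "wprod (p # w) = X (fst p) (snd p) * wprod w"

definition words :: "nat set \<Rightarrow> (nat \<times> nat) list set" where
  "words C = {w. set w \<subseteq> ix \<times> C}"

lemma words_Cons [simp]: "p # w \<in> words C \<longleftrightarrow> fst p \<in> ix \<and> snd p \<in> C \<and> w \<in> words C"
  by (cases p) (auto simp: words_def)

lemma words_Nil [simp]: "[] \<in> words C"
  by (simp add: words_def)

lemma wprod_S [simp]: "w \<in> words ix \<Longrightarrow> wprod w \<in> S"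
  by (induction w) auto

lemma words_mono: "C \<subseteq> D \<Longrightarrow> w \<in> words C \<Longrightarrow> w \<in> words D"
  by (auto simp: words_def)

lemma wprod_append: "v \<in> words ix \<Longrightarrow> w \<in> words ix \<Longrightarrow> wprod (v @ w) = wprod v * wprod w"
  by (induction v) (auto simp: S_unit mult.assoc)

lemma X_wprod:
  assumes "i \<in> ix" "j \<in> ix" "w \<in> words ix"
  shows "\<exists>c. X i j * wprod w = c *c (wprod w * X i j)"
  using assms(3)
proof (induction w)
  case Nil
  then show ?case using assms by (intro exI[of _ 1]) simp
next
  case (Cons p w)
  then obtain c where c: "X i j * wprod w = c *c (wprod w * X i j)" by auto
  have "X i j * wprod (p # w) = (eta \<theta> (fst p) i * eta \<theta> j (snd p)) *c (X (fst p) (snd p) * (X i j * wprod w))"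
    using X_comm_left[of i j "fst p" "snd p" "wprod w"] Cons assms by simp
  then show ?case
    unfolding c by (auto simp: mult.assoc)
qed

definition bal :: "nat \<Rightarrow> nat \<Rightarrow> nat \<Rightarrow> (nat \<times> nat) list set" where
  "bal k p q = {w \<in> words {k, cj k}. length (filter (\<lambda>x. snd x = k) w) = p \<and> length (filter (\<lambda>x. snd x \<noteq> k) w) = q}"

lemma bal_words: "k \<in> ix \<Longrightarrow> w \<in> bal k p q \<Longrightarrow> w \<in> words ix"
  unfolding bal_def using words_mono[of "{k, cj k}" ix w] by auto

lemma bal_S [simp]: "k \<in> ix \<Longrightarrow> w \<in> bal k p q \<Longrightarrow> wprod w \<in> S"
  using bal_words wprod_S by blast

lemma cj_neq: "k \<in> ix \<Longrightarrow> cj k \<noteq> k" "k \<in> ix \<Longrightarrow> k \<noteq> cj k"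
  by (auto elim!: ix_cases)

lemma bal_swap: "k \<in> ix \<Longrightarrow> bal (cj k) q p = bal k p q"
proof -
  assume k: "k \<in> ix"
  have "filter (\<lambda>x. snd x = cj k) w = filter (\<lambda>x. snd x \<noteq> k) w \<and> filter (\<lambda>x. snd x \<noteq> cj k) w = filter (\<lambda>x. snd x = k) w"
    if "w \<in> words {k, cj k}" for w
    using that cj_neq[OF k] by (induction w) auto
  moreover have "words {cj k, cj (cj k)} = words {k, cj k}"
    using k by (simp add: insert_commute)
  ultimately show ?thesis
    unfolding bal_def by auto
qed

lemma bal_Nil: "[] \<in> bal k p q \<longleftrightarrow> p = 0 \<and> q = 0"
  by (auto simp: bal_def)

lemma bal_Cons_k: "k \<in> ix \<Longrightarrow> i \<in> ix \<Longrightarrow> (i, k) # w \<in> bal k p q \<longleftrightarrow> p \<noteq> 0 \<and> w \<in> bal k (p - 1) q"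
  by (cases p) (auto simp: bal_def)

lemma bal_Cons_cj: "k \<in> ix \<Longrightarrow> i \<in> ix \<Longrightarrow> (i, cj k) # w \<in> bal k p q \<longleftrightarrow> q \<noteq> 0 \<and> w \<in> bal k p (q - 1)"
  using cj_neq[of k] by (cases q) (auto simp: bal_def)

lemma bal_ConsE:
  assumes "x # w \<in> bal k p q"
  obtains i where "i \<in> ix" "x = (i, k)" | i where "i \<in> ix" "x = (i, cj k)"
  using assms by (cases x) (auto simp: bal_def)

text \<open>Minors as coefficients on the left, a word of bidegree \<open>(p, q)\<close> in the
  middle, and a right factor from \<open>R\<close>. The set \<open>R\<close> holds what the
  operators of the block of \<open>k\<close> do not see: balanced words in the other block at first,
  then only \<open>e\<close>.\<close>

definition G :: "nat \<Rightarrow> 'a set \<Rightarrow> nat \<Rightarrow> nat \<Rightarrow> 'a set" where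
  "G k R p q = cspan {t * (wprod w * r) | t w r. t \<in> T \<and> w \<in> bal k p q \<and> r \<in> R}"

text \<open>The error terms of a reordering: a minor replaces one letter from each of the two
  columns. If one of the columns does not occur there is nothing to reorder, hence the zero
  space.\<close>

definition D :: "nat \<Rightarrow> 'a set \<Rightarrow> nat \<Rightarrow> nat \<Rightarrow> 'a set" where
  "D k R p q = (if p = 0 \<or> q = 0 then {0} else G k R (p - 1) (q - 1))"

lemma G_swap: "k \<in> ix \<Longrightarrow> G (cj k) R q p = G k R p q"
  by (simp add: G_def bal_swap)

lemma D_swap: "k \<in> ix \<Longrightarrow> D (cj k) R q p = D k R p q"
  by (auto simp: D_def G_swap)

lemma G_gen: "t \<in> T \<Longrightarrow> w \<in> bal k p q \<Longrightarrow> r \<in> R \<Longrightarrow> t * (wprod w * r) \<in> G k R p q"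
  unfolding G_def by (intro cspan_gen) blast

lemma G_0 [simp]: "0 \<in> G k R p q"
  by (simp add: G_def)

lemma G_add: "x \<in> G k R p q \<Longrightarrow> y \<in> G k R p q \<Longrightarrow> x + y \<in> G k R p q"
  by (simp add: G_def cspan_add)

lemma G_scale: "x \<in> G k R p q \<Longrightarrow> c *c x \<in> G k R p q"
  by (simp add: G_def cspan_scale)

lemma G_diff: "x \<in> G k R p q \<Longrightarrow> y \<in> G k R p q \<Longrightarrow> x - y \<in> G k R p q"
  by (simp add: G_def cspan_diff)

lemma D_add: "x \<in> D k R p q \<Longrightarrow> y \<in> D k R p q \<Longrightarrow> x + y \<in> D k R p q"
  by (auto simp: D_def G_def cspan_add)

lemma D_diff: "x \<in> D k R p q \<Longrightarrow> y \<in> D k R p q \<Longrightarrow> x - y \<in> D k R p q"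
  by (auto simp: D_def G_def cspan_diff)

lemma D_scale: "x \<in> D k R p q \<Longrightarrow> c *c x \<in> D k R p q"
  by (auto simp: D_def G_def cspan_scale)

lemma D_0 [simp]: "0 \<in> D k R p q"
  by (auto simp: D_def G_def)

section \<open>Multiplication and sorting of words modulo minors\<close>

lemma T_G: "t \<in> T \<Longrightarrow> x \<in> G k R p q \<Longrightarrow> t * x \<in> G k R p q"
  unfolding G_def
  by (erule cspan_mult_left) (auto simp: mult.assoc[symmetric] intro!: cspan_gen T_mult, (metis T_mult mult.assoc))

lemma X_G_k:
  assumes "k \<in> ix" "i \<in> ix" "x \<in> G k R p q"
  shows "X i k * x \<in> G k R (Suc p) q"
  using assms(3) unfolding G_def
proof (rule cspan_mult_left)
  fix x assume "x \<in> {t * (wprod w * r) | t w r. t \<in> T \<and> w \<in> bal k p q \<and> r \<in> R}"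
  then obtain t w r where x: "x = t * (wprod w * r)" "t \<in> T" "w \<in> bal k p q" "r \<in> R" by auto
  obtain t' where t': "t' \<in> T" "X i k * t = t' * X i k"
    using T_commute[OF assms(2,1) x(2)] by auto
  have "X i k * x = t' * (wprod ((i, k) # w) * r)"
    by (simp add: x(1) mult.assoc[symmetric] t'(2))
  moreover have "(i, k) # w \<in> bal k (Suc p) q"
    using x assms by (simp add: bal_Cons_k)
  ultimately show "X i k * x \<in> cspan {t * (wprod w * r) | t w r. t \<in> T \<and> w \<in> bal k (Suc p) q \<and> r \<in> R}"
    using t'(1) x(4) by (intro cspan_gen) blast
qed

lemma X_G_cj:
  assumes "k \<in> ix" "i \<in> ix" "x \<in> G k R p q"
  shows "X i (cj k) * x \<in> G k R p (Suc q)"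
  using X_G_k[of "cj k" i x R q p] assms by (simp add: G_swap)

lemma X_D_k: "k \<in> ix \<Longrightarrow> i \<in> ix \<Longrightarrow> x \<in> D k R p q \<Longrightarrow> X i k * x \<in> D k R (Suc p) q"
  using X_G_k[of k i x R "p - 1" "q - 1"] by (auto simp: D_def split: if_splits)

lemma X_D_cj: "k \<in> ix \<Longrightarrow> i \<in> ix \<Longrightarrow> x \<in> D k R p q \<Longrightarrow> X i (cj k) * x \<in> D k R p (Suc q)"
  using X_G_cj[of k i x R "p - 1" "q - 1"] by (auto simp: D_def split: if_splits)

text \<open>The normal form of a word: the sequence of rows is kept, and the letters in column
  \<open>k\<close> come first.\<close>

primrec srt :: "nat \<Rightarrow> nat list \<Rightarrow> nat \<Rightarrow> (nat \<times> nat) list" where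
  "srt k [] p = []"
| "srt k (i # rows) p = (i, if p = 0 then cj k else k) # srt k rows (p - 1)"

lemma srt_0: "srt k (i # rows) 0 = (i, cj k) # srt k rows 0"
  by simp

lemma srt_Suc: "srt k (i # rows) (Suc p) = (i, k) # srt k rows p"
  by simp

lemma srt_bal:
  assumes "k \<in> ix" "set rows \<subseteq> ix" "p \<le> length rows"
  shows "srt k rows p \<in> bal k p (length rows - p)"
  using assms(2,3)
proof (induction rows arbitrary: p)
  case (Cons i rows)
  then show ?case
    using assms(1) Cons.IH[of 0] Cons.IH[of "p - 1"]
    by (cases p) (auto simp: bal_Cons_k bal_Cons_cj)
qed (simp add: bal_def)

lemma map_fst_srt: "map fst (srt k rows p) = rows"
  by (induction rows arbitrary: p) auto

lemma bal_length: "w \<in> bal k p q \<Longrightarrow> length w = p + q"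
  using sum_length_filter_compl[of "\<lambda>x. snd x = k" w] by (auto simp: bal_def)

text \<open>Exchanging the columns of two neighbouring letters costs a minor of their rows, which is
  an error term. The tail is sorted first; if the head is in column \<open>cj k\<close>, it trades
  columns with the second letter, and what follows the head, one letter shorter than the word, is
  sorted again.\<close>

lemma sort_word:
  assumes "k \<in> ix" "r \<in> R" "w \<in> bal k p q"
  shows "wprod w * r - wprod (srt k (map fst w) p) * r \<in> D k R p q"
  using assms(3)
proof (induction "length w" arbitrary: w p q rule: less_induct)
  case less
  show ?case
  proof (cases w)
    case Nil
    then show ?thesis by simp
  next
    case (Cons x w')
    show ?thesis
    proof (rule bal_ConsE[of x w' k p q])
      show "x # w' \<in> bal k p q" using less Cons by simp
    next
      fix i assume i: "i \<in> ix" "x = (i, k)"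
      obtain p' where p: "p = Suc p'" "w' \<in> bal k p' q"
        using less Cons i assms by (cases p) (auto simp: bal_Cons_k)
      have "X i k * (wprod w' * r - wprod (srt k (map fst w') p') * r) \<in> D k R p q"
        unfolding p(1) using less(1)[OF _ p(2)] Cons i assms by (intro X_D_k) auto
      then show ?thesis
        by (simp add: Cons i p srt_Suc right_diff_distrib mult.assoc)
    next
      fix i assume i: "i \<in> ix" "x = (i, cj k)"
      obtain q' where q: "q = Suc q'" "w' \<in> bal k p q'"
        using less Cons i assms by (cases q) (auto simp: bal_Cons_cj)
      have 1: "X i (cj k) * (wprod w' * r - wprod (srt k (map fst w') p) * r) \<in> D k R p q"
        unfolding q(1) using less(1)[OF _ q(2)] Cons i assms by (intro X_D_cj) auto
      show ?thesis
      proof (cases p)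
        case 0
        then show ?thesis
          using 1 by (simp add: Cons i srt_0 right_diff_distrib mult.assoc)
      next
        case (Suc p')
        have len: "length w' = p + q'"
          using bal_length[OF q(2)] .
        then obtain y w'' where w': "w' = y # w''" using Suc by (cases w') auto
        define i2 where "i2 = fst y"
        have rows: "set (map fst w') \<subseteq> ix"
          using bal_words[OF assms(1) q(2)] by (auto simp: words_def)
        then have i2: "i2 \<in> ix" by (simp add: w' i2_def)
        define rest where "rest = srt k (map fst w'') p'"
        have rest: "rest \<in> bal k p' q'"
          using srt_bal[OF assms(1), of "map fst w''" p'] rows len Suc w' by (auto simp: rest_def)
        \<comment> \<open>Since \<open>p\<close> is positive, the sorted tail begins in column
          \<open>k\<close>, and a trade with the head is possible.\<close>
        have srt1: "srt k (map fst w') p = (i2, k) # rest"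
          by (simp add: w' Suc srt_Suc rest_def i2_def)
        have "X i (cj k) * (X i2 k * z) - X i k * (X i2 (cj k) * z) = - mnr k i i2 * z" for z
          by (simp add: mnr_def left_diff_distrib mult.assoc)
        then have 2: "X i (cj k) * (X i2 k * (wprod rest * r)) - X i k * (X i2 (cj k) * (wprod rest * r)) \<in> D k R p q"
          using G_gen[of "- mnr k i i2" rest k p' q' r R] rest assms i i2
          by (simp add: T_minus T_mnr D_def Suc q)
        have v: "(i2, cj k) # rest \<in> bal k p' q"
          using rest assms i2 q by (simp add: bal_Cons_cj)
        have "length ((i2, cj k) # rest) < length w"
          using bal_length[OF rest] Cons len Suc by simp
        from less(1)[OF this v]
        have "X i k * (wprod ((i2, cj k) # rest) * r - wprod (srt k (map fst ((i2, cj k) # rest)) p') * r) \<in> D k R p q"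
          unfolding Suc using assms i by (intro X_D_k)
        then have 3: "X i k * (X i2 (cj k) * (wprod rest * r)) - wprod (srt k (map fst w) p) * r \<in> D k R p q"
          by (simp add: Cons i w' Suc srt_Suc rest_def map_fst_srt i2_def[symmetric] right_diff_distrib mult.assoc)
        have "wprod w * r - wprod (srt k (map fst w) p) * r =
          X i (cj k) * (wprod w' * r - wprod (srt k (map fst w') p) * r) +
          (X i (cj k) * (X i2 k * (wprod rest * r)) - X i k * (X i2 (cj k) * (wprod rest * r))) +
          (X i k * (X i2 (cj k) * (wprod rest * r)) - wprod (srt k (map fst w) p) * r)"
          by (simp add: srt1 right_diff_distrib mult.assoc) (simp add: Cons i mult.assoc)
        then show ?thesis
          using 1 2 3 D_add by metis
      qed
    qed
  qed
qed

text \<open>Both words have the same normal form: modulo error terms only rows and bidegree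
  matter.\<close>

lemma same_rows:
  assumes "k \<in> ix" "r \<in> R" "w \<in> bal k p q" "w' \<in> bal k p q" "map fst w = map fst w'"
  shows "wprod w * r - wprod w' * r \<in> D k R p q"
  using D_diff[OF sort_word[OF assms(1,2,3)] sort_word[OF assms(1,2,4)]] assms(5) by simp

text \<open>The twist has phase 1 on both columns of the block of \<open>k\<close>, so on such words
  \<open>E k\<close> is an ordinary derivation.\<close>

lemma H_word: "k \<in> ix \<Longrightarrow> w \<in> bal k p q \<Longrightarrow> H k (wprod w) = wprod w"
proof -
  assume k: "k \<in> ix" and w: "w \<in> bal k p q"
  then have "w \<in> words {k, cj k}" by (simp add: bal_def)
  then show ?thesis
  proof (induction w)
    case (Cons x w)
    moreover from Cons have "w \<in> words ix" "x # w \<in> words ix"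
      using k words_mono[of "{k, cj k}" ix] by auto
    ultimately show ?case
      using k by (auto simp: H_mult H_X eta_cj)
  qed (simp add: H_e k)
qed

lemma E_Cons_k:
  assumes "k \<in> ix" "i \<in> ix" "w \<in> bal k p q"
  shows "E k (wprod ((i, k) # w)) = X i k * E k (wprod w)"
  using assms cj_neq[of k] by (simp add: E_mult E_X)

lemma E_Cons_cj:
  assumes "k \<in> ix" "i \<in> ix" "w \<in> bal k p q"
  shows "E k (wprod ((i, cj k) # w)) = X i (cj k) * E k (wprod w) + X i k * wprod w"
  using assms by (simp add: E_mult E_X H_word)

text \<open>The derivation converts each of the \<open>q\<close> letters of column
  \<open>cj k\<close> in turn. All results have the same rows and the same bidegree, hence the same
  normal form modulo error terms, which explains the factor \<open>q\<close>.\<close>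

lemma E_word:
  assumes "k \<in> ix" "r \<in> R" "w \<in> bal k p q"
  shows "E k (wprod w) * r - of_nat q *c (wprod (srt k (map fst w) (Suc p)) * r) \<in> D k R (Suc p) (q - 1)"
  using assms(3)
proof (induction w arbitrary: p q)
  case Nil
  then show ?case using assms by (simp add: bal_Nil E_e)
next
  case (Cons x w)
  show ?case
  proof (rule bal_ConsE[OF Cons.prems])
    fix i assume i: "i \<in> ix" "x = (i, k)"
    obtain p' where p: "p = Suc p'" "w \<in> bal k p' q"
      using Cons i assms by (cases p) (auto simp: bal_Cons_k)
    have "X i k * (E k (wprod w) * r - of_nat q *c (wprod (srt k (map fst w) p) * r)) \<in> D k R (Suc p) (q - 1)"
      using X_D_k[OF assms(1) i(1) Cons.IH[OF p(2)]] by (simp add: p(1))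
    then show ?thesis
      using E_Cons_k[OF assms(1) i(1) p(2)] by (simp add: i srt_Suc right_diff_distrib mult.assoc)
  next
    fix i assume i: "i \<in> ix" "x = (i, cj k)"
    obtain q' where q: "q = Suc q'" "w \<in> bal k p q'"
      using Cons i assms by (cases q) (auto simp: bal_Cons_cj)
    have rows: "set (map fst w) \<subseteq> ix"
      using bal_words[OF assms(1) q(2)] by (auto simp: words_def)
    have len: "length w = p + q'" using bal_length[OF q(2)] .
    let ?s = "srt k (map fst (x # w)) (Suc p)"
    have 1: "X i (cj k) * (E k (wprod w) * r) - of_nat q' *c (X i (cj k) * (wprod (srt k (map fst w) (Suc p)) * r)) \<in> D k R (Suc p) q'"
    proof (cases q')
      \<comment> \<open>The error space of the induction hypothesis is zero here, so the truncated
        \<open>q' - 1\<close> does no harm.\<close>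
      case 0
      then show ?thesis using Cons.IH[OF q(2)] by (simp add: D_def)
    next
      case (Suc q'')
      then show ?thesis
        using X_D_cj[OF assms(1) i(1) Cons.IH[OF q(2)]] by (simp add: right_diff_distrib)
    qed
    have 2: "of_nat q' *c (X i (cj k) * (wprod (srt k (map fst w) (Suc p)) * r)) - of_nat q' *c (wprod ?s * r) \<in> D k R (Suc p) q'"
    proof (cases q')
      case (Suc q'')
      have "srt k (map fst w) (Suc p) \<in> bal k (Suc p) q''"
        using srt_bal[OF assms(1) rows, of "Suc p"] len Suc by simp
      then have b: "(i, cj k) # srt k (map fst w) (Suc p) \<in> bal k (Suc p) q'"
        using assms i Suc by (simp add: bal_Cons_cj)
      have "X i (cj k) * (wprod (srt k (map fst w) (Suc p)) * r) - wprod ?s * r \<in> D k R (Suc p) q'"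
        using sort_word[OF assms(1,2) b] by (simp add: i map_fst_srt mult.assoc)
      then show ?thesis
        using D_scale by (simp add: cscale_diff_right[symmetric])
    qed simp
    have b: "(i, k) # w \<in> bal k (Suc p) q'"
      using assms i q by (simp add: bal_Cons_k)
    have 3: "X i k * (wprod w * r) - wprod ?s * r \<in> D k R (Suc p) q'"
      using sort_word[OF assms(1,2) b] by (simp add: i mult.assoc)
    have "E k (wprod (x # w)) * r - of_nat q *c (wprod ?s * r) =
      (X i (cj k) * (E k (wprod w) * r) - of_nat q' *c (X i (cj k) * (wprod (srt k (map fst w) (Suc p)) * r))) +
      (of_nat q' *c (X i (cj k) * (wprod (srt k (map fst w) (Suc p)) * r)) - of_nat q' *c (wprod ?s * r)) +
      (X i k * (wprod w * r) - wprod ?s * r)"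
      using E_Cons_cj[OF assms(1) i(1) q(2)]
      by (simp add: i q(1) ring_distribs mult.assoc cscale_add_left)
    then show ?thesis
      using 1 2 3 D_add q(1) by (metis diff_Suc_1)
  qed
qed

text \<open>Exact bookkeeping of the bidegree, without error terms; it is what allows the second
  root vector to be applied to the errors left by the first.\<close>

lemma E_word_span:
  assumes "k \<in> ix" "w \<in> bal k p q"
  shows "E k (wprod w) \<in> cspan {wprod w' | w'. q \<noteq> 0 \<and> w' \<in> bal k (Suc p) (q - 1)}"
  using assms(2)
proof (induction w arbitrary: p q)
  case Nil
  then show ?case using assms by (simp add: E_e)
next
  case (Cons x w)
  show ?case
  proof (rule bal_ConsE[OF Cons.prems])
    fix i assume i: "i \<in> ix" "x = (i, k)"
    obtain p' where p: "p = Suc p'" "w \<in> bal k p' q"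
      using Cons i assms by (cases p) (auto simp: bal_Cons_k)
    have "X i k * E k (wprod w) \<in> cspan {wprod w' | w'. q \<noteq> 0 \<and> w' \<in> bal k (Suc p) (q - 1)}"
    proof (rule cspan_mult_left[OF Cons.IH[OF p(2)]])
      fix y assume "y \<in> {wprod w' | w'. q \<noteq> 0 \<and> w' \<in> bal k (Suc p') (q - 1)}"
      then obtain w' where "y = wprod w'" "q \<noteq> 0" "w' \<in> bal k (Suc p') (q - 1)" by auto
      then have "X i k * y = wprod ((i, k) # w')" "(i, k) # w' \<in> bal k (Suc p) (q - 1)"
        using assms i p by (simp_all add: bal_Cons_k)
      then show "X i k * y \<in> cspan {wprod w' | w'. q \<noteq> 0 \<and> w' \<in> bal k (Suc p) (q - 1)}"
        using \<open>q \<noteq> 0\<close> by (intro cspan_gen) blast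
    qed
    then show ?thesis
      using E_Cons_k[OF assms(1) i(1) p(2)] by (simp add: i)
  next
    fix i assume i: "i \<in> ix" "x = (i, cj k)"
    obtain q' where q: "q = Suc q'" "w \<in> bal k p q'"
      using Cons i assms by (cases q) (auto simp: bal_Cons_cj)
    have "X i (cj k) * E k (wprod w) \<in> cspan {wprod w' | w'. q \<noteq> 0 \<and> w' \<in> bal k (Suc p) (q - 1)}"
    proof (rule cspan_mult_left[OF Cons.IH[OF q(2)]])
      fix y assume "y \<in> {wprod w' | w'. q' \<noteq> 0 \<and> w' \<in> bal k (Suc p) (q' - 1)}"
      then obtain w' where "y = wprod w'" "q' \<noteq> 0" "w' \<in> bal k (Suc p) (q' - 1)" by auto
      then have "X i (cj k) * y = wprod ((i, cj k) # w')" "(i, cj k) # w' \<in> bal k (Suc p) (q - 1)"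
        using assms i q by (simp_all add: bal_Cons_cj)
      then show "X i (cj k) * y \<in> cspan {wprod w' | w'. q \<noteq> 0 \<and> w' \<in> bal k (Suc p) (q - 1)}"
        using q by (intro cspan_gen) blast
    qed
    moreover have "X i k * wprod w \<in> cspan {wprod w' | w'. q \<noteq> 0 \<and> w' \<in> bal k (Suc p) (q - 1)}"
    proof (rule cspan_gen)
      have "(i, k) # w \<in> bal k (Suc p) (q - 1)" using assms i q by (simp add: bal_Cons_k)
      then show "X i k * wprod w \<in> {wprod w' | w'. q \<noteq> 0 \<and> w' \<in> bal k (Suc p) (q - 1)}"
        using q by force
    qed
    ultimately show ?thesis
      using E_Cons_cj[OF assms(1) i(1) q(2)] by (simp add: i cspan_add)
  qed
qed

text \<open>What makes \<open>E k (w * r)\<close> equal to \<open>E k w * r\<close>: the twisted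
  Leibniz rule contributes \<open>w * E k r\<close>, which is zero, and
  \<open>E k w * H k r\<close>.\<close>

definition inert :: "nat \<Rightarrow> 'a set \<Rightarrow> bool" where
  "inert k R \<longleftrightarrow> R \<subseteq> S \<and> (\<forall>r\<in>R. E k r = 0 \<and> H k r = r)"

lemma E_gen:
  assumes "k \<in> ix" "inert k R" "t \<in> T" "w \<in> bal k p q" "r \<in> R"
  shows "E k (t * (wprod w * r)) = t * (E k (wprod w) * r)"
proof -
  have r: "r \<in> S" "E k r = 0" "H k r = r" using assms by (auto simp: inert_def)
  then show ?thesis
    using assms by (simp add: E_mult E_T)
qed

lemma G_S:
  assumes "k \<in> ix" "R \<subseteq> S" "x \<in> G k R p q"
  shows "x \<in> S"
  using assms(3) unfolding G_def by induction (use assms in \<open>auto simp: subset_iff\<close>)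

lemma E_G:
  assumes "k \<in> ix" "inert k R" "x \<in> G k R p q"
  shows "E k x \<in> (if q = 0 then {0} else G k R (Suc p) (q - 1))"
  using assms(3) unfolding G_def
proof induction
  case zero
  then show ?case using assms by (simp add: E_0)
next
  case (step x y c)
  then obtain t w r where x: "x = t * (wprod w * r)" "t \<in> T" "w \<in> bal k p q" "r \<in> R" by auto
  have S: "x \<in> S" "y \<in> S"
    using step x assms G_S[OF assms(1), of R y p q] by (auto simp: inert_def G_def)
  have "E k (wprod w) * r \<in> cspan {wprod w' * r | w'. q \<noteq> 0 \<and> w' \<in> bal k (Suc p) (q - 1)}"
    by (rule cspan_mult_right[OF E_word_span[OF assms(1) x(3)]]) (auto intro!: cspan_gen)
  then have "t * (E k (wprod w) * r) \<in> cspan {t * (wprod w' * r) | w'. q \<noteq> 0 \<and> w' \<in> bal k (Suc p) (q - 1)}"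
    by (rule cspan_mult_left) (auto intro!: cspan_gen)
  then have "E k x \<in> cspan {t * (wprod w' * r) | w'. q \<noteq> 0 \<and> w' \<in> bal k (Suc p) (q - 1)}"
    using E_gen[OF assms(1,2) x(2,3,4)] x(1) by simp
  then have "E k x \<in> (if q = 0 then {0} else G k R (Suc p) (q - 1))"
  proof (cases "q = 0")
    case True
    have "z = 0" if "z \<in> cspan {}" for z :: 'a
      using that by induction auto
    then show ?thesis using True \<open>E k x \<in> _\<close> by simp
  next
    case False
    then show ?thesis
      using \<open>E k x \<in> _\<close> x(2,4) unfolding G_def by (auto elim!: subsetD[OF cspan_mono, rotated])
  qed
  then show ?case
    using step.IH S assms(1) by (auto simp: E_add E_scale G_def intro: cspan_add cspan_scale split: if_splits)
qed

text \<open>For a word with \<open>Suc j\<close> letters from each column the first operator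
  produces the factor \<open>Suc j\<close>; column \<open>k\<close> then holds
  \<open>Suc (Suc j)\<close> letters, which is the factor of the second. The errors of both steps
  end in bidegree \<open>(j, j)\<close>.\<close>

lemma capelli_word:
  assumes "k \<in> ix" "inert k R" "inert (cj k) R" "r \<in> R" "w \<in> bal k (Suc j) (Suc j)"
  shows "E (cj k) (E k (wprod w) * r) - of_nat (Suc j * Suc (Suc j)) *c (wprod w * r) \<in> G k R j j"
proof -
  let ?s = "srt k (map fst w) (Suc (Suc j))"
  have r: "r \<in> S" "\<And>k'. k' = k \<or> k' = cj k \<Longrightarrow> E k' r = 0" "\<And>k'. k' = k \<or> k' = cj k \<Longrightarrow> H k' r = r"
    using assms by (auto simp: inert_def)
  have rows: "set (map fst w) \<subseteq> ix"
    using bal_words[OF assms(1,5)] by (auto simp: words_def)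
  have len: "length w = 2 * Suc j" using bal_length[OF assms(5)] by simp
  have s: "?s \<in> bal k (Suc (Suc j)) j"
    using srt_bal[OF assms(1) rows, of "Suc (Suc j)"] len by simp
  have s': "?s \<in> bal (cj k) j (Suc (Suc j))" using s bal_swap[OF assms(1)] by simp
  define d where "d = E k (wprod w) * r - of_nat (Suc j) *c (wprod ?s * r)"
  have d: "d \<in> D k R (Suc (Suc j)) j"
    using E_word[OF assms(1,4,5)] by (simp add: d_def)
  have dS: "d \<in> S" and Ed: "E (cj k) d \<in> G k R j j"
  proof -
    have "d \<in> S \<and> E (cj k) d \<in> G k R j j"
    proof (cases j)
      case 0
      then show ?thesis using d assms(1) by (simp add: D_def E_0 G_def)
    next
      case (Suc j')
      then have d': "d \<in> G k R (Suc j) j'" using d by (simp add: D_def)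
      then have "d \<in> G (cj k) R j' (Suc j)" using G_swap[OF assms(1)] by simp
      from E_G[OF _ assms(3) this] have "E (cj k) d \<in> G (cj k) R j j"
        using assms(1) Suc by simp
      then show ?thesis
        using d' G_S[OF assms(1) _ d'] assms(2) G_swap[OF assms(1)] by (auto simp: inert_def)
    qed
    then show "d \<in> S" "E (cj k) d \<in> G k R j j" by auto
  qed
  have sS: "wprod ?s \<in> S" using s assms(1) by simp
  have Er: "E (cj k) (wprod ?s * r) = E (cj k) (wprod ?s) * r"
    using r sS assms(1) by (simp add: E_mult)
  have 1: "E (cj k) (wprod ?s) * r - of_nat (Suc (Suc j)) *c (wprod (srt (cj k) (map fst w) (Suc j)) * r) \<in> G k R j j"
    using E_word[OF _ assms(4) s'] assms(1) by (simp add: map_fst_srt D_swap) (simp add: D_def G_swap)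
  have "srt (cj k) (map fst w) (Suc j) \<in> bal (cj k) (Suc j) (Suc j)"
    using srt_bal[of "cj k" "map fst w" "Suc j"] rows len assms(1) by simp
  then have b: "srt (cj k) (map fst w) (Suc j) \<in> bal k (Suc j) (Suc j)"
    using bal_swap[OF assms(1)] by simp
  have 2: "wprod (srt (cj k) (map fst w) (Suc j)) * r - wprod w * r \<in> G k R j j"
    using same_rows[OF assms(1,4) b assms(5)] by (simp add: map_fst_srt D_def)
  have "E k (wprod w) * r = of_nat (Suc j) *c (wprod ?s * r) + d" by (simp add: d_def)
  then have "E (cj k) (E k (wprod w) * r) = of_nat (Suc j) *c (E (cj k) (wprod ?s) * r) + E (cj k) d"
    using assms(1) sS r(1) dS by (simp add: E_add E_scale Er)
  then have "E (cj k) (E k (wprod w) * r) - of_nat (Suc j * Suc (Suc j)) *c (wprod w * r) =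
    of_nat (Suc j) *c (E (cj k) (wprod ?s) * r - of_nat (Suc (Suc j)) *c (wprod (srt (cj k) (map fst w) (Suc j)) * r)) +
    of_nat (Suc j * Suc (Suc j)) *c (wprod (srt (cj k) (map fst w) (Suc j)) * r - wprod w * r) + E (cj k) d"
    by (simp only: cscale_diff_right cscale_cscale of_nat_mult) simp
  then show ?thesis
    using G_add[OF G_add[OF G_scale[OF 1] G_scale[OF 2]] Ed] by (simp only:)
qed

text \<open>Linear extension of the word case. Membership of \<open>E k x\<close> in
  \<open>S\<close> is carried along because \<open>E (cj k)\<close> is known to be additive only
  there.\<close>

lemma capelli:
  assumes "k \<in> ix" "inert k R" "inert (cj k) R" "x \<in> G k R (Suc j) (Suc j)"
  shows "E (cj k) (E k x) - of_nat (Suc j * Suc (Suc j)) *c x \<in> G k R j j \<and> E k x \<in> S"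
  using assms(4) unfolding G_def
proof induction
  case zero
  then show ?case using assms(1) by (simp add: E_0)
next
  case (step x y c)
  then obtain t w r where x: "x = t * (wprod w * r)" "t \<in> T" "w \<in> bal k (Suc j) (Suc j)" "r \<in> R" by auto
  have R: "R \<subseteq> S" using assms by (simp add: inert_def)
  have S: "x \<in> S" "y \<in> S"
    using step x assms R G_S[OF assms(1) R, of y "Suc j" "Suc j"] by (auto simp: G_def)
  have Ex: "E k x = t * (E k (wprod w) * r)"
    using E_gen[OF assms(1,2) x(2,3,4)] x(1) by simp
  have ExS: "E k x \<in> S"
    using E_G[OF assms(1,2) G_gen[OF x(2,3,4)]] G_S[OF assms(1) R] x(1) by auto
  have EwS: "E k (wprod w) * r \<in> S"
  proof -
    have "e * (wprod w * r) \<in> G k R (Suc j) (Suc j)" by (rule G_gen[OF T_e x(3,4)])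
    from E_G[OF assms(1,2) this] have "E k (e * (wprod w * r)) \<in> S" using G_S[OF assms(1) R] by auto
    then show ?thesis
      using E_gen[OF assms(1,2) T_e x(3,4)] E_mult[of k "wprod w" r] S_unit x assms R
      by (auto simp: inert_def)
  qed
  have "E (cj k) (E k x) = t * E (cj k) (E k (wprod w) * r)"
    unfolding Ex using EwS x(2) assms(1) E_T[of "cj k" t] by (simp add: E_mult)
  then have "E (cj k) (E k x) - of_nat (Suc j * Suc (Suc j)) *c x =
    t * (E (cj k) (E k (wprod w) * r) - of_nat (Suc j * Suc (Suc j)) *c (wprod w * r))"
    by (simp add: x(1) right_diff_distrib)
  then have 1: "E (cj k) (E k x) - of_nat (Suc j * Suc (Suc j)) *c x \<in> G k R j j"
    using T_G[OF x(2) capelli_word[OF assms(1-3) x(4,3)]] by simp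
  have "E (cj k) (E k (c *c x + y)) - of_nat (Suc j * Suc (Suc j)) *c (c *c x + y) =
    c *c (E (cj k) (E k x) - of_nat (Suc j * Suc (Suc j)) *c x) +
    (E (cj k) (E k y) - of_nat (Suc j * Suc (Suc j)) *c y)"
    using S ExS step.IH assms(1)
    by (simp add: E_add E_scale cscale_add_right cscale_diff_right mult_ac)
  moreover have "E k (c *c x + y) \<in> S"
    using S ExS step.IH assms(1) by (simp add: E_add E_scale)
  ultimately show ?case
    using 1 step.IH by (simp add: G_def cspan_add cspan_scale)
qed

text \<open>If \<open>E k x\<close> vanishes, the Capelli identity leaves the multiple
  \<open>Suc j * Suc (Suc j)\<close> of \<open>x\<close> in \<open>G k R j j\<close>; the constant
  is nonzero, so the degree drops step by step down to zero.\<close>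

lemma lower_degree:
  assumes "k \<in> ix" "inert k R" "inert (cj k) R" "E k x = 0" "x \<in> G k R j j"
  shows "x \<in> G k R 0 0"
  using assms(5)
proof (induction j)
  case (Suc j)
  have "- (of_nat (Suc j * Suc (Suc j)) *c x) \<in> G k R j j"
    using capelli[OF assms(1-3) Suc.prems] assms(1,4) by (simp add: E_0)
  then have "(- 1 / of_nat (Suc j * Suc (Suc j))) *c (- (of_nat (Suc j * Suc (Suc j)) *c x)) \<in> G k R j j"
    unfolding G_def by (rule cspan_scale)
  moreover have "(- 1 / of_nat (Suc j * Suc (Suc j))) *c (- (of_nat (Suc j * Suc (Suc j)) *c x)) = x"
    by (simp del: of_nat_Suc of_nat_mult mult_Suc mult_Suc_right)
  ultimately show ?case using Suc.IH by simp
qed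

text \<open>The unit is up to sign the sum of the minors of rows 1, 2 and of rows 3, 4. Written out
  and inserted before a word, it raises both degrees by one, so that elements of different degrees
  can be brought to a common one.\<close>

lemma G_pad:
  assumes "k \<in> ix" "x \<in> G k R j j"
  shows "x \<in> G k R (Suc j) (Suc j)"
  using assms(2) unfolding G_def
proof (rule cspan_subset)
  fix x assume "x \<in> {t * (wprod w * r) | t w r. t \<in> T \<and> w \<in> bal k j j \<and> r \<in> R}"
  then obtain t w r where x: "x = t * (wprod w * r)" "t \<in> T" "w \<in> bal k j j" "r \<in> R" by auto
  have m: "mnr k 1 2 + mnr k 3 4 = sg (Suc k) *c e"
    using assms(1) mnr_col_sum[of 1] mnr_col_sum[of 3]
    by (elim ix_cases) (simp_all add: mnr_def algebra_simps)
  have "wprod w * r = e * (wprod w * r)" using x assms(1) S_unit(1)[of "wprod w"] by (simp add: mult.assoc[symmetric])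
  also have "\<dots> = (sg (Suc k) *c (mnr k 1 2 + mnr k 3 4)) * (wprod w * r)"
    unfolding m by (simp add: sg_def)
  also have "\<dots> = sg (Suc k) *c (wprod ((1, k) # (2, cj k) # w) * r - wprod ((1, cj k) # (2, k) # w) * r
      + wprod ((3, k) # (4, cj k) # w) * r - wprod ((3, cj k) # (4, k) # w) * r)"
    by (simp add: mnr_def ring_distribs mult.assoc add_diff_eq)
  finally have eq: "wprod w * r = sg (Suc k) *c (wprod ((1, k) # (2, cj k) # w) * r - wprod ((1, cj k) # (2, k) # w) * r
      + wprod ((3, k) # (4, cj k) # w) * r - wprod ((3, cj k) # (4, k) # w) * r)" .
  have x_eq: "x = sg (Suc k) *c (t * (wprod ((1, k) # (2, cj k) # w) * r) - t * (wprod ((1, cj k) # (2, k) # w) * r)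
      + t * (wprod ((3, k) # (4, cj k) # w) * r) - t * (wprod ((3, cj k) # (4, k) # w) * r))"
    unfolding x(1) by (subst eq) (simp only: right_diff_distrib distrib_left mult_cscale_right)
  have mem: "t * (wprod ((i, k) # (i', cj k) # w) * r) \<in> G k R (Suc j) (Suc j)"
    "t * (wprod ((i, cj k) # (i', k) # w) * r) \<in> G k R (Suc j) (Suc j)" if "i \<in> ix" "i' \<in> ix" for i i'
    using x assms(1) that by (auto intro!: G_gen simp: bal_Cons_k bal_Cons_cj simp del: wprod.simps)
  show "x \<in> cspan {t * (wprod w * r) | t w r. t \<in> T \<and> w \<in> bal k (Suc j) (Suc j) \<and> r \<in> R}"
    unfolding x_eq G_def[symmetric] by (intro G_scale G_add G_diff mem ix_mem)
qed

lemma G_pad_le: "k \<in> ix \<Longrightarrow> x \<in> G k R j j \<Longrightarrow> j \<le> j' \<Longrightarrow> x \<in> G k R j' j'"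
  by (induction j' rule: nat_induct) (auto simp: le_Suc_eq intro: G_pad)

lemma balanced_G:
  assumes "k \<in> ix" "x \<in> cspan {t * (wprod w * r) | t w r j. t \<in> T \<and> w \<in> bal k j j \<and> r \<in> R}"
  shows "\<exists>j. x \<in> G k R j j"
  using assms(2)
proof induction
  case zero
  then show ?case by (auto simp: G_def)
next
  case (step x y c)
  then obtain j j' where "x \<in> G k R j j" "y \<in> G k R j' j'"
    by (auto intro: G_gen)
  then have "x \<in> G k R (max j j') (max j j')" "y \<in> G k R (max j j') (max j j')"
    using G_pad_le assms(1) by auto
  then show ?case
    by (auto simp: G_def intro!: exI[of _ "max j j'"] cspan_add cspan_scale)
qed

text \<open>Two descents: one in columns 1, 2 with the balanced words in columns 3, 4 as right
  factors, then one in columns 3, 4 with right factor \<open>e\<close>.\<close>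

theorem coinvariant_in_T:
  assumes x: "x \<in> cspan {wprod u * wprod v | u v i j. u \<in> bal 1 i i \<and> v \<in> bal 3 j j}"
    and E: "\<And>k. k \<in> ix \<Longrightarrow> E k x = 0"
  shows "x \<in> T"
proof -
  define R where "R = {wprod v | v j. v \<in> bal 3 j j}"
  have R: "inert k R" if "k = 1 \<or> k = 2" for k
  proof -
    have k: "k \<in> ix" using that by auto
    \<comment> \<open>Letters of columns 3 and 4 are killed by \<open>E k\<close>, and
      \<open>H k\<close> multiplies them by phases that are inverse to each other; in a balanced
      word these cancel.\<close>
    have HE: "E k (wprod v) = 0 \<and> H k (wprod v) = ((eta \<theta> 3 k * eta \<theta> (cj k) 3) ^ p * (eta \<theta> 4 k * eta \<theta> (cj k) 4) ^ q) *c wprod v"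
      if "v \<in> bal 3 p q" for v p q
      using that
    proof (induction v arbitrary: p q)
      case Nil
      then show ?case using k by (simp add: bal_Nil E_e H_e)
    next
      case (Cons y v)
      show ?case
      proof (rule bal_ConsE[OF Cons.prems])
        fix i assume i: "i \<in> ix" "y = (i, 3)"
        obtain p' where p: "p = Suc p'" "v \<in> bal 3 p' q"
          using Cons i by (cases p) (auto simp: bal_Cons_k)
        then show ?thesis
          using Cons.IH[OF p(2)] i k bal_S[OF _ p(2)] \<open>k = 1 \<or> k = 2\<close> by (auto simp: E_mult E_X H_mult H_X mult_ac)
      next
        fix i assume i: "i \<in> ix" "y = (i, cj 3)"
        obtain q' where q: "q = Suc q'" "v \<in> bal 3 p q'"
          using Cons i bal_Cons_cj[of 3 i v p q] by (cases q) auto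
        then show ?thesis
          using Cons.IH[OF q(2)] i k bal_S[OF _ q(2)] \<open>k = 1 \<or> k = 2\<close> by (auto simp: E_mult E_X H_mult H_X mult_ac)
      qed
    qed
    have one: "(eta \<theta> 3 k * eta \<theta> (cj k) 3) ^ j * (eta \<theta> 4 k * eta \<theta> (cj k) 4) ^ j = 1" for j
      using that by (auto simp: power_mult_distrib[symmetric] eta_simps mult.assoc)
    have "wprod v \<in> S \<and> E k (wprod v) = 0 \<and> H k (wprod v) = wprod v" if "v \<in> bal 3 j j" for v j
      using HE[OF that] one[of j] bal_S[OF _ that] by simp
    then show ?thesis
      unfolding inert_def R_def by blast
  qed
  have "x \<in> cspan {t * (wprod w * r) | t w r j. t \<in> T \<and> w \<in> bal 1 j j \<and> r \<in> R}"
    using x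
  proof (rule cspan_subset)
    fix x assume "x \<in> {wprod u * wprod v | u v i j. u \<in> bal 1 i i \<and> v \<in> bal 3 j j}"
    then obtain u v i j where x: "x = wprod u * wprod v" "u \<in> bal 1 i i" "v \<in> bal 3 j j" by auto
    then have "x = e * (wprod u * wprod v)"
      using S_unit(1)[of "wprod u"] bal_S[of 1 u i i] by (simp add: mult.assoc[symmetric])
    then show "x \<in> cspan {t * (wprod w * r) | t w r j. t \<in> T \<and> w \<in> bal 1 j j \<and> r \<in> R}"
      using x T_e unfolding R_def by (intro cspan_gen) blast
  qed
  then obtain j where "x \<in> G 1 R j j"
    using balanced_G[OF ix_mem(1), of x R] by blast
  then have "x \<in> G 1 R 0 0"
    using lower_degree[of 1 R x j] R E by simp
  then have "x \<in> cspan {t * (wprod w * r) | t w r j. t \<in> T \<and> w \<in> bal 3 j j \<and> r \<in> {e}}"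
    unfolding G_def
  proof (rule cspan_subset)
    fix x assume "x \<in> {t * (wprod w * r) | t w r. t \<in> T \<and> w \<in> bal 1 0 0 \<and> r \<in> R}"
    then obtain t w v j where x: "x = t * (wprod w * wprod v)" "t \<in> T" "w \<in> bal 1 0 0" "v \<in> bal 3 j j"
      by (auto simp: R_def)
    then have "w = []" using bal_length by fastforce
    then have "x = t * (wprod v * e)"
      using x S_unit[of "wprod v"] bal_S[of 3 v j j] by simp
    then show "x \<in> cspan {t * (wprod w * r) | t w r j. t \<in> T \<and> w \<in> bal 3 j j \<and> r \<in> {e}}"
      using x by (intro cspan_gen) blast
  qed
  then obtain j where "x \<in> G 3 {e} j j"
    using balanced_G[OF ix_mem(3), of x "{e}"] by blast
  moreover have "inert k {e}" if "k \<in> ix" for k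
    using that by (simp add: inert_def E_e H_e)
  ultimately have "x \<in> G 3 {e} 0 0"
    using lower_degree[of 3 "{e}" x j] E by simp
  then show ?thesis
    unfolding G_def
  proof induction
    case (step x y c)
    then obtain t w where "x = t * (wprod w * e)" "t \<in> T" "w \<in> bal 3 0 0" by auto
    moreover then have "w = []" using bal_length by fastforce
    ultimately have "x \<in> T" using S_unit by simp
    then show ?case using step by (auto intro: T_add T_scale)
  qed simp
qed

end

text \<open>Without independence of \<open>B\<close>, coefficients cannot be compared. Instead an
  eigenvalue \<open>l\<close> other than 1 is removed from an expansion of \<open>x\<close> by
  applying (K - l) / (1 - l), which fixes \<open>x\<close> and kills the eigenvectors for
  \<open>l\<close>.\<close>

lemma eigen_fixed:
  fixes K :: "'a::calg \<Rightarrow> 'a"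
  assumes add: "\<And>x y. x \<in> S \<Longrightarrow> y \<in> S \<Longrightarrow> K (x + y) = K x + K y"
    and scale: "\<And>c x. x \<in> S \<Longrightarrow> K (c *c x) = c *c K x"
    and S: "cspan B \<subseteq> S" "0 \<in> S" "\<And>c x. x \<in> S \<Longrightarrow> c *c x \<in> S"
    and eigen: "\<And>b. b \<in> B \<Longrightarrow> \<exists>c. K b = c *c b"
    and x: "x \<in> cspan B" "K x = x"
  shows "x \<in> cspan {b \<in> B. K b = b}"
proof -
  have K0: "K 0 = 0" using scale[OF S(2), of 0] by simp
  have "x \<in> cspan {b \<in> B. K b = b}"
    if "finite \<Lambda>" "1 \<notin> \<Lambda>" "x \<in> cspan {b \<in> B. \<exists>c\<in>insert 1 \<Lambda>. K b = c *c b}" for \<Lambda>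
    using that
  proof (induction \<Lambda> rule: finite_induct)
    case (insert l \<Lambda>)
    have "K y - l *c y \<in> cspan {b \<in> B. \<exists>c\<in>insert 1 \<Lambda>. K b = c *c b}"
      if "y \<in> cspan {b \<in> B. \<exists>c\<in>insert 1 (insert l \<Lambda>). K b = c *c b}" for y
      using that
    proof induction
      case (step b y d)
      then obtain c where b: "b \<in> B" "c \<in> insert 1 (insert l \<Lambda>)" "K b = c *c b" by blast
      have "y \<in> cspan B"
        using step.hyps(2) cspan_mono[of "{b \<in> B. \<exists>c\<in>insert 1 (insert l \<Lambda>). K b = c *c b}" B] by auto
      then have "K (d *c b + y) = d *c (K b) + K y"
        using b S cspan_gen[of b B] by (simp add: add scale subset_iff)
      then have eq: "K (d *c b + y) - l *c (d *c b + y) = (d * (c - l)) *c b + (K y - l *c y)"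
        by (simp add: b(3) cscale_add_right cscale_diff_left ring_distribs mult_ac)
      show ?case
      proof (cases "c = l")
        case True
        then show ?thesis using eq step.IH by simp
      next
        case False
        then have "b \<in> {b \<in> B. \<exists>c\<in>insert 1 \<Lambda>. K b = c *c b}" using b by auto
        then show ?thesis unfolding eq by (intro cspan.step step.IH)
      qed
    qed (simp add: K0)
    from cspan_scale[OF this[OF insert.prems(2)], of "1 / (1 - l)"]
    have "(1 / (1 - l)) *c (x - l *c x) \<in> cspan {b \<in> B. \<exists>c\<in>insert 1 \<Lambda>. K b = c *c b}"
      by (simp only: x(2))
    moreover have "(1 / (1 - l)) *c (x - l *c x) = x"
    proof -
      have "x - l *c x = (1 - l) *c x" by (simp add: cscale_diff_left)
      then show ?thesis using insert.prems(1) by auto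
    qed
    ultimately show ?case using insert.IH insert.prems(1) by auto
  qed simp
  moreover have "\<exists>\<Lambda>. finite \<Lambda> \<and> 1 \<notin> \<Lambda> \<and> y \<in> cspan {b \<in> B. \<exists>c\<in>insert 1 \<Lambda>. K b = c *c b}" if "y \<in> cspan B" for y
    using that
  proof induction
    case zero
    then show ?case by (intro exI[of _ "{}"]) simp
  next
    case (step b y d)
    then obtain \<Lambda> where L: "finite \<Lambda>" "1 \<notin> \<Lambda>" "y \<in> cspan {b \<in> B. \<exists>c\<in>insert 1 \<Lambda>. K b = c *c b}" by auto
    obtain c where c: "K b = c *c b" using eigen step by auto
    have sub: "{b \<in> B. \<exists>c\<in>insert 1 \<Lambda>. K b = c *c b} \<subseteq> {b \<in> B. \<exists>c\<in>insert 1 (insert c \<Lambda> - {1}). K b = c *c b}"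
      by auto
    have "d *c b + y \<in> cspan {b \<in> B. \<exists>c\<in>insert 1 (insert c \<Lambda> - {1}). K b = c *c b}"
      using L(3) cspan_mono[OF sub] step(1) c by (intro cspan.step) auto
    then show ?case
      using L by (intro exI[of _ "insert c \<Lambda> - {1}"]) auto
  qed
  ultimately show ?thesis using x(1) by blast
qed

text \<open>The operator \<open>K b\<close> is right translation by a diagonal group element with
  entries 2 at \<open>b\<close> and 1/2 at \<open>cj b\<close>. As 2 has infinite multiplicative
  order, the eigenvalue on a word is 1 exactly when the columns \<open>b\<close> and
  \<open>cj b\<close> are used equally often.\<close>

locale coinv_torus = coinv_data +
  fixes K :: "nat \<Rightarrow> 'a \<Rightarrow> 'a"
  assumes K_add: "x \<in> S \<Longrightarrow> y \<in> S \<Longrightarrow> K b (x + y) = K b x + K b y"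
    and K_scale: "x \<in> S \<Longrightarrow> K b (c *c x) = c *c K b x"
    and K_mult: "x \<in> S \<Longrightarrow> y \<in> S \<Longrightarrow> K b (x * y) = K b x * K b y"
    and K_X: "i \<in> ix \<Longrightarrow> j \<in> ix \<Longrightarrow> b \<in> ix \<Longrightarrow> K b (X i j) = (if j = b then 2 else if j = cj b then 1 / 2 else 1) *c X i j"
    and K_e: "K b e = e"
begin

lemma K_word:
  assumes "b \<in> ix" "w \<in> bal k p q" "k \<in> {b, cj b}"
  shows "K b (wprod w) = (if k = b then 2 ^ p / 2 ^ q else 2 ^ q / 2 ^ p) *c wprod w"
proof -
  have k: "k \<in> ix" using assms by auto
  show ?thesis
    using assms(2)
  proof (induction w arbitrary: p q)
    case Nil
    then show ?case by (simp add: K_e bal_Nil)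
  next
    case (Cons y w)
    show ?case
    proof (rule bal_ConsE[OF Cons.prems])
      fix i assume i: "i \<in> ix" "y = (i, k)"
      obtain p' where p: "p = Suc p'" "w \<in> bal k p' q"
        using Cons i k by (cases p) (auto simp: bal_Cons_k)
      show ?thesis
        using Cons.IH[OF p(2)] bal_S[OF k p(2)] i p k assms cj_neq[of b] by (auto simp: K_mult K_X mult_ac)
    next
      fix i assume i: "i \<in> ix" "y = (i, cj k)"
      obtain q' where q: "q = Suc q'" "w \<in> bal k p q'"
        using Cons i k by (cases q) (auto simp: bal_Cons_cj)
      show ?thesis
        using Cons.IH[OF q(2)] bal_S[OF k q(2)] i q k assms cj_neq[of b] by (auto simp: K_mult K_X mult_ac)
    qed
  qed
qed

lemma words_bal: "w \<in> words {k, cj k} \<Longrightarrow> \<exists>p q. w \<in> bal k p q"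
  by (auto simp: bal_def)

lemma K_word_other:
  assumes "b \<in> ix" "k \<in> ix" "w \<in> bal k p q" "k \<noteq> b" "k \<noteq> cj b"
  shows "K b (wprod w) = wprod w"
  using assms(3)
proof (induction w arbitrary: p q)
  case (Cons y w)
  have "cj k \<noteq> b" "cj k \<noteq> cj b" using assms by (auto simp: cj_eq_iff)
  moreover have "w \<in> words ix" using bal_words[OF assms(2) Cons.prems] by simp
  moreover have "K b (wprod w) = wprod w"
    using Cons.IH words_bal[of w k] Cons.prems by (auto simp: bal_def)
  ultimately show ?case
    using Cons.prems assms by (auto elim!: bal_ConsE simp: K_mult K_X)
qed (simp add: K_e)

text \<open>Letters of columns 1, 2 can be moved to the front at the cost of phases only.\<close>

lemma sorted_span:
  assumes "w \<in> words ix"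
  shows "wprod w \<in> cspan {wprod u * wprod v | u v. u \<in> words {1, 2} \<and> v \<in> words {3, 4}}" (is "_ \<in> cspan ?B")
  using assms
proof (induction w)
  case Nil
  have "wprod [] * wprod [] \<in> ?B" using words_Nil by blast
  from cspan_gen[OF this] show ?case by simp
next
  case (Cons p w)
  have p: "fst p \<in> ix" "snd p \<in> ix" and w: "w \<in> words ix" using Cons.prems by auto
  have "X (fst p) (snd p) * wprod w \<in> cspan ?B"
  proof (rule cspan_mult_left[OF Cons.IH[OF w]])
    fix y assume "y \<in> ?B"
    then obtain u v where y: "y = wprod u * wprod v" "u \<in> words {1, 2}" "v \<in> words {3, 4}" by auto
    have sub: "{1, 2} \<subseteq> ix" by auto
    show "X (fst p) (snd p) * y \<in> cspan ?B"
    proof (cases "snd p \<in> {1, 2}")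
      case True
      then have "X (fst p) (snd p) * y = wprod (p # u) * wprod v" "p # u \<in> words {1, 2}"
        using y p by (simp_all add: mult.assoc)
      then show ?thesis using y(3) by (intro cspan_gen) blast
    next
      case False
      then have "snd p \<in> {3, 4}" using p by (auto elim: ix_cases)
      moreover obtain c where "X (fst p) (snd p) * wprod u = c *c (wprod u * X (fst p) (snd p))"
        using X_wprod[OF p words_mono[OF sub y(2)]] by auto
      ultimately have eq: "X (fst p) (snd p) * y = c *c (wprod u * wprod (p # v))" and pv: "p # v \<in> words {3, 4}"
        using y p by (simp_all add: mult.assoc[symmetric])
      have "wprod u * wprod (p # v) \<in> ?B" using y(2) pv by blast
      then show ?thesis unfolding eq by (intro cspan_scale cspan_gen)
    qed
  qed
  then show ?case by simp
qed

text \<open>Invariance under both torus elements cuts an expansion down to products that are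
  balanced in each block, the starting point of the two descents.\<close>

theorem coinvariant_in_minor_alg:
  assumes x: "x \<in> cspan (wprod ` words ix)" and E: "\<And>k. k \<in> ix \<Longrightarrow> E k x = 0" and K: "K 1 x = x" "K 3 x = x"
  shows "x \<in> T"
proof (rule coinvariant_in_T[OF _ E])
  let ?B = "{wprod u * wprod v | u v. u \<in> words {1, 2} \<and> v \<in> words {3, 4}}"
  have S: "cspan C \<subseteq> S" if "C \<subseteq> S" for C
  proof
    fix y assume "y \<in> cspan C"
    then show "y \<in> S" using that by induction auto
  qed
  have B: "?B \<subseteq> S"
    using words_mono[of "{1,2}" ix] words_mono[of "{3,4}" ix] by auto
  have Beig: "\<exists>p q p' q'. u \<in> bal 1 p q \<and> v \<in> bal 3 p' q' \<and>
      K 1 (wprod u * wprod v) = (2 ^ p / 2 ^ q) *c (wprod u * wprod v) \<and>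
      K 3 (wprod u * wprod v) = (2 ^ p' / 2 ^ q') *c (wprod u * wprod v)"
    if uv: "u \<in> words {1, 2}" "v \<in> words {3, 4}" for u v
  proof -
    obtain p q p' q' where b: "u \<in> bal 1 p q" "v \<in> bal 3 p' q'"
      using words_bal[of u 1] words_bal[of v 3] uv by auto
    then have "K 1 (wprod u) = (2 ^ p / 2 ^ q) *c wprod u" "K 1 (wprod v) = wprod v"
      "K 3 (wprod v) = (2 ^ p' / 2 ^ q') *c wprod v" "K 3 (wprod u) = wprod u" "wprod u \<in> S" "wprod v \<in> S"
      using K_word[of 1 u 1 p q] K_word_other[of 1 3 v p' q'] K_word[of 3 v 3 p' q'] K_word_other[of 3 1 u p q]
        bal_S[of 1 u p q] bal_S[of 3 v p' q'] by auto
    then show ?thesis using b by (auto simp: K_mult)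
  qed
  have "x \<in> cspan ?B"
    using x by (rule cspan_subset) (auto intro: sorted_span)
  have eig: "\<exists>c. K k b = c *c b" if "b \<in> ?B" "k = 1 \<or> k = 3" for b k
    using that Beig by blast
  have fixed: "y \<in> cspan {b \<in> C. K k b = b}" if "C \<subseteq> ?B" "y \<in> cspan C" "K k y = y" "k = 1 \<or> k = 3" for C y k
  proof (rule eigen_fixed[of S "K k" C y])
    show "cspan C \<subseteq> S" using that(1) B by (intro S) (rule subset_trans)
    show "\<exists>c. K k b = c *c b" if "b \<in> C" for b using eig that \<open>C \<subseteq> ?B\<close> \<open>k = 1 \<or> k = 3\<close> by blast
  qed (use that in \<open>simp_all add: K_add K_scale\<close>)
  have x1: "x \<in> cspan {b \<in> ?B. K 1 b = b}"
    by (rule fixed[OF subset_refl \<open>x \<in> cspan ?B\<close> K(1)]) simp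
  have "{b \<in> ?B. K 1 b = b} \<subseteq> ?B" by (rule Collect_restrict)
  from fixed[OF this x1 K(2)] have "x \<in> cspan {b \<in> {b \<in> ?B. K 1 b = b}. K 3 b = b}"
    by simp
  then show "x \<in> cspan {wprod u * wprod v | u v i j. u \<in> bal 1 i i \<and> v \<in> bal 3 j j}"
  proof (rule cspan_subset)
    fix b assume "b \<in> {b \<in> {b \<in> ?B. K 1 b = b}. K 3 b = b}"
    then obtain u v where b: "b = wprod u * wprod v" "u \<in> words {1, 2}" "v \<in> words {3, 4}" "K 1 b = b" "K 3 b = b" by auto
    obtain p q p' q' where pq: "u \<in> bal 1 p q" "v \<in> bal 3 p' q'" "K 1 b = (2 ^ p / 2 ^ q) *c b" "K 3 b = (2 ^ p' / 2 ^ q') *c b"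
      using Beig[OF b(2,3)] b(1) by auto
    \<comment> \<open>A product of words may be fixed although its weight differs from 1; it is then
      zero and lies in every span.\<close>
    have zero: "b = 0" if "c *c b = b" "c \<noteq> 1" for c
    proof -
      have "(c - 1) *c b = 0" using that by (simp add: cscale_diff_left)
      then show ?thesis using that cscale_cancel[of "c - 1" b 0] by simp
    qed
    have ne: "(2 :: complex) ^ m / 2 ^ n \<noteq> 1" if "m \<noteq> n" for m n :: nat
    proof
      assume "(2 :: complex) ^ m / 2 ^ n = 1"
      then have "(of_nat (2 ^ m) :: complex) = of_nat (2 ^ n)" by (simp add: field_simps)
      then have "(2 :: nat) ^ m = 2 ^ n" by (simp only: of_nat_eq_iff)
      then show False using that by simp
    qed
    show "b \<in> cspan {wprod u * wprod v | u v i j. u \<in> bal 1 i i \<and> v \<in> bal 3 j j}"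
    proof (cases "p = q \<and> p' = q'")
      case True
      then show ?thesis using b(1) pq(1,2) by (intro cspan_gen) blast
    next
      case False
      then have "b = 0" using zero pq(3,4) b(4,5) ne by metis
      then show ?thesis by simp
    qed
  qed
qed

end

section \<open>The algebra of minors\<close>

text \<open>Only minors of columns 1, 2 are generators, and no star occurs; the comparison with the
  *-subalgebra is made in \<open>minor_alg_star_subalg\<close>.\<close>

inductive_set (in theta_mat) minor_alg :: "'a set" where
  e [simp]: "e \<in> minor_alg"
| mnr: "i \<in> ix \<Longrightarrow> j \<in> ix \<Longrightarrow> mnr 1 i j \<in> minor_alg"
| add: "x \<in> minor_alg \<Longrightarrow> y \<in> minor_alg \<Longrightarrow> x + y \<in> minor_alg"
| mult: "x \<in> minor_alg \<Longrightarrow> y \<in> minor_alg \<Longrightarrow> x * y \<in> minor_alg"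
| scale: "x \<in> minor_alg \<Longrightarrow> c *c x \<in> minor_alg"

text \<open>An entry passes a minor at the cost of a phase that depends on the rows, so
  \<open>t'\<close> is obtained from \<open>t\<close> by rescaling its minors. This lets
  coefficients be collected on the left of words.\<close>

lemma (in theta_mat) minor_alg_commute:
  assumes "t \<in> minor_alg" "i \<in> ix" "j \<in> ix"
  shows "\<exists>t'\<in>minor_alg. X i j * t = t' * X i j"
  using assms(1)
proof induction
  case e
  then show ?case using assms by (intro bexI[of _ e]) simp_all
next
  case (mnr k l)
  then show ?case
    using X_mnr[of i j 1 k l] assms
    by (intro bexI[of _ "(eta \<theta> k i * eta \<theta> l i) *c mnr 1 k l"]) (auto intro: minor_alg.intros)
next
  case (add x y)
  then obtain x' y' where "x' \<in> minor_alg" "y' \<in> minor_alg" "X i j * x = x' * X i j" "X i j * y = y' * X i j" by auto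
  then show ?case by (intro bexI[of _ "x' + y'"]) (auto simp: ring_distribs intro: minor_alg.intros)
next
  case (mult x y)
  then obtain x' y' where "x' \<in> minor_alg" "y' \<in> minor_alg" "X i j * x = x' * X i j" "X i j * y = y' * X i j" by auto
  then show ?case by (intro bexI[of _ "x' * y'"]) (auto simp: mult.assoc[symmetric] intro: minor_alg.intros, simp add: mult.assoc)
next
  case (scale x c)
  then obtain x' where "x' \<in> minor_alg" "X i j * x = x' * X i j" by auto
  then show ?case by (intro bexI[of _ "c *c x'"]) (auto intro: minor_alg.intros)
qed

section \<open>Triangular representations of the quotient\<close>

text \<open>Upper triangular complex \<open>2 \<times> 2\<close> matrices with rows \<open>(a, b)\<close> and \<open>(0, c)\<close>.\<close>

definition tri_alg :: "(complex \<times> complex \<times> complex) star_algebra" where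
  "tri_alg = \<lparr>carrier = UNIV,
     mult = (\<lambda>x y. (fst x * fst y, fst x * fst (snd y) + fst (snd x) * snd (snd y), snd (snd x) * snd (snd y))),
     one = (1, 0, 1), zero = (0, 0, 0),
     add = (\<lambda>x y. (fst x + fst y, fst (snd x) + fst (snd y), snd (snd x) + snd (snd y))),
     smult = (\<lambda>c x. (c * fst x, c * fst (snd x), c * snd (snd x))), star = id\<rparr>"

lemma tri_alg_simps:
  "x \<in> carrier tri_alg"
  "x \<otimes>\<^bsub>tri_alg\<^esub> y = (fst x * fst y, fst x * fst (snd y) + fst (snd x) * snd (snd y), snd (snd x) * snd (snd y))"
  "\<one>\<^bsub>tri_alg\<^esub> = (1, 0, 1)" "\<zero>\<^bsub>tri_alg\<^esub> = (0, 0, 0)"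
  "x \<oplus>\<^bsub>tri_alg\<^esub> y = (fst x + fst y, fst (snd x) + fst (snd y), snd (snd x) + snd (snd y))"
  "c \<odot>\<^bsub>tri_alg\<^esub> x = (c * fst x, c * fst (snd x), c * snd (snd x))"
  by (simp_all add: tri_alg_def)

lemma tri_alg: "alg tri_alg"
proof (rule alg.intro)
  show "ring tri_alg"
  proof (rule ringI)
    show "abelian_group tri_alg"
    proof (rule abelian_groupI)
      show "\<exists>y\<in>carrier tri_alg. y \<oplus>\<^bsub>tri_alg\<^esub> x = \<zero>\<^bsub>tri_alg\<^esub>" for x
        by (intro bexI[of _ "(- fst x, - fst (snd x), - snd (snd x))"]) (simp_all add: tri_alg_simps)
    qed (simp_all add: tri_alg_simps)
    show "monoid tri_alg"
      by (rule monoidI) (simp_all add: tri_alg_simps algebra_simps)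
  qed (simp_all add: tri_alg_simps algebra_simps)
  show "alg_axioms tri_alg"
    by unfold_locales (simp_all add: tri_alg_simps algebra_simps)
qed

text \<open>Values on the matrix entries of a homomorphism from the quotient by the block ideal to
  triangular matrices. The second condition is A^* A = 1 with the sum over the four rows written
  out.\<close>

definition tri_rep :: "real \<Rightarrow> (nat \<Rightarrow> nat \<Rightarrow> complex \<times> complex \<times> complex) \<Rightarrow> bool" where
  "tri_rep \<theta> V \<longleftrightarrow>
    (\<forall>i\<in>ix. \<forall>j\<in>ix. \<forall>k\<in>ix. \<forall>l\<in>ix. V i j \<otimes>\<^bsub>tri_alg\<^esub> V k l = (eta \<theta> k i * eta \<theta> j l) \<odot>\<^bsub>tri_alg\<^esub> (V k l \<otimes>\<^bsub>tri_alg\<^esub> V i j)) \<and>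
    (\<forall>i\<in>ix. \<forall>j\<in>ix.
      sg (1 + i) \<odot>\<^bsub>tri_alg\<^esub> (V 2 (cj i) \<otimes>\<^bsub>tri_alg\<^esub> V 1 j) \<oplus>\<^bsub>tri_alg\<^esub> sg (2 + i) \<odot>\<^bsub>tri_alg\<^esub> (V 1 (cj i) \<otimes>\<^bsub>tri_alg\<^esub> V 2 j) \<oplus>\<^bsub>tri_alg\<^esub>
      sg (3 + i) \<odot>\<^bsub>tri_alg\<^esub> (V 4 (cj i) \<otimes>\<^bsub>tri_alg\<^esub> V 3 j) \<oplus>\<^bsub>tri_alg\<^esub> sg (4 + i) \<odot>\<^bsub>tri_alg\<^esub> (V 3 (cj i) \<otimes>\<^bsub>tri_alg\<^esub> V 4 j) =
      (if i = j then \<one>\<^bsub>tri_alg\<^esub> else \<zero>\<^bsub>tri_alg\<^esub>)) \<and>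
    (\<forall>i\<in>ix. \<forall>j\<in>ix. \<not> same_block i j \<longrightarrow> V i j = \<zero>\<^bsub>tri_alg\<^esub>)"

lemma tri_rep_sp_mat:
  assumes "tri_rep \<theta> V"
  shows "sp_mat \<theta> (\<lambda>i j. iota tri_alg (V i j)) (iota tri_alg \<one>\<^bsub>tri_alg\<^esub>)"
proof -
  interpret A: alg tri_alg by (rule tri_alg)
  have cl: "x \<in> carrier tri_alg" for x by (simp add: tri_alg_simps)
  let ?i = "iota tri_alg"
  show ?thesis
  proof
    fix i j assume ij: "i \<in> ix" "j \<in> ix"
    {
      fix k l assume "k \<in> ix" "l \<in> ix"
      then have "?i (V i j \<otimes>\<^bsub>tri_alg\<^esub> V k l) = ?i ((eta \<theta> k i * eta \<theta> j l) \<odot>\<^bsub>tri_alg\<^esub> (V k l \<otimes>\<^bsub>tri_alg\<^esub> V i j))"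
        using assms ij unfolding tri_rep_def by (intro arg_cong[where f = ?i]) blast
      then show "?i (V i j) * ?i (V k l) = (eta \<theta> k i * eta \<theta> j l) *c (?i (V k l) * ?i (V i j))"
        by (simp only: A.iota_mult A.iota_smult cl)
    }
    have "?i (sg (1 + i) \<odot>\<^bsub>tri_alg\<^esub> (V 2 (cj i) \<otimes>\<^bsub>tri_alg\<^esub> V 1 j) \<oplus>\<^bsub>tri_alg\<^esub> sg (2 + i) \<odot>\<^bsub>tri_alg\<^esub> (V 1 (cj i) \<otimes>\<^bsub>tri_alg\<^esub> V 2 j) \<oplus>\<^bsub>tri_alg\<^esub>
      sg (3 + i) \<odot>\<^bsub>tri_alg\<^esub> (V 4 (cj i) \<otimes>\<^bsub>tri_alg\<^esub> V 3 j) \<oplus>\<^bsub>tri_alg\<^esub> sg (4 + i) \<odot>\<^bsub>tri_alg\<^esub> (V 3 (cj i) \<otimes>\<^bsub>tri_alg\<^esub> V 4 j)) =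
      ?i (if i = j then \<one>\<^bsub>tri_alg\<^esub> else \<zero>\<^bsub>tri_alg\<^esub>)"
      using assms ij unfolding tri_rep_def by (intro arg_cong[where f = ?i]) blast
    then show "(\<Sum>k\<in>ix. sg (k + i) *c (?i (V (cj k) (cj i)) * ?i (V k j))) = (if i = j then ?i \<one>\<^bsub>tri_alg\<^esub> else 0)"
      by (simp only: A.iota_mult A.iota_smult A.iota_add cl sum_ix cj_simps) (simp add: A.iota_zero)
  qed (simp_all only: A.iota_one_left A.iota_one_right cl)
qed

text \<open>The single off-diagonal number sits at place \<open>(k, cj k)\<close>; it differentiates
  in the direction that replaces column \<open>cj k\<close> by column \<open>k\<close>. The
  commutation relations between this entry and the diagonal ones force the lower character to be
  \<open>eta \<theta> i k * eta \<theta> (cj k) i\<close>, which is the origin of the twist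
  \<open>H k\<close>.\<close>

definition root_mat :: "real \<Rightarrow> nat \<Rightarrow> nat \<Rightarrow> nat \<Rightarrow> complex \<times> complex \<times> complex" where
  "root_mat \<theta> k i j = (if i = j then (1, 0, eta \<theta> i k * eta \<theta> (cj k) i) else if i = k \<and> j = cj k then (0, 1, 0) else (0, 0, 0))"

lemma tri_rep_root_mat:
  assumes "k \<in> ix"
  shows "tri_rep \<theta> (root_mat \<theta> k)"
  unfolding tri_rep_def
proof (intro conjI ballI impI)
  fix i j assume ij: "i \<in> ix" "j \<in> ix"
  {
    fix m l assume ml: "m \<in> ix" "l \<in> ix"
    show "root_mat \<theta> k i j \<otimes>\<^bsub>tri_alg\<^esub> root_mat \<theta> k m l = (eta \<theta> m i * eta \<theta> j l) \<odot>\<^bsub>tri_alg\<^esub> (root_mat \<theta> k m l \<otimes>\<^bsub>tri_alg\<^esub> root_mat \<theta> k i j)"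
      using ij ml assms by (auto simp: root_mat_def tri_alg_simps mult_ac eta_cj)
  }
  show "sg (1 + i) \<odot>\<^bsub>tri_alg\<^esub> (root_mat \<theta> k 2 (cj i) \<otimes>\<^bsub>tri_alg\<^esub> root_mat \<theta> k 1 j) \<oplus>\<^bsub>tri_alg\<^esub> sg (2 + i) \<odot>\<^bsub>tri_alg\<^esub> (root_mat \<theta> k 1 (cj i) \<otimes>\<^bsub>tri_alg\<^esub> root_mat \<theta> k 2 j) \<oplus>\<^bsub>tri_alg\<^esub>
      sg (3 + i) \<odot>\<^bsub>tri_alg\<^esub> (root_mat \<theta> k 4 (cj i) \<otimes>\<^bsub>tri_alg\<^esub> root_mat \<theta> k 3 j) \<oplus>\<^bsub>tri_alg\<^esub> sg (4 + i) \<odot>\<^bsub>tri_alg\<^esub> (root_mat \<theta> k 3 (cj i) \<otimes>\<^bsub>tri_alg\<^esub> root_mat \<theta> k 4 j) =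
      (if i = j then \<one>\<^bsub>tri_alg\<^esub> else \<zero>\<^bsub>tri_alg\<^esub>)"
    using ij assms by (elim ix_cases) (simp_all add: root_mat_def tri_alg_simps eta_simps mult.assoc)
  assume "\<not> same_block i j"
  then show "root_mat \<theta> k i j = \<zero>\<^bsub>tri_alg\<^esub>"
    using assms by (auto simp: root_mat_def same_block_def tri_alg_simps)
qed

text \<open>A diagonal element with determinant 1 in each block. The numbers 2 and 1/2 are not
  unitary, which is harmless as representations need not respect the star; what counts is that the
  powers of 2 are distinct.\<close>

definition torus_mat :: "nat \<Rightarrow> nat \<Rightarrow> nat \<Rightarrow> complex \<times> complex \<times> complex" where
  "torus_mat b i j = (if i = j then if j = b then (2, 0, 2) else if j = cj b then (1 / 2, 0, 1 / 2) else (1, 0, 1) else (0, 0, 0))"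

lemma tri_rep_torus_mat:
  assumes "b \<in> ix"
  shows "tri_rep \<theta> (torus_mat b)"
  unfolding tri_rep_def
proof (intro conjI ballI impI)
  fix i j assume ij: "i \<in> ix" "j \<in> ix"
  {
    fix m l assume ml: "m \<in> ix" "l \<in> ix"
    show "torus_mat b i j \<otimes>\<^bsub>tri_alg\<^esub> torus_mat b m l = (eta \<theta> m i * eta \<theta> j l) \<odot>\<^bsub>tri_alg\<^esub> (torus_mat b m l \<otimes>\<^bsub>tri_alg\<^esub> torus_mat b i j)"
      using ij ml by (auto simp: torus_mat_def tri_alg_simps)
  }
  show "sg (1 + i) \<odot>\<^bsub>tri_alg\<^esub> (torus_mat b 2 (cj i) \<otimes>\<^bsub>tri_alg\<^esub> torus_mat b 1 j) \<oplus>\<^bsub>tri_alg\<^esub> sg (2 + i) \<odot>\<^bsub>tri_alg\<^esub> (torus_mat b 1 (cj i) \<otimes>\<^bsub>tri_alg\<^esub> torus_mat b 2 j) \<oplus>\<^bsub>tri_alg\<^esub>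
      sg (3 + i) \<odot>\<^bsub>tri_alg\<^esub> (torus_mat b 4 (cj i) \<otimes>\<^bsub>tri_alg\<^esub> torus_mat b 3 j) \<oplus>\<^bsub>tri_alg\<^esub> sg (4 + i) \<odot>\<^bsub>tri_alg\<^esub> (torus_mat b 3 (cj i) \<otimes>\<^bsub>tri_alg\<^esub> torus_mat b 4 j) =
      (if i = j then \<one>\<^bsub>tri_alg\<^esub> else \<zero>\<^bsub>tri_alg\<^esub>)"
    using ij assms by (elim ix_cases) (simp_all add: torus_mat_def tri_alg_simps)
  assume "\<not> same_block i j"
  then show "torus_mat b i j = \<zero>\<^bsub>tri_alg\<^esub>"
    by (auto simp: torus_mat_def same_block_def tri_alg_simps)
qed

lemma alg_hom_finsum:
  assumes "alg A" "alg B" and h: "h \<in> alg_hom A B" and "finite S" "f \<in> S \<rightarrow> carrier A"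
  shows "h (\<Oplus>\<^bsub>A\<^esub>i\<in>S. f i) = (\<Oplus>\<^bsub>B\<^esub>i\<in>S. h (f i))"
proof -
  interpret A: alg A by fact
  interpret B: alg B by fact
  have "h (0 \<odot>\<^bsub>A\<^esub> \<one>\<^bsub>A\<^esub>) = 0 \<odot>\<^bsub>B\<^esub> \<one>\<^bsub>B\<^esub>"
    using h A.one_closed unfolding alg_hom_iff by metis
  then have h0: "h \<zero>\<^bsub>A\<^esub> = \<zero>\<^bsub>B\<^esub>" by simp
  have hc: "\<And>x. x \<in> carrier A \<Longrightarrow> h x \<in> carrier B"
    and ha: "\<And>x y. x \<in> carrier A \<Longrightarrow> y \<in> carrier A \<Longrightarrow> h (x \<oplus>\<^bsub>A\<^esub> y) = h x \<oplus>\<^bsub>B\<^esub> h y"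
    using h by (auto simp: alg_hom_iff)
  show ?thesis
    using assms(4,5)
  proof (induction S rule: finite_induct)
    case empty
    then show ?case by (simp add: h0)
  next
    case (insert s S)
    then have "f \<in> S \<rightarrow> carrier A" "f s \<in> carrier A" "(\<lambda>i. h (f i)) \<in> S \<rightarrow> carrier B"
      using hc by auto
    then show ?case
      using insert by (simp add: A.finsum_insert B.finsum_insert hc ha)
  qed
qed

lemma J_coaction_mat:
  assumes "i \<in> ix" "j \<in> ix"
  shows "J_coaction \<theta> (Sp_mat \<theta> i j) =
    (\<Oplus>\<^bsub>tensor_alg (Sp_alg \<theta>) (J_quot \<theta>)\<^esub>k\<in>ix. tens (Sp_alg \<theta>) (J_quot \<theta>) (Sp_mat \<theta> i k) (J_proj \<theta> (Sp_mat \<theta> k j)))"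
proof -
  interpret D: alg_pair "Sp_alg \<theta>" "Sp_alg \<theta>" by (rule Sp_alg_pair)
  interpret D': alg_pair "Sp_alg \<theta>" "J_quot \<theta>"
    by (simp add: alg_pair_def Sp.alg_axioms J_quot_alg)
  have id: "id \<in> alg_hom (Sp_alg \<theta>) (Sp_alg \<theta>)" by (simp add: alg_hom_iff)
  note tm = tensor_map_alg_hom[OF Sp.alg_axioms Sp.alg_axioms Sp.alg_axioms J_quot_alg id J_proj_hom]
  let ?m = "tensor_map (Sp_alg \<theta>) (J_quot \<theta>) id (J_proj \<theta>)"
  have "J_coaction \<theta> (Sp_mat \<theta> i j) = ?m (\<Oplus>\<^bsub>D.T\<^esub>k\<in>ix. tens (Sp_alg \<theta>) (Sp_alg \<theta>) (Sp_mat \<theta> i k) (Sp_mat \<theta> k j))"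
    using assms by (simp add: J_coaction_def Sp_comult)
  also have "\<dots> = (\<Oplus>\<^bsub>D'.T\<^esub>k\<in>ix. ?m (tens (Sp_alg \<theta>) (Sp_alg \<theta>) (Sp_mat \<theta> i k) (Sp_mat \<theta> k j)))"
    using assms by (intro alg_hom_finsum[OF D.T.alg_axioms D'.T.alg_axioms tm(1)]) auto
  also have "\<dots> = (\<Oplus>\<^bsub>D'.T\<^esub>k\<in>ix. tens (Sp_alg \<theta>) (J_quot \<theta>) (Sp_mat \<theta> i k) (J_proj \<theta> (Sp_mat \<theta> k j)))"
    using assms J_proj_hom[of \<theta>] by (intro D'.T.finsum_cong') (auto simp: tm alg_hom_iff)
  finally show ?thesis .
qed

text \<open>The coaction followed by a triangular representation of the second tensor factor is a
  homomorphism to triangular matrices over the quantum group. Its entries are \<open>L1\<close>,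
  \<open>L12\<close>, \<open>L2\<close>, and their product rules are matrix multiplication. A
  coinvariant goes to a multiple of the identity matrix.\<close>

lemma tri_operators:
  assumes V: "tri_rep \<theta> V"
  shows "\<exists>L1 L12 L2 :: Sp_elt \<Rightarrow> Sp_elt algprod.
    (\<forall>L\<in>{L1, L12, L2}. \<forall>x\<in>carrier (Sp_alg \<theta>). \<forall>y\<in>carrier (Sp_alg \<theta>). L (x \<oplus>\<^bsub>Sp_alg \<theta>\<^esub> y) = L x + L y) \<and>
    (\<forall>L\<in>{L1, L12, L2}. \<forall>c. \<forall>x\<in>carrier (Sp_alg \<theta>). L (c \<odot>\<^bsub>Sp_alg \<theta>\<^esub> x) = c *c L x) \<and>
    (\<forall>x\<in>carrier (Sp_alg \<theta>). \<forall>y\<in>carrier (Sp_alg \<theta>). L1 (x \<otimes>\<^bsub>Sp_alg \<theta>\<^esub> y) = L1 x * L1 y \<and>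
       L12 (x \<otimes>\<^bsub>Sp_alg \<theta>\<^esub> y) = L1 x * L12 y + L12 x * L2 y \<and> L2 (x \<otimes>\<^bsub>Sp_alg \<theta>\<^esub> y) = L2 x * L2 y) \<and>
    (\<forall>i\<in>ix. \<forall>j\<in>ix.
       L1 (Sp_mat \<theta> i j) = (\<Sum>k\<in>ix. fst (V k j) *c iota (Sp_alg \<theta>) (Sp_mat \<theta> i k)) \<and>
       L12 (Sp_mat \<theta> i j) = (\<Sum>k\<in>ix. fst (snd (V k j)) *c iota (Sp_alg \<theta>) (Sp_mat \<theta> i k)) \<and>
       L2 (Sp_mat \<theta> i j) = (\<Sum>k\<in>ix. snd (snd (V k j)) *c iota (Sp_alg \<theta>) (Sp_mat \<theta> i k))) \<and>
    (\<forall>f\<in>insert \<one>\<^bsub>Sp_alg \<theta>\<^esub> (J_coinvariants \<theta>). L1 f = iota (Sp_alg \<theta>) f \<and> L12 f = 0 \<and> L2 f = iota (Sp_alg \<theta>) f)"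
proof -
  interpret D: alg_pair "Sp_alg \<theta>" "J_quot \<theta>"
    by (simp add: alg_pair_def Sp.alg_axioms J_quot_alg)
  interpret A: alg tri_alg by (rule tri_alg)
  interpret J: alg_ideal "Sp_alg \<theta>" "J_ideal \<theta>" by (rule J_alg_ideal)
  let ?A = "Sp_alg \<theta>" and ?Q = "J_quot \<theta>" and ?i = "iota (Sp_alg \<theta>)"
  obtain h where h: "typed_hom ?A h" "h \<one>\<^bsub>?A\<^esub> = iota tri_alg \<one>\<^bsub>tri_alg\<^esub>"
    and hX: "\<And>i j. i \<in> ix \<Longrightarrow> j \<in> ix \<Longrightarrow> h (Sp_mat \<theta> i j) = iota tri_alg (V i j)"
    using Sp_universal[OF tri_rep_sp_mat[OF V]] by blast
  have "h x = 0" if "x \<in> J_ideal \<theta>" for x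
  proof (rule Sp.typed_hom_genideal[OF h(1) J_gens_closed _ that[unfolded J_ideal_eq]])
    fix x assume "x \<in> J_gens \<theta>"
    then obtain i j where "i \<in> ix" "j \<in> ix" "\<not> same_block i j" "x = Sp_mat \<theta> i j" by (rule J_gensE)
    moreover then have "V i j = \<zero>\<^bsub>tri_alg\<^esub>" using V unfolding tri_rep_def by blast
    ultimately show "h x = 0" using hX[of i j] A.iota_zero by simp
  qed
  then obtain h' where h': "typed_hom ?Q h'" "\<And>x. x \<in> carrier ?A \<Longrightarrow> h' (J_proj \<theta> x) = h x"
    using J.typed_hom_quot[OF h(1)] by (auto simp: J_quot_def J_proj_def)
  define r where "r y = ev tri_alg (h' y)" for y
  have r_add: "r (x \<oplus>\<^bsub>?Q\<^esub> y) = r x \<oplus>\<^bsub>tri_alg\<^esub> r y" and r_mult: "r (x \<otimes>\<^bsub>?Q\<^esub> y) = r x \<otimes>\<^bsub>tri_alg\<^esub> r y"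
    if "x \<in> carrier ?Q" "y \<in> carrier ?Q" for x y
    using that by (simp_all add: r_def typed_homD[OF h'(1)] A.ev_add A.ev_mult)
  have r_smult: "r (c \<odot>\<^bsub>?Q\<^esub> x) = c \<odot>\<^bsub>tri_alg\<^esub> r x" if "x \<in> carrier ?Q" for x c
    using that by (simp add: r_def typed_homD[OF h'(1)] A.ev_cscale)
  have proj_cl: "J_proj \<theta> x \<in> carrier ?Q" if "x \<in> carrier ?A" for x
    using J_proj_hom[of \<theta>] that by (auto simp: alg_hom_iff)
  have one: "\<one>\<^bsub>?Q\<^esub> = J_proj \<theta> \<one>\<^bsub>?A\<^esub>"
    using J_proj_hom[of \<theta>] by (simp add: alg_hom_iff)
  have r_one: "r \<one>\<^bsub>?Q\<^esub> = (1, 0, 1)"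
    unfolding one using A.ev_iota[of "\<one>\<^bsub>tri_alg\<^esub>"] by (simp add: r_def h'(2) h(2) tri_alg_simps)
  have rX: "r (J_proj \<theta> (Sp_mat \<theta> i j)) = V i j" if "i \<in> ix" "j \<in> ix" for i j
    using that A.ev_iota[of "V i j"] by (simp add: r_def h'(2) hX tri_alg_simps)
  \<comment> \<open>Slice maps: a coordinate \<open>p\<close> of the representation is applied to
    the second factor of a tensor.\<close>
  define good where "good l p \<longleftrightarrow> (\<forall>s\<in>carrier D.T. \<forall>t\<in>carrier D.T. l (s \<oplus>\<^bsub>D.T\<^esub> t) = l s + l t) \<and>
    (\<forall>c. \<forall>t\<in>carrier D.T. l (c \<odot>\<^bsub>D.T\<^esub> t) = c *c l t) \<and>
    (\<forall>x\<in>carrier ?A. \<forall>y\<in>carrier ?Q. l (tens ?A ?Q x y) = p (r y) *c ?i x)" for l :: "_ \<Rightarrow> Sp_elt algprod" and p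
  have ex: "\<exists>l. good l p" if "p \<in> {fst, \<lambda>x. fst (snd x), \<lambda>x. snd (snd x)}" for p
    unfolding good_def
  proof (rule D.tensor_linear_map)
    show "D.bilin (\<lambda>x y. p (r y) *c ?i x)"
      using that unfolding D.bilin_def
      by (auto simp: cscale_add_left cscale_add_right r_add r_smult tri_alg_simps mult_ac)
  qed
  obtain l1 l12 l2 where l: "good l1 fst" "good l12 (\<lambda>x. fst (snd x))" "good l2 (\<lambda>x. snd (snd x))"
  proof -
    have "\<exists>l. good l fst" "\<exists>l. good l (\<lambda>x. fst (snd x))" "\<exists>l. good l (\<lambda>x. snd (snd x))"
      by (rule ex, simp)+
    then show thesis using that by (elim exE)
  qed
  have l1_add: "\<And>s t. s \<in> carrier D.T \<Longrightarrow> t \<in> carrier D.T \<Longrightarrow> l1 (s \<oplus>\<^bsub>D.T\<^esub> t) = l1 s + l1 t"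
    and l1_smult: "\<And>c t. t \<in> carrier D.T \<Longrightarrow> l1 (c \<odot>\<^bsub>D.T\<^esub> t) = c *c l1 t"
    and l1_tens: "\<And>x y. x \<in> carrier ?A \<Longrightarrow> y \<in> carrier ?Q \<Longrightarrow> l1 (tens ?A ?Q x y) = fst (r y) *c ?i x"
    using l(1) by (simp_all add: good_def)
  have l12_add: "\<And>s t. s \<in> carrier D.T \<Longrightarrow> t \<in> carrier D.T \<Longrightarrow> l12 (s \<oplus>\<^bsub>D.T\<^esub> t) = l12 s + l12 t"
    and l12_smult: "\<And>c t. t \<in> carrier D.T \<Longrightarrow> l12 (c \<odot>\<^bsub>D.T\<^esub> t) = c *c l12 t"
    and l12_tens: "\<And>x y. x \<in> carrier ?A \<Longrightarrow> y \<in> carrier ?Q \<Longrightarrow> l12 (tens ?A ?Q x y) = fst (snd (r y)) *c ?i x"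
    using l(2) by (simp_all add: good_def)
  have l2_add: "\<And>s t. s \<in> carrier D.T \<Longrightarrow> t \<in> carrier D.T \<Longrightarrow> l2 (s \<oplus>\<^bsub>D.T\<^esub> t) = l2 s + l2 t"
    and l2_smult: "\<And>c t. t \<in> carrier D.T \<Longrightarrow> l2 (c \<odot>\<^bsub>D.T\<^esub> t) = c *c l2 t"
    and l2_tens: "\<And>x y. x \<in> carrier ?A \<Longrightarrow> y \<in> carrier ?Q \<Longrightarrow> l2 (tens ?A ?Q x y) = snd (snd (r y)) *c ?i x"
    using l(3) by (simp_all add: good_def)
  have l0: "l1 \<zero>\<^bsub>D.T\<^esub> = 0" "l12 \<zero>\<^bsub>D.T\<^esub> = 0" "l2 \<zero>\<^bsub>D.T\<^esub> = 0"
    using l1_smult[of "\<zero>\<^bsub>D.T\<^esub>" 0] l12_smult[of "\<zero>\<^bsub>D.T\<^esub>" 0] l2_smult[of "\<zero>\<^bsub>D.T\<^esub>" 0] by simp_all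
  have l_mult: "l1 (s \<otimes>\<^bsub>D.T\<^esub> t) = l1 s * l1 t \<and> l12 (s \<otimes>\<^bsub>D.T\<^esub> t) = l1 s * l12 t + l12 s * l2 t \<and> l2 (s \<otimes>\<^bsub>D.T\<^esub> t) = l2 s * l2 t"
    if s: "s \<in> carrier D.T" and t: "t \<in> carrier D.T" for s t
    using s
  proof (induction s rule: D.tens_induct)
    case (tens x y)
    show ?case
      using t
    proof (induction t rule: D.tens_induct)
      case (tens x' y')
      with \<open>x \<in> _\<close> \<open>y \<in> _\<close> show ?case
        by (simp add: D.tens_mult l1_tens l12_tens l2_tens r_mult tri_alg_simps cscale_add_left mult_ac)
    qed (use tens in \<open>simp_all add: l0 D.T.r_distr l1_add l12_add l2_add ring_distribs\<close>)
  qed (use t in \<open>simp_all add: l0 D.T.l_distr l1_add l12_add l2_add ring_distribs\<close>)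
  have co: "J_coaction \<theta> x \<in> carrier D.T" if "x \<in> carrier ?A" for x
    using J_coaction_hom[of \<theta>] that by (auto simp: alg_hom_iff)
  have sum: "l (J_coaction \<theta> (Sp_mat \<theta> i j)) = (\<Sum>k\<in>ix. l (tens ?A ?Q (Sp_mat \<theta> i k) (J_proj \<theta> (Sp_mat \<theta> k j))))"
    if l: "\<And>s t. s \<in> carrier D.T \<Longrightarrow> t \<in> carrier D.T \<Longrightarrow> l (s \<oplus>\<^bsub>D.T\<^esub> t) = l s + l t" "l \<zero>\<^bsub>D.T\<^esub> = 0"
      and ij: "i \<in> ix" "j \<in> ix" for i j and l :: "_ \<Rightarrow> Sp_elt algprod"
  proof -
    have "l (\<Oplus>\<^bsub>D.T\<^esub>k\<in>S. tens ?A ?Q (Sp_mat \<theta> i k) (J_proj \<theta> (Sp_mat \<theta> k j))) = (\<Sum>k\<in>S. l (tens ?A ?Q (Sp_mat \<theta> i k) (J_proj \<theta> (Sp_mat \<theta> k j))))"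
      if "finite S" "S \<subseteq> ix" for S
      using that
    proof (induction S rule: finite_induct)
      case (insert k S)
      moreover have "(\<lambda>k. tens ?A ?Q (Sp_mat \<theta> i k) (J_proj \<theta> (Sp_mat \<theta> k j))) \<in> S \<rightarrow> carrier D.T"
        using insert ij proj_cl by auto
      ultimately show ?case
        using ij proj_cl by (simp add: D.T.finsum_insert l)
    qed (simp add: l)
    from this[of ix] show ?thesis using ij by (simp add: J_coaction_mat)
  qed
  have coinv: "J_coaction \<theta> f = tens ?A ?Q f \<one>\<^bsub>?Q\<^esub> \<and> f \<in> carrier ?A" if "f \<in> insert \<one>\<^bsub>?A\<^esub> (J_coinvariants \<theta>)" for f
    using that J_coaction_hom[of \<theta>]
    by (auto simp: J_coinvariants_def coinvariants_def alg_hom_iff D.tens_one)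
  show ?thesis
    using J_coaction_hom[of \<theta>]
    by (intro exI[of _ "\<lambda>x. l1 (J_coaction \<theta> x)"] exI[of _ "\<lambda>x. l12 (J_coaction \<theta> x)"] exI[of _ "\<lambda>x. l2 (J_coaction \<theta> x)"])
      (auto simp: alg_hom_iff co l1_add l12_add l2_add l1_smult l12_smult l2_smult l_mult
        sum[OF l1_add l0(1)] sum[OF l12_add l0(2)] sum[OF l2_add l0(3)] l1_tens l12_tens l2_tens rX proj_cl
        D.tens_one[symmetric] r_one dest!: coinv[OF insertI2])
qed

section \<open>The coinvariants\<close>

definition Sp_minor :: "real \<Rightarrow> nat \<Rightarrow> nat \<Rightarrow> Sp_elt" where
  "Sp_minor \<theta> i j = (Sp_mat \<theta> i 1 \<otimes>\<^bsub>Sp_alg \<theta>\<^esub> Sp_mat \<theta> j 2) \<ominus>\<^bsub>Sp_alg \<theta>\<^esub> (Sp_mat \<theta> i 2 \<otimes>\<^bsub>Sp_alg \<theta>\<^esub> Sp_mat \<theta> j 1)"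

definition Sp_iota :: "real \<Rightarrow> nat \<Rightarrow> nat \<Rightarrow> Sp_elt algprod" where
  "Sp_iota \<theta> i j = iota (Sp_alg \<theta>) (Sp_mat \<theta> i j)"

abbreviation Sp_e :: "real \<Rightarrow> Sp_elt algprod" where
  "Sp_e \<theta> \<equiv> iota (Sp_alg \<theta>) \<one>\<^bsub>Sp_alg \<theta>\<^esub>"

interpretation SpX: sp_mat \<theta> "Sp_iota \<theta>" "Sp_e \<theta>"
  using Sp_sp_mat[OF Sp.typed_hom_iota] unfolding Sp_iota_def[abs_def] .

lemma Sp_minor_closed [simp]: "i \<in> ix \<Longrightarrow> j \<in> ix \<Longrightarrow> Sp_minor \<theta> i j \<in> carrier (Sp_alg \<theta>)"
  by (simp add: Sp_minor_def)

lemma iota_Sp_minor: "i \<in> ix \<Longrightarrow> j \<in> ix \<Longrightarrow> iota (Sp_alg \<theta>) (Sp_minor \<theta> i j) = SpX.mnr \<theta> 1 i j"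
  by (simp add: Sp_minor_def SpX.mnr_def Sp_iota_def)

text \<open>Names the conclusion of \<open>tri_operators\<close>, so that operators for all indices
  can be chosen at once.\<close>

definition tri_ops where
  "tri_ops \<theta> V L1 L12 L2 \<longleftrightarrow>
    (\<forall>L\<in>{L1, L12, L2}. \<forall>x\<in>carrier (Sp_alg \<theta>). \<forall>y\<in>carrier (Sp_alg \<theta>). L (x \<oplus>\<^bsub>Sp_alg \<theta>\<^esub> y) = L x + L y) \<and>
    (\<forall>L\<in>{L1, L12, L2}. \<forall>c. \<forall>x\<in>carrier (Sp_alg \<theta>). L (c \<odot>\<^bsub>Sp_alg \<theta>\<^esub> x) = c *c L x) \<and>
    (\<forall>x\<in>carrier (Sp_alg \<theta>). \<forall>y\<in>carrier (Sp_alg \<theta>). L1 (x \<otimes>\<^bsub>Sp_alg \<theta>\<^esub> y) = L1 x * L1 y \<and>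
       L12 (x \<otimes>\<^bsub>Sp_alg \<theta>\<^esub> y) = L1 x * L12 y + L12 x * L2 y \<and> L2 (x \<otimes>\<^bsub>Sp_alg \<theta>\<^esub> y) = L2 x * L2 y) \<and>
    (\<forall>i\<in>ix. \<forall>j\<in>ix.
       L1 (Sp_mat \<theta> i j) = (\<Sum>k\<in>ix. fst (V k j) *c iota (Sp_alg \<theta>) (Sp_mat \<theta> i k)) \<and>
       L12 (Sp_mat \<theta> i j) = (\<Sum>k\<in>ix. fst (snd (V k j)) *c iota (Sp_alg \<theta>) (Sp_mat \<theta> i k)) \<and>
       L2 (Sp_mat \<theta> i j) = (\<Sum>k\<in>ix. snd (snd (V k j)) *c iota (Sp_alg \<theta>) (Sp_mat \<theta> i k))) \<and>
    (\<forall>f\<in>insert \<one>\<^bsub>Sp_alg \<theta>\<^esub> (J_coinvariants \<theta>). L1 f = iota (Sp_alg \<theta>) f \<and> L12 f = 0 \<and> L2 f = iota (Sp_alg \<theta>) f)"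

lemma tri_opsD:
  assumes "tri_ops \<theta> V L1 L12 L2"
  shows "x \<in> carrier (Sp_alg \<theta>) \<Longrightarrow> y \<in> carrier (Sp_alg \<theta>) \<Longrightarrow> L1 (x \<oplus>\<^bsub>Sp_alg \<theta>\<^esub> y) = L1 x + L1 y"
    "x \<in> carrier (Sp_alg \<theta>) \<Longrightarrow> y \<in> carrier (Sp_alg \<theta>) \<Longrightarrow> L12 (x \<oplus>\<^bsub>Sp_alg \<theta>\<^esub> y) = L12 x + L12 y"
    "x \<in> carrier (Sp_alg \<theta>) \<Longrightarrow> L1 (c \<odot>\<^bsub>Sp_alg \<theta>\<^esub> x) = c *c L1 x"
    "x \<in> carrier (Sp_alg \<theta>) \<Longrightarrow> L12 (c \<odot>\<^bsub>Sp_alg \<theta>\<^esub> x) = c *c L12 x"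
    "x \<in> carrier (Sp_alg \<theta>) \<Longrightarrow> y \<in> carrier (Sp_alg \<theta>) \<Longrightarrow> L1 (x \<otimes>\<^bsub>Sp_alg \<theta>\<^esub> y) = L1 x * L1 y"
    "x \<in> carrier (Sp_alg \<theta>) \<Longrightarrow> y \<in> carrier (Sp_alg \<theta>) \<Longrightarrow> L12 (x \<otimes>\<^bsub>Sp_alg \<theta>\<^esub> y) = L1 x * L12 y + L12 x * L2 y"
    "x \<in> carrier (Sp_alg \<theta>) \<Longrightarrow> y \<in> carrier (Sp_alg \<theta>) \<Longrightarrow> L2 (x \<otimes>\<^bsub>Sp_alg \<theta>\<^esub> y) = L2 x * L2 y"
    "i \<in> ix \<Longrightarrow> j \<in> ix \<Longrightarrow> L1 (Sp_mat \<theta> i j) = (\<Sum>k\<in>ix. fst (V k j) *c Sp_iota \<theta> i k)"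
    "i \<in> ix \<Longrightarrow> j \<in> ix \<Longrightarrow> L12 (Sp_mat \<theta> i j) = (\<Sum>k\<in>ix. fst (snd (V k j)) *c Sp_iota \<theta> i k)"
    "i \<in> ix \<Longrightarrow> j \<in> ix \<Longrightarrow> L2 (Sp_mat \<theta> i j) = (\<Sum>k\<in>ix. snd (snd (V k j)) *c Sp_iota \<theta> i k)"
    "f = \<one>\<^bsub>Sp_alg \<theta>\<^esub> \<or> f \<in> J_coinvariants \<theta> \<Longrightarrow> L1 f = iota (Sp_alg \<theta>) f"
    "f = \<one>\<^bsub>Sp_alg \<theta>\<^esub> \<or> f \<in> J_coinvariants \<theta> \<Longrightarrow> L12 f = 0"
    "f = \<one>\<^bsub>Sp_alg \<theta>\<^esub> \<or> f \<in> J_coinvariants \<theta> \<Longrightarrow> L2 f = iota (Sp_alg \<theta>) f"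
  using assms unfolding tri_ops_def Sp_iota_def by auto

lemma tri_ops_family:
  assumes "\<And>k. k \<in> ix \<Longrightarrow> tri_rep \<theta> (V k)"
  shows "\<exists>L1 L12 L2. \<forall>k\<in>ix. tri_ops \<theta> (V k) (L1 k) (L12 k) (L2 k)"
proof -
  have "\<forall>k. \<exists>L. k \<in> ix \<longrightarrow> tri_ops \<theta> (V k) (fst L) (fst (snd L)) (snd (snd L))"
  proof
    fix k
    show "\<exists>L. k \<in> ix \<longrightarrow> tri_ops \<theta> (V k) (fst L) (fst (snd L)) (snd (snd L))"
    proof (cases "k \<in> ix")
      case True
      obtain L1 L12 L2 where "tri_ops \<theta> (V k) L1 L12 L2"
        using tri_operators[OF assms[OF True]] unfolding tri_ops_def by blast
      then show ?thesis by (intro exI[of _ "(L1, L12, L2)"]) simp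
    qed simp
  qed
  from choice[OF this] obtain L where L: "\<forall>k. k \<in> ix \<longrightarrow> tri_ops \<theta> (V k) (fst (L k)) (fst (snd (L k))) (snd (snd (L k)))" ..
  show ?thesis
    by (rule exI[of _ "\<lambda>k. fst (L k)"], rule exI[of _ "\<lambda>k. fst (snd (L k))"], rule exI[of _ "\<lambda>k. snd (snd (L k))"])
      (use L in blast)
qed

text \<open>For the root matrices the first diagonal entry is the trivial character, so
  \<open>L1\<close> is the embedding and the product rule of \<open>L12\<close> becomes the Leibniz
  rule twisted on one side only.\<close>

lemma Sp_coinv_torus:
  "\<exists>E H K. coinv_torus \<theta> (Sp_iota \<theta>) (Sp_e \<theta>) (iota (Sp_alg \<theta>) ` carrier (Sp_alg \<theta>)) (SpX.minor_alg \<theta>) E H K \<and>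
    (\<forall>f\<in>J_coinvariants \<theta>. (\<forall>k\<in>ix. E k (iota (Sp_alg \<theta>) f) = 0 \<and> K k (iota (Sp_alg \<theta>) f) = iota (Sp_alg \<theta>) f))"
proof -
  let ?A = "Sp_alg \<theta>" and ?i = "iota (Sp_alg \<theta>)"
  obtain L1 L12 L2 where L: "\<And>k. k \<in> ix \<Longrightarrow> tri_ops \<theta> (root_mat \<theta> k) (L1 k) (L12 k) (L2 k)"
    using tri_ops_family[of \<theta> "root_mat \<theta>", OF tri_rep_root_mat] by blast
  obtain M1 M12 M2 where M: "\<And>k. k \<in> ix \<Longrightarrow> tri_ops \<theta> (torus_mat k) (M1 k) (M12 k) (M2 k)"
    using tri_ops_family[of \<theta> torus_mat, OF tri_rep_torus_mat] by blast
  have L1: "L1 k x = ?i x" if k: "k \<in> ix" and x: "x \<in> carrier ?A" for k x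
    using x
  proof (induction x rule: Sp_induct)
    case (entry i j)
    then show ?case
      using tri_opsD(8)[OF L[OF k] entry] by (auto simp: root_mat_def sum_ix Sp_iota_def elim!: ix_cases)
  qed (simp_all add: tri_opsD[OF L[OF k]])
  define E where "E k u = L12 k (ev ?A u)" for k u
  define H where "H k u = L2 k (ev ?A u)" for k u
  \<comment> \<open>The identity is the default outside \<open>ix\<close>, because most laws of
    \<open>K\<close> in the locale are stated for every index.\<close>
  define K where "K k u = (if k \<in> ix then M1 k (ev ?A u) else u)" for k u
  have e: "?i \<one>\<^bsub>?A\<^esub> * u = u" "u * ?i \<one>\<^bsub>?A\<^esub> = u" if "u \<in> ?i ` carrier ?A" for u
    using that by auto
  have E: "E k (?i x) = L12 k x" "H k (?i x) = L2 k x" if "x \<in> carrier ?A" for k x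
    using that by (simp_all add: E_def H_def)
  have K: "K k (?i x) = (if k \<in> ix then M1 k x else ?i x)" if "x \<in> carrier ?A" for k x
    using that by (simp add: K_def)
  have EX: "E k (Sp_iota \<theta> i j) = (if j = cj k then Sp_iota \<theta> i k else 0)" if "k \<in> ix" "i \<in> ix" "j \<in> ix" for k i j
    using that tri_opsD(9)[OF L[of k], of i j]
    by (auto simp: Sp_iota_def E root_mat_def sum_ix elim!: ix_cases)
  have HX: "H k (Sp_iota \<theta> i j) = (eta \<theta> j k * eta \<theta> (cj k) j) *c Sp_iota \<theta> i j" if "k \<in> ix" "i \<in> ix" "j \<in> ix" for k i j
    using that tri_opsD(10)[OF L[of k], of i j]
    by (auto simp: Sp_iota_def E root_mat_def sum_ix elim!: ix_cases)
  have EHe: "E k (?i \<one>\<^bsub>?A\<^esub>) = 0" "H k (?i \<one>\<^bsub>?A\<^esub>) = ?i \<one>\<^bsub>?A\<^esub>" if "k \<in> ix" for k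
    using that by (simp_all add: E tri_opsD[OF L])
  have EE: "E k (u + v) = E k u + E k v" "E k (c *c u) = c *c E k u" "E k (u * v) = u * E k v + E k u * H k v"
    "H k (u * v) = H k u * H k v" if "k \<in> ix" "u \<in> ?i ` carrier ?A" "v \<in> ?i ` carrier ?A" for k u v c
    using that by (auto simp: Sp.iota_add[symmetric] Sp.iota_mult[symmetric] Sp.iota_smult[symmetric] E tri_opsD[OF L]
        simp del: Sp.iota_add Sp.iota_mult Sp.iota_smult) (simp_all add: L1 E)
  have S: "u + v \<in> ?i ` carrier ?A" "u * v \<in> ?i ` carrier ?A" "c *c u \<in> ?i ` carrier ?A"
    if "u \<in> ?i ` carrier ?A" "v \<in> ?i ` carrier ?A" for u v c
    using that by (auto simp: Sp.iota_add[symmetric] Sp.iota_mult[symmetric] Sp.iota_smult[symmetric]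
        simp del: Sp.iota_add Sp.iota_mult Sp.iota_smult)
  have Ec: "E k (c *c u) = c *c E k u" if "k \<in> ix" "u \<in> ?i ` carrier ?A" for k u c
    using EE(2) that by blast
  have Sc: "c *c u \<in> ?i ` carrier ?A" if "u \<in> ?i ` carrier ?A" for u c
    using S(3) that by blast
  have X: "Sp_iota \<theta> i j \<in> ?i ` carrier ?A" if "i \<in> ix" "j \<in> ix" for i j
    using that by (simp add: Sp_iota_def)
  have minor_S: "t \<in> ?i ` carrier ?A" if "t \<in> SpX.minor_alg \<theta>" for t
    using that
  proof induction
    case (mnr i j)
    then show ?case by (simp add: iota_Sp_minor[symmetric])
  qed (use S(1,2) Sc in auto)
  have E_mnr: "E k (SpX.mnr \<theta> 1 i j) = 0" if "k \<in> ix" "i \<in> ix" "j \<in> ix" for k i j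
  proof -
    have "SpX.mnr \<theta> 1 i j = Sp_iota \<theta> i 1 * Sp_iota \<theta> j 2 + (- 1) *c (Sp_iota \<theta> i 2 * Sp_iota \<theta> j 1)"
      by (simp add: SpX.mnr_def)
    also have "E k \<dots> = 0"
      using that by (simp only: EE(1,3) Ec S(1,2) Sc X ix_mem) (auto simp: EX HX eta_simps elim!: ix_cases)
    finally show ?thesis .
  qed
  have "coinv_torus \<theta> (Sp_iota \<theta>) (Sp_e \<theta>) (?i ` carrier ?A) (SpX.minor_alg \<theta>) E H K"
  proof
    fix k t assume "k \<in> ix" "t \<in> SpX.minor_alg \<theta>"
    from this(2) show "E k t = 0"
      by induction (use \<open>k \<in> ix\<close> minor_S in \<open>auto simp: EE(1,3) Ec E_mnr EHe\<close>)
  next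
    fix b u v assume uv: "u \<in> ?i ` carrier ?A" "v \<in> ?i ` carrier ?A"
    show "K b (u + v) = K b u + K b v"
      using uv by (auto simp: Sp.iota_add[symmetric] K tri_opsD[OF M] simp del: Sp.iota_add)
    show "K b (u * v) = K b u * K b v"
      using uv by (auto simp: Sp.iota_mult[symmetric] K tri_opsD[OF M] simp del: Sp.iota_mult)
  next
    fix b u c assume "u \<in> ?i ` carrier ?A"
    then show "K b (c *c u) = c *c K b u"
      by (auto simp: Sp.iota_smult[symmetric] K tri_opsD[OF M] simp del: Sp.iota_smult)
  next
    fix i j b assume "i \<in> ix" "j \<in> ix" "b \<in> ix"
    then show "K b (Sp_iota \<theta> i j) = (if j = b then 2 else if j = cj b then 1 / 2 else 1) *c Sp_iota \<theta> i j"
      using tri_opsD(8)[OF M[of b], of i j]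
      by (auto simp: Sp_iota_def K torus_mat_def sum_ix elim!: ix_cases)
  next
    show "K b (?i \<one>\<^bsub>?A\<^esub>) = ?i \<one>\<^bsub>?A\<^esub>" for b
      by (simp add: K tri_opsD[OF M])
  qed (use S(1,2) Sc X minor_S EE(1,3,4) Ec EX HX EHe SpX.minor_alg_commute in \<open>auto intro: SpX.minor_alg.intros\<close>)
  moreover have "E k (?i f) = 0 \<and> K k (?i f) = ?i f" if "f \<in> J_coinvariants \<theta>" "k \<in> ix" for f k
  proof -
    have "f \<in> carrier ?A" using that by (simp add: J_coinvariants_def coinvariants_def)
    then show ?thesis using that tri_opsD(12)[OF L[of k], of f] tri_opsD(11)[OF M[of k], of f] by (simp add: E K)
  qed
  ultimately show ?thesis by blast
qed

lemma coinvariant_minor_alg: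
  assumes "f \<in> J_coinvariants \<theta>"
  shows "iota (Sp_alg \<theta>) f \<in> SpX.minor_alg \<theta>"
proof -
  let ?A = "Sp_alg \<theta>" and ?i = "iota (Sp_alg \<theta>)"
  obtain E H K where EHK: "coinv_torus \<theta> (Sp_iota \<theta>) (Sp_e \<theta>) (?i ` carrier ?A) (SpX.minor_alg \<theta>) E H K"
    and f: "\<And>k. k \<in> ix \<Longrightarrow> E k (?i f) = 0 \<and> K k (?i f) = ?i f"
    using Sp_coinv_torus assms by blast
  interpret C: coinv_torus \<theta> "Sp_iota \<theta>" "Sp_e \<theta>" "?i ` carrier ?A" "SpX.minor_alg \<theta>" E H K by (rule EHK)
  have "f \<in> carrier ?A" using assms by (simp add: J_coinvariants_def coinvariants_def)
  then have "?i f \<in> cspan (C.wprod ` C.words ix)"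
  proof (induction f rule: Sp_induct)
    case one
    have "C.wprod [] \<in> C.wprod ` C.words ix" by (intro imageI) simp
    from cspan_gen[OF this] show ?case by simp
  next
    case (mult x y)
    show ?case
      unfolding Sp.iota_mult[OF mult(1,2)]
    proof (rule cspan_mult_left[OF mult(4)], rule cspan_mult_right[OF mult(3)])
      fix v w assume "v \<in> C.wprod ` C.words ix" "w \<in> C.wprod ` C.words ix"
      then obtain v' w' where "v = C.wprod v'" "w = C.wprod w'" "v' \<in> C.words ix" "w' \<in> C.words ix" by auto
      moreover then have "w' @ v' \<in> C.words ix" by (auto simp: C.words_def)
      ultimately have "w * v \<in> C.wprod ` C.words ix" by (metis C.wprod_append imageI)
      then show "w * v \<in> cspan (C.wprod ` C.words ix)" by (rule cspan_gen)
    qed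
  next
    case (entry i j)
    have "C.wprod [(i, j)] \<in> C.wprod ` C.words ix" using entry by (intro imageI) simp
    from cspan_gen[OF this] show ?case using entry by (simp add: Sp_iota_def[symmetric])
  qed (simp_all add: cspan_add cspan_scale)
  then show ?thesis
    using f by (intro C.coinvariant_in_minor_alg) auto
qed

definition Sp_minor_gens :: "real \<Rightarrow> Sp_elt set" where
  "Sp_minor_gens \<theta> = {Sp_minor \<theta> 1 2, Sp_minor \<theta> 3 2, \<ominus>\<^bsub>Sp_alg \<theta>\<^esub> Sp_minor \<theta> 3 1}"

lemma Sp_minor_star:
  assumes "i \<in> ix" "j \<in> ix"
  shows "star (Sp_alg \<theta>) (Sp_minor \<theta> i j) = (- sg (i + j)) \<odot>\<^bsub>Sp_alg \<theta>\<^esub> Sp_minor \<theta> (cj j) (cj i)"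
proof -
  have "iota (Sp_alg \<theta>) (star (Sp_alg \<theta>) (Sp_minor \<theta> i j)) = iota (Sp_alg \<theta>) ((- sg (i + j)) \<odot>\<^bsub>Sp_alg \<theta>\<^esub> Sp_minor \<theta> (cj j) (cj i))"
    using assms
    by (simp add: Sp_minor_def Sp.star_diff Sp.star_mult Sp_mat_star cscale_diff_right mult_ac)
  then show ?thesis
    using assms by (subst (asm) Sp.iota_eq_iff) simp_all
qed

lemma star_subalg_closed:
  assumes "salg A" "X \<subseteq> carrier A"
  shows "star_subalg A X \<subseteq> carrier A"
proof
  interpret salg A by fact
  fix x assume "x \<in> star_subalg A X"
  then show "x \<in> carrier A" by induction (use assms in auto)
qed

lemma Sp_minor_gens_closed: "Sp_minor_gens \<theta> \<subseteq> carrier (Sp_alg \<theta>)"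
  by (simp add: Sp_minor_gens_def)

text \<open>By the star the three generators also give the minors of rows 1, 4 and 2, 4, and the
  column sum gives that of rows 3, 4. Exchanging rows costs a sign and a phase, and minors with
  equal rows vanish.\<close>

lemma Sp_minor_in_star_subalg:
  assumes "i \<in> ix" "j \<in> ix"
  shows "Sp_minor \<theta> i j \<in> star_subalg (Sp_alg \<theta>) (Sp_minor_gens \<theta>)"
proof -
  let ?A = "Sp_alg \<theta>" and ?B = "star_subalg (Sp_alg \<theta>) (Sp_minor_gens \<theta>)"
  have B: "x \<in> carrier ?A" if "x \<in> ?B" for x
    using star_subalg_closed[OF Sp_salg Sp_minor_gens_closed] that by auto
  have scale: "y \<in> ?B" if "c \<odot>\<^bsub>?A\<^esub> y \<in> ?B" "c \<noteq> 0" "y \<in> carrier ?A" for c y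
    using star_subalg.smult[OF that(1), of "1 / c"] that(2,3) by (simp add: Sp.smult_smult)
  have swap: "Sp_minor \<theta> j i \<in> ?B" if "Sp_minor \<theta> i j \<in> ?B" "i \<in> ix" "j \<in> ix" for i j
  proof -
    have "iota ?A (Sp_minor \<theta> j i) = iota ?A ((- eta \<theta> i j) \<odot>\<^bsub>?A\<^esub> Sp_minor \<theta> i j)"
      using that SpX.mnr_swap[of 1 i j \<theta>] by (simp add: iota_Sp_minor)
    then have "Sp_minor \<theta> j i = (- eta \<theta> i j) \<odot>\<^bsub>?A\<^esub> Sp_minor \<theta> i j"
      using that by (subst (asm) Sp.iota_eq_iff) simp_all
    then show ?thesis using star_subalg.smult[OF that(1)] by simp
  qed
  have star: "Sp_minor \<theta> (cj j) (cj i) \<in> ?B" if "Sp_minor \<theta> i j \<in> ?B" "i \<in> ix" "j \<in> ix" for i j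
    using star_subalg.star[OF that(1)] that scale[of "- sg (i + j)" "Sp_minor \<theta> (cj j) (cj i)"]
    by (simp add: Sp_minor_star) (simp add: sg_def split: if_splits)
  have m12: "Sp_minor \<theta> 1 2 \<in> ?B" and m32: "Sp_minor \<theta> 3 2 \<in> ?B" and "\<ominus>\<^bsub>?A\<^esub> Sp_minor \<theta> 3 1 \<in> ?B"
    by (auto intro: star_subalg.gen simp: Sp_minor_gens_def)
  then have m31: "Sp_minor \<theta> 3 1 \<in> ?B"
    using scale[of "- 1" "Sp_minor \<theta> 3 1"] by (simp add: Sp.minus_smult)
  have m14: "Sp_minor \<theta> 1 4 \<in> ?B" using star[OF m32] by simp
  have m24: "Sp_minor \<theta> 2 4 \<in> ?B" using star[OF m31] by simp
  have z: "Sp_minor \<theta> i i \<in> ?B" if "i \<in> ix" for i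
  proof -
    have "iota ?A (Sp_minor \<theta> i i) = iota ?A (0 \<odot>\<^bsub>?A\<^esub> \<one>\<^bsub>?A\<^esub>)"
      using that SpX.mnr_self[of 1 i \<theta>] by (simp add: iota_Sp_minor)
    then have "Sp_minor \<theta> i i = 0 \<odot>\<^bsub>?A\<^esub> \<one>\<^bsub>?A\<^esub>"
      using that by (subst (asm) Sp.iota_eq_iff) simp_all
    then show ?thesis using star_subalg.smult[OF star_subalg.one, where A = ?A] by metis
  qed
  have "iota ?A (Sp_minor \<theta> 3 4) = iota ?A (\<one>\<^bsub>?A\<^esub> \<oplus>\<^bsub>?A\<^esub> (- 1) \<odot>\<^bsub>?A\<^esub> Sp_minor \<theta> 1 2)"
    using SpX.mnr_col_sum[of 1 \<theta>] by (simp add: iota_Sp_minor algebra_simps)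
  then have "Sp_minor \<theta> 3 4 = \<one>\<^bsub>?A\<^esub> \<oplus>\<^bsub>?A\<^esub> (- 1) \<odot>\<^bsub>?A\<^esub> Sp_minor \<theta> 1 2"
    by (subst (asm) Sp.iota_eq_iff) simp_all
  then have m34: "Sp_minor \<theta> 3 4 \<in> ?B"
    using m12 by (auto intro: star_subalg.intros)
  show ?thesis
    using assms m12 m31 m32 m14 m24 m34 z swap[OF m12] swap[OF m31] swap[OF m32] swap[OF m14] swap[OF m24] swap[OF m34]
    by (auto elim!: ix_cases)
qed

lemma minor_alg_star_subalg:
  assumes "iota (Sp_alg \<theta>) f \<in> SpX.minor_alg \<theta>" "f \<in> carrier (Sp_alg \<theta>)"
  shows "f \<in> star_subalg (Sp_alg \<theta>) (Sp_minor_gens \<theta>)"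
proof -
  let ?A = "Sp_alg \<theta>" and ?B = "star_subalg (Sp_alg \<theta>) (Sp_minor_gens \<theta>)"
  have B: "x \<in> carrier ?A" if "x \<in> ?B" for x
    using star_subalg_closed[OF Sp_salg Sp_minor_gens_closed] that by auto
  have "\<exists>g\<in>?B. t = iota ?A g" if "t \<in> SpX.minor_alg \<theta>" for t
    using that
  proof induction
    case e
    then show ?case by (intro bexI[of _ "\<one>\<^bsub>?A\<^esub>"]) (simp_all add: star_subalg.one)
  next
    case (mnr i j)
    then show ?case by (intro bexI[of _ "Sp_minor \<theta> i j"]) (simp_all add: iota_Sp_minor Sp_minor_in_star_subalg)
  next
    case (add x y)
    then obtain g g' where "g \<in> ?B" "g' \<in> ?B" "x = iota ?A g" "y = iota ?A g'" by auto
    then show ?case by (intro bexI[of _ "g \<oplus>\<^bsub>?A\<^esub> g'"]) (simp_all add: B star_subalg.add)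
  next
    case (mult x y)
    then obtain g g' where "g \<in> ?B" "g' \<in> ?B" "x = iota ?A g" "y = iota ?A g'" by auto
    then show ?case by (intro bexI[of _ "g \<otimes>\<^bsub>?A\<^esub> g'"]) (simp_all add: B star_subalg.mult)
  next
    case (scale x c)
    then obtain g where "g \<in> ?B" "x = iota ?A g" by auto
    then show ?case by (intro bexI[of _ "c \<odot>\<^bsub>?A\<^esub> g"]) (simp_all add: B star_subalg.smult)
  qed
  then obtain g where g: "g \<in> ?B" "iota ?A f = iota ?A g" using assms(1) by blast
  then show ?thesis using Sp.iota_eq_iff[OF assms(2) B[OF g(1)]] by simp
qed

text \<open>In the coaction the first two columns are multiplied by a 2 by 2 block of determinant 1,
  and minors are multiplicative.\<close>

lemma Sp_minor_coinvariant:
  assumes "i \<in> ix" "j \<in> ix"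
  shows "Sp_minor \<theta> i j \<in> J_coinvariants \<theta>"
proof -
  interpret D: alg_pair "Sp_alg \<theta>" "J_quot \<theta>"
    by (simp add: alg_pair_def Sp.alg_axioms J_quot_alg)
  interpret Q: alg "J_quot \<theta>" by (rule J_quot_alg)
  let ?A = "Sp_alg \<theta>" and ?Q = "J_quot \<theta>" and ?i = "iota D.T"
  define P where "P i j = ?i (tens ?A ?Q (Sp_mat \<theta> i j) \<one>\<^bsub>?Q\<^esub>)" for i j
  define R where "R i j = ?i (tens ?A ?Q \<one>\<^bsub>?A\<^esub> (J_proj \<theta> (Sp_mat \<theta> i j)))" for i j
  have proj: "J_proj \<theta> x \<in> carrier ?Q" if "x \<in> carrier ?A" for x
    using J_proj_hom[of \<theta>] that by (auto simp: alg_hom_iff)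
  have one: "J_proj \<theta> \<one>\<^bsub>?A\<^esub> = \<one>\<^bsub>?Q\<^esub>"
    using J_proj_hom[of \<theta>] by (simp add: alg_hom_iff)
  have "typed_hom ?A (\<lambda>x. ?i (tens ?A ?Q \<one>\<^bsub>?A\<^esub> (J_proj \<theta> x)))"
    using D.typed_hom_tens_right J_proj_hom[of \<theta>] proj by (auto simp: typed_hom_def alg_hom_iff)
  from Sp_sp_mat[OF this] interpret R: sp_mat \<theta> R "?i \<one>\<^bsub>D.T\<^esub>"
    unfolding R_def[abs_def] by (simp add: one D.tens_one)
  interpret P: sp_mat \<theta> P "?i \<one>\<^bsub>D.T\<^esub>"
    using Sp_sp_mat[OF D.typed_hom_tens_left] unfolding P_def[abs_def] by (simp add: D.tens_one)
  have PR: "R i j * P k l = P k l * R i j" "R i j * (P k l * z) = P k l * (R i j * z)" if "i \<in> ix" "j \<in> ix" "k \<in> ix" "l \<in> ix" for i j k l z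
  proof -
    show *: "R i j * P k l = P k l * R i j"
      using that by (simp add: P_def R_def D.T.iota_mult[symmetric] D.tens_mult proj del: D.T.iota_mult)
    show "R i j * (P k l * z) = P k l * (R i j * z)"
      by (simp add: mult.assoc[symmetric] *)
  qed
  have Roff: "R i j = 0" if "i \<in> ix" "j \<in> ix" "\<not> same_block i j" for i j
    using that by (simp add: R_def J_proj_off_block)
  have co: "?i (J_coaction \<theta> (Sp_mat \<theta> i j)) = (\<Sum>k\<in>ix. P i k * R k j)" if "i \<in> ix" "j \<in> ix" for i j
  proof -
    have "?i (J_coaction \<theta> (Sp_mat \<theta> i j)) = (\<Sum>k\<in>ix. ?i (tens ?A ?Q (Sp_mat \<theta> i k) (J_proj \<theta> (Sp_mat \<theta> k j))))"
      unfolding J_coaction_mat[OF that] using that proj by (intro D.T.iota_finsum) auto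
    then show ?thesis
      using that by (simp add: P_def R_def D.T.iota_mult[symmetric] D.tens_mult proj del: D.T.iota_mult)
  qed
  have coc: "J_coaction \<theta> x \<in> carrier D.T" if "x \<in> carrier ?A" for x
    using J_coaction_hom[of \<theta>] that by (auto simp: alg_hom_iff)
  have "typed_hom ?A (\<lambda>x. ?i (J_coaction \<theta> x))"
    by (rule D.T.typed_hom_alg_hom[OF J_coaction_hom])
  note hom = Sp.typed_hom_diff[OF this] typed_homD[OF this]
  have off: "R 3 1 = 0" "R 4 1 = 0" "R 3 2 = 0" "R 4 2 = 0"
    by (simp_all add: Roff same_block_def)
  \<comment> \<open>With the entries of the block \<open>c\<close> gone, the column sum is the
    determinant of the upper block alone.\<close>
  have det: "R 1 1 * R 2 2 - R 1 2 * R 2 1 = ?i \<one>\<^bsub>D.T\<^esub>"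
    using R.mnr_col_sum[of 1] by (simp add: R.mnr_def off)
  have comm: "R 1 2 * R 1 1 = R 1 1 * R 1 2" "R 2 2 * R 1 1 = R 1 1 * R 2 2" "R 2 1 * R 1 2 = R 1 2 * R 2 1" "R 2 2 * R 2 1 = R 2 1 * R 2 2"
    using R.X_comm[of 1 2 1 1] R.X_comm[of 2 2 1 1] R.X_comm[of 2 1 1 2] R.X_comm[of 2 2 2 1] by (simp_all add: eta_simps)
  have "?i (J_coaction \<theta> (Sp_minor \<theta> i j)) =
    (P i 1 * R 1 1 + P i 2 * R 2 1) * (P j 1 * R 1 2 + P j 2 * R 2 2) - (P i 1 * R 1 2 + P i 2 * R 2 2) * (P j 1 * R 1 1 + P j 2 * R 2 1)"
    using assms by (simp add: Sp_minor_def hom co sum_ix off)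
  also have "\<dots> = (P i 1 * P j 2 - P i 2 * P j 1) * (R 1 1 * R 2 2 - R 1 2 * R 2 1)"
    using assms by (simp add: ring_distribs mult.assoc PR comm algebra_simps)
  also have "\<dots> = ?i (tens ?A ?Q (Sp_minor \<theta> i j) \<one>\<^bsub>?Q\<^esub>)"
    unfolding det using assms Sp.typed_hom_diff[OF D.typed_hom_tens_left] typed_homD(2)[OF D.typed_hom_tens_left]
    by (simp add: Sp_minor_def P_def[symmetric] ring_distribs mult.assoc)
  finally have "J_coaction \<theta> (Sp_minor \<theta> i j) = tens ?A ?Q (Sp_minor \<theta> i j) \<one>\<^bsub>?Q\<^esub>"
    using assms by (subst (asm) D.T.iota_eq_iff) (simp_all add: coc)
  then show ?thesis
    using assms by (simp add: J_coinvariants_def coinvariants_def)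
qed

lemma J_coinvariants_subalg:
  shows "\<one>\<^bsub>Sp_alg \<theta>\<^esub> \<in> J_coinvariants \<theta>"
    and "x \<in> J_coinvariants \<theta> \<Longrightarrow> y \<in> J_coinvariants \<theta> \<Longrightarrow> x \<oplus>\<^bsub>Sp_alg \<theta>\<^esub> y \<in> J_coinvariants \<theta>"
    and "x \<in> J_coinvariants \<theta> \<Longrightarrow> y \<in> J_coinvariants \<theta> \<Longrightarrow> x \<otimes>\<^bsub>Sp_alg \<theta>\<^esub> y \<in> J_coinvariants \<theta>"
    and "x \<in> J_coinvariants \<theta> \<Longrightarrow> c \<odot>\<^bsub>Sp_alg \<theta>\<^esub> x \<in> J_coinvariants \<theta>"
proof -
  interpret D: alg_pair "Sp_alg \<theta>" "J_quot \<theta>"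
    by (simp add: alg_pair_def Sp.alg_axioms J_quot_alg)
  interpret Q: alg "J_quot \<theta>" by (rule J_quot_alg)
  show "\<one>\<^bsub>Sp_alg \<theta>\<^esub> \<in> J_coinvariants \<theta>"
    "x \<in> J_coinvariants \<theta> \<Longrightarrow> y \<in> J_coinvariants \<theta> \<Longrightarrow> x \<oplus>\<^bsub>Sp_alg \<theta>\<^esub> y \<in> J_coinvariants \<theta>"
    "x \<in> J_coinvariants \<theta> \<Longrightarrow> y \<in> J_coinvariants \<theta> \<Longrightarrow> x \<otimes>\<^bsub>Sp_alg \<theta>\<^esub> y \<in> J_coinvariants \<theta>"
    "x \<in> J_coinvariants \<theta> \<Longrightarrow> c \<odot>\<^bsub>Sp_alg \<theta>\<^esub> x \<in> J_coinvariants \<theta>"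
    using J_coaction_hom[of \<theta>]
    by (simp_all add: J_coinvariants_def coinvariants_def alg_hom_iff D.tens_one D.tens_add_left D.tens_mult D.tens_smult_left)
qed

lemma J_coinvariants_closed: "x \<in> J_coinvariants \<theta> \<Longrightarrow> x \<in> carrier (Sp_alg \<theta>)"
  by (simp add: J_coinvariants_def coinvariants_def)

theorem J_coinvariants_eq: "J_coinvariants \<theta> = star_subalg (Sp_alg \<theta>) (Sp_minor_gens \<theta>)"
proof
  show "J_coinvariants \<theta> \<subseteq> star_subalg (Sp_alg \<theta>) (Sp_minor_gens \<theta>)"
    using coinvariant_minor_alg minor_alg_star_subalg
    by (auto simp: J_coinvariants_def coinvariants_def)
  let ?C = "J_coinvariants \<theta>"
  \<comment> \<open>Element and adjoint are treated together; this takes the place of compatibility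
    of the coaction with the star.\<close>
  have "x \<in> ?C \<and> star (Sp_alg \<theta>) x \<in> ?C" if "x \<in> star_subalg (Sp_alg \<theta>) (Sp_minor_gens \<theta>)" for x
    using that
  proof induction
    case (gen x)
    have m: "Sp_minor \<theta> i j \<in> ?C" "star (Sp_alg \<theta>) (Sp_minor \<theta> i j) \<in> ?C" if "i \<in> ix" "j \<in> ix" for i j
      using that by (simp_all add: Sp_minor_coinvariant Sp_minor_star J_coinvariants_subalg(4))
    moreover have "\<ominus>\<^bsub>Sp_alg \<theta>\<^esub> y = (- 1) \<odot>\<^bsub>Sp_alg \<theta>\<^esub> y" if "y \<in> carrier (Sp_alg \<theta>)" for y
      using that by (simp add: Sp.minus_smult)
    moreover have "star (Sp_alg \<theta>) (\<ominus>\<^bsub>Sp_alg \<theta>\<^esub> Sp_minor \<theta> 3 1) = (- 1) \<odot>\<^bsub>Sp_alg \<theta>\<^esub> star (Sp_alg \<theta>) (Sp_minor \<theta> 3 1)"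
      by (simp add: Sp.star_minus Sp.minus_smult)
    ultimately show ?case
      using gen J_coinvariants_subalg(4)[OF m(1)[of 3 1], of "- 1"] J_coinvariants_subalg(4)[OF m(2)[of 3 1], of "- 1"]
      by (auto simp: Sp_minor_gens_def)
  next
    case (star x)
    then show ?case using J_coinvariants_closed by auto
  next
    case (mult x y)
    then show ?case
      by (metis Sp.star_mult J_coinvariants_closed J_coinvariants_subalg(3))
  next
    case (add x y)
    then show ?case
      by (metis Sp.star_add J_coinvariants_closed J_coinvariants_subalg(2))
  next
    case (smult x c)
    then show ?case
      by (metis Sp.star_smult J_coinvariants_closed J_coinvariants_subalg(4))
  next
    case one
    show ?case by (simp add: J_coinvariants_subalg)
  qed
  then show "star_subalg (Sp_alg \<theta>) (Sp_minor_gens \<theta>) \<subseteq> ?C" by blast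
qed

section \<open>The quantum sphere\<close>

definition cx :: "nat set" where "cx = {1, 2}"

lemma cx_mem [simp]: "1 \<in> cx" "2 \<in> cx"
  by (simp_all add: cx_def)

lemma cx_cases: "a \<in> cx \<Longrightarrow> (a = 1 \<Longrightarrow> P) \<Longrightarrow> (a = 2 \<Longrightarrow> P) \<Longrightarrow> P"
  by (auto simp: cx_def)

lemma cx_ix [simp]: "a \<in> cx \<Longrightarrow> a \<in> ix"
  by (auto simp: cx_def)

lemma cj_cx [simp]: "a \<in> cx \<Longrightarrow> cj a \<in> cx"
  by (auto simp: cx_def)

lemma sum_cx: "(\<Sum>k\<in>cx. f k) = f 1 + f (2 :: nat)" for f :: "nat \<Rightarrow> 'a::comm_monoid_add"
  by (simp add: cx_def)

lemma eta_cx: "a \<in> cx \<Longrightarrow> b \<in> cx \<Longrightarrow> eta \<theta> a b = 1"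
  by (auto elim!: cx_cases simp: eta_simps)

text \<open>The relations of the sphere without the star: z_1^* z_1 is \<open>u 2 2 * u 1 1\<close>,
  z_2^* z_2 is \<open>- (u 2 1 * u 1 2)\<close>, and so on. Column phases do not show, as
  \<open>eta\<close> is 1 on the columns 1, 2.\<close>

locale sphere_mat =
  fixes \<theta> :: real and u :: "nat \<Rightarrow> nat \<Rightarrow> 'a::calg" and e :: 'a
  assumes ee [simp]: "e * e = e"
    and eu [simp]: "i \<in> ix \<Longrightarrow> a \<in> cx \<Longrightarrow> e * u i a = u i a"
    and ue [simp]: "i \<in> ix \<Longrightarrow> a \<in> cx \<Longrightarrow> u i a * e = u i a"
    and u_comm: "i \<in> ix \<Longrightarrow> j \<in> ix \<Longrightarrow> a \<in> cx \<Longrightarrow> b \<in> cx \<Longrightarrow>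
      u i a * u j b = eta \<theta> j i *c (u j b * u i a)"
    and sphere: "u 2 2 * u 1 1 - u 2 1 * u 1 2 + u 4 2 * u 3 1 - u 4 1 * u 3 2 = e"

lemma (in sp_mat) sphere_mat: "sphere_mat \<theta> X e"
proof
  show "X 2 2 * X 1 1 - X 2 1 * X 1 2 + X 4 2 * X 3 1 - X 4 1 * X 3 2 = e"
    using mnr_col_sum[of 1] X_comm[of 2 2 1 1] X_comm[of 2 1 1 2] X_comm[of 4 2 3 1] X_comm[of 4 1 3 2]
    by (simp add: mnr_def eta_simps add_diff_eq)
  show "X i a * X j b = eta \<theta> j i *c (X j b * X i a)" if "i \<in> ix" "j \<in> ix" "a \<in> cx" "b \<in> cx" for i j a b
    using X_comm[of i a j b] that by (simp add: eta_cx)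
qed simp_all

lemma u_mat_simps:
  "u_mat B v 1 1 = v gen_z1" "u_mat B v 1 2 = v gen_z2"
  "u_mat B v 2 1 = \<ominus>\<^bsub>B\<^esub> star B (v gen_z2)" "u_mat B v 2 2 = star B (v gen_z1)"
  "u_mat B v 3 1 = v gen_z3" "u_mat B v 3 2 = v gen_z4"
  "u_mat B v 4 1 = \<ominus>\<^bsub>B\<^esub> star B (v gen_z4)" "u_mat B v 4 2 = star B (v gen_z3)"
  by (simp_all add: u_mat_def Let_def mat_entry_def)

primrec z_row :: "S7_gen \<Rightarrow> nat" where
  "z_row gen_z1 = 1" | "z_row gen_z2 = 1" | "z_row gen_z3 = 3" | "z_row gen_z4 = 3"

primrec z_col :: "S7_gen \<Rightarrow> nat" where
  "z_col gen_z1 = 1" | "z_col gen_z2 = 2" | "z_col gen_z3 = 1" | "z_col gen_z4 = 2"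

lemma z_row_col_ix [simp]: "z_row g \<in> ix" "z_col g \<in> cx"
  by (cases g; simp)+

lemma u_mat_gen: "u_mat B v (z_row g) (z_col g) = v g"
  by (cases g) (simp_all add: u_mat_simps)

context salg begin

lemma u_mat_closed [simp]: "(\<And>g. v g \<in> carrier A) \<Longrightarrow> i \<in> ix \<Longrightarrow> a \<in> cx \<Longrightarrow> u_mat A v i a \<in> carrier A"
  by (auto elim!: ix_cases cx_cases simp: u_mat_simps)

lemma u_mat_star:
  "(\<And>g. v g \<in> carrier A) \<Longrightarrow> i \<in> ix \<Longrightarrow> a \<in> cx \<Longrightarrow> star A (u_mat A v i a) = sg (i + a) \<odot> u_mat A v (cj i) (cj a)"
  by (auto elim!: ix_cases cx_cases simp: u_mat_simps star_minus minus_smult)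

lemma u_mat_star_gen:
  "(\<And>g. v g \<in> carrier A) \<Longrightarrow> star A (v g) = sg (z_row g + z_col g) \<odot> u_mat A v (cj (z_row g)) (cj (z_col g))"
  using u_mat_star[of v "z_row g" "z_col g"] by (simp add: u_mat_gen)

lemma u_mat_typed_hom:
  assumes h: "typed_hom A h" and v: "\<And>g. v g \<in> carrier A"
    and hv: "\<And>g. h (v g) = u (z_row g) (z_col g)"
    "\<And>g. h (star A (v g)) = sg (z_row g + z_col g) *c u (cj (z_row g)) (cj (z_col g))"
    and ia: "i \<in> ix" "a \<in> cx"
  shows "h (u_mat A v i a) = u i a"
  using ia v hv(1)[of gen_z1] hv(1)[of gen_z2] hv(1)[of gen_z3] hv(1)[of gen_z4]
    hv(2)[of gen_z1] hv(2)[of gen_z2] hv(2)[of gen_z3] hv(2)[of gen_z4]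
  by (auto elim!: ix_cases cx_cases simp: u_mat_simps typed_hom_minus[OF h])

end

lemma (in salg_ideal) u_mat_quot:
  assumes "\<And>g. v g \<in> carrier A" "i \<in> ix" "a \<in> cx"
  shows "u_mat (quot_alg A I) (\<lambda>g. I +> v g) i a = I +> u_mat A v i a"
  using assms(2,3)
  by (auto elim!: ix_cases cx_cases simp: u_mat_simps quot_star quot_minus assms(1))

section \<open>Presentation and universal property of the seven-sphere\<close>

abbreviation free_u :: "nat \<Rightarrow> nat \<Rightarrow> S7_gen free_elt" where
  "free_u \<equiv> u_mat free_star_alg free_gen"

definition S7_rels :: "real \<Rightarrow> S7_gen free_elt set" where
  "S7_rels \<theta> = {free_u i a \<otimes>\<^bsub>free_star_alg\<^esub> free_u j b \<ominus>\<^bsub>free_star_alg\<^esub>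
     eta \<theta> j i \<odot>\<^bsub>free_star_alg\<^esub> (free_u j b \<otimes>\<^bsub>free_star_alg\<^esub> free_u i a) | i j a b.
       i \<in> ix \<and> j \<in> ix \<and> a \<in> cx \<and> b \<in> cx}"

definition S7_rad :: "S7_gen free_elt" where
  "S7_rad = (\<Oplus>\<^bsub>free_star_alg\<^esub>g\<in>{gen_z1, gen_z2, gen_z3, gen_z4}. star free_star_alg (free_gen g) \<otimes>\<^bsub>free_star_alg\<^esub> free_gen g)"

lemma S7_ideal_eq: "S7_ideal \<theta> = star_genideal free_star_alg
    (S7_rels \<theta> \<union> {S7_rad \<ominus>\<^bsub>free_star_alg\<^esub> \<one>\<^bsub>free_star_alg\<^esub>})"
proof -
  have cx: "{1..2} = cx"
    by (auto simp: cx_def)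
  show ?thesis
    unfolding S7_ideal_def Let_def S7_rels_def S7_rad_def ix_atLeastAtMost cx
    by (intro arg_cong[where f = "star_genideal free_star_alg"] arg_cong2[where f = "(\<union>)"] refl) auto
qed

interpretation FS: salg "free_star_alg :: S7_gen free_elt star_algebra"
  by (rule free_salg)

lemma S7_rad_eq: "S7_rad = star free_star_alg (free_gen gen_z1) \<otimes>\<^bsub>free_star_alg\<^esub> free_gen gen_z1 \<oplus>\<^bsub>free_star_alg\<^esub>
    (star free_star_alg (free_gen gen_z2) \<otimes>\<^bsub>free_star_alg\<^esub> free_gen gen_z2 \<oplus>\<^bsub>free_star_alg\<^esub>
    (star free_star_alg (free_gen gen_z3) \<otimes>\<^bsub>free_star_alg\<^esub> free_gen gen_z3 \<oplus>\<^bsub>free_star_alg\<^esub>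
     star free_star_alg (free_gen gen_z4) \<otimes>\<^bsub>free_star_alg\<^esub> free_gen gen_z4))"
  unfolding S7_rad_def by (simp add: FS.finsum_insert)

lemma S7_rad_star: "star free_star_alg S7_rad = S7_rad"
  by (simp add: S7_rad_eq FS.star_add FS.star_mult)

lemma S7_salg_ideal: "salg_ideal (free_star_alg :: S7_gen free_elt star_algebra) (S7_ideal \<theta>)"
  unfolding S7_ideal_eq by (rule FS.salg_ideal_star_genideal) (simp add: subset_iff)

lemmas FSI_quot_mult = alg_ideal.quot_mult[OF salg_ideal.axioms(2)[OF S7_salg_ideal]]
lemmas FSI_quot_smult = alg_ideal.quot_smult[OF salg_ideal.axioms(2)[OF S7_salg_ideal]]
lemmas FSI_quot_one = alg_ideal.quot_one[OF salg_ideal.axioms(2)[OF S7_salg_ideal]]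
lemmas FSI_quot_add = alg_ideal.quot_add[OF salg_ideal.axioms(2)[OF S7_salg_ideal]]
lemmas FSI_coset_eq_iff = alg_ideal.coset_eq_iff[OF salg_ideal.axioms(2)[OF S7_salg_ideal]]
lemmas FSI_typed_hom_quot = alg_ideal.typed_hom_quot[OF salg_ideal.axioms(2)[OF S7_salg_ideal]]
lemmas FSI_quot_carrierI = alg_ideal.quot_carrierI[OF salg_ideal.axioms(2)[OF S7_salg_ideal]]
lemmas FSI_quot_carrierE = alg_ideal.quot_carrierE[OF salg_ideal.axioms(2)[OF S7_salg_ideal]]
lemmas FSI_quot_star = salg_ideal.quot_star[OF S7_salg_ideal]

interpretation S7: salg "S7_alg \<theta>"
  unfolding S7_alg_def by (rule salg_ideal.quot_salg[OF S7_salg_ideal])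

lemma S7_val_closed [simp]: "S7_val \<theta> g \<in> carrier (S7_alg \<theta>)"
  by (simp add: S7_alg_def S7_val_def FSI_quot_carrierI)

abbreviation S7_mat :: "real \<Rightarrow> nat \<Rightarrow> nat \<Rightarrow> S7_elt" where
  "S7_mat \<theta> \<equiv> u_mat (S7_alg \<theta>) (S7_val \<theta>)"

lemma S7_mat_eq: "i \<in> ix \<Longrightarrow> a \<in> cx \<Longrightarrow> S7_mat \<theta> i a = S7_ideal \<theta> +>\<^bsub>free_star_alg\<^esub> free_u i a"
  using salg_ideal.u_mat_quot[OF S7_salg_ideal, of free_gen i a \<theta>] by (simp add: S7_alg_def S7_val_def[abs_def])

lemma S7_mat_comm:
  assumes "i \<in> ix" "j \<in> ix" "a \<in> cx" "b \<in> cx"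
  shows "S7_mat \<theta> i a \<otimes>\<^bsub>S7_alg \<theta>\<^esub> S7_mat \<theta> j b = eta \<theta> j i \<odot>\<^bsub>S7_alg \<theta>\<^esub> (S7_mat \<theta> j b \<otimes>\<^bsub>S7_alg \<theta>\<^esub> S7_mat \<theta> i a)"
proof -
  have "free_u i a \<otimes>\<^bsub>free_star_alg\<^esub> free_u j b \<ominus>\<^bsub>free_star_alg\<^esub>
     eta \<theta> j i \<odot>\<^bsub>free_star_alg\<^esub> (free_u j b \<otimes>\<^bsub>free_star_alg\<^esub> free_u i a) \<in> S7_ideal \<theta>"
    unfolding S7_ideal_eq using assms
    by (intro subsetD[OF FS.star_genideal(3)]) (auto simp: S7_rels_def)
  then show ?thesis
    using assms
    by (simp add: S7_mat_eq) (simp add: S7_alg_def FSI_quot_mult FSI_quot_smult FSI_coset_eq_iff)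
qed

lemma S7_sphere:
  "star (S7_alg \<theta>) (S7_val \<theta> gen_z1) \<otimes>\<^bsub>S7_alg \<theta>\<^esub> S7_val \<theta> gen_z1 \<oplus>\<^bsub>S7_alg \<theta>\<^esub>
    (star (S7_alg \<theta>) (S7_val \<theta> gen_z2) \<otimes>\<^bsub>S7_alg \<theta>\<^esub> S7_val \<theta> gen_z2 \<oplus>\<^bsub>S7_alg \<theta>\<^esub>
    (star (S7_alg \<theta>) (S7_val \<theta> gen_z3) \<otimes>\<^bsub>S7_alg \<theta>\<^esub> S7_val \<theta> gen_z3 \<oplus>\<^bsub>S7_alg \<theta>\<^esub>
     star (S7_alg \<theta>) (S7_val \<theta> gen_z4) \<otimes>\<^bsub>S7_alg \<theta>\<^esub> S7_val \<theta> gen_z4)) = \<one>\<^bsub>S7_alg \<theta>\<^esub>"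
proof -
  have "S7_rad \<ominus>\<^bsub>free_star_alg\<^esub> \<one>\<^bsub>free_star_alg\<^esub> \<in> S7_ideal \<theta>"
    unfolding S7_ideal_eq by (intro subsetD[OF FS.star_genideal(3)]) auto
  then show ?thesis
    by (simp add: S7_val_def S7_alg_def FSI_quot_star FSI_quot_mult FSI_quot_add FSI_quot_one FSI_coset_eq_iff S7_rad_eq)
qed

lemma S7_sphere_mat:
  assumes h: "typed_hom (S7_alg \<theta>) h"
  shows "sphere_mat \<theta> (\<lambda>i a. h (S7_mat \<theta> i a)) (h \<one>\<^bsub>S7_alg \<theta>\<^esub>)"
proof
  fix i j a b assume "i \<in> ix" "j \<in> ix" "a \<in> cx" "b \<in> cx"
  then show "h (S7_mat \<theta> i a) * h (S7_mat \<theta> j b) = eta \<theta> j i *c (h (S7_mat \<theta> j b) * h (S7_mat \<theta> i a))"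
    using S7_mat_comm[of i j a b \<theta>] by (simp add: typed_homD[OF h, symmetric])
next
  show "h (S7_mat \<theta> 2 2) * h (S7_mat \<theta> 1 1) - h (S7_mat \<theta> 2 1) * h (S7_mat \<theta> 1 2) +
    h (S7_mat \<theta> 4 2) * h (S7_mat \<theta> 3 1) - h (S7_mat \<theta> 4 1) * h (S7_mat \<theta> 3 2) = h \<one>\<^bsub>S7_alg \<theta>\<^esub>"
    unfolding S7_sphere[of \<theta>, symmetric] by (simp add: u_mat_simps typed_homD[OF h] S7.typed_hom_minus[OF h])
qed (simp_all add: typed_homD[OF h, symmetric])

lemma S7_universal:
  assumes "sphere_mat \<theta> u e"
  shows "\<exists>h. typed_hom (S7_alg \<theta>) h \<and> h \<one>\<^bsub>S7_alg \<theta>\<^esub> = e \<and> (\<forall>i\<in>ix. \<forall>a\<in>cx. h (S7_mat \<theta> i a) = u i a)"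
proof -
  interpret sphere_mat \<theta> u e by fact
  let ?f = "\<lambda>(g, b). if b then sg (z_row g + z_col g) *c u (cj (z_row g)) (cj (z_col g)) else u (z_row g) (z_col g)"
  have f: "e * ?f l = ?f l" "?f l * e = ?f l" for l
    by (cases l; simp)+
  obtain h where h: "typed_hom (free_star_alg :: S7_gen free_elt star_algebra) h" and h1: "h \<one>\<^bsub>free_star_alg\<^esub> = e"
    and hg: "\<And>g. h (free_gen g) = u (z_row g) (z_col g)"
      "\<And>g. h (star free_star_alg (free_gen g)) = sg (z_row g + z_col g) *c u (cj (z_row g)) (cj (z_col g))"
    using free_typed_hom[of e ?f, OF ee f] by auto
  have hm: "h (free_u i a) = u i a" if "i \<in> ix" "a \<in> cx" for i a
    by (rule FS.u_mat_typed_hom[OF h]) (auto simp: hg that)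
  have rad: "h S7_rad = e"
    unfolding sphere[symmetric] by (simp add: S7_rad_eq typed_homD[OF h] hg)
  have "h x = 0" if "x \<in> S7_ideal \<theta>" for x
  proof (rule FS.typed_hom_star_genideal[OF h _ _ _ that[unfolded S7_ideal_eq]])
    fix x assume x: "x \<in> S7_rels \<theta> \<union> {S7_rad \<ominus>\<^bsub>free_star_alg\<^esub> \<one>\<^bsub>free_star_alg\<^esub>}"
    have "h x = 0 \<and> h (star free_star_alg x) = 0"
    proof (cases "x \<in> S7_rels \<theta>")
      case True
      then obtain i j a b where ix: "i \<in> ix" "j \<in> ix" "a \<in> cx" "b \<in> cx"
        and x: "x = free_u i a \<otimes>\<^bsub>free_star_alg\<^esub> free_u j b \<ominus>\<^bsub>free_star_alg\<^esub>
          eta \<theta> j i \<odot>\<^bsub>free_star_alg\<^esub> (free_u j b \<otimes>\<^bsub>free_star_alg\<^esub> free_u i a)"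
        by (auto simp: S7_rels_def)
      have "h x = 0"
        using u_comm[of i j a b] ix by (simp add: x FS.typed_hom_diff[OF h] typed_homD[OF h] hm)
      moreover have "h (star free_star_alg x) = 0"
        using u_comm[of "cj j" "cj i" "cj b" "cj a"] ix
        by (simp add: x FS.star_diff FS.star_mult FS.star_smult FS.u_mat_star FS.typed_hom_diff[OF h]
            typed_homD[OF h] hm eta_cj eta_cnj mult_ac)
      ultimately show ?thesis by simp
    next
      case False
      then show ?thesis
        using x by (auto simp: FS.star_diff S7_rad_star FS.typed_hom_diff[OF h] rad h1)
    qed
    then show "h x = 0" "h (star free_star_alg x) = 0" by simp_all
  qed auto
  then obtain h' where h': "typed_hom (S7_alg \<theta>) h'" "\<And>x. h' (S7_ideal \<theta> +>\<^bsub>free_star_alg\<^esub> x) = h x"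
    using FSI_typed_hom_quot[OF h, of \<theta>] by (auto simp: S7_alg_def)
  moreover have "h' \<one>\<^bsub>S7_alg \<theta>\<^esub> = e"
    using h1 by (simp add: S7_alg_def FSI_quot_one h'(2))
  ultimately show ?thesis
    by (intro exI[of _ h']) (auto simp: S7_mat_eq hm)
qed

lemma S7_induct [consumes 1, case_names one add mult smult entry]:
  assumes x: "x \<in> carrier (S7_alg \<theta>)"
    and one: "P \<one>\<^bsub>S7_alg \<theta>\<^esub>"
    and add: "\<And>x y. x \<in> carrier (S7_alg \<theta>) \<Longrightarrow> y \<in> carrier (S7_alg \<theta>) \<Longrightarrow> P x \<Longrightarrow> P y \<Longrightarrow> P (x \<oplus>\<^bsub>S7_alg \<theta>\<^esub> y)"
    and mult: "\<And>x y. x \<in> carrier (S7_alg \<theta>) \<Longrightarrow> y \<in> carrier (S7_alg \<theta>) \<Longrightarrow> P x \<Longrightarrow> P y \<Longrightarrow> P (x \<otimes>\<^bsub>S7_alg \<theta>\<^esub> y)"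
    and smult: "\<And>c x. x \<in> carrier (S7_alg \<theta>) \<Longrightarrow> P x \<Longrightarrow> P (c \<odot>\<^bsub>S7_alg \<theta>\<^esub> x)"
    and entry: "\<And>i a. i \<in> ix \<Longrightarrow> a \<in> cx \<Longrightarrow> P (S7_mat \<theta> i a)"
  shows "P x"
proof -
  let ?pr = "\<lambda>y. S7_ideal \<theta> +>\<^bsub>free_star_alg\<^esub> y"
  have cl: "?pr y \<in> carrier (S7_alg \<theta>)" for y
    by (simp add: S7_alg_def FSI_quot_carrierI)
  have pr_star: "?pr (star free_star_alg (free_gen g)) = star (S7_alg \<theta>) (S7_val \<theta> g)" for g
    by (simp add: S7_alg_def S7_val_def FSI_quot_star)
  obtain y where "x = ?pr y"
    using x unfolding S7_alg_def by (metis FSI_quot_carrierE)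
  moreover have "P (?pr y)"
  proof (induction y rule: free_induct)
    case one
    then show ?case using \<open>P \<one>\<^bsub>S7_alg \<theta>\<^esub>\<close> by (simp add: S7_alg_def FSI_quot_one)
  next
    case (add y z)
    then show ?case using assms(3)[OF cl cl add(1,2)] by (simp add: S7_alg_def FSI_quot_add)
  next
    case (mult y z)
    then show ?case using assms(4)[OF cl cl mult(1,2)] by (simp add: S7_alg_def FSI_quot_mult)
  next
    case (smult c y)
    then show ?case using assms(5)[OF cl smult(1), of c] by (simp add: S7_alg_def FSI_quot_smult)
  next
    case (gen g)
    then show ?case using entry[of "z_row g" "z_col g"] by (simp add: u_mat_gen S7_val_def)
  next
    case (star g)
    show ?case
      using assms(5)[OF _ entry[of "cj (z_row g)" "cj (z_col g)"], of "sg (z_row g + z_col g)"]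
      by (simp add: pr_star S7.u_mat_star_gen)
  qed
  ultimately show ?thesis by simp
qed

section \<open>The projection complementary to the two columns of the sphere\<close>

context sphere_mat begin

lemma eu_left [simp]: "i \<in> ix \<Longrightarrow> a \<in> cx \<Longrightarrow> e * (u i a * z) = u i a * z"
  by (simp add: mult.assoc[symmetric])

lemma ue_left [simp]: "i \<in> ix \<Longrightarrow> a \<in> cx \<Longrightarrow> u i a * (e * z) = u i a * z"
  by (simp add: mult.assoc[symmetric])

lemma u_comm_left:
  "i \<in> ix \<Longrightarrow> j \<in> ix \<Longrightarrow> a \<in> cx \<Longrightarrow> b \<in> cx \<Longrightarrow>
    u i a * (u j b * z) = eta \<theta> j i *c (u j b * (u i a * z))"
  using u_comm[of i j a b] by (simp add: mult.assoc[symmetric])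

text \<open>This is u^* u = 1: both diagonal entries are the sphere relation up to reordering, and
  in the others the terms cancel in pairs.\<close>

lemma unit_u:
  assumes "a \<in> cx" "b \<in> cx"
  shows "(\<Sum>k\<in>ix. sg (k + a) *c (u (cj k) (cj a) * u k b)) = (if a = b then e else 0)"
  using assms sphere u_comm[of 2 1 2 1] u_comm[of 2 1 1 2] u_comm[of 4 3 2 1] u_comm[of 4 3 1 2]
    u_comm[of 2 1 2 2] u_comm[of 2 1 1 1] u_comm[of 4 3 2 2] u_comm[of 4 3 1 1]
  by (auto elim!: cx_cases simp: sum_ix eta_simps algebra_simps)

text \<open>Entries of 1 - u u^*. By the sphere relation the entry \<open>(1, 1)\<close> is z_3
  z_3^* + z_4 z_4^* and the entry \<open>(3, 3)\<close> is z_1 z_1^* + z_2 z_2^*, the two central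
  elements to be inverted.\<close>

definition proj :: "nat \<Rightarrow> nat \<Rightarrow> 'a" where
  "proj i j = (if i = j then e else 0) - (\<Sum>a\<in>cx. sg (j + a) *c (u i a * u (cj j) (cj a)))"

lemma e_proj [simp]: "i \<in> ix \<Longrightarrow> j \<in> ix \<Longrightarrow> e * proj i j = proj i j"
    "i \<in> ix \<Longrightarrow> j \<in> ix \<Longrightarrow> proj i j * e = proj i j"
  by (simp_all add: proj_def ring_distribs sum_cx mult.assoc)

lemma proj_u:
  assumes "i \<in> ix" "b \<in> cx"
  shows "(\<Sum>k\<in>ix. proj i k * u k b) = 0"
proof -
  have "(\<Sum>k\<in>ix. proj i k * u k b) = (\<Sum>k\<in>ix. if i = k then u k b else 0) -
     (\<Sum>k\<in>ix. \<Sum>a\<in>cx. u i a * sg (k + a) *c (u (cj k) (cj a) * u k b))"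
    using assms by (simp add: proj_def left_diff_distrib sum_subtractf sum_distrib_right mult.assoc if_distrib[of "\<lambda>x. x * _"] cong: if_cong sum.cong)
  also have "(\<Sum>k\<in>ix. \<Sum>a\<in>cx. u i a * sg (k + a) *c (u (cj k) (cj a) * u k b)) =
     (\<Sum>a\<in>cx. u i a * (\<Sum>k\<in>ix. sg (k + a) *c (u (cj k) (cj a) * u k b)))"
    by (subst sum.swap) (simp add: sum_distrib_left)
  also have "\<dots> = (\<Sum>a\<in>cx. u i a * (if a = b then e else 0))"
    using assms by (intro sum.cong refl) (simp only: unit_u)
  also have "\<dots> = u i b"
    using assms by (auto elim!: cx_cases simp: sum_cx)
  finally show ?thesis using assms by simp
qed

lemma ustar_proj:
  assumes "a \<in> cx" "j \<in> ix"
  shows "(\<Sum>k\<in>ix. sg (k + a) *c (u (cj k) (cj a) * proj k j)) = 0"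
proof -
  have "(\<Sum>k\<in>ix. sg (k + a) *c (u (cj k) (cj a) * proj k j)) = (\<Sum>k\<in>ix. if k = j then sg (k + a) *c u (cj k) (cj a) else 0) -
     (\<Sum>k\<in>ix. \<Sum>b\<in>cx. sg (k + a) *c ((u (cj k) (cj a) * u k b) * sg (j + b) *c u (cj j) (cj b)))"
    using assms by (simp add: proj_def right_diff_distrib cscale_diff_right sum_subtractf sum_distrib_left cscale_sum_right mult.assoc
        if_distrib[of "\<lambda>x. _ * x"] if_distrib[of "\<lambda>x. _ *c x"] cong: if_cong sum.cong)
  also have "(\<Sum>k\<in>ix. \<Sum>b\<in>cx. sg (k + a) *c ((u (cj k) (cj a) * u k b) * sg (j + b) *c u (cj j) (cj b))) =
     (\<Sum>b\<in>cx. (\<Sum>k\<in>ix. sg (k + a) *c (u (cj k) (cj a) * u k b)) * sg (j + b) *c u (cj j) (cj b))"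
    by (subst sum.swap) (simp add: sum_distrib_right cscale_sum_right mult_ac)
  also have "\<dots> = (\<Sum>b\<in>cx. (if a = b then e else 0) * sg (j + b) *c u (cj j) (cj b))"
    using assms by (intro sum.cong refl) (simp only: unit_u)
  also have "\<dots> = sg (j + a) *c u (cj j) (cj a)"
    using assms by (auto elim!: cx_cases simp: sum_cx)
  finally show ?thesis using assms by simp
qed

lemma proj_proj:
  assumes "i \<in> ix" "j \<in> ix"
  shows "(\<Sum>k\<in>ix. proj i k * proj k j) = proj i j"
proof -
  have "proj i k * proj k j = (if k = j then proj i k else 0) - (\<Sum>a\<in>cx. (proj i k * u k a) * sg (j + a) *c u (cj j) (cj a))"
    if "k \<in> ix" for k
    using assms that by (subst proj_def[of k j]) (simp add: right_diff_distrib sum_distrib_left mult.assoc)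
  then have "(\<Sum>k\<in>ix. proj i k * proj k j) = (\<Sum>k\<in>ix. if k = j then proj i k else 0) -
     (\<Sum>k\<in>ix. \<Sum>a\<in>cx. (proj i k * u k a) * sg (j + a) *c u (cj j) (cj a))"
    by (simp add: sum_subtractf cong: sum.cong)
  also have "(\<Sum>k\<in>ix. \<Sum>a\<in>cx. (proj i k * u k a) * sg (j + a) *c u (cj j) (cj a)) =
     (\<Sum>a\<in>cx. (\<Sum>k\<in>ix. proj i k * u k a) * sg (j + a) *c u (cj j) (cj a))"
    by (subst sum.swap) (simp add: sum_distrib_right cscale_sum_right)
  also have "\<dots> = 0"
    using assms by (intro sum.neutral ballI) (simp add: proj_u)
  finally show ?thesis using assms by simp
qed

text \<open>The quaternionic symmetry of the projection: conjugating both indices amounts to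
  transposition, up to a sign and a phase.\<close>

lemma proj_cj:
  assumes "i \<in> ix" "j \<in> ix"
  shows "proj (cj i) (cj j) = (sg (i + j) * eta \<theta> i j) *c proj j i"
  using assms u_comm[of "cj i" j 1 2] u_comm[of "cj i" j 2 1]
  by (auto simp: proj_def sum_cx cj_eq_iff eta_cj cscale_diff_right cscale_add_right cscale_sum_right mult_ac)

lemma u_proj:
  assumes "k \<in> ix" "a \<in> cx" "i \<in> ix" "j \<in> ix"
  shows "u k a * proj i j = (eta \<theta> i k * eta \<theta> k j) *c (proj i j * u k a)"
proof -
  have 1: "u k a * (u i b * u (cj j) (cj b)) = (eta \<theta> i k * eta \<theta> k j) *c (u i b * (u (cj j) (cj b) * u k a))" if "b \<in> cx" for b
    using assms that u_comm_left[of k i a b] u_comm[of k "cj j" a "cj b"] by (simp add: eta_cj)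
  show ?thesis
    using assms 1[of 1] 1[of 2] unfolding proj_def
    by (auto simp: ring_distribs sum_cx mult.assoc cscale_add_right cscale_diff_right mult_ac)
qed

lemma proj_comm:
  assumes "i \<in> ix" "j \<in> ix" "k \<in> ix" "l \<in> ix"
  shows "proj k l * proj i j = (eta \<theta> i k * eta \<theta> k j * eta \<theta> l i * eta \<theta> j l) *c (proj i j * proj k l)"
proof -
  have 1: "u k a * (u (cj l) (cj a) * proj i j) = (eta \<theta> i k * eta \<theta> k j * eta \<theta> l i * eta \<theta> j l) *c (proj i j * (u k a * u (cj l) (cj a)))" if "a \<in> cx" for a
  proof -
    have "u (cj l) (cj a) * proj i j = (eta \<theta> l i * eta \<theta> j l) *c (proj i j * u (cj l) (cj a))"
      using assms that u_proj[of "cj l" "cj a" i j] by (simp add: eta_cj)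
    moreover have "u k a * (proj i j * z) = (eta \<theta> i k * eta \<theta> k j) *c (proj i j * (u k a * z))" for z
      using assms that u_proj[of k a i j] by (simp add: mult.assoc[symmetric])
    ultimately show ?thesis by (simp add: mult_ac)
  qed
  define c where "c = eta \<theta> i k * eta \<theta> k j * eta \<theta> l i * eta \<theta> j l"
  have 2: "c = 1" if "k = l"
    using assms that eta_swap(2)[of i l \<theta> "eta \<theta> l j * eta \<theta> j l"] by (simp add: c_def mult_ac)
  show ?thesis
    using assms 1[of 1] 1[of 2] 2 unfolding proj_def[of k l] c_def[symmetric]
    by (auto simp: ring_distribs sum_cx mult.assoc cscale_add_right cscale_diff_right mult_ac)
qed

end

section \<open>Completing the two columns to a symplectic matrix\<close>

definition col :: "nat \<Rightarrow> nat \<Rightarrow> nat" where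
  "col \<kappa> \<gamma> = (if \<gamma> = 3 then \<kappa> else \<kappa> + 1)"

text \<open>In a localisation of the sphere the last two columns of a symplectic matrix are the two
  columns \<open>\<kappa>\<close>, \<open>\<kappa> + 1\<close> of the projection \<open>1 - u u\<^sup>*\<close>, normalised by \<open>y\<close>.\<close>

locale sphere_completion = sphere_mat +
  fixes \<kappa> :: nat and y :: "nat \<Rightarrow> 'a"
  assumes kappa: "\<kappa> = 1 \<or> \<kappa> = 3"
    and ye: "\<gamma> \<in> {3, 4} \<Longrightarrow> y \<gamma> * e = y \<gamma>" "\<gamma> \<in> {3, 4} \<Longrightarrow> e * y \<gamma> = y \<gamma>"
    and u_y: "i \<in> ix \<Longrightarrow> a \<in> cx \<Longrightarrow> \<gamma> \<in> {3, 4} \<Longrightarrow>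
      u i a * y \<gamma> = (eta \<theta> (col \<kappa> \<gamma>) i * eta \<theta> a \<gamma>) *c (y \<gamma> * u i a)"
    and y_comm: "y 3 * y 4 = y 4 * y 3"
    and e_y: "proj \<kappa> \<kappa> * (y 3 * y 4) = e"
begin

lemma col_simps:
  assumes "\<gamma> \<in> {3, 4}"
  shows "col \<kappa> \<gamma> \<in> ix" "cj (col \<kappa> \<gamma>) = col \<kappa> (cj \<gamma>)" "sg (col \<kappa> \<gamma>) = sg \<gamma>" "cj \<gamma> \<in> {3, 4}" "\<gamma> \<in> ix"
  using assms kappa by (auto simp: col_def)

lemma eta_col: "\<gamma> \<in> {3, 4} \<Longrightarrow> \<delta> \<in> {3, 4} \<Longrightarrow> eta \<theta> (col \<kappa> \<gamma>) (col \<kappa> \<delta>) = 1" "\<gamma> \<in> {3, 4} \<Longrightarrow> \<delta> \<in> {3, 4} \<Longrightarrow> eta \<theta> \<gamma> \<delta> = 1"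
    "\<gamma> \<in> {3, 4} \<Longrightarrow> \<delta> \<in> {3, 4} \<Longrightarrow> col \<kappa> \<gamma> = col \<kappa> \<delta> \<longleftrightarrow> \<gamma> = \<delta>"
  using kappa by (auto simp: col_def eta_simps)

definition compl :: "nat \<Rightarrow> nat \<Rightarrow> 'a" where
  "compl i j = (if j \<in> cx then u i j else proj i (col \<kappa> j) * y j)"

lemma y_y: "\<gamma> \<in> {3, 4} \<Longrightarrow> \<delta> \<in> {3, 4} \<Longrightarrow> y \<gamma> * y \<delta> = y \<delta> * y \<gamma>"
  using y_comm by auto

text \<open>In each summand of the projection the column phases of \<open>a\<close> and
  \<open>cj a\<close> cancel, so only the phase of the row \<open>i\<close> is left.\<close>

lemma proj_y:
  assumes "i \<in> ix" "j \<in> {3, 4}" "\<gamma> \<in> {3, 4}"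
  shows "proj i (col \<kappa> j) * y \<gamma> = eta \<theta> (col \<kappa> \<gamma>) i *c (y \<gamma> * proj i (col \<kappa> j))"
proof -
  let ?j = "col \<kappa> j" and ?g = "col \<kappa> \<gamma>"
  have g: "?j \<in> ix" "?g \<in> ix" "\<gamma> \<in> ix" "cj ?j = col \<kappa> (cj j)"
    using col_simps[OF assms(2)] col_simps[OF assms(3)] by auto
  have 1: "u i a * (u (cj ?j) (cj a) * y \<gamma>) = eta \<theta> ?g i *c (y \<gamma> * (u i a * u (cj ?j) (cj a)))" if "a \<in> cx" for a
  proof -
    have "u (cj ?j) (cj a) * y \<gamma> = eta \<theta> (cj a) \<gamma> *c (y \<gamma> * u (cj ?j) (cj a))"
      using assms that g u_y[of "cj ?j" "cj a" \<gamma>] eta_col(1)[of \<gamma> "cj j"] col_simps(4)[of j] cj_ix[OF g(1)] by simp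
    moreover have "u i a * y \<gamma> = (eta \<theta> ?g i * eta \<theta> a \<gamma>) *c (y \<gamma> * u i a)"
      using assms that by (intro u_y) auto
    moreover have eta1: "eta \<theta> a \<gamma> * (eta \<theta> (cj a) \<gamma> * z) = z" for z
      using that g by (simp add: eta_cj)
    ultimately show ?thesis
      by (simp add: mult.assoc[symmetric]) (simp add: mult_ac eta1)
  qed
  have 2: "eta \<theta> ?g ?j = 1" "e * y \<gamma> = y \<gamma>" "y \<gamma> * e = y \<gamma>"
    using assms eta_col(1) ye by auto
  show ?thesis
    using 1[of 1] 1[of 2] 2 assms unfolding proj_def
    by (auto simp: ring_distribs sum_cx mult.assoc cscale_add_right cscale_diff_right mult_ac)
qed

text \<open>The diagonal blocks of the projection are scalar: their off-diagonal entries are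
  commutators of commuting entries, and their diagonal entries agree. Hence the single element
  \<open>proj \<kappa> \<kappa>\<close> normalises both columns.\<close>

lemma proj_block:
  assumes "\<gamma> \<in> {3, 4}" "\<delta> \<in> {3, 4}"
  shows "proj (col \<kappa> \<gamma>) (col \<kappa> \<delta>) = (if \<gamma> = \<delta> then proj \<kappa> \<kappa> else 0)"
proof -
  have "u i 2 * u i 1 = u i 1 * u i 2" if "i \<in> ix" for i
    using that u_comm[of i i 2 1] by simp
  note self = this[of 1] this[of 2] this[of 3] this[of 4]
  have "u i b * u j a = u j a * u i b" if "eta \<theta> j i = 1" "i \<in> ix" "j \<in> ix" "a \<in> cx" "b \<in> cx" for i j a b
    using that u_comm[of i j b a] by simp
  note pair = this[of 2 1 1 2] this[of 2 1 2 1] this[of 4 3 1 2] this[of 4 3 2 1]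
  consider "\<gamma> = 3" "\<delta> = 3" | "\<gamma> = 3" "\<delta> = 4" | "\<gamma> = 4" "\<delta> = 3" | "\<gamma> = 4" "\<delta> = 4"
    using assms by auto
  then show ?thesis
    using kappa self pair by cases (elim disjE; simp add: proj_def col_def sum_cx eta_simps)+
qed

lemma y_proj:
  assumes "i \<in> ix" "j \<in> {3, 4}" "\<gamma> \<in> {3, 4}"
  shows "y \<gamma> * (proj i (col \<kappa> j) * z) = eta \<theta> i (col \<kappa> \<gamma>) *c (proj i (col \<kappa> j) * (y \<gamma> * z))"
  using proj_y[OF assms] assms col_simps(1)[of \<gamma>] by (simp add: mult.assoc[symmetric])

text \<open>The phase of \<open>y \<gamma>\<close> removes the trace of the column
  \<open>col \<kappa> \<gamma>\<close> of the projection and supplies the phase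
  \<open>eta \<theta> a \<gamma>\<close> expected of column \<open>\<gamma>\<close>; this is what
  the assumption \<open>u_y\<close> is made for.\<close>

lemma compl_mixed:
  assumes "i \<in> ix" "a \<in> cx" "k \<in> ix" "\<gamma> \<in> {3, 4}"
  shows "compl i a * compl k \<gamma> = (eta \<theta> k i * eta \<theta> a \<gamma>) *c (compl k \<gamma> * compl i a)"
proof -
  have g: "col \<kappa> \<gamma> \<in> ix" "\<gamma> \<notin> cx"
    using assms col_simps(1)[of \<gamma>] by (auto simp: cx_def)
  have "u i a * (proj k (col \<kappa> \<gamma>) * y \<gamma>) = (eta \<theta> k i * eta \<theta> i (col \<kappa> \<gamma>)) *c (proj k (col \<kappa> \<gamma>) * (u i a * y \<gamma>))"
    using assms g u_proj[of i a k "col \<kappa> \<gamma>"] by (simp add: mult.assoc[symmetric])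
  also have "u i a * y \<gamma> = (eta \<theta> (col \<kappa> \<gamma>) i * eta \<theta> a \<gamma>) *c (y \<gamma> * u i a)"
    using assms by (intro u_y) auto
  finally show ?thesis
    using assms g by (simp add: compl_def mult.assoc)
qed

lemma compl_comm:
  assumes "i \<in> ix" "\<gamma> \<in> {3, 4}" "k \<in> ix" "\<delta> \<in> {3, 4}"
  shows "compl i \<gamma> * compl k \<delta> = eta \<theta> k i *c (compl k \<delta> * compl i \<gamma>)"
proof -
  let ?g = "col \<kappa> \<gamma>" and ?d = "col \<kappa> \<delta>"
  have g: "?g \<in> ix" "?d \<in> ix" "\<gamma> \<notin> cx" "\<delta> \<notin> cx"
    using assms col_simps(1)[of \<gamma>] col_simps(1)[of \<delta>] by (auto simp: cx_def)
  have 1: "proj i ?g * y \<gamma> * (proj k ?d * y \<delta>) = eta \<theta> k ?g *c ((proj i ?g * proj k ?d) * (y \<gamma> * y \<delta>))"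
    using assms by (simp add: mult.assoc y_proj)
  have 2: "proj k ?d * y \<delta> * (proj i ?g * y \<gamma>) = eta \<theta> i ?d *c ((proj k ?d * proj i ?g) * (y \<delta> * y \<gamma>))"
    using assms by (simp add: mult.assoc y_proj)
  have 3: "proj i ?g * proj k ?d = (eta \<theta> k i * eta \<theta> i ?d * eta \<theta> ?g k) *c (proj k ?d * proj i ?g)"
    using assms g proj_comm[of k ?d i ?g] eta_col(1)[of \<delta> \<gamma>] by simp
  have 4: "eta \<theta> k ?g * (eta \<theta> ?g k * z) = z" for z
    using assms g by simp
  have "proj i ?g * y \<gamma> * (proj k ?d * y \<delta>) = eta \<theta> k i *c (proj k ?d * y \<delta> * (proj i ?g * y \<gamma>))"
    unfolding 1 2 3 y_y[OF assms(2,4)] by (simp add: mult_ac 4 assms g)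
  then show ?thesis using g by (simp add: compl_def)
qed

text \<open>With p = 1 - u u^*, the products with the first two columns vanish because p u = 0, and
  those with the last two reduce by p p = p to the scalar block, which \<open>e_y\<close>
  normalises.\<close>

lemma compl_unit:
  assumes "\<gamma> \<in> {3, 4}" "j \<in> ix"
  shows "(\<Sum>k\<in>ix. sg (k + \<gamma>) *c (compl (cj k) (cj \<gamma>) * compl k j)) = (if \<gamma> = j then e else 0)"
proof -
  let ?g = "col \<kappa> \<gamma>"
  have g: "?g \<in> ix" "cj ?g = col \<kappa> (cj \<gamma>)" "sg ?g = sg \<gamma>" "cj \<gamma> \<in> {3, 4}" "\<gamma> \<in> ix" "cj \<gamma> \<notin> cx"
    using col_simps[OF assms(1)] by (auto simp: cx_def)
  have hd: "sg (k + \<gamma>) *c (compl (cj k) (cj \<gamma>) * w) = proj ?g k * (eta \<theta> k ?g *c (y (cj \<gamma>) * w))" if "k \<in> ix" for k w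
  proof -
    have "compl (cj k) (cj \<gamma>) = proj (cj k) (cj ?g) * y (cj \<gamma>)"
      using g by (simp add: compl_def)
    also have "proj (cj k) (cj ?g) = (sg (k + \<gamma>) * eta \<theta> k ?g) *c proj ?g k"
      using proj_cj[OF that g(1)] g(3) by simp
    finally show ?thesis by (simp add: mult_ac)
  qed
  have sum: "(\<Sum>k\<in>ix. sg (k + \<gamma>) *c (compl (cj k) (cj \<gamma>) * compl k j)) =
      (\<Sum>k\<in>ix. proj ?g k * (eta \<theta> k ?g *c (y (cj \<gamma>) * compl k j)))"
    by (intro sum.cong refl hd)
  show ?thesis
  proof (cases "j \<in> cx")
    case True
    have "eta \<theta> k ?g *c (y (cj \<gamma>) * u k j) = eta \<theta> j \<gamma> *c (u k j * y (cj \<gamma>))" if "k \<in> ix" for k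
    proof -
      have "u k j * y (cj \<gamma>) = (eta \<theta> k ?g * eta \<theta> \<gamma> j) *c (y (cj \<gamma>) * u k j)"
        using u_y[OF that True g(4), folded g(2)] that True g(1,5) by (simp add: eta_cj)
      then show ?thesis
        by (simp add: mult_ac that True g)
    qed
    then have "(\<Sum>k\<in>ix. sg (k + \<gamma>) *c (compl (cj k) (cj \<gamma>) * compl k j)) = eta \<theta> j \<gamma> *c ((\<Sum>k\<in>ix. proj ?g k * u k j) * y (cj \<gamma>))"
      unfolding sum using True by (simp add: compl_def sum_distrib_right cscale_sum_right mult.assoc cong: sum.cong)
    moreover have "\<gamma> \<noteq> j" using True assms by (auto simp: cx_def)
    ultimately show ?thesis using True g(1) proj_u[of ?g j] by simp
  next
    case False
    then have j: "j \<in> {3, 4}" using assms(2) by (auto elim!: ix_cases simp: cx_def)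
    let ?j = "col \<kappa> j"
    have gj: "eta \<theta> (cj ?g) ?j = 1" "?j \<in> ix"
      using eta_col(1)[OF g(4) j] g(2) col_simps(1)[OF j] by auto
    have "eta \<theta> k ?g *c (y (cj \<gamma>) * (proj k ?j * y j)) = proj k ?j * (y (cj \<gamma>) * y j)" if "k \<in> ix" for k
      using y_proj[OF that j g(4), of "y j", folded g(2)] that g(1) by (simp add: eta_cj)
    then have "(\<Sum>k\<in>ix. sg (k + \<gamma>) *c (compl (cj k) (cj \<gamma>) * compl k j)) = (\<Sum>k\<in>ix. proj ?g k * proj k ?j) * (y (cj \<gamma>) * y j)"
      unfolding sum using False by (simp add: compl_def sum_distrib_right mult.assoc cong: sum.cong)
    also have "\<dots> = (if \<gamma> = j then e else 0)"
      using proj_proj[OF g(1) gj(2)] proj_block[OF assms(1) j] e_y y_comm assms(1) by auto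
    finally show ?thesis .
  qed
qed

lemma sp_mat_compl: "sp_mat \<theta> compl e"
proof
  have c: "\<gamma> \<in> {3, 4}" "\<gamma> \<in> ix" if "\<gamma> \<in> ix" "\<gamma> \<notin> cx" for \<gamma>
    using that by (auto elim!: ix_cases simp: cx_def)
  have e: "e * compl i j = compl i j \<and> compl i j * e = compl i j" if "i \<in> ix" "j \<in> ix" for i j
  proof (cases "j \<in> cx")
    case False
    then have "j \<in> {3, 4}" using c that by blast
    then show ?thesis
      using e_proj(1)[OF that(1) col_simps(1)] ye(1) by (simp add: compl_def mult.assoc[symmetric] False) (simp add: mult.assoc)
  qed (simp add: compl_def that)
  then show "e * compl i j = compl i j" "compl i j * e = compl i j" if "i \<in> ix" "j \<in> ix" for i j
    using that by auto
  show "compl i j * compl k l = (eta \<theta> k i * eta \<theta> j l) *c (compl k l * compl i j)"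
    if ix: "i \<in> ix" "j \<in> ix" "k \<in> ix" "l \<in> ix" for i j k l
  proof -
    consider "j \<in> cx" "l \<in> cx" | "j \<in> cx" "l \<in> {3, 4}" | "j \<in> {3, 4}" "l \<in> cx" | "j \<in> {3, 4}" "l \<in> {3, 4}"
      using c ix by blast
    then show ?thesis
    proof cases
      case 1
      then show ?thesis using u_comm[of i k j l] ix by (simp add: compl_def eta_cx)
    next
      case 2
      then show ?thesis using compl_mixed ix by blast
    next
      case 3
      then have "compl k l * compl i j = (eta \<theta> i k * eta \<theta> l j) *c (compl i j * compl k l)"
        using compl_mixed ix by blast
      then show ?thesis using ix by (simp add: mult_ac)
    next
      case 4
      then show ?thesis using compl_comm[of i j k l] eta_col(2)[of j l] ix by simp
    qed
  qed
  show "(\<Sum>k\<in>ix. sg (k + i) *c (compl (cj k) (cj i) * compl k j)) = (if i = j then e else 0)"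
    if ij: "i \<in> ix" "j \<in> ix" for i j
  proof (cases "i \<in> cx")
    case True
    show ?thesis
    proof (cases "j \<in> cx")
      case j: True
      then show ?thesis using unit_u[OF True j] True by (simp add: compl_def)
    next
      case False
      have j: "col \<kappa> j \<in> ix" using c[OF ij(2) False] col_simps(1) by blast
      have "(\<Sum>k\<in>ix. sg (k + i) *c (compl (cj k) (cj i) * compl k j)) =
        (\<Sum>k\<in>ix. sg (k + i) *c (u (cj k) (cj i) * proj k (col \<kappa> j))) * y j"
        using True False by (simp add: compl_def sum_distrib_right mult.assoc)
      also have "\<dots> = 0" unfolding ustar_proj[OF True j] by simp
      finally show ?thesis using True False by auto
    qed
  next
    case False
    then show ?thesis using compl_unit[of i j] c ij by blast
  qed
qed simp

end

section \<open>Germs of double sequences as a localisation\<close>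

text \<open>The localisation is modelled on double sequences \<open>h\<close> satisfying \<open>h (i + 1) (j + 1) = r h i j\<close>
  for large \<open>i\<close>, \<open>j\<close>, modulo those that vanish for large \<open>i\<close>, \<open>j\<close>: shifting both indices
  inverts \<open>r\<close>.\<close>

definition ev2 :: "(nat \<Rightarrow> nat \<Rightarrow> bool) \<Rightarrow> bool" where
  "ev2 P \<longleftrightarrow> (\<exists>N. \<forall>i\<ge>N. \<forall>j\<ge>N. P i j)"

lemma ev2I: "(\<And>i j. i \<ge> N \<Longrightarrow> j \<ge> N \<Longrightarrow> P i j) \<Longrightarrow> ev2 P"
  by (auto simp: ev2_def)

lemma ev2_mono2:
  assumes "ev2 P" "ev2 Q" "\<And>i j. P i j \<Longrightarrow> Q i j \<Longrightarrow> R i j"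
  shows "ev2 R"
proof -
  obtain M N where "\<forall>i\<ge>M. \<forall>j\<ge>M. P i j" "\<forall>i\<ge>N. \<forall>j\<ge>N. Q i j"
    using assms(1,2) by (auto simp: ev2_def)
  then show ?thesis using assms(3) by (intro ev2I[of "max M N"]) auto
qed

lemma ev2_mono: "ev2 P \<Longrightarrow> (\<And>i j. P i j \<Longrightarrow> R i j) \<Longrightarrow> ev2 R"
  using ev2_mono2[of P P R] by blast

lemma ev2_shift: "ev2 P \<Longrightarrow> ev2 (\<lambda>i j. i > 0 \<and> P (i - 1) j)" "ev2 P \<Longrightarrow> ev2 (\<lambda>i j. j > 0 \<and> P i (j - 1))"
proof -
  assume "ev2 P"
  then obtain N where N: "\<forall>i\<ge>N. \<forall>j\<ge>N. P i j" by (auto simp: ev2_def)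
  show "ev2 (\<lambda>i j. i > 0 \<and> P (i - 1) j)" "ev2 (\<lambda>i j. j > 0 \<and> P i (j - 1))"
    using N by (auto intro!: ev2I[of "Suc N"])
qed

type_synonym 'a dseq = "nat \<Rightarrow> nat \<Rightarrow> 'a"

definition null_dseq :: "'a::calg dseq set" where
  "null_dseq = {h. ev2 (\<lambda>i j. h i j = 0)}"

definition geom_dseq :: "'a::calg \<Rightarrow> 'a \<Rightarrow> 'a dseq set" where
  "geom_dseq r e = {h. (\<forall>i j. e * h i j = h i j) \<and> ev2 (\<lambda>i j. h (Suc i) (Suc j) = r * h i j)}"

text \<open>Operators rather than sequences form the localised algebra, since multiplications and
  shifts must both live in it. Preserving geometric and null sequences lets them act on
  germs.\<close>

definition dseq_ops :: "'a::calg \<Rightarrow> 'a \<Rightarrow> ('a dseq \<Rightarrow> 'a dseq) set" where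
  "dseq_ops r e = {T. (\<forall>h k. T (\<lambda>i j. h i j + k i j) = (\<lambda>i j. T h i j + T k i j)) \<and>
     (\<forall>c h. T (\<lambda>i j. c *c h i j) = (\<lambda>i j. c *c T h i j)) \<and>
     (\<forall>h\<in>geom_dseq r e. T h \<in> geom_dseq r e) \<and> (\<forall>h\<in>null_dseq. T h \<in> null_dseq)}"

definition dseq_alg :: "'a::calg \<Rightarrow> 'a \<Rightarrow> ('a dseq \<Rightarrow> 'a dseq) star_algebra" where
  "dseq_alg r e = \<lparr>carrier = dseq_ops r e, mult = (\<lambda>S T h. S (T h)), one = (\<lambda>h. h), zero = (\<lambda>h i j. 0),
     add = (\<lambda>S T h i j. S h i j + T h i j), smult = (\<lambda>c T h i j. c *c T h i j), star = (\<lambda>T. T)\<rparr>"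

lemma dseq_alg_simps [simp]:
  "carrier (dseq_alg r e) = dseq_ops r e"
  "S \<otimes>\<^bsub>dseq_alg r e\<^esub> T = (\<lambda>h. S (T h))"
  "\<one>\<^bsub>dseq_alg r e\<^esub> = (\<lambda>h. h)"
  "\<zero>\<^bsub>dseq_alg r e\<^esub> = (\<lambda>h i j. 0)"
  "S \<oplus>\<^bsub>dseq_alg r e\<^esub> T = (\<lambda>h i j. S h i j + T h i j)"
  "c \<odot>\<^bsub>dseq_alg r e\<^esub> T = (\<lambda>h i j. c *c T h i j)"
  by (simp_all add: dseq_alg_def)

lemma null_dseq_closed:
  "(\<lambda>i j. 0) \<in> null_dseq" "h \<in> null_dseq \<Longrightarrow> k \<in> null_dseq \<Longrightarrow> (\<lambda>i j. h i j + k i j) \<in> null_dseq"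
  "h \<in> null_dseq \<Longrightarrow> (\<lambda>i j. c *c h i j) \<in> null_dseq"
  by (auto simp: null_dseq_def intro: ev2I elim: ev2_mono ev2_mono2)

lemma geom_dseq_closed:
  "(\<lambda>i j. 0) \<in> geom_dseq r e" "h \<in> geom_dseq r e \<Longrightarrow> k \<in> geom_dseq r e \<Longrightarrow> (\<lambda>i j. h i j + k i j) \<in> geom_dseq r e"
  "h \<in> geom_dseq r e \<Longrightarrow> (\<lambda>i j. c *c h i j) \<in> geom_dseq r e"
  by (auto simp: geom_dseq_def ring_distribs intro: ev2I elim: ev2_mono ev2_mono2)

lemma dseq_opsD:
  assumes "T \<in> dseq_ops r e"
  shows "T (\<lambda>i j. h i j + k i j) = (\<lambda>i j. T h i j + T k i j)" "T (\<lambda>i j. c *c h i j) = (\<lambda>i j. c *c T h i j)"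
    "h \<in> geom_dseq r e \<Longrightarrow> T h \<in> geom_dseq r e" "h \<in> null_dseq \<Longrightarrow> T h \<in> null_dseq"
  using assms by (auto simp: dseq_ops_def)

lemma dseq_ops_closed:
  "(\<lambda>h. h) \<in> dseq_ops r e" "(\<lambda>h i j. 0) \<in> dseq_ops r e"
  "S \<in> dseq_ops r e \<Longrightarrow> T \<in> dseq_ops r e \<Longrightarrow> (\<lambda>h i j. S h i j + T h i j) \<in> dseq_ops r e"
  "S \<in> dseq_ops r e \<Longrightarrow> T \<in> dseq_ops r e \<Longrightarrow> (\<lambda>h. S (T h)) \<in> dseq_ops r e"
  "T \<in> dseq_ops r e \<Longrightarrow> (\<lambda>h i j. c *c T h i j) \<in> dseq_ops r e"
proof -
  show "S \<in> dseq_ops r e \<Longrightarrow> T \<in> dseq_ops r e \<Longrightarrow> (\<lambda>h i j. S h i j + T h i j) \<in> dseq_ops r e"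
    unfolding dseq_ops_def by (auto simp: null_dseq_closed geom_dseq_closed cscale_add_right add_ac)
  show "T \<in> dseq_ops r e \<Longrightarrow> (\<lambda>h i j. c *c T h i j) \<in> dseq_ops r e"
    unfolding dseq_ops_def by (auto simp: null_dseq_closed geom_dseq_closed cscale_add_right mult_ac)
qed (auto simp: dseq_ops_def null_dseq_closed geom_dseq_closed)

lemma dseq_minus_closed:
  "T \<in> dseq_ops r e \<Longrightarrow> (\<lambda>h i j. - T h i j) \<in> dseq_ops r e" "h \<in> null_dseq \<Longrightarrow> (\<lambda>i j. - h i j) \<in> null_dseq"
  using dseq_ops_closed(5)[of T r e "- 1"] null_dseq_closed(3)[of h "- 1"] by simp_all

lemma dseq_alg: "alg (dseq_alg r e)"
proof -
  have "ring (dseq_alg r e)"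
  proof (intro ringI abelian_groupI monoidI)
    fix T assume "T \<in> carrier (dseq_alg r e)"
    then show "\<exists>S\<in>carrier (dseq_alg r e). S \<oplus>\<^bsub>dseq_alg r e\<^esub> T = \<zero>\<^bsub>dseq_alg r e\<^esub>"
      by (intro bexI[of _ "\<lambda>h i j. (- 1) *c T h i j"]) (auto simp: dseq_minus_closed)
  qed (auto simp: dseq_ops_closed dseq_opsD(1) add_ac)
  then show ?thesis
    by (auto simp: alg_def alg_axioms_def dseq_ops_closed dseq_opsD(2) cscale_add_right cscale_add_left)
qed

text \<open>The operators that act as zero on germs; dividing by them makes the action
  faithful.\<close>

definition dseq_null_ops :: "'a::calg \<Rightarrow> 'a \<Rightarrow> ('a dseq \<Rightarrow> 'a dseq) set" where
  "dseq_null_ops r e = {T \<in> dseq_ops r e. \<forall>h\<in>geom_dseq r e. T h \<in> null_dseq}"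

lemma dseq_alg_ideal: "alg_ideal (dseq_alg r e) (dseq_null_ops r e)"
proof -
  interpret E: alg "dseq_alg r e" by (rule dseq_alg)
  have "subgroup (dseq_null_ops r e) (add_monoid (dseq_alg r e))"
  proof
    fix T assume T: "T \<in> dseq_null_ops r e"
    then have "T \<in> carrier (dseq_alg r e)" by (simp add: dseq_null_ops_def)
    from E.minus_smult[OF this, of 1] T
    have "\<ominus>\<^bsub>dseq_alg r e\<^esub> T = (\<lambda>h i j. (- 1) *c T h i j)"
      by simp
    then show "inv\<^bsub>add_monoid (dseq_alg r e)\<^esub> T \<in> dseq_null_ops r e"
      using T unfolding a_inv_def[symmetric] by (simp only:) (auto simp: dseq_null_ops_def dseq_minus_closed)
  qed (auto simp: dseq_null_ops_def dseq_ops_closed null_dseq_closed)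
  then have "ideal (dseq_null_ops r e) (dseq_alg r e)"
    by (intro idealI E.ring_axioms) (auto simp: dseq_null_ops_def dseq_ops_closed dseq_opsD)
  then show ?thesis
    by (intro alg_ideal.intro E.alg_axioms)
qed

definition germ_alg :: "'a::calg \<Rightarrow> 'a \<Rightarrow> ('a dseq \<Rightarrow> 'a dseq) set star_algebra" where
  "germ_alg r e = quot_alg (dseq_alg r e) (dseq_null_ops r e)"

definition germ :: "'a::calg \<Rightarrow> 'a \<Rightarrow> ('a dseq \<Rightarrow> 'a dseq) \<Rightarrow> ('a dseq \<Rightarrow> 'a dseq) set algprod" where
  "germ r e T = iota (germ_alg r e) (dseq_null_ops r e +>\<^bsub>dseq_alg r e\<^esub> T)"

lemma germ_hom:
  assumes "S \<in> dseq_ops r e" "T \<in> dseq_ops r e"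
  shows "germ r e S * germ r e T = germ r e (\<lambda>h. S (T h))"
    "germ r e S + germ r e T = germ r e (\<lambda>h i j. S h i j + T h i j)"
    "c *c germ r e T = germ r e (\<lambda>h i j. c *c T h i j)"
    "germ r e S - germ r e T = germ r e (\<lambda>h i j. S h i j - T h i j)"
    "germ r e S = germ r e T \<longleftrightarrow> (\<forall>h\<in>geom_dseq r e. ev2 (\<lambda>i j. S h i j = T h i j))"
proof -
  interpret E: alg "dseq_alg r e" by (rule dseq_alg)
  interpret I: alg_ideal "dseq_alg r e" "dseq_null_ops r e" by (rule dseq_alg_ideal)
  interpret Q: alg "germ_alg r e" unfolding germ_alg_def by (rule I.quot_alg)
  have cl: "dseq_null_ops r e +>\<^bsub>dseq_alg r e\<^esub> U \<in> carrier (germ_alg r e)" if "U \<in> dseq_ops r e" for U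
    unfolding germ_alg_def using that by (intro I.quot_carrierI) simp
  show "germ r e S * germ r e T = germ r e (\<lambda>h. S (T h))"
    unfolding germ_def Q.iota_mult[OF cl[OF assms(1)] cl[OF assms(2)], symmetric]
    using assms by (simp add: germ_alg_def I.quot_mult)
  have add: "germ r e S + germ r e T = germ r e (\<lambda>h i j. S h i j + T h i j)" if "S \<in> dseq_ops r e" "T \<in> dseq_ops r e" for S T
    unfolding germ_def Q.iota_add[OF cl[OF that(1)] cl[OF that(2)], symmetric]
    using that by (simp add: germ_alg_def I.quot_add)
  from add[OF assms] show "germ r e S + germ r e T = germ r e (\<lambda>h i j. S h i j + T h i j)" .
  have smult: "c *c germ r e T = germ r e (\<lambda>h i j. c *c T h i j)" for c
    unfolding germ_def Q.iota_smult[OF cl[OF assms(2)], symmetric]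
    using assms by (simp add: germ_alg_def I.quot_smult)
  then show "c *c germ r e T = germ r e (\<lambda>h i j. c *c T h i j)" .
  have m: "- germ r e T = germ r e (\<lambda>h i j. - T h i j)"
    using smult[of "- 1"] by simp
  show "germ r e S - germ r e T = germ r e (\<lambda>h i j. S h i j - T h i j)"
    unfolding diff_conv_add_uminus m by (rule add) (simp_all add: assms dseq_minus_closed)
  have "\<ominus>\<^bsub>dseq_alg r e\<^esub> T = (\<lambda>h i j. - T h i j)"
    using E.minus_smult[of T 1] assms by simp
  then have "S \<ominus>\<^bsub>dseq_alg r e\<^esub> T = (\<lambda>h i j. S h i j - T h i j)"
    by (simp add: a_minus_def)
  moreover have "(\<lambda>h i j. S h i j - T h i j) \<in> dseq_ops r e"
    using dseq_ops_closed(3)[OF assms(1) dseq_minus_closed(1)[OF assms(2)]] by simp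
  ultimately show "germ r e S = germ r e T \<longleftrightarrow> (\<forall>h\<in>geom_dseq r e. ev2 (\<lambda>i j. S h i j = T h i j))"
    unfolding germ_def Q.iota_eq_iff[OF cl[OF assms(1)] cl[OF assms(2)]]
    using assms by (simp add: I.coset_eq_iff) (simp add: dseq_null_ops_def null_dseq_def)
qed

text \<open>The phases make multiplication operators commute with the shifts up to the factors \<open>w\<close> and
  \<open>w'\<close>.\<close>

definition mult_op :: "complex \<Rightarrow> complex \<Rightarrow> 'a::calg \<Rightarrow> 'a dseq \<Rightarrow> 'a dseq" where
  "mult_op w w' x = (\<lambda>h i j. (w ^ i * w' ^ j) *c (x * h i j))"

text \<open>At index 0 the truncated subtraction repeats a value, which no germ notices.\<close>

definition shift_op :: "nat \<Rightarrow> 'a dseq \<Rightarrow> 'a dseq" where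
  "shift_op \<gamma> h = (\<lambda>i j. if \<gamma> = 3 then h (i - 1) j else h i (j - 1))"

lemma shift_op_closed: "shift_op \<gamma> \<in> dseq_ops r e"
  unfolding dseq_ops_def
proof (intro CollectI conjI ballI allI)
  fix h assume "h \<in> null_dseq"
  then show "shift_op \<gamma> h \<in> null_dseq"
    using ev2_mono[OF ev2_shift(1)[of "\<lambda>i j. h i j = 0"], of "\<lambda>i j. h (i - 1) j = 0"]
      ev2_mono[OF ev2_shift(2)[of "\<lambda>i j. h i j = 0"], of "\<lambda>i j. h i (j - 1) = 0"]
    by (cases "\<gamma> = 3") (simp_all add: null_dseq_def shift_op_def)
next
  fix h assume "h \<in> geom_dseq r e"
  then have *: "\<And>i j. e * h i j = h i j" "ev2 (\<lambda>i j. h (Suc i) (Suc j) = r * h i j)"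
    by (auto simp: geom_dseq_def)
  have "ev2 (\<lambda>i j. h i (Suc j) = r * h (i - 1) j)"
    using ev2_shift(1)[OF *(2)] by (rule ev2_mono) auto
  moreover have "ev2 (\<lambda>i j. h (Suc i) j = r * h i (j - 1))"
    using ev2_shift(2)[OF *(2)] by (rule ev2_mono) auto
  ultimately show "shift_op \<gamma> h \<in> geom_dseq r e"
    using *(1) by (cases "\<gamma> = 3") (simp_all add: geom_dseq_def shift_op_def)
qed (auto simp: shift_op_def fun_eq_iff)

text \<open>The recurrence moves along the diagonal, where the phase changes by
  \<open>w * w'\<close>, so this product must be 1. Compatibility with the factor \<open>r\<close>
  is the commutation of \<open>x\<close> with \<open>r\<close>.\<close>

lemma mult_op_closed:
  assumes "w * w' = 1" "e * x = x" "x * r = r * x"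
  shows "mult_op w w' x \<in> dseq_ops r e"
  unfolding dseq_ops_def
proof (intro CollectI conjI ballI allI)
  fix h :: "'a dseq" assume "h \<in> null_dseq"
  then show "mult_op w w' x h \<in> null_dseq"
    by (auto simp: null_dseq_def mult_op_def elim!: ev2_mono)
next
  fix h assume "h \<in> geom_dseq r e"
  then have *: "\<And>i j. e * h i j = h i j" "ev2 (\<lambda>i j. h (Suc i) (Suc j) = r * h i j)"
    by (auto simp: geom_dseq_def)
  have w: "w * (w' * z) = z" for z
    using assms(1) by (simp add: mult.assoc[symmetric])
  have "e * (x * z) = x * z" "x * (r * z) = r * (x * z)" for z
    using assms(2,3) by (simp_all add: mult.assoc[symmetric])
  then show "mult_op w w' x h \<in> geom_dseq r e"
    using *(2) by (auto simp: geom_dseq_def mult_op_def mult_ac w elim!: ev2_mono)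
qed (auto simp: mult_op_def ring_distribs cscale_add_right mult_ac)

definition germ_mult :: "'a::calg \<Rightarrow> 'a \<Rightarrow> complex \<Rightarrow> complex \<Rightarrow> 'a \<Rightarrow> ('a dseq \<Rightarrow> 'a dseq) set algprod" where
  "germ_mult r e w w' x = germ r e (mult_op w w' x)"

locale germ_data =
  fixes r e :: "'a::calg"
  assumes ee: "e * e = e" and er: "e * r = r" and re: "r * e = r"
begin

definition adm :: "complex \<Rightarrow> complex \<Rightarrow> 'a \<Rightarrow> bool" where
  "adm w w' x \<longleftrightarrow> w * w' = 1 \<and> e * x = x \<and> x * r = r * x"

lemma adm_closed: "adm w w' x \<Longrightarrow> mult_op w w' x \<in> dseq_ops r e"
  by (auto simp: adm_def intro: mult_op_closed)

lemma germ_mult_mult: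
  assumes "adm w w' x" "adm v v' y"
  shows "germ_mult r e w w' x * germ_mult r e v v' y = germ_mult r e (w * v) (w' * v') (x * y)"
  using assms by (simp add: germ_mult_def germ_hom(1) adm_closed) (simp add: mult_op_def mult_ac power_mult_distrib)

lemma germ_mult_diff:
  assumes "adm w w' x" "adm w w' y"
  shows "germ_mult r e w w' x - germ_mult r e w w' y = germ_mult r e w w' (x - y)"
  using assms by (simp add: germ_mult_def germ_hom(4) adm_closed) (simp add: mult_op_def ring_distribs cscale_diff_right)

lemma germ_mult_add:
  assumes "adm w w' x" "adm w w' y"
  shows "germ_mult r e w w' x + germ_mult r e w w' y = germ_mult r e w w' (x + y)"
  using assms by (simp add: germ_mult_def germ_hom(2) adm_closed) (simp add: mult_op_def ring_distribs cscale_add_right)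

lemma germ_mult_cscale:
  assumes "adm w w' x"
  shows "c *c germ_mult r e w w' x = germ_mult r e w w' (c *c x)"
  using assms by (simp add: germ_mult_def germ_hom(3)[OF adm_closed adm_closed] adm_closed) (simp add: mult_op_def mult_ac)

lemma adm_e: "adm 1 1 e"
  by (simp add: adm_def ee er re)

lemma germ_one: "germ r e (\<lambda>h. h) = germ_mult r e 1 1 e"
  unfolding germ_mult_def
  by (subst germ_hom(5)[OF dseq_ops_closed(1) adm_closed[OF adm_e]])
    (auto simp: mult_op_def geom_dseq_def intro: ev2I)

text \<open>A shift in the first index changes \<open>w ^ i\<close> by one factor \<open>w\<close>,
  a shift in the second changes \<open>w' ^ j\<close> by one factor \<open>w'\<close>: the shifts
  acquire prescribed phases while \<open>x\<close> itself stays the same.\<close>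

lemma germ_shift_mult:
  assumes "adm w w' x" "\<gamma> \<in> {3, 4}"
  shows "germ_mult r e w w' x * germ r e (shift_op \<gamma>) = (if \<gamma> = 3 then w else w') *c (germ r e (shift_op \<gamma>) * germ_mult r e w w' x)"
proof -
  let ?c = "if \<gamma> = 3 then w else w'"
  have cl: "(\<lambda>h. mult_op w w' x (shift_op \<gamma> h)) \<in> dseq_ops r e" "(\<lambda>h. shift_op \<gamma> (mult_op w w' x h)) \<in> dseq_ops r e"
    by (rule dseq_ops_closed(4)[OF adm_closed[OF assms(1)] shift_op_closed],
        rule dseq_ops_closed(4)[OF shift_op_closed adm_closed[OF assms(1)]])
  have "germ r e (\<lambda>h. mult_op w w' x (shift_op \<gamma> h)) = germ r e (\<lambda>h i j. ?c *c shift_op \<gamma> (mult_op w w' x h) i j)"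
  proof (rule germ_hom(5)[OF cl(1) dseq_ops_closed(5)[OF cl(2)], THEN iffD2])
    have p: "w ^ i = w * w ^ (i - 1)" "w' ^ i = w' * w' ^ (i - 1)" if "i \<ge> 1" for i
      using that by (cases i; simp)+
    show "\<forall>h\<in>geom_dseq r e. ev2 (\<lambda>i j. mult_op w w' x (shift_op \<gamma> h) i j = ?c *c shift_op \<gamma> (mult_op w w' x h) i j)"
    proof (intro ballI ev2I[of 1])
      fix h i j assume "1 \<le> (i::nat)" "1 \<le> (j::nat)"
      then show "mult_op w w' x (shift_op \<gamma> h) i j = ?c *c shift_op \<gamma> (mult_op w w' x h) i j"
        using p(1)[of i] p(2)[of j] by (simp add: mult_op_def shift_op_def mult_ac)
    qed
  qed
  then show ?thesis
    unfolding germ_mult_def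
    by (simp add: germ_hom(1)[OF adm_closed[OF assms(1)] shift_op_closed] germ_hom(1)[OF shift_op_closed adm_closed[OF assms(1)]]
        germ_hom(3)[OF cl(2) cl(2)])
qed

text \<open>On a geometric sequence, \<open>r\<close> times the value one step back along the
  diagonal is the value itself, so the two shifts together invert \<open>r\<close>.\<close>

lemma germ_shift_shift: "germ_mult r e 1 1 r * (germ r e (shift_op 3) * germ r e (shift_op 4)) = germ_mult r e 1 1 e"
proof -
  have r: "adm 1 1 r" by (simp add: adm_def er)
  have cl: "(\<lambda>h. shift_op 3 (shift_op 4 h)) \<in> dseq_ops r e"
    by (rule dseq_ops_closed(4)[OF shift_op_closed shift_op_closed])
  have "germ r e (\<lambda>h. mult_op 1 1 r (shift_op 3 (shift_op 4 h))) = germ r e (mult_op 1 1 e)"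
  proof (rule germ_hom(5)[OF dseq_ops_closed(4)[OF adm_closed[OF r] cl] adm_closed[OF adm_e], THEN iffD2])
    show "\<forall>h\<in>geom_dseq r e. ev2 (\<lambda>i j. mult_op 1 1 r (shift_op 3 (shift_op 4 h)) i j = mult_op 1 1 e h i j)"
    proof
      fix h assume "h \<in> geom_dseq r e"
      then have *: "\<And>i j. e * h i j = h i j" "ev2 (\<lambda>i j. h (Suc i) (Suc j) = r * h i j)"
        by (auto simp: geom_dseq_def)
      have "ev2 (\<lambda>i j. i > 0 \<and> j > 0 \<and> h (Suc (i - 1)) (Suc (j - 1)) = r * h (i - 1) (j - 1))"
        using ev2_shift(1)[OF ev2_shift(2)[OF *(2)]] by simp
      then show "ev2 (\<lambda>i j. mult_op 1 1 r (shift_op 3 (shift_op 4 h)) i j = mult_op 1 1 e h i j)"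
        by (rule ev2_mono) (auto simp: mult_op_def shift_op_def *(1))
    qed
  qed
  then show ?thesis
    unfolding germ_mult_def by (simp add: germ_hom(1)[OF shift_op_closed shift_op_closed] germ_hom(1)[OF adm_closed[OF r] cl])
qed

end

context sphere_mat begin

lemma proj_diag_comm: "k \<in> ix \<Longrightarrow> a \<in> cx \<Longrightarrow> i \<in> ix \<Longrightarrow> u k a * proj i i = proj i i * u k a"
  using u_proj[of k a i i] by simp

lemma proj_diag_sum: "proj 1 1 + proj 3 3 = e"
  using sphere u_comm[of 2 1 2 1] u_comm[of 2 1 1 2] u_comm[of 4 3 2 1] u_comm[of 4 3 1 2]
  by (simp add: proj_def sum_cx eta_simps algebra_simps)

text \<open>The phases are dictated by \<open>u_y\<close>: the shift for column 3 needs
  \<open>eta \<theta> \<kappa> i * eta \<theta> a 3\<close>, and the one for column 4 needs the same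
  with \<open>cj \<kappa>\<close> and 4, which is its inverse.\<close>

lemma germ_completion:
  assumes kappa: "\<kappa> = 1 \<or> \<kappa> = 3"
  defines "w \<equiv> \<lambda>i a. eta \<theta> \<kappa> i * eta \<theta> a 3" and "w' \<equiv> \<lambda>i a. eta \<theta> i \<kappa> * eta \<theta> 3 a"
    and "G \<equiv> germ_mult (proj \<kappa> \<kappa>) e"
  shows "sphere_completion \<theta> (\<lambda>i a. G (w i a) (w' i a) (u i a)) (G 1 1 e) \<kappa> (\<lambda>\<gamma>. germ (proj \<kappa> \<kappa>) e (shift_op \<gamma>))"
    and "germ_data (proj \<kappa> \<kappa>) e"
    and "i \<in> ix \<Longrightarrow> a \<in> cx \<Longrightarrow> germ_data.adm (proj \<kappa> \<kappa>) e (w i a) (w' i a) (u i a)"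
proof -
  let ?r = "proj \<kappa> \<kappa>"
  have k: "\<kappa> \<in> ix" using kappa by auto
  show gd: "germ_data ?r e"
    using k by unfold_locales simp_all
  interpret D: germ_data ?r e by (rule gd)
  have adm: "D.adm (w i a) (w' i a) (u i a)" if "i \<in> ix" "a \<in> cx" for i a
    using that k by (simp add: D.adm_def w_def w'_def proj_diag_comm mult_ac)
  then show "i \<in> ix \<Longrightarrow> a \<in> cx \<Longrightarrow> D.adm (w i a) (w' i a) (u i a)" .
  have admr: "D.adm 1 1 ?r" using k by (simp add: D.adm_def)
  have adm2: "D.adm (w i a * w j b) (w' i a * w' j b) (u i a * u j b)" if "i \<in> ix" "a \<in> cx" "j \<in> ix" "b \<in> cx" for i j a b
    using adm[OF that(1,2)] adm[OF that(3,4)] that by (simp add: D.adm_def mult_ac) (simp add: mult.assoc[symmetric])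
  have w: "w (cj i) (cj a) * w i a = 1" "w' (cj i) (cj a) * w' i a = 1" if "i \<in> ix" "a \<in> cx" for i a
    using that k by (simp_all add: w_def w'_def eta_cj mult_ac)
  have ww: "w 2 2 * w 1 1 = 1" "w 2 1 * w 1 2 = 1" "w 4 2 * w 3 1 = 1" "w 4 1 * w 3 2 = 1"
    "w' 2 2 * w' 1 1 = 1" "w' 2 1 * w' 1 2 = 1" "w' 4 2 * w' 3 1 = 1" "w' 4 1 * w' 3 2 = 1"
    using w[of 1 1] w[of 1 2] w[of 3 1] w[of 3 2] by simp_all
  have uu: "D.adm 1 1 (u i a * u j b)" if "i \<in> ix" "a \<in> cx" "j \<in> ix" "b \<in> cx" for i j a b
    using adm2[OF that] by (simp add: D.adm_def)
  have adm_add: "D.adm 1 1 x \<Longrightarrow> D.adm 1 1 y \<Longrightarrow> D.adm 1 1 (x + y)" "D.adm 1 1 x \<Longrightarrow> D.adm 1 1 y \<Longrightarrow> D.adm 1 1 (x - y)"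
    "D.adm 1 1 x \<Longrightarrow> D.adm 1 1 (c *c x)" "D.adm 1 1 x \<Longrightarrow> D.adm 1 1 (- x)" for x y c
    by (simp_all add: D.adm_def ring_distribs)
  interpret S: sphere_mat \<theta> "\<lambda>i a. G (w i a) (w' i a) (u i a)" "G 1 1 e"
  proof
    show "G 1 1 e * G 1 1 e = G 1 1 e"
      by (simp add: G_def D.germ_mult_mult D.adm_e)
    fix i a assume ia: "i \<in> ix" "a \<in> cx"
    then show "G 1 1 e * G (w i a) (w' i a) (u i a) = G (w i a) (w' i a) (u i a)"
      "G (w i a) (w' i a) (u i a) * G 1 1 e = G (w i a) (w' i a) (u i a)"
      by (simp_all add: G_def D.germ_mult_mult D.adm_e adm)
    fix j b assume jb: "j \<in> ix" "b \<in> cx"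
    show "G (w i a) (w' i a) (u i a) * G (w j b) (w' j b) (u j b) =
      eta \<theta> j i *c (G (w j b) (w' j b) (u j b) * G (w i a) (w' i a) (u i a))"
      using ia jb u_comm[of i j a b]
      by (simp add: G_def D.germ_mult_mult adm D.germ_mult_cscale adm2) (simp add: mult_ac)
  next
    show "G (w 2 2) (w' 2 2) (u 2 2) * G (w 1 1) (w' 1 1) (u 1 1) - G (w 2 1) (w' 2 1) (u 2 1) * G (w 1 2) (w' 1 2) (u 1 2) +
      G (w 4 2) (w' 4 2) (u 4 2) * G (w 3 1) (w' 3 1) (u 3 1) - G (w 4 1) (w' 4 1) (u 4 1) * G (w 3 2) (w' 3 2) (u 3 2) = G 1 1 e"
      by (simp add: G_def D.germ_mult_mult adm ww D.germ_mult_add D.germ_mult_diff uu adm_add sphere)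
  qed
  have "S.proj \<kappa> \<kappa> = G 1 1 ?r"
  proof -
    have 1: "w \<kappa> a * w (cj \<kappa>) (cj a) = 1" "w' \<kappa> a * w' (cj \<kappa>) (cj a) = 1" if "a \<in> cx" for a
      using w[OF k that] by (simp_all add: mult_ac)
    have "G (w \<kappa> a) (w' \<kappa> a) (u \<kappa> a) * G (w (cj \<kappa>) (cj a)) (w' (cj \<kappa>) (cj a)) (u (cj \<kappa>) (cj a)) = G 1 1 (u \<kappa> a * u (cj \<kappa>) (cj a))"
      if "a \<in> cx" for a
      using that k 1[OF that] by (simp add: G_def D.germ_mult_mult adm)
    then show ?thesis
      unfolding S.proj_def proj_def
      using k by (simp add: sum_cx G_def D.germ_mult_cscale D.germ_mult_add D.germ_mult_diff uu adm_add D.adm_e)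
  qed
  then have "S.proj \<kappa> \<kappa> * (germ ?r e (shift_op 3) * germ ?r e (shift_op 4)) = G 1 1 e"
    by (simp add: G_def D.germ_shift_shift)
  moreover have "G (w i a) (w' i a) (u i a) * germ ?r e (shift_op \<gamma>) =
    (eta \<theta> (col \<kappa> \<gamma>) i * eta \<theta> a \<gamma>) *c (germ ?r e (shift_op \<gamma>) * G (w i a) (w' i a) (u i a))"
    if "i \<in> ix" "a \<in> cx" "\<gamma> \<in> {3, 4}" for i a \<gamma>
  proof -
    have "(if \<gamma> = 3 then w i a else w' i a) = eta \<theta> (col \<kappa> \<gamma>) i * eta \<theta> a \<gamma>"
      using that kappa by (auto elim!: ix_cases cx_cases simp: w_def w'_def col_def eta_simps)
    then show ?thesis
      using D.germ_shift_mult[OF adm[OF that(1,2)] that(3)] by (simp add: G_def)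
  qed
  moreover have "germ ?r e (shift_op \<gamma>) * G 1 1 e = germ ?r e (shift_op \<gamma>)" "G 1 1 e * germ ?r e (shift_op \<gamma>) = germ ?r e (shift_op \<gamma>)" for \<gamma>
    unfolding G_def D.germ_one[symmetric]
    by (simp_all add: germ_hom(1)[OF shift_op_closed dseq_ops_closed(1)] germ_hom(1)[OF dseq_ops_closed(1) shift_op_closed])
  moreover have "germ ?r e (shift_op 3) * germ ?r e (shift_op 4) = germ ?r e (shift_op 4) * germ ?r e (shift_op 3)"
    by (simp add: germ_hom(1)[OF shift_op_closed shift_op_closed]) (simp add: shift_op_def)
  ultimately show "sphere_completion \<theta> (\<lambda>i a. G (w i a) (w' i a) (u i a)) (G 1 1 e) \<kappa> (\<lambda>\<gamma>. germ ?r e (shift_op \<gamma>))"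
    using kappa by unfold_locales auto
qed

end

subsection \<open>Embedding the sphere\<close>

definition S7_iota :: "real \<Rightarrow> nat \<Rightarrow> nat \<Rightarrow> S7_elt algprod" where
  "S7_iota \<theta> i a = iota (S7_alg \<theta>) (S7_mat \<theta> i a)"

abbreviation S7_e :: "real \<Rightarrow> S7_elt algprod" where
  "S7_e \<theta> \<equiv> iota (S7_alg \<theta>) \<one>\<^bsub>S7_alg \<theta>\<^esub>"

interpretation S7U: sphere_mat \<theta> "S7_iota \<theta>" "S7_e \<theta>"
  using S7_sphere_mat[OF S7.typed_hom_iota] unfolding S7_iota_def[abs_def] .

definition S7_to_Sp :: "real \<Rightarrow> S7_elt \<Rightarrow> Sp_elt" where
  "S7_to_Sp \<theta> = (SOME h. h \<in> alg_hom (S7_alg \<theta>) (Sp_alg \<theta>) \<and> (\<forall>i\<in>ix. \<forall>a\<in>cx. h (S7_mat \<theta> i a) = Sp_mat \<theta> i a))"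

lemma S7_to_Sp: "S7_to_Sp \<theta> \<in> alg_hom (S7_alg \<theta>) (Sp_alg \<theta>)"
    "i \<in> ix \<Longrightarrow> a \<in> cx \<Longrightarrow> S7_to_Sp \<theta> (S7_mat \<theta> i a) = Sp_mat \<theta> i a"
proof -
  obtain h where h: "typed_hom (S7_alg \<theta>) h" "h \<one>\<^bsub>S7_alg \<theta>\<^esub> = Sp_e \<theta>" "\<And>i a. i \<in> ix \<Longrightarrow> a \<in> cx \<Longrightarrow> h (S7_mat \<theta> i a) = Sp_iota \<theta> i a"
    using S7_universal[OF SpX.sphere_mat[of \<theta>]] by blast
  have "\<exists>h. h \<in> alg_hom (S7_alg \<theta>) (Sp_alg \<theta>) \<and> (\<forall>i\<in>ix. \<forall>a\<in>cx. h (S7_mat \<theta> i a) = Sp_mat \<theta> i a)"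
    using Sp.ev_alg_hom[OF h(1,2)] h(3) by (intro exI[of _ "\<lambda>x. ev (Sp_alg \<theta>) (h x)"]) (simp add: Sp_iota_def)
  from someI_ex[OF this] show "S7_to_Sp \<theta> \<in> alg_hom (S7_alg \<theta>) (Sp_alg \<theta>)"
    "i \<in> ix \<Longrightarrow> a \<in> cx \<Longrightarrow> S7_to_Sp \<theta> (S7_mat \<theta> i a) = Sp_mat \<theta> i a"
    unfolding S7_to_Sp_def by blast+
qed

lemma S7_to_Sp_hom:
  "x \<in> carrier (S7_alg \<theta>) \<Longrightarrow> S7_to_Sp \<theta> x \<in> carrier (Sp_alg \<theta>)"
  "x \<in> carrier (S7_alg \<theta>) \<Longrightarrow> y \<in> carrier (S7_alg \<theta>) \<Longrightarrow> S7_to_Sp \<theta> (x \<oplus>\<^bsub>S7_alg \<theta>\<^esub> y) = S7_to_Sp \<theta> x \<oplus>\<^bsub>Sp_alg \<theta>\<^esub> S7_to_Sp \<theta> y"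
  "x \<in> carrier (S7_alg \<theta>) \<Longrightarrow> y \<in> carrier (S7_alg \<theta>) \<Longrightarrow> S7_to_Sp \<theta> (x \<otimes>\<^bsub>S7_alg \<theta>\<^esub> y) = S7_to_Sp \<theta> x \<otimes>\<^bsub>Sp_alg \<theta>\<^esub> S7_to_Sp \<theta> y"
  "x \<in> carrier (S7_alg \<theta>) \<Longrightarrow> S7_to_Sp \<theta> (c \<odot>\<^bsub>S7_alg \<theta>\<^esub> x) = c \<odot>\<^bsub>Sp_alg \<theta>\<^esub> S7_to_Sp \<theta> x"
  "S7_to_Sp \<theta> \<one>\<^bsub>S7_alg \<theta>\<^esub> = \<one>\<^bsub>Sp_alg \<theta>\<^esub>"
  using S7_to_Sp(1)[of \<theta>] by (simp_all add: alg_hom_iff)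

text \<open>The completed matrix gives a homomorphism from the quantum group to germs whose
  restriction to the sphere is multiplication by the element, up to phases. An \<open>f\<close> in
  the kernel therefore acts as zero on germs, and testing it on the powers of \<open>r\<close> shows
  that \<open>f\<close> times some power of \<open>r\<close> is zero.\<close>

lemma S7_to_Sp_kernel:
  assumes f: "f \<in> carrier (S7_alg \<theta>)" "S7_to_Sp \<theta> f = \<zero>\<^bsub>Sp_alg \<theta>\<^esub>" and kappa: "\<kappa> = 1 \<or> \<kappa> = 3"
  shows "\<exists>n. ((\<lambda>x. x * S7U.proj \<theta> \<kappa> \<kappa>) ^^ n) (iota (S7_alg \<theta>) f) = 0"
proof -
  let ?i = "iota (S7_alg \<theta>)" and ?r = "S7U.proj \<theta> \<kappa> \<kappa>" and ?e = "S7_e \<theta>"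
  let ?G = "germ_mult ?r ?e"
  have k: "\<kappa> \<in> ix" using kappa by auto
  define w w' where "w = (\<lambda>i a. eta \<theta> \<kappa> i * eta \<theta> a 3)" and "w' = (\<lambda>i a. eta \<theta> i \<kappa> * eta \<theta> 3 a)"
  have C: "sphere_completion \<theta> (\<lambda>i a. ?G (w i a) (w' i a) (S7_iota \<theta> i a)) (?G 1 1 ?e) \<kappa> (\<lambda>\<gamma>. germ ?r ?e (shift_op \<gamma>))"
    unfolding w_def w'_def by (rule S7U.germ_completion(1)[OF kappa])
  have gd: "germ_data ?r ?e"
    by (rule S7U.germ_completion(2)[OF kappa])
  have adm: "germ_data.adm ?r ?e (w i a) (w' i a) (S7_iota \<theta> i a)" if "i \<in> ix" "a \<in> cx" for i a
    unfolding w_def w'_def by (rule S7U.germ_completion(3)[OF kappa that])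
  interpret D: germ_data ?r ?e by (rule gd)
  interpret C: sphere_completion \<theta> "\<lambda>i a. ?G (w i a) (w' i a) (S7_iota \<theta> i a)" "?G 1 1 ?e" \<kappa> "\<lambda>\<gamma>. germ ?r ?e (shift_op \<gamma>)"
    by (rule C)
  obtain \<chi> where \<chi>: "typed_hom (Sp_alg \<theta>) \<chi>" "\<chi> \<one>\<^bsub>Sp_alg \<theta>\<^esub> = ?G 1 1 ?e"
    and \<chi>_mat: "\<And>i j. i \<in> ix \<Longrightarrow> j \<in> ix \<Longrightarrow> \<chi> (Sp_mat \<theta> i j) = C.compl i j"
    using Sp_universal[OF C.sp_mat_compl] by blast
  note \<chi>_hom = typed_homD[OF \<chi>(1)]
  \<comment> \<open>The phases depend on both indices but have product 1 on the diagonal, so the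
    diagonal coefficients \<open>\<tau> i i\<close> recover \<open>x\<close> itself.\<close>
  have "\<exists>T \<tau>. \<chi> (S7_to_Sp \<theta> x) = germ ?r ?e T \<and> T \<in> dseq_ops ?r ?e \<and> (\<forall>h i j. T h i j = \<tau> i j * h i j) \<and> (\<forall>i. \<tau> i i = ?i x)"
    if "x \<in> carrier (S7_alg \<theta>)" for x
    using that
  proof (induction x rule: S7_induct)
    case one
    show ?case
      by (intro exI[of _ "mult_op 1 1 ?e"] exI[of _ "\<lambda>_ _. ?e"])
        (simp add: S7_to_Sp_hom \<chi>(2) germ_mult_def D.adm_closed[OF D.adm_e], simp add: mult_op_def)
  next
    case (add x y)
    then obtain T \<tau> T' \<tau>' where T: "\<chi> (S7_to_Sp \<theta> x) = germ ?r ?e T" "T \<in> dseq_ops ?r ?e" "\<And>h i j. T h i j = \<tau> i j * h i j" "\<And>i. \<tau> i i = ?i x"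
      "\<chi> (S7_to_Sp \<theta> y) = germ ?r ?e T'" "T' \<in> dseq_ops ?r ?e" "\<And>h i j. T' h i j = \<tau>' i j * h i j" "\<And>i. \<tau>' i i = ?i y"
      by blast
    have "(\<lambda>h i j. T h i j + T' h i j) \<in> dseq_ops ?r ?e"
      by (rule dseq_ops_closed(3)[OF T(2,6)])
    then show ?case
      using add(1,2) T
      by (intro exI[of _ "\<lambda>h i j. T h i j + T' h i j"] exI[of _ "\<lambda>i j. \<tau> i j + \<tau>' i j"])
        (simp add: S7_to_Sp_hom \<chi>_hom germ_hom(2) distrib_right)
  next
    case (mult x y)
    then obtain T \<tau> T' \<tau>' where T: "\<chi> (S7_to_Sp \<theta> x) = germ ?r ?e T" "T \<in> dseq_ops ?r ?e" "\<And>h i j. T h i j = \<tau> i j * h i j" "\<And>i. \<tau> i i = ?i x"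
      "\<chi> (S7_to_Sp \<theta> y) = germ ?r ?e T'" "T' \<in> dseq_ops ?r ?e" "\<And>h i j. T' h i j = \<tau>' i j * h i j" "\<And>i. \<tau>' i i = ?i y"
      by blast
    have "(\<lambda>h. T (T' h)) \<in> dseq_ops ?r ?e"
      by (rule dseq_ops_closed(4)[OF T(2,6)])
    moreover have "\<chi> (S7_to_Sp \<theta> (x \<otimes>\<^bsub>S7_alg \<theta>\<^esub> y)) = germ ?r ?e (\<lambda>h. T (T' h))"
      using mult(1,2) by (simp only: S7_to_Sp_hom \<chi>_hom T(1,5) germ_hom(1)[OF T(2,6)])
    moreover have "T (T' h) i j = (\<tau> i j * \<tau>' i j) * h i j" for h i j
      by (simp only: T(3,7) mult.assoc)
    moreover have "\<tau> i i * \<tau>' i i = ?i (x \<otimes>\<^bsub>S7_alg \<theta>\<^esub> y)" for i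
      using mult(1,2) T(4,8) by simp
    ultimately show ?case
      by (intro exI[of _ "\<lambda>h. T (T' h)"] exI[of _ "\<lambda>i j. \<tau> i j * \<tau>' i j"]) blast
  next
    case (smult c x)
    then obtain T \<tau> where T: "\<chi> (S7_to_Sp \<theta> x) = germ ?r ?e T" "T \<in> dseq_ops ?r ?e" "\<And>h i j. T h i j = \<tau> i j * h i j" "\<And>i. \<tau> i i = ?i x"
      by blast
    have "(\<lambda>h i j. c *c T h i j) \<in> dseq_ops ?r ?e"
      by (rule dseq_ops_closed(5)[OF T(2)])
    then show ?case
      using smult(1) T
      by (intro exI[of _ "\<lambda>h i j. c *c T h i j"] exI[of _ "\<lambda>i j. c *c \<tau> i j"])
        (simp add: S7_to_Sp_hom \<chi>_hom germ_hom(3)[OF T(2) T(2)])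
  next
    case (entry i a)
    have "w i a ^ n * w' i a ^ n = 1" for n
      using adm[OF entry] by (simp add: D.adm_def flip: power_mult_distrib)
    then have "(w i a ^ n * w' i a ^ n) *c S7_iota \<theta> i a = ?i (S7_mat \<theta> i a)" for n
      by (simp add: S7_iota_def)
    moreover have "\<chi> (S7_to_Sp \<theta> (S7_mat \<theta> i a)) = germ ?r ?e (mult_op (w i a) (w' i a) (S7_iota \<theta> i a))"
      using entry by (simp add: S7_to_Sp \<chi>_mat C.compl_def) (simp add: germ_mult_def)
    moreover have "mult_op (w i a) (w' i a) (S7_iota \<theta> i a) \<in> dseq_ops ?r ?e"
      by (rule D.adm_closed[OF adm[OF entry]])
    moreover have "mult_op (w i a) (w' i a) (S7_iota \<theta> i a) h k l = ((w i a ^ k * w' i a ^ l) *c S7_iota \<theta> i a) * h k l" for h k l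
      by (simp add: mult_op_def)
    ultimately show ?case
      by (intro exI[of _ "mult_op (w i a) (w' i a) (S7_iota \<theta> i a)"] exI[of _ "\<lambda>k l. (w i a ^ k * w' i a ^ l) *c S7_iota \<theta> i a"]) blast
  qed
  then obtain T \<tau> where T: "\<chi> (S7_to_Sp \<theta> f) = germ ?r ?e T" "T \<in> dseq_ops ?r ?e" "\<And>h i j. T h i j = \<tau> i j * h i j" "\<And>i. \<tau> i i = ?i f"
    using f(1) by blast
  \<comment> \<open>The powers of \<open>?r\<close>, started at \<open>?e\<close> because the class
    has no unit.\<close>
  define p where "p n = ((\<lambda>x. x * ?r) ^^ n) ?e" for n
  have p: "?e * p n = p n" "?r * p n = p n * ?r" "?i f * p n = ((\<lambda>x. x * ?r) ^^ n) (?i f)" for n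
  proof (induction n)
    case 0
    show "?e * p 0 = p 0" "?r * p 0 = p 0 * ?r" "?i f * p 0 = ((\<lambda>x. x * ?r) ^^ 0) (?i f)"
      using f(1) k by (simp_all add: p_def)
  next
    case (Suc n)
    then show "?e * p (Suc n) = p (Suc n)" "?r * p (Suc n) = p (Suc n) * ?r" "?i f * p (Suc n) = ((\<lambda>x. x * ?r) ^^ Suc n) (?i f)"
      by (simp_all add: p_def mult.assoc[symmetric])
  qed
  \<comment> \<open>The test sequence lives on the diagonal only, where the phases are trivial; it
    is geometric because both indices advance together.\<close>
  have "(\<lambda>i j. if i = j then p i else 0) \<in> geom_dseq ?r ?e"
    using p(1,2) by (auto simp: geom_dseq_def p_def intro!: ev2I)
  moreover have "germ ?r ?e T = germ ?r ?e (\<lambda>h i j. 0)"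
    using f(2) Sp.typed_hom_zero[OF \<chi>(1)] T(1) germ_hom(4)[OF T(2) T(2)] by simp
  ultimately have "ev2 (\<lambda>i j. T (\<lambda>i j. if i = j then p i else 0) i j = 0)"
    using germ_hom(5)[OF T(2) dseq_ops_closed(2)] by blast
  then obtain n where "T (\<lambda>i j. if i = j then p i else 0) n n = 0"
    by (auto simp: ev2_def)
  then show ?thesis
    using T(3,4) p(3)[of n] by auto
qed

text \<open>Induction on \<open>m + n\<close>: the elements \<open>x * r\<close> and
  \<open>x * s\<close> inherit the hypotheses with one exponent lowered, so both vanish, and
  \<open>x\<close> is their sum. This glues the two localisations.\<close>

lemma funpow_mult_kernel:
  fixes r s :: "'a::calg"
  assumes "r * s = s * r" "x * (r + s) = x" "((\<lambda>x. x * r) ^^ m) x = 0" "((\<lambda>x. x * s) ^^ n) x = 0"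
  shows "x = 0"
  using assms(2-)
proof (induction "m + n" arbitrary: m n x rule: less_induct)
  case less
  have pow: "((\<lambda>x. x * r) ^^ n) (x * r) = ((\<lambda>x. x * r) ^^ n) x * r" "((\<lambda>x. x * s) ^^ n) (x * s) = ((\<lambda>x. x * s) ^^ n) x * s"
    "((\<lambda>x. x * s) ^^ n) (x * r) = ((\<lambda>x. x * s) ^^ n) x * r" "((\<lambda>x. x * r) ^^ n) (x * s) = ((\<lambda>x. x * r) ^^ n) x * s" for x n
    using assms(1) by (induction n) (simp_all add: mult.assoc)
  have comm: "(x * r) * (r + s) = x * (r + s) * r" "(x * s) * (r + s) = x * (r + s) * s"
    using assms(1) by (simp_all add: ring_distribs mult.assoc)
  show ?case
  proof (cases "m = 0 \<or> n = 0")
    case False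
    then obtain m' n' where mn: "m = Suc m'" "n = Suc n'"
      by (metis not0_implies_Suc)
    have "x * r = 0"
      using less(1)[of m' n "x * r"] less(2-) mn(1) comm by (simp add: pow)
    moreover have "x * s = 0"
      using less(1)[of m n' "x * s"] less(2-) mn(2) comm by (simp add: pow)
    ultimately show ?thesis
      using less(2) by (simp add: distrib_left)
  qed (use less in auto)
qed

lemma S7_to_Sp_inj: "inj_on (S7_to_Sp \<theta>) (carrier (S7_alg \<theta>))"
proof (rule inj_onI)
  fix x y assume xy: "x \<in> carrier (S7_alg \<theta>)" "y \<in> carrier (S7_alg \<theta>)" "S7_to_Sp \<theta> x = S7_to_Sp \<theta> y"
  let ?f = "x \<oplus>\<^bsub>S7_alg \<theta>\<^esub> (- 1) \<odot>\<^bsub>S7_alg \<theta>\<^esub> y"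
  have f: "?f \<in> carrier (S7_alg \<theta>)" using xy by simp
  have "S7_to_Sp \<theta> ?f = \<zero>\<^bsub>Sp_alg \<theta>\<^esub>"
    using xy Sp.minus_smult[of "S7_to_Sp \<theta> y" \<theta> 1] by (simp add: S7_to_Sp_hom Sp.r_neg)
  then obtain m n where mn: "((\<lambda>x. x * S7U.proj \<theta> 1 1) ^^ m) (iota (S7_alg \<theta>) ?f) = 0" "((\<lambda>x. x * S7U.proj \<theta> 3 3) ^^ n) (iota (S7_alg \<theta>) ?f) = 0"
    using S7_to_Sp_kernel[OF f] by metis
  have "S7U.proj \<theta> 1 1 * S7U.proj \<theta> 3 3 = S7U.proj \<theta> 3 3 * S7U.proj \<theta> 1 1"
    using S7U.proj_comm[of 3 3 1 1 \<theta>] by (simp add: eta_simps)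
  moreover have "iota (S7_alg \<theta>) ?f * (S7U.proj \<theta> 1 1 + S7U.proj \<theta> 3 3) = iota (S7_alg \<theta>) ?f"
    unfolding S7U.proj_diag_sum by (rule S7.iota_one_right[OF f])
  ultimately have "iota (S7_alg \<theta>) ?f = 0"
    using mn by (rule funpow_mult_kernel)
  then have "iota (S7_alg \<theta>) x = iota (S7_alg \<theta>) y" using xy by simp
  then show "x = y" using xy by (simp add: S7.iota_eq_iff)
qed

lemma S7_to_Sp_star: "x \<in> carrier (S7_alg \<theta>) \<Longrightarrow> S7_to_Sp \<theta> (star (S7_alg \<theta>) x) = star (Sp_alg \<theta>) (S7_to_Sp \<theta> x)"
proof (induction x rule: S7_induct)
  case (entry i a)
  then show ?case by (simp add: S7.u_mat_star S7_to_Sp S7_to_Sp_hom Sp_mat_star)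
qed (simp_all add: S7.star_add S7.star_mult S7.star_smult Sp.star_add Sp.star_mult Sp.star_smult S7_to_Sp_hom)

section \<open>Transport of the generators to the four-sphere\<close>

lemma star_subalg_image:
  assumes A: "salg A" and X: "X \<subseteq> carrier A" and h: "h \<in> star_alg_hom A B"
  shows "h ` star_subalg A X = star_subalg B (h ` X)"
proof -
  interpret salg A by (rule A)
  have cl: "x \<in> carrier A" if "x \<in> star_subalg A X" for x
    using star_subalg_closed[OF A X] that by blast
  have hom: "h (x \<oplus>\<^bsub>A\<^esub> y) = h x \<oplus>\<^bsub>B\<^esub> h y" "h (x \<otimes>\<^bsub>A\<^esub> y) = h x \<otimes>\<^bsub>B\<^esub> h y" "h (c \<odot>\<^bsub>A\<^esub> x) = c \<odot>\<^bsub>B\<^esub> h x"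
    "h (star A x) = star B (h x)" "h \<one>\<^bsub>A\<^esub> = \<one>\<^bsub>B\<^esub>" if "x \<in> carrier A" "y \<in> carrier A" for x y c
    using h that by (simp_all add: star_alg_hom_def alg_hom_iff)
  show ?thesis
  proof (intro equalityI subsetI)
    fix y assume "y \<in> h ` star_subalg A X"
    then obtain x where x: "x \<in> star_subalg A X" "y = h x" by auto
    have "h x \<in> star_subalg B (h ` X)"
      using x(1)
    proof induction
      case (gen x)
      then show ?case by (intro star_subalg.gen imageI)
    next
      case one
      then show ?case using hom(5)[OF one_closed one_closed] by (simp add: star_subalg.one)
    next
      case (add x y)
      then show ?case using hom(1)[OF cl cl] by (simp add: star_subalg.add)
    next
      case (mult x y)
      then show ?case using hom(2)[OF cl cl] by (simp add: star_subalg.mult)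
    next
      case (smult x c)
      then show ?case using hom(3)[OF cl cl] by (simp add: star_subalg.smult)
    next
      case (star x)
      then show ?case using hom(4)[OF cl cl] by (simp add: star_subalg.star)
    qed
    then show "y \<in> star_subalg B (h ` X)" using x by simp
  next
    fix y assume "y \<in> star_subalg B (h ` X)"
    then show "y \<in> h ` star_subalg A X"
    proof induction
      case (gen x)
      then show ?case by (auto intro: star_subalg.gen)
    next
      case one
      then show ?case using hom(5)[OF one_closed one_closed] star_subalg.one[of A X] by (metis imageI)
    next
      case (add x y)
      then obtain x' y' where "x = h x'" "y = h y'" "x' \<in> star_subalg A X" "y' \<in> star_subalg A X" by auto
      then show ?case using hom(1)[OF cl cl, of x' y'] star_subalg.add[of x' A X y'] by (metis imageI)
    next
      case (mult x y)
      then obtain x' y' where "x = h x'" "y = h y'" "x' \<in> star_subalg A X" "y' \<in> star_subalg A X" by auto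
      then show ?case using hom(2)[OF cl cl, of x' y'] star_subalg.mult[of x' A X y'] by (metis imageI)
    next
      case (smult x c)
      then obtain x' where "x = h x'" "x' \<in> star_subalg A X" by auto
      then show ?case using hom(3)[OF cl cl, of x' x' c] star_subalg.smult[of x' A X c] by (metis imageI)
    next
      case (star x)
      then obtain x' where "x = h x'" "x' \<in> star_subalg A X" by auto
      then show ?case using hom(4)[OF cl cl, of x' x'] star_subalg.star[of x' A X] by (metis imageI)
    qed
  qed
qed

lemma star_subalg_mono:
  assumes "X \<subseteq> star_subalg A Y"
  shows "star_subalg A X \<subseteq> star_subalg A Y"
proof
  fix x assume "x \<in> star_subalg A X"
  then show "x \<in> star_subalg A Y"
    by induction (use assms in \<open>auto intro: star_subalg.intros\<close>)
qed

lemma S7_to_Sp_star_alg_hom: "S7_to_Sp \<theta> \<in> star_alg_hom (S7_alg \<theta>) (Sp_alg \<theta>)"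
  by (simp add: star_alg_hom_def S7_to_Sp S7_to_Sp_star)

lemma S7_alg_generated: "carrier (S7_alg \<theta>) = star_subalg (S7_alg \<theta>) (range (S7_val \<theta>))"
proof
  show "star_subalg (S7_alg \<theta>) (range (S7_val \<theta>)) \<subseteq> carrier (S7_alg \<theta>)"
    by (rule star_subalg_closed[OF S7.salg_axioms]) auto
  show "carrier (S7_alg \<theta>) \<subseteq> star_subalg (S7_alg \<theta>) (range (S7_val \<theta>))"
  proof
    fix x assume "x \<in> carrier (S7_alg \<theta>)"
    then show "x \<in> star_subalg (S7_alg \<theta>) (range (S7_val \<theta>))"
    proof (induction x rule: S7_induct)
      case (entry i a)
      have v: "S7_val \<theta> g \<in> star_subalg (S7_alg \<theta>) (range (S7_val \<theta>))" for g
        by (intro star_subalg.gen rangeI)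
      have "\<ominus>\<^bsub>S7_alg \<theta>\<^esub> star (S7_alg \<theta>) (S7_val \<theta> g) \<in> star_subalg (S7_alg \<theta>) (range (S7_val \<theta>))" for g
        using star_subalg.smult[OF star_subalg.star[OF v[of g]], of "- 1"] by (simp add: S7.minus_smult)
      then show ?case
        using entry v star_subalg.star[OF v] by (auto elim!: ix_cases cx_cases simp: u_mat_simps)
    qed (auto intro: star_subalg.intros)
  qed
qed

lemma S7_val_eq: "S7_val \<theta> gen_z1 = S7_mat \<theta> 1 1" "S7_val \<theta> gen_z2 = S7_mat \<theta> 1 2"
    "S7_val \<theta> gen_z3 = S7_mat \<theta> 3 1" "S7_val \<theta> gen_z4 = S7_mat \<theta> 3 2"
  by (simp_all add: u_mat_simps)

lemma S7_to_Sp_val: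
  "S7_to_Sp \<theta> (S7_val \<theta> gen_z1) = Sp_val \<theta> gen_a1" "S7_to_Sp \<theta> (S7_val \<theta> gen_z2) = Sp_val \<theta> gen_a2"
  "S7_to_Sp \<theta> (S7_val \<theta> gen_z3) = Sp_val \<theta> gen_c1" "S7_to_Sp \<theta> (S7_val \<theta> gen_z4) = Sp_val \<theta> gen_c2"
  unfolding S7_val_eq by (simp_all add: S7_to_Sp A_mat_simps)

lemma Sp_minor_gens_eq: "Sp_minor_gens \<theta> =
    {Sp_val \<theta> gen_a1 \<otimes>\<^bsub>Sp_alg \<theta>\<^esub> star (Sp_alg \<theta>) (Sp_val \<theta> gen_a1) \<oplus>\<^bsub>Sp_alg \<theta>\<^esub> Sp_val \<theta> gen_a2 \<otimes>\<^bsub>Sp_alg \<theta>\<^esub> star (Sp_alg \<theta>) (Sp_val \<theta> gen_a2),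
     Sp_val \<theta> gen_c1 \<otimes>\<^bsub>Sp_alg \<theta>\<^esub> star (Sp_alg \<theta>) (Sp_val \<theta> gen_a1) \<oplus>\<^bsub>Sp_alg \<theta>\<^esub> Sp_val \<theta> gen_c2 \<otimes>\<^bsub>Sp_alg \<theta>\<^esub> star (Sp_alg \<theta>) (Sp_val \<theta> gen_a2),
     \<ominus>\<^bsub>Sp_alg \<theta>\<^esub> (Sp_val \<theta> gen_c1 \<otimes>\<^bsub>Sp_alg \<theta>\<^esub> Sp_val \<theta> gen_a2) \<oplus>\<^bsub>Sp_alg \<theta>\<^esub> Sp_val \<theta> gen_c2 \<otimes>\<^bsub>Sp_alg \<theta>\<^esub> Sp_val \<theta> gen_a1}"
proof -
  have 1: "x \<oplus>\<^bsub>Sp_alg \<theta>\<^esub> y \<otimes>\<^bsub>Sp_alg \<theta>\<^esub> z = x \<ominus>\<^bsub>Sp_alg \<theta>\<^esub> y \<otimes>\<^bsub>Sp_alg \<theta>\<^esub> (\<ominus>\<^bsub>Sp_alg \<theta>\<^esub> z)"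
    if "x \<in> carrier (Sp_alg \<theta>)" "y \<in> carrier (Sp_alg \<theta>)" "z \<in> carrier (Sp_alg \<theta>)" for x y z
    using that by (simp add: Sp.r_minus Sp.minus_eq)
  have 2: "\<ominus>\<^bsub>Sp_alg \<theta>\<^esub> (x \<ominus>\<^bsub>Sp_alg \<theta>\<^esub> y) = \<ominus>\<^bsub>Sp_alg \<theta>\<^esub> x \<oplus>\<^bsub>Sp_alg \<theta>\<^esub> y"
    if "x \<in> carrier (Sp_alg \<theta>)" "y \<in> carrier (Sp_alg \<theta>)" for x y
    using that by (simp add: Sp.minus_add Sp.minus_eq)
  have 3: "\<ominus>\<^bsub>Sp_alg \<theta>\<^esub> x \<oplus>\<^bsub>Sp_alg \<theta>\<^esub> y = y \<oplus>\<^bsub>Sp_alg \<theta>\<^esub> \<ominus>\<^bsub>Sp_alg \<theta>\<^esub> x"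
    if "x \<in> carrier (Sp_alg \<theta>)" "y \<in> carrier (Sp_alg \<theta>)" for x y
    using that by (simp add: Sp.a_comm)
  show ?thesis
    by (simp add: Sp_minor_gens_def Sp_minor_def A_mat_simps 1 2)
qed

text \<open>The constants come from the normalisation of the generators and from reordering: \<beta>
  is a multiple of the minor of rows 1, 3, and exchanging these rows costs the phase
  \<open>mu \<theta>\<close>; x is the difference of the minors of rows 1, 2 and 3, 4, whose sum is
  1.\<close>

lemma S7_to_Sp_S4:
  shows S7_to_Sp_alpha: "S7_to_Sp \<theta> (S4_alpha \<theta>) = 2 \<odot>\<^bsub>Sp_alg \<theta>\<^esub> star (Sp_alg \<theta>) (Sp_minor \<theta> 3 2)"
    and S7_to_Sp_beta: "S7_to_Sp \<theta> (S4_beta \<theta>) = (- 2 * mu \<theta>) \<odot>\<^bsub>Sp_alg \<theta>\<^esub> (\<ominus>\<^bsub>Sp_alg \<theta>\<^esub> Sp_minor \<theta> 3 1)"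
    and S7_to_Sp_x: "S7_to_Sp \<theta> (S4_x \<theta>) = 2 \<odot>\<^bsub>Sp_alg \<theta>\<^esub> Sp_minor \<theta> 1 2 \<oplus>\<^bsub>Sp_alg \<theta>\<^esub> (- 1) \<odot>\<^bsub>Sp_alg \<theta>\<^esub> \<one>\<^bsub>Sp_alg \<theta>\<^esub>"
    and S4_gens_closed: "{S4_alpha \<theta>, S4_beta \<theta>, S4_x \<theta>} \<subseteq> carrier (S7_alg \<theta>)"
proof -
  let ?A = "Sp_alg \<theta>" and ?h = "\<lambda>x. iota (Sp_alg \<theta>) (S7_to_Sp \<theta> x)"
  have h: "typed_hom (S7_alg \<theta>) ?h"
    by (rule Sp.typed_hom_alg_hom[OF S7_to_Sp(1)])
  note hom = typed_homD[OF h] S7.typed_hom_minus[OF h] S7.typed_hom_diff[OF h]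
  have v: "?h (S7_val \<theta> gen_z1) = Sp_iota \<theta> 1 1" "?h (S7_val \<theta> gen_z2) = Sp_iota \<theta> 1 2"
    "?h (S7_val \<theta> gen_z3) = Sp_iota \<theta> 3 1" "?h (S7_val \<theta> gen_z4) = Sp_iota \<theta> 3 2"
    "?h (star (S7_alg \<theta>) (S7_val \<theta> gen_z1)) = Sp_iota \<theta> 2 2" "?h (star (S7_alg \<theta>) (S7_val \<theta> gen_z2)) = - Sp_iota \<theta> 2 1"
    "?h (star (S7_alg \<theta>) (S7_val \<theta> gen_z3)) = Sp_iota \<theta> 4 2" "?h (star (S7_alg \<theta>) (S7_val \<theta> gen_z4)) = - Sp_iota \<theta> 4 1"
    unfolding S7_val_eq by (simp_all add: S7.u_mat_star S7_to_Sp S7_to_Sp_hom Sp_iota_def)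
  show cl: "{S4_alpha \<theta>, S4_beta \<theta>, S4_x \<theta>} \<subseteq> carrier (S7_alg \<theta>)"
    by (simp add: S4_alpha_def S4_beta_def S4_x_def Let_def)
  have "?h (S4_alpha \<theta>) = iota ?A (2 \<odot>\<^bsub>?A\<^esub> star ?A (Sp_minor \<theta> 3 2))"
    by (simp add: S4_alpha_def Let_def hom v Sp_minor_star iota_Sp_minor SpX.mnr_def)
  then show "S7_to_Sp \<theta> (S4_alpha \<theta>) = 2 \<odot>\<^bsub>?A\<^esub> star ?A (Sp_minor \<theta> 3 2)"
    using cl by (subst (asm) Sp.iota_eq_iff) (simp_all add: S7_to_Sp_hom)
  have "?h (S4_beta \<theta>) = iota ?A ((- 2 * mu \<theta>) \<odot>\<^bsub>?A\<^esub> (\<ominus>\<^bsub>?A\<^esub> Sp_minor \<theta> 3 1))"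
    using arg_cong[OF SpX.mnr_swap[of 1 3 1 \<theta>], of "\<lambda>t. - 2 *c t"]
    by (simp add: S4_beta_def Let_def hom v iota_Sp_minor) (simp add: SpX.mnr_def eta_simps cscale_diff_right cscale_add_right)
  then show "S7_to_Sp \<theta> (S4_beta \<theta>) = (- 2 * mu \<theta>) \<odot>\<^bsub>?A\<^esub> (\<ominus>\<^bsub>?A\<^esub> Sp_minor \<theta> 3 1)"
    using cl by (subst (asm) Sp.iota_eq_iff) (simp_all add: S7_to_Sp_hom)
  have "?h (S4_x \<theta>) = SpX.mnr \<theta> 1 1 2 - SpX.mnr \<theta> 1 3 4"
    by (simp add: S4_x_def Let_def hom v SpX.mnr_def)
  also have "\<dots> = 2 *c SpX.mnr \<theta> 1 1 2 - Sp_e \<theta>"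
    using SpX.mnr_col_sum[of 1 \<theta>] cscale_add_left[of 1 1 "SpX.mnr \<theta> 1 1 2"] by (simp add: algebra_simps)
  also have "\<dots> = iota ?A (2 \<odot>\<^bsub>?A\<^esub> Sp_minor \<theta> 1 2 \<oplus>\<^bsub>?A\<^esub> (- 1) \<odot>\<^bsub>?A\<^esub> \<one>\<^bsub>?A\<^esub>)"
    by (simp add: iota_Sp_minor)
  finally show "S7_to_Sp \<theta> (S4_x \<theta>) = 2 \<odot>\<^bsub>?A\<^esub> Sp_minor \<theta> 1 2 \<oplus>\<^bsub>?A\<^esub> (- 1) \<odot>\<^bsub>?A\<^esub> \<one>\<^bsub>?A\<^esub>"
    using cl by (subst (asm) Sp.iota_eq_iff) (simp_all add: S7_to_Sp_hom)
qed

text \<open>Each generating set is expressed through the other; solving for the minors divides by 2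
  and by \<open>mu \<theta>\<close>.\<close>

lemma S7_to_Sp_S4_image:
  "S7_to_Sp \<theta> ` star_subalg (S7_alg \<theta>) {S4_alpha \<theta>, S4_beta \<theta>, S4_x \<theta>} = star_subalg (Sp_alg \<theta>) (Sp_minor_gens \<theta>)"
proof -
  let ?A = "Sp_alg \<theta>" and ?X = "{S4_alpha \<theta>, S4_beta \<theta>, S4_x \<theta>}"
  let ?h = "S7_to_Sp \<theta>"
  have "?h ` ?X \<subseteq> star_subalg ?A (Sp_minor_gens \<theta>)"
    by (auto simp: S7_to_Sp_alpha S7_to_Sp_beta S7_to_Sp_x Sp_minor_gens_def
        intro!: star_subalg.smult star_subalg.add star_subalg.star star_subalg.one intro: star_subalg.gen)
  moreover have "Sp_minor_gens \<theta> \<subseteq> star_subalg ?A (?h ` ?X)"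
  proof -
    have X: "?h (S4_alpha \<theta>) \<in> star_subalg ?A (?h ` ?X)" "?h (S4_beta \<theta>) \<in> star_subalg ?A (?h ` ?X)" "?h (S4_x \<theta>) \<in> star_subalg ?A (?h ` ?X)"
      by (auto intro: star_subalg.gen)
    have "mu \<theta> \<noteq> 0" by (metis mu_cnj(1) mult_zero_left zero_neq_one)
    have "(1 / 2) \<odot>\<^bsub>?A\<^esub> (?h (S4_x \<theta>) \<oplus>\<^bsub>?A\<^esub> \<one>\<^bsub>?A\<^esub>) = Sp_minor \<theta> 1 2"
    proof -
      have "iota ?A ((1 / 2) \<odot>\<^bsub>?A\<^esub> (?h (S4_x \<theta>) \<oplus>\<^bsub>?A\<^esub> \<one>\<^bsub>?A\<^esub>)) = iota ?A (Sp_minor \<theta> 1 2)"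
        unfolding S7_to_Sp_x by simp
      then show ?thesis unfolding S7_to_Sp_x by (subst (asm) Sp.iota_eq_iff) simp_all
    qed
    moreover have "(1 / 2) \<odot>\<^bsub>?A\<^esub> star ?A (?h (S4_alpha \<theta>)) = Sp_minor \<theta> 3 2"
      unfolding S7_to_Sp_alpha by (simp add: Sp.star_smult Sp.smult_smult)
    moreover have "(- 1 / (2 * mu \<theta>)) \<odot>\<^bsub>?A\<^esub> ?h (S4_beta \<theta>) = \<ominus>\<^bsub>?A\<^esub> Sp_minor \<theta> 3 1"
      unfolding S7_to_Sp_beta using \<open>mu \<theta> \<noteq> 0\<close> by (simp add: Sp.smult_smult)
    ultimately show ?thesis
      using star_subalg.smult[OF star_subalg.add[OF X(3) star_subalg.one], of "1 / 2"]
        star_subalg.smult[OF star_subalg.star[OF X(1)], of "1 / 2"]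
        star_subalg.smult[OF X(2), of "- 1 / (2 * mu \<theta>)"]
      unfolding Sp_minor_gens_def by simp
  qed
  ultimately have "star_subalg ?A (?h ` ?X) = star_subalg ?A (Sp_minor_gens \<theta>)"
    by (intro equalityI star_subalg_mono)
  then show ?thesis
    using star_subalg_image[OF S7.salg_axioms S4_gens_closed S7_to_Sp_star_alg_hom] by simp
qed

lemma star_alg_hom_inv_into:
  assumes h: "h \<in> star_alg_hom A B" "inj_on h (carrier A)" and A: "salg A" and D: "h ` carrier A = D"
  shows "inv_into (carrier A) h \<in> star_alg_hom (B\<lparr>carrier := D\<rparr>) A"
proof -
  interpret salg A by (rule A)
  let ?g = "inv_into (carrier A) h"
  have gh: "?g (h x) = x" if "x \<in> carrier A" for x
    using h(2) that by (rule inv_into_f_f)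
  have hom: "h x \<oplus>\<^bsub>B\<^esub> h y = h (x \<oplus>\<^bsub>A\<^esub> y)" "h x \<otimes>\<^bsub>B\<^esub> h y = h (x \<otimes>\<^bsub>A\<^esub> y)" "c \<odot>\<^bsub>B\<^esub> h x = h (c \<odot>\<^bsub>A\<^esub> x)"
    "star B (h x) = h (star A x)" "\<one>\<^bsub>B\<^esub> = h \<one>\<^bsub>A\<^esub>" if "x \<in> carrier A" "y \<in> carrier A" for x y c
    using h(1) that by (simp_all add: star_alg_hom_def alg_hom_iff)
  show ?thesis
    unfolding star_alg_hom_def alg_hom_iff
    using D by (auto simp: gh hom hom(5)[OF one_closed one_closed])
qed

lemma star_alg_hom_restrict:
  assumes "h \<in> star_alg_hom (A\<lparr>carrier := D\<rparr>) C" "B \<subseteq> D" "h ` B \<subseteq> E"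
  shows "h \<in> star_alg_hom (A\<lparr>carrier := B\<rparr>) (C\<lparr>carrier := E\<rparr>)"
  using assms unfolding star_alg_hom_def alg_hom_iff by (simp add: subset_iff image_subset_iff)

theorem mainTheorem7:
  fixes \<theta> :: real
  shows "hopf_ideal (Sp_alg \<theta>) (Sp_comult \<theta>) (Sp_counit \<theta>) (Sp_antipode \<theta>) (J_ideal \<theta>) \<and>
    (let A = Sp_alg \<theta>; S7 = S7_alg \<theta>; B = J_coinvariants \<theta>;
         a1 = Sp_val \<theta> gen_a1; a2 = Sp_val \<theta> gen_a2; c1 = Sp_val \<theta> gen_c1; c2 = Sp_val \<theta> gen_c2
     in B = star_subalg A
           {a1 \<otimes>\<^bsub>A\<^esub> star A a1 \<oplus>\<^bsub>A\<^esub> a2 \<otimes>\<^bsub>A\<^esub> star A a2,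
            c1 \<otimes>\<^bsub>A\<^esub> star A a1 \<oplus>\<^bsub>A\<^esub> c2 \<otimes>\<^bsub>A\<^esub> star A a2,
            \<ominus>\<^bsub>A\<^esub> (c1 \<otimes>\<^bsub>A\<^esub> a2) \<oplus>\<^bsub>A\<^esub> c2 \<otimes>\<^bsub>A\<^esub> a1} \<and>
        (\<exists>\<phi>. \<phi> \<in> star_alg_hom (A\<lparr>carrier := star_subalg A {a1, a2, c1, c2}\<rparr>) S7 \<and>
           \<phi> a1 = S7_val \<theta> gen_z1 \<and> \<phi> a2 = S7_val \<theta> gen_z2 \<and>
           \<phi> c1 = S7_val \<theta> gen_z3 \<and> \<phi> c2 = S7_val \<theta> gen_z4 \<and>
           \<phi> \<in> star_alg_iso (A\<lparr>carrier := B\<rparr>) (S4_alg \<theta>)))"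
proof -
  let ?A = "Sp_alg \<theta>" and ?S7 = "S7_alg \<theta>" and ?h = "S7_to_Sp \<theta>" and ?B = "J_coinvariants \<theta>"
  let ?D = "star_subalg ?A {Sp_val \<theta> gen_a1, Sp_val \<theta> gen_a2, Sp_val \<theta> gen_c1, Sp_val \<theta> gen_c2}"
  let ?S4 = "star_subalg ?S7 {S4_alpha \<theta>, S4_beta \<theta>, S4_x \<theta>}"
  \<comment> \<open>The inverse of the embedding, taken on its whole image. That image is generated
    by the first two columns and contains the coinvariants, so the same map has the prescribed
    values on the generators and restricts to the isomorphism.\<close>
  define \<phi> where "\<phi> = inv_into (carrier ?S7) ?h"
  have range: "range (S7_val \<theta>) = {S7_val \<theta> gen_z1, S7_val \<theta> gen_z2, S7_val \<theta> gen_z3, S7_val \<theta> gen_z4}"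
  proof -
    have "g \<in> {gen_z1, gen_z2, gen_z3, gen_z4}" for g
      by (cases g) auto
    then have UNIV: "UNIV = {gen_z1, gen_z2, gen_z3, gen_z4}" by blast
    show ?thesis unfolding UNIV by simp
  qed
  have "?h ` carrier ?S7 = star_subalg ?A (?h ` range (S7_val \<theta>))"
    unfolding S7_alg_generated by (intro star_subalg_image[OF S7.salg_axioms _ S7_to_Sp_star_alg_hom]) auto
  then have D: "?h ` carrier ?S7 = ?D"
    unfolding range by (simp add: S7_to_Sp_val)
  have hom: "\<phi> \<in> star_alg_hom (?A\<lparr>carrier := ?D\<rparr>) ?S7"
    unfolding \<phi>_def by (rule star_alg_hom_inv_into[OF S7_to_Sp_star_alg_hom S7_to_Sp_inj S7.salg_axioms D])
  have gen: "\<phi> (Sp_val \<theta> gen_a1) = S7_val \<theta> gen_z1" "\<phi> (Sp_val \<theta> gen_a2) = S7_val \<theta> gen_z2"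
    "\<phi> (Sp_val \<theta> gen_c1) = S7_val \<theta> gen_z3" "\<phi> (Sp_val \<theta> gen_c2) = S7_val \<theta> gen_z4"
    unfolding \<phi>_def S7_to_Sp_val[symmetric] by (simp_all add: inv_into_f_f[OF S7_to_Sp_inj])
  have S4: "?S4 \<subseteq> carrier ?S7"
    by (rule star_subalg_closed[OF S7.salg_axioms S4_gens_closed])
  have img: "?h ` ?S4 = ?B"
    unfolding J_coinvariants_eq by (rule S7_to_Sp_S4_image)
  have "\<phi> ` ?B = ?S4"
    unfolding \<phi>_def img[symmetric] by (rule inv_into_image_cancel[OF S7_to_Sp_inj S4])
  moreover have "inj_on \<phi> ?B"
    unfolding \<phi>_def img[symmetric] by (intro inj_on_inv_into image_mono S4)
  ultimately have bij: "bij_betw \<phi> ?B ?S4"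
    by (simp add: bij_betw_def)
  have "?B \<subseteq> ?D"
    unfolding img[symmetric] D[symmetric] by (rule image_mono[OF S4])
  then have "\<phi> \<in> star_alg_hom (?A\<lparr>carrier := ?B\<rparr>) (S4_alg \<theta>)"
    unfolding S4_alg_def using bij by (intro star_alg_hom_restrict[OF hom]) (simp_all add: bij_betw_def)
  then have "\<phi> \<in> star_alg_iso (?A\<lparr>carrier := ?B\<rparr>) (S4_alg \<theta>)"
    using bij by (simp add: star_alg_iso_def S4_alg_def)
  then show ?thesis
    unfolding Let_def J_coinvariants_eq[symmetric] Sp_minor_gens_eq[symmetric]
    using J_hopf_ideal hom gen by blast
qed

end
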